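(* Let $\lambda$ be a partition of $n$. Then $$\lim_{c\to-\infty}ch_s(M_c(\lambda))=\sum_{T\in\mathrm{Std}(\lambda)}\Big(\prod_{j=0}^{n-1}\frac{1}{1-(-1)^{k_j(T)}t^{n-j}}\Big)\sum_{\sigma\in S_n}\Big((-1)^{|\mathcal{J}_T(\sigma)|}\prod_{i\in\mathcal{I}(\sigma)}(-1)^{k_i(T)}t^{n-i}\Big),$$ where, with $(d_1,\dots,d_n)$ the content vector of $T$, $\mathcal{J}_T(\sigma)=\{(s,t):1\le s<t\le n,\ \sigma(s)>\sigma(t),\ d_t-d_s\in\{0,-1\}\}$, $\mathcal{I}(\sigma)=\{1\le i\le n-1:\sigma(i)>\sigma(i+1)\}$, and $$k_j(T)=\#\{i: d_i<0,\ i>j\}+\#\{(s,t):1\le s\le j<t\le n,\ d_t-d_s\in\{0,-1\}\}.$$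
   Context: $\mathbb{H}_c$ ($n\ge2$) is the rational Cherednik algebra for $W=S_n$, $\mathfrak h=\mathbb{C}^n$: it is generated by $\mathbb{C}S_n$ and $x_1,\dots,x_n,y_1,\dots,y_n$, where the $x_i$ commute, the $y_i$ commute, $wx_iw^{-1}=x_{w(i)}$, $wy_iw^{-1}=y_{w(i)}$, $y_ix_j-x_jy_i=c\,s_{ij}$ for $i\ne j$, and $y_ix_i-x_iy_i=1-c\sum_{j\neq i}s_{ij}$ ($s_{ij}$ the transposition). For a partition $\lambda$ of $n$, viewed as an irreducible representation of $S_n$ ($(n)$ trivial, $(1^n)$ sign), $M_c(\lambda)$ is the $\mathbb{H}_c$-module induced from $\lambda$ on which all $y_i$ act by $0$; as a vector space it is $\mathbb{C}[x_1,\dots,x_n]\otimes\lambda$, graded by polynomial degree. It has a contravariant Hermitian form $\langle\cdot,\cdot\rangle$ ($S_n$-invariant, with $\langle x_iu,v\rangle=\langle u,y_iv\rangle$), unique up to scaling, normalized to be positive definite on $\lambda$ in degree $0$; it is nondegenerate for real $c$ not of the form $r/m$ with $\gcd(r,m)=1$, $2\le m\le n$, and only such $c$ are considered. The signature character is $ch_s(M_c(\lambda))=\sum_{m\ge0}t^ms_m$, where $s_m$ is the number of positive minus the number of negative eigenvalues of the form on the degree $m$ part. The limit is taken coefficientwise in $t$; rational functions are expanded as power series at $t=0$. $\mathrm{Std}(\lambda)$ is the set of standard Young tableaux of shape $\lambda$; the content vector of $T$ is $(d_1,\dots,d_n)$, where $d_k=(\text{column})-(\text{row})$ of the box containing $k$.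 *)

theory Defs
  imports
    Complex_Main
    "HOL-Library.FuncSet"
    "HOL-Library.Poly_Mapping"
    "HOL-Combinatorics.Permutations"
    "HOL-Computational_Algebra.Polynomial"
    "HOL-Computational_Algebra.Formal_Power_Series"
    "Jordan_Normal_Form.Char_Poly"
begin

section \<open>Partitions and standard Young tableaux\<close>

definition is_partition :: "nat list \<Rightarrow> nat \<Rightarrow> bool" where
  "is_partition lam n \<longleftrightarrow> sorted_wrt (\<ge>) lam \<and> (\<forall>r\<in>set lam. r > 0) \<and> sum_list lam = n"

text \<open>A box is a pair (row, column), both counted from 0.\<close>

definition boxes :: "nat list \<Rightarrow> (nat \<times> nat) set" where
  "boxes lam = {(r, c). r < length lam \<and> c < lam ! r}"

definition Std :: "nat list \<Rightarrow> (nat \<times> nat \<Rightarrow> nat) set" where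
  "Std lam = {T \<in> boxes lam \<rightarrow>\<^sub>E {1..sum_list lam}.
     bij_betw T (boxes lam) {1..sum_list lam} \<and>
     (\<forall>r c c'. (r, c) \<in> boxes lam \<and> (r, c') \<in> boxes lam \<and> c < c' \<longrightarrow> T (r, c) < T (r, c')) \<and>
     (\<forall>r r' c. (r, c) \<in> boxes lam \<and> (r', c) \<in> boxes lam \<and> r < r' \<longrightarrow> T (r, c) < T (r', c))}"

definition box_content :: "nat list \<Rightarrow> (nat \<times> nat \<Rightarrow> nat) \<Rightarrow> nat \<Rightarrow> int" where
  "box_content lam T k = (let (r, c) = inv_into (boxes lam) T k in int c - int r)"


section \<open>The irreducible representation of the symmetric group attached to a partition\<close>

text \<open>The group algebra of \<open>S\<^sub>n\<close> consists of the elements whose keys permute \<open>{1..n}\<close>.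
  Its product is defined by hand because the product of \<^typ>\<open>'a \<Rightarrow>\<^sub>0 'b\<close> needs an additive monoid of keys.\<close>

type_synonym galg = "(nat \<Rightarrow> nat) \<Rightarrow>\<^sub>0 complex"

definition galg :: "nat \<Rightarrow> galg set" where
  "galg n = {a. \<forall>p \<in> Poly_Mapping.keys a. p permutes {1..n}}"

definition gmult :: "galg \<Rightarrow> galg \<Rightarrow> galg" where
  "gmult a b = (\<Sum>p\<in>Poly_Mapping.keys a. \<Sum>q\<in>Poly_Mapping.keys b.
     Poly_Mapping.single (p \<circ> q) (Poly_Mapping.lookup a p * Poly_Mapping.lookup b q))"

text \<open>The tableau of shape \<open>lam\<close> filled with 1, 2, ... row by row, and its row and column groups.\<close>

definition row_tableau :: "nat list \<Rightarrow> nat \<times> nat \<Rightarrow> nat" where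
  "row_tableau lam = (\<lambda>(r, c). sum_list (take r lam) + c + 1)"

definition row_group :: "nat list \<Rightarrow> (nat \<Rightarrow> nat) set" where
  "row_group lam = {p. p permutes {1..sum_list lam} \<and>
     (\<forall>(r, c)\<in>boxes lam. \<exists>c'. (r, c') \<in> boxes lam \<and> p (row_tableau lam (r, c)) = row_tableau lam (r, c'))}"

definition column_group :: "nat list \<Rightarrow> (nat \<Rightarrow> nat) set" where
  "column_group lam = {p. p permutes {1..sum_list lam} \<and>
     (\<forall>(r, c)\<in>boxes lam. \<exists>r'. (r', c) \<in> boxes lam \<and> p (row_tableau lam (r, c)) = row_tableau lam (r', c))}"

definition young_symmetrizer :: "nat list \<Rightarrow> galg" where
  "young_symmetrizer lam = (\<Sum>p\<in>row_group lam. \<Sum>q\<in>column_group lam.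
     Poly_Mapping.single (p \<circ> q) (of_int (sign q)))"

text \<open>The left ideal generated by the Young symmetrizer, with \<open>S\<^sub>n\<close> acting by left multiplication:
  trivial for \<open>lam = [n]\<close>, sign for \<open>lam = [1,...,1]\<close>.\<close>

definition specht :: "nat list \<Rightarrow> galg set" where
  "specht lam = (\<lambda>a. gmult a (young_symmetrizer lam)) ` galg (sum_list lam)"


section \<open>The rational Cherednik algebra and its standard modules\<close>

datatype gen = X nat | Y nat | W "nat \<Rightarrow> nat"

definition gens :: "nat \<Rightarrow> gen set" where
  "gens n = X ` {1..n} \<union> Y ` {1..n} \<union> W ` {p. p permutes {1..n}}"

text \<open>Elements of the tensor product of the free algebra on the generators with the group algebra:
  \<open>Poly_Mapping.single w v\<close> is the pure tensor of the word \<open>w\<close> and the vector \<open>v\<close>.\<close>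

type_synonym fmod = "gen list \<Rightarrow>\<^sub>0 galg"

definition gen_act :: "gen \<Rightarrow> fmod \<Rightarrow> fmod" where
  "gen_act g u = (\<Sum>w\<in>Poly_Mapping.keys u. Poly_Mapping.single (g # w) (Poly_Mapping.lookup u w))"

definition fscale :: "complex \<Rightarrow> fmod \<Rightarrow> fmod" where
  "fscale a u = Poly_Mapping.map (Poly_Mapping.map ((*) a)) u"

definition free_module :: "nat \<Rightarrow> nat list \<Rightarrow> fmod set" where
  "free_module n lam = {u. \<forall>w. Poly_Mapping.lookup u w \<in> specht lam \<and>
     (w \<in> Poly_Mapping.keys u \<longrightarrow> set w \<subseteq> gens n)}"

text \<open>The standard module \<open>M\<^sub>c(lam)\<close> is the quotient of \<open>free_module n lam\<close> (free algebra tensor \<open>lam\<close>)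
  by the submodule \<open>std_relations n lam c\<close> generated by the defining relations of the rational
  Cherednik algebra, applied to arbitrary elements, and by the relations saying that the copy of
  \<open>lam\<close> (empty word) carries its given action of \<open>S\<^sub>n\<close> and is killed by every \<open>Y i\<close>. This is the
  module obtained by induction from the subalgebra generated by \<open>S\<^sub>n\<close> and the \<open>Y i\<close>.
  The quotient is not formed as a type or as a set of cosets: elements of \<open>M\<^sub>c(lam)\<close> are given by
  representatives, and equality means that the difference lies in \<open>std_relations n lam c\<close>.\<close>

inductive_set std_relations :: "nat \<Rightarrow> nat list \<Rightarrow> real \<Rightarrow> fmod set"
  for n :: nat and lam :: "nat list" and c :: real where
  zero: "0 \<in> std_relations n lam c"
| add: "u \<in> std_relations n lam c \<Longrightarrow> v \<in> std_relations n lam c \<Longrightarrow> u + v \<in> std_relations n lam c"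
| scale: "u \<in> std_relations n lam c \<Longrightarrow> fscale a u \<in> std_relations n lam c"
| act: "u \<in> std_relations n lam c \<Longrightarrow> g \<in> gens n \<Longrightarrow> gen_act g u \<in> std_relations n lam c"
| W_one: "u \<in> free_module n lam \<Longrightarrow> gen_act (W id) u - u \<in> std_relations n lam c"
| W_mult: "u \<in> free_module n lam \<Longrightarrow> p permutes {1..n} \<Longrightarrow> q permutes {1..n} \<Longrightarrow>
    gen_act (W p) (gen_act (W q) u) - gen_act (W (p \<circ> q)) u \<in> std_relations n lam c"
| X_comm: "u \<in> free_module n lam \<Longrightarrow> i \<in> {1..n} \<Longrightarrow> j \<in> {1..n} \<Longrightarrow>
    gen_act (X i) (gen_act (X j) u) - gen_act (X j) (gen_act (X i) u) \<in> std_relations n lam c"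
| Y_comm: "u \<in> free_module n lam \<Longrightarrow> i \<in> {1..n} \<Longrightarrow> j \<in> {1..n} \<Longrightarrow>
    gen_act (Y i) (gen_act (Y j) u) - gen_act (Y j) (gen_act (Y i) u) \<in> std_relations n lam c"
| W_X: "u \<in> free_module n lam \<Longrightarrow> p permutes {1..n} \<Longrightarrow> i \<in> {1..n} \<Longrightarrow>
    gen_act (W p) (gen_act (X i) (gen_act (W (inv_into UNIV p)) u)) - gen_act (X (p i)) u \<in> std_relations n lam c"
| W_Y: "u \<in> free_module n lam \<Longrightarrow> p permutes {1..n} \<Longrightarrow> i \<in> {1..n} \<Longrightarrow>
    gen_act (W p) (gen_act (Y i) (gen_act (W (inv_into UNIV p)) u)) - gen_act (Y (p i)) u \<in> std_relations n lam c"
| Y_X_neq: "u \<in> free_module n lam \<Longrightarrow> i \<in> {1..n} \<Longrightarrow> j \<in> {1..n} \<Longrightarrow> i \<noteq> j \<Longrightarrow>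
    gen_act (Y i) (gen_act (X j) u) - gen_act (X j) (gen_act (Y i) u)
      - fscale (of_real c) (gen_act (W (Transposition.transpose i j)) u) \<in> std_relations n lam c"
| Y_X_eq: "u \<in> free_module n lam \<Longrightarrow> i \<in> {1..n} \<Longrightarrow>
    gen_act (Y i) (gen_act (X i) u) - gen_act (X i) (gen_act (Y i) u)
      - (u - fscale (of_real c) (\<Sum>j\<in>{1..n} - {i}. gen_act (W (Transposition.transpose i j)) u))
      \<in> std_relations n lam c"
| lam_W: "v \<in> specht lam \<Longrightarrow> p permutes {1..n} \<Longrightarrow>
    gen_act (W p) (Poly_Mapping.single [] v) - Poly_Mapping.single [] (gmult (Poly_Mapping.single p 1) v)
      \<in> std_relations n lam c"
| lam_Y: "v \<in> specht lam \<Longrightarrow> i \<in> {1..n} \<Longrightarrow>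
    gen_act (Y i) (Poly_Mapping.single [] v) \<in> std_relations n lam c"

text \<open>Representatives of the degree \<open>m\<close> part: combinations of monomials of length \<open>m\<close> in the \<open>X i\<close>
  applied to vectors of \<open>lam\<close>.\<close>

definition degree_part :: "nat \<Rightarrow> nat list \<Rightarrow> nat \<Rightarrow> fmod set" where
  "degree_part n lam m = {u \<in> free_module n lam.
     \<forall>w \<in> Poly_Mapping.keys u. length w = m \<and> set w \<subseteq> X ` {1..n}}"


section \<open>The contravariant form and the signature character\<close>

text \<open>A form on the quotient \<open>M\<^sub>c(lam)\<close> is a form on representatives that vanishes on
  \<open>std_relations\<close>. It is linear in the first argument and conjugate linear in the second.\<close>

definition is_contravariant_form :: "nat \<Rightarrow> nat list \<Rightarrow> real \<Rightarrow> (fmod \<Rightarrow> fmod \<Rightarrow> complex) \<Rightarrow> bool" where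
  "is_contravariant_form n lam c \<beta> \<longleftrightarrow>
     (\<forall>u\<in>free_module n lam. \<forall>v\<in>free_module n lam. \<forall>w\<in>free_module n lam.
        \<beta> (u + v) w = \<beta> u w + \<beta> v w) \<and>
     (\<forall>u\<in>free_module n lam. \<forall>v\<in>free_module n lam. \<forall>a. \<beta> (fscale a u) v = a * \<beta> u v) \<and>
     (\<forall>u\<in>free_module n lam. \<forall>v\<in>free_module n lam. \<beta> v u = cnj (\<beta> u v)) \<and>
     (\<forall>u\<in>std_relations n lam c. \<forall>v\<in>free_module n lam. \<beta> u v = 0) \<and>
     (\<forall>u\<in>free_module n lam. \<forall>v\<in>free_module n lam. \<forall>p. p permutes {1..n} \<longrightarrow>
        \<beta> (gen_act (W p) u) (gen_act (W p) v) = \<beta> u v) \<and>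
     (\<forall>u\<in>free_module n lam. \<forall>v\<in>free_module n lam. \<forall>i\<in>{1..n}.
        \<beta> (gen_act (X i) u) v = \<beta> u (gen_act (Y i) v)) \<and>
     (\<forall>v\<in>specht lam. v \<noteq> 0 \<longrightarrow>
        Re (\<beta> (Poly_Mapping.single [] v) (Poly_Mapping.single [] v)) > 0)"

text \<open>The form is unique up to a positive scalar, which does not affect signatures.\<close>

definition contravariant_form :: "nat \<Rightarrow> nat list \<Rightarrow> real \<Rightarrow> fmod \<Rightarrow> fmod \<Rightarrow> complex" where
  "contravariant_form n lam c = (SOME \<beta>. is_contravariant_form n lam c \<beta>)"

definition is_degree_basis :: "nat \<Rightarrow> nat list \<Rightarrow> real \<Rightarrow> nat \<Rightarrow> fmod list \<Rightarrow> bool" where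
  "is_degree_basis n lam c m bs \<longleftrightarrow>
     set bs \<subseteq> degree_part n lam m \<and>
     (\<forall>a. (\<Sum>i<length bs. fscale (a i) (bs ! i)) \<in> std_relations n lam c \<longrightarrow> (\<forall>i<length bs. a i = 0)) \<and>
     (\<forall>u\<in>degree_part n lam m. \<exists>a. u - (\<Sum>i<length bs. fscale (a i) (bs ! i)) \<in> std_relations n lam c)"

definition gram_matrix :: "(fmod \<Rightarrow> fmod \<Rightarrow> complex) \<Rightarrow> fmod list \<Rightarrow> complex mat" where
  "gram_matrix \<beta> bs = mat (length bs) (length bs) (\<lambda>(i, j). \<beta> (bs ! i) (bs ! j))"

text \<open>Number of positive minus number of negative eigenvalues of a Hermitian matrix, counted with
  multiplicity (the eigenvalues are real).\<close>

definition signature :: "complex mat \<Rightarrow> int" where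
  "signature A = int (size {#e \<in># proots (char_poly A). Re e > 0#})
               - int (size {#e \<in># proots (char_poly A). Re e < 0#})"

text \<open>The signature of the Gram matrix does not depend on the basis (Sylvester's law of inertia).\<close>

definition degree_signature :: "nat \<Rightarrow> nat list \<Rightarrow> real \<Rightarrow> nat \<Rightarrow> int" where
  "degree_signature n lam c m =
     signature (gram_matrix (contravariant_form n lam c) (SOME bs. is_degree_basis n lam c m bs))"

definition ch_s :: "nat \<Rightarrow> nat list \<Rightarrow> real \<Rightarrow> real fps" where
  "ch_s n lam c = Abs_fps (\<lambda>m. of_int (degree_signature n lam c m))"

text \<open>The parameters at which the form is nondegenerate.\<close>

definition regular_params :: "nat \<Rightarrow> real set" where
  "regular_params n =
     {c. \<not> (\<exists>(r::int) (m::nat). 2 \<le> m \<and> m \<le> n \<and> coprime r (int m) \<and> c = of_int r / of_nat m)}"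


section \<open>The statistics\<close>

definition J_set :: "nat \<Rightarrow> (nat \<Rightarrow> int) \<Rightarrow> (nat \<Rightarrow> nat) \<Rightarrow> (nat \<times> nat) set" where
  "J_set n d \<sigma> = {(s, t). 1 \<le> s \<and> s < t \<and> t \<le> n \<and> \<sigma> s > \<sigma> t \<and> d t - d s \<in> {0, -1}}"

definition I_set :: "nat \<Rightarrow> (nat \<Rightarrow> nat) \<Rightarrow> nat set" where
  "I_set n \<sigma> = {i. 1 \<le> i \<and> i \<le> n - 1 \<and> \<sigma> i > \<sigma> (i + 1)}"

definition k_stat :: "nat \<Rightarrow> (nat \<Rightarrow> int) \<Rightarrow> nat \<Rightarrow> nat" where
  "k_stat n d j = card {i. 1 \<le> i \<and> i \<le> n \<and> d i < 0 \<and> i > j}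
     + card {(s, t). 1 \<le> s \<and> s \<le> j \<and> j < t \<and> t \<le> n \<and> d t - d s \<in> {0, -1}}"

end

theory Submission
  imports Defs "Jordan_Normal_Form.Schur_Decomposition" "HOL-Library.Infinite_Set"
begin

text \<open>Put \<open>\<kappa> = - c\<close>. The Dunkl-Opdam operators \<open>x\<^sub>k y\<^sub>k + \<kappa> \<Sum>\<^bsub>j<k\<^esub> s\<^bsub>jk\<^esub>\<close> commute and are
  self-adjoint for the contravariant form, so joint eigenvectors with different eigenvalues (weights) are
  orthogonal. Together with the adjacent transpositions they satisfy the relations of the degenerate affine Hecke
  algebra. Starting from a Young basis vector \<open>v\<^sub>T\<close> in degree 0, of weight \<open>\<kappa> d\<close> with \<open>d\<close> the content vector,
  further weight vectors are produced by the intertwiners, which exchange adjacent weights \<open>a\<^sub>i, a\<^bsub>i+1\<^esub>\<close> and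
  multiply the norm by \<open>1 - \<kappa>\<^sup>2 / (a\<^sub>i - a\<^bsub>i+1\<^esub>)\<^sup>2\<close>, and by the raising operator \<open>x\<^sub>1 (1 2 ... n)\<close>, which rotates the
  weight, adds 1 to the last entry \<open>a\<^sub>n\<close> and multiplies the norm by \<open>a\<^sub>n + 1\<close>. They have the weights
  \<open>p (\<sigma>\<^sup>-\<^sup>1 i) + \<kappa> d (\<sigma>\<^sup>-\<^sup>1 i)\<close>, where \<open>p\<close> is weakly increasing, strictly at the descents of \<open>\<sigma>\<close>.
  If \<open>\<kappa>\<close> exceeds the degree \<open>m\<close>, all these weights are different, and since there are as many triples
  \<open>(T, \<sigma>, p)\<close> with \<open>\<Sum> p = m\<close> as monomials of degree \<open>m\<close> times tableaux, one gets an orthogonal basis of the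
  degree \<open>m\<close> part. The signs of the norms no longer depend on \<open>\<kappa>\<close>; summing them with \<open>p\<close> encoded by its
  increments gives the products of geometric series. A contravariant form exists because the module spanned by the
  words in the \<open>x\<^sub>i\<close>, before they are made to commute, carries commuting operators \<open>y\<^sub>i\<close>: they define a Hermitian form
  by moving all \<open>x\<^sub>i\<close> to the other side.\<close>

section \<open>Signatures of Hermitian matrices\<close>

text \<open>The conditions in the statement are signs of norm factors. An intertwiner moving an
  entry with exponent q > 0 past one with exponent 0 contributes 1 - (\<kappa> / (q + \<kappa>
  e))^2, where e is the difference of their contents; for q < \<kappa> this is negative exactly for
  e = 0 and e = -1. The raising factor p + 1 + \<kappa> d, with p + 1 < \<kappa>, is negative
  exactly for d < 0. This is why \<kappa> has to exceed all exponents, hence the degree. The size of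
  a graded piece is bounded from two sides: monomials applied to Young vectors span it, while the
  weight vectors, having nonzero norms and distinct weights, are independent and just as many. The
  obstacle to a form is that the module is given by generators and relations. On words in
  noncommuting x_i, Hermitian symmetry can be proved by recursion; since the y_i commute, every x_i
  x_j - x_j x_i lies in the radical, and the form descends.\<close>

definition adj :: "complex mat \<Rightarrow> complex mat" where
  "adj A = mat (dim_col A) (dim_row A) (\<lambda>(i, j). cnj (A $$ (j, i)))"

lemma adj_carrier [simp]: "A \<in> carrier_mat m n \<Longrightarrow> adj A \<in> carrier_mat n m"
  by (auto simp: adj_def)

lemma adj_dim [simp]: "dim_row (adj A) = dim_col A" "dim_col (adj A) = dim_row A"
  by (simp_all add: adj_def)

lemma adj_index [simp]: "i < dim_col A \<Longrightarrow> j < dim_row A \<Longrightarrow> adj A $$ (i, j) = cnj (A $$ (j, i))"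
  by (simp add: adj_def)

lemma adj_adj [simp]: "adj (adj A) = A"
  by (rule eq_matI) auto

lemma mult_index:
  "A \<in> carrier_mat n k \<Longrightarrow> B \<in> carrier_mat k m \<Longrightarrow> i < n \<Longrightarrow> j < m \<Longrightarrow>
    (A * B) $$ (i, j) = (\<Sum>l<k. A $$ (i, l) * B $$ (l, j))"
  by (auto simp: scalar_prod_def atLeast0LessThan intro!: sum.cong)

lemma adj_mult: "A \<in> carrier_mat n k \<Longrightarrow> B \<in> carrier_mat k m \<Longrightarrow> adj (A * B) = adj B * adj A"
proof (rule eq_matI)
  fix i j assume AB: "A \<in> carrier_mat n k" "B \<in> carrier_mat k m" and "i < dim_row (adj B * adj A)" "j < dim_col (adj B * adj A)"
  then have ij: "i < m" "j < n" by auto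
  have "adj (A * B) $$ (i, j) = cnj (\<Sum>l<k. A $$ (j, l) * B $$ (l, i))"
    using AB ij by (subst mult_index[OF AB ij(2,1), symmetric]) auto
  also have "\<dots> = (adj B * adj A) $$ (i, j)"
    using AB ij by (subst mult_index[of "adj B" m k "adj A" n]) (auto simp: mult.commute)
  finally show "adj (A * B) $$ (i, j) = (adj B * adj A) $$ (i, j)" .
qed auto

lemma adj_one [simp]: "adj (1\<^sub>m n) = 1\<^sub>m n"
  by (rule eq_matI) auto

lemma sum_rotate: "(\<Sum>i\<in>A. \<Sum>j\<in>B. \<Sum>k\<in>C. H i j k) = (\<Sum>k\<in>C. \<Sum>i\<in>A. \<Sum>j\<in>B. H i j k)"
proof -
  have "(\<Sum>i\<in>A. \<Sum>j\<in>B. \<Sum>k\<in>C. H i j k) = (\<Sum>i\<in>A. \<Sum>k\<in>C. \<Sum>j\<in>B. H i j k)"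
    by (intro sum.cong refl sum.swap)
  then show ?thesis by (simp only:) (rule sum.swap)
qed

lemma adj_conjugate:
  assumes "A \<in> carrier_mat n n" "U \<in> carrier_mat n n" "Q \<in> carrier_mat n n"
  shows "adj (U * Q) * A * (U * Q) = adj Q * (adj U * A * U) * Q"
proof -
  note sq = mult_carrier_mat[of _ n n _ n]
  have 1: "adj Q * adj U * A = adj Q * (adj U * A)"
    using assms by (intro assoc_mult_mat[of _ n n _ n _ n]) auto
  have 2: "adj Q * (adj U * A) * (U * Q) = adj Q * (adj U * A) * U * Q"
    using assms by (intro assoc_mult_mat[of _ n n _ n _ n, symmetric] sq) auto
  have 3: "adj Q * (adj U * A) * U = adj Q * (adj U * A * U)"
    using assms by (intro assoc_mult_mat[of _ n n _ n _ n] sq) auto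
  show ?thesis
    unfolding adj_mult[OF assms(2,3)] 1 2 3 ..
qed

lemma adj_conjugate_hermitian:
  assumes "A \<in> carrier_mat n n" "U \<in> carrier_mat n n" "adj A = A"
  shows "adj (adj U * A * U) = adj U * A * U"
proof -
  note sq = mult_carrier_mat[of _ n n _ n]
  have "adj (adj U * A * U) = adj U * adj (adj U * A)"
    using assms by (intro adj_mult[of _ n n _ n] sq) auto
  also have "adj (adj U * A) = adj A * adj (adj U)"
    using assms by (intro adj_mult[of _ n n _ n]) auto
  finally have "adj (adj U * A * U) = adj U * (A * U)"
    by (simp add: assms(3))
  also have "\<dots> = adj U * A * U"
    using assms by (intro assoc_mult_mat[of _ n n _ n _ n, symmetric]) auto
  finally show ?thesis .
qed

text \<open>Deflation step of the spectral theorem: \<open>v\<close> is completed to a basis,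
  Gram-Schmidt keeps the first vector, and the columns are normalized. The scalar \<open>c\<close>
  is the inverse length of \<open>v\<close>.\<close>

lemma unitary_first_column:
  fixes v :: "complex vec"
  assumes v: "v \<in> carrier_vec n" "v \<noteq> 0\<^sub>v n"
  obtains U c where "U \<in> carrier_mat n n" "adj U * U = 1\<^sub>m n" "col U 0 = c \<cdot>\<^sub>v v"
proof -
  interpret cof_vec_space n "TYPE(complex)" .
  define ws where "ws = gram_schmidt n (basis_completion v)"
  note bc = basis_completion[OF v]
  have ne: "n \<noteq> 0" using v by (cases n) auto
  have len: "length ws = n" and ws: "set ws \<subseteq> carrier_vec n" and orth: "corthogonal ws"
    using gram_schmidt_result[OF bc(2,4,5) ws_def] bc(6) by auto
  have hd: "hd ws = v"
    using bc(6,7) ne gram_schmidt_hd[OF v(1)] unfolding ws_def by (metis length_0_conv list.collapse)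
  define r where "r = (\<lambda>i. sqrt (Re (ws ! i \<bullet>c ws ! i)))"
  have wsi: "ws ! i \<in> carrier_vec n" if "i < n" for i using ws len that by auto
  have sp: "ws ! i \<bullet>c ws ! j = (\<Sum>k<n. ws ! i $ k * cnj (ws ! j $ k))" if "i < n" "j < n" for i j
    using wsi[OF that(1)] wsi[OF that(2)] by (auto simp: scalar_prod_def atLeast0LessThan intro!: sum.cong)
  have self: "ws ! i \<bullet>c ws ! i = complex_of_real ((r i)\<^sup>2)" and r0: "r i \<noteq> 0" if i: "i < n" for i
  proof -
    have s: "ws ! i \<bullet>c ws ! i = complex_of_real (\<Sum>k<n. (cmod (ws ! i $ k))\<^sup>2)"
      unfolding sp[OF i i] by (simp add: complex_mult_cnj cmod_power2)
    then have "Re (ws ! i \<bullet>c ws ! i) \<ge> 0" by (simp add: sum_nonneg)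
    then show e: "ws ! i \<bullet>c ws ! i = complex_of_real ((r i)\<^sup>2)" using s by (simp add: r_def)
    have "ws ! i \<bullet>c ws ! i \<noteq> 0" using corthogonalD[OF orth, of i i] i len by auto
    then show "r i \<noteq> 0" using e by auto
  qed
  define U where "U = mat n n (\<lambda>(k, j). ws ! j $ k / complex_of_real (r j))"
  have U: "U \<in> carrier_mat n n" by (simp add: U_def)
  have "adj U * U = 1\<^sub>m n"
  proof (rule eq_matI)
    fix i j assume "i < dim_row (1\<^sub>m n :: complex mat)" "j < dim_col (1\<^sub>m n :: complex mat)"
    then have ij: "i < n" "j < n" by auto
    have "(adj U * U) $$ (i, j) = (\<Sum>k<n. cnj (ws ! i $ k / r i) * (ws ! j $ k / r j))"
      using ij U by (subst mult_index[of _ n n _ n]) (auto simp: U_def)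
    also have "\<dots> = (ws ! j \<bullet>c ws ! i) / (complex_of_real (r i) * complex_of_real (r j))"
      unfolding sp[OF ij(2,1)] by (simp add: sum_divide_distrib ac_simps)
    also have "\<dots> = 1\<^sub>m n $$ (i, j)"
      using corthogonalD[OF orth, of j i] self[OF ij(1)] r0[OF ij(1)] ij len by (auto simp: power2_eq_square)
    finally show "(adj U * U) $$ (i, j) = 1\<^sub>m n $$ (i, j)" .
  qed (use U in auto)
  moreover have "col U 0 = (1 / complex_of_real (r 0)) \<cdot>\<^sub>v v"
  proof -
    have "ws ! 0 = v" using hd ne len by (metis hd_conv_nth list.size(3))
    then show ?thesis using ne v(1) by (intro eq_vecI) (auto simp: U_def)
  qed
  ultimately show ?thesis using U that by blast
qed

text \<open>Induction that splits off an eigenvector for the first listed root. The list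
  \<open>es\<close> carries the roots of the characteristic polynomial with multiplicity, so the
  diagonal entries are the very eigenvalues counted by \<open>signature\<close>.\<close>

lemma hermitian_diagonalization:
  assumes "A \<in> carrier_mat n n" "adj A = A" "char_poly A = (\<Prod>e\<leftarrow>es. [:- e, 1:])"
  shows "\<exists>U\<in>carrier_mat n n. adj U * U = 1\<^sub>m n \<and> adj U * A * U = mat_diag n (\<lambda>i. es ! i)"
  using assms
proof (induction es arbitrary: n A)
  case Nil
  then have "n = 0" using degree_monic_char_poly[of A n] by simp
  then show ?case using Nil by (intro bexI[of _ "1\<^sub>m n"]) (auto simp: mat_diag_def)
next
  case (Cons e es)
  note A = Cons.prems(1)
  have "degree (char_poly A) \<noteq> 0"
  proof -
    have "(\<Prod>e\<leftarrow>es. [:- e, 1:]) \<noteq> 0" by (auto simp: prod_list_zero_iff)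
    then have "degree ([:- e, 1:] * (\<Prod>e\<leftarrow>es. [:- e, 1:])) = Suc (degree (\<Prod>e\<leftarrow>es. [:- e, 1:]))"
      by (subst degree_mult_eq) auto
    then show ?thesis using Cons.prems(3) by simp
  qed
  then obtain m where n: "n = Suc m" using degree_monic_char_poly[OF A] by (cases n) auto
  have "eigenvalue A e"
    unfolding eigenvalue_root_char_poly[OF A] Cons.prems(3) by simp
  then obtain v where v: "v \<in> carrier_vec n" "v \<noteq> 0\<^sub>v n" "A *\<^sub>v v = e \<cdot>\<^sub>v v"
    using A unfolding eigenvalue_def eigenvector_def by auto
  obtain U c where U: "U \<in> carrier_mat n n" "adj U * U = 1\<^sub>m n" "col U 0 = c \<cdot>\<^sub>v v"
    using unitary_first_column[OF v(1,2)] by blast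
  have U': "adj U \<in> carrier_mat n n" using U by simp
  have UU': "U * adj U = 1\<^sub>m n" using mat_mult_left_right_inverse[OF U' U(1) U(2)] .
  define C where "C = adj U * A * U"
  have C: "C \<in> carrier_mat n n" unfolding C_def using U(1) A by (intro mult_carrier_mat[of _ n n _ n]) auto
  have C_adj: "adj C = C"
    unfolding C_def by (rule adj_conjugate_hermitian[OF A U(1) Cons.prems(2)])
  have Au: "A *\<^sub>v col U 0 = e \<cdot>\<^sub>v col U 0"
    using v A unfolding U(3) by (simp add: mult_mat_vec smult_smult_assoc mult.commute)
  \<comment> \<open>The first column of \<open>U\<close> is an eigenvector, so the first column of
    \<open>C\<close> is \<open>e\<close> times a unit vector; Hermitian symmetry then clears the
    first row too.\<close>
  have C0: "C $$ (i, 0) = (if i = 0 then e else 0)" if i: "i < n" for i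
  proof -
    have "C $$ (i, 0) = row (adj U) i \<bullet> col (A * U) 0"
      unfolding C_def assoc_mult_mat[OF U' A U(1)] using A U(1) i n by simp
    also have "col (A * U) 0 = e \<cdot>\<^sub>v col U 0"
      using A U n Au by (subst col_mult2[of _ n n _ n]) auto
    also have "row (adj U) i \<bullet> (e \<cdot>\<^sub>v col U 0) = e * (row (adj U) i \<bullet> col U 0)"
    proof (rule scalar_prod_smult_distrib[of _ n])
      show "row (adj U) i \<in> carrier_vec n" "col U 0 \<in> carrier_vec n"
        using U(1) i n by (auto intro!: carrier_vecI)
    qed
    also have "row (adj U) i \<bullet> col U 0 = (adj U * U) $$ (i, 0)"
      using U(1) i n by simp
    also have "\<dots> = (if i = 0 then 1 else 0)" unfolding U(2) using i n by simp
    finally show ?thesis by simp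
  qed
  have C0': "C $$ (0, j) = (if j = 0 then e else 0)" if j: "j < n" for j
  proof (cases "j = 0")
    case False
    have "C $$ (0, j) = cnj (C $$ (j, 0))"
      using C j n by (subst C_adj[symmetric], subst adj_index) auto
    then show ?thesis using C0[OF j] False by simp
  qed (use C0[of 0] n in simp)
  define D where "D = mat m m (\<lambda>(i, j). C $$ (Suc i, Suc j))"
  define E where "E = (mat 1 1 (\<lambda>_. e) :: complex mat)"
  have D: "D \<in> carrier_mat m m" and E: "E \<in> carrier_mat 1 1" by (simp_all add: D_def E_def)
  have C_block: "C = four_block_mat E (0\<^sub>m 1 m) (0\<^sub>m m 1) D"
    using C n C0 C0' by (intro eq_matI) (auto simp: D_def E_def)
  have D_adj: "adj D = D"
  proof (rule eq_matI)
    fix i j assume "i < dim_row D" "j < dim_col D"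
    then have ij: "i < m" "j < m" using D by auto
    have "C $$ (Suc i, Suc j) = cnj (C $$ (Suc j, Suc i))"
      using C ij n by (subst C_adj[symmetric], subst adj_index) auto
    then show "adj D $$ (i, j) = D $$ (i, j)" using ij D by (simp add: D_def)
  qed (use D in auto)
  have "similar_mat C A"
  proof (rule similar_matI[of _ _ _ _ n])
    show "C = adj U * A * U" by (simp add: C_def)
  qed (use C A U U' UU' in auto)
  then have "char_poly A = char_poly C" by (simp add: char_poly_similar)
  also have "\<dots> = char_poly E * char_poly D"
    unfolding C_block by (rule char_poly_four_block_zeros_col[OF E _ D]) simp
  also have "char_poly E = [:- e, 1:]"
    by (simp add: E_def char_poly_defs det_def sign_def)
  finally have "[:- e, 1:] * char_poly D = [:- e, 1:] * (\<Prod>e\<leftarrow>es. [:- e, 1:])"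
    using Cons.prems(3) by simp
  then have "char_poly D = (\<Prod>e\<leftarrow>es. [:- e, 1:])"
    by (subst (asm) mult_cancel_left) auto
  from Cons.IH[OF D D_adj this] obtain P where P: "P \<in> carrier_mat m m" "adj P * P = 1\<^sub>m m"
      "adj P * D * P = mat_diag m (\<lambda>i. es ! i)" by blast
  define Q where "Q = four_block_mat (1\<^sub>m 1) (0\<^sub>m 1 m) (0\<^sub>m m 1) P"
  have Q: "Q \<in> carrier_mat n n"
    using four_block_carrier_mat[of "1\<^sub>m 1" 1 1 P m m "0\<^sub>m 1 m" "0\<^sub>m m 1"] P(1) n by (simp add: Q_def)
  have adj_Q: "adj Q = four_block_mat (1\<^sub>m 1) (0\<^sub>m 1 m) (0\<^sub>m m 1) (adj P)"
    using P by (intro eq_matI) (auto simp: Q_def)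
  have adj_P: "adj P \<in> carrier_mat m m" using P by simp
  have QQ: "adj Q * Q = 1\<^sub>m n"
    unfolding adj_Q unfolding Q_def
    by (subst mult_four_block_mat[of _ 1 1 _ m _ m _ _ 1 _ m]) (use P adj_P n in \<open>auto simp: four_block_one_mat\<close>)
  have QCQ: "adj Q * C * Q = four_block_mat E (0\<^sub>m 1 m) (0\<^sub>m m 1) (mat_diag m (\<lambda>i. es ! i))"
    unfolding adj_Q C_block unfolding Q_def P(3)[symmetric]
    by (subst mult_four_block_mat[of _ 1 1 _ m _ m _ _ 1 _ m], use P(1) adj_P D E in auto,
        subst mult_four_block_mat[of _ 1 1 _ m _ m _ _ 1 _ m],
        use P(1) adj_P D E mult_carrier_mat[OF adj_P D] mult_carrier_mat[OF mult_carrier_mat[OF adj_P D] P(1)] in auto)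
  also have "\<dots> = mat_diag n (\<lambda>i. (e # es) ! i)"
    by (intro eq_matI) (auto simp: E_def mat_diag_def n)
  finally have diag: "adj Q * C * Q = mat_diag n (\<lambda>i. (e # es) ! i)" .
  have UQ: "U * Q \<in> carrier_mat n n" using U(1) Q by simp
  have "adj (U * Q) * 1\<^sub>m n * (U * Q) = adj Q * (adj U * 1\<^sub>m n * U) * Q"
    by (rule adj_conjugate[OF _ U(1) Q]) simp
  then have 1: "adj (U * Q) * (U * Q) = 1\<^sub>m n"
    using U(1,2) UQ QQ Q right_mult_one_mat[of "adj U" n n] right_mult_one_mat[of "adj (U * Q)" n n]
      right_mult_one_mat[of "adj Q" n n] by simp
  have "adj (U * Q) * A * (U * Q) = adj Q * C * Q"
    unfolding C_def by (rule adj_conjugate[OF A U(1) Q])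
  then show ?case using 1 diag U Q by (intro bexI[of _ "U * Q"]) auto
qed

section \<open>Sylvester's law of inertia\<close>

lemma underdetermined_system:
  fixes R :: "(nat \<Rightarrow> complex) list"
  assumes "length R < n"
  obtains x where "\<exists>j<n. x j \<noteq> 0" "\<And>r. r \<in> set R \<Longrightarrow> (\<Sum>j<n. r j * x j) = 0"
proof -
  define c where "c = (\<lambda>i. vec n (\<lambda>j. if i < length R then (R ! i) j else 0))"
  \<comment> \<open>The system is padded with zero rows to a square one; as there are fewer than n
    equations, the last row is zero and the determinant vanishes.\<close>
  define A where "A = mat\<^sub>r n n (\<lambda>i. if i = n - 1 then 0\<^sub>v n else c i)"
  have A: "A \<in> carrier_mat n n" by (simp add: A_def)
  have "det A = 0"
    unfolding A_def by (rule det_row_0) (use assms in \<open>auto simp: c_def\<close>)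
  then obtain v where v: "v \<in> carrier_vec n" "v \<noteq> 0\<^sub>v n" "A *\<^sub>v v = 0\<^sub>v n"
    using det_0_iff_vec_prod_zero[OF A] by auto
  have "(\<Sum>j<n. r j * v $ j) = 0" if r: "r \<in> set R" for r
  proof -
    obtain i where i: "i < length R" "r = R ! i" using r by (auto simp: in_set_conv_nth)
    then have "row A i = vec n r" using assms by (auto simp: A_def c_def)
    moreover have "(A *\<^sub>v v) $ i = 0" using v i assms by simp
    ultimately have "vec n r \<bullet> v = 0" using i assms A by simp
    then show ?thesis using v by (simp add: scalar_prod_def atLeast0LessThan)
  qed
  moreover have "\<exists>j<n. v $ j \<noteq> 0" using v by (metis eq_vecI carrier_vecD index_zero_vec)
  ultimately show ?thesis using that by blast
qed

text \<open>Dimension count: if \<open>f\<close> had more positive entries than \<open>d\<close>,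
  some nonzero x would vanish where \<open>f\<close> is not positive while its image y vanishes
  where \<open>d\<close> is positive. The same quadratic form would be positive at x by
  \<open>f\<close> and at most 0 by \<open>d\<close>.\<close>

lemma inertia_le:
  fixes f d :: "nat \<Rightarrow> real" and G :: "nat \<Rightarrow> nat \<Rightarrow> complex"
  assumes eq: "\<And>i j. i < n \<Longrightarrow> j < n \<Longrightarrow>
    (\<Sum>k<n. G i k * complex_of_real (d k) * cnj (G j k)) = (if i = j then complex_of_real (f i) else 0)"
  shows "card {i. i < n \<and> f i > 0} \<le> card {k. k < n \<and> d k > 0}"
proof (rule ccontr)
  assume less: "\<not> ?thesis"
  define R1 where "R1 = map (\<lambda>i j. if j = i then 1 else 0 :: complex) (filter (\<lambda>i. \<not> f i > 0) [0..<n])"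
  define R2 where "R2 = map (\<lambda>k i. G i k) (filter (\<lambda>k. d k > 0) [0..<n])"
  have len: "length (filter P [0..<n]) = card {i. i < n \<and> P i}" for P
    by (subst distinct_card[symmetric]) (auto intro: arg_cong[of _ _ card])
  have "card {i. i < n \<and> \<not> f i > 0} + card {i. i < n \<and> f i > 0} = n"
    by (subst card_Un_disjoint[symmetric]) (auto simp: Collect_disj_eq[symmetric] intro: trans[OF arg_cong[of _ "{..<n}" card]])
  then have "length (R1 @ R2) < n" using less by (simp add: R1_def R2_def len)
  then obtain x where x: "\<exists>j<n. x j \<noteq> 0" "\<And>r. r \<in> set (R1 @ R2) \<Longrightarrow> (\<Sum>j<n. r j * x j) = 0"
    using underdetermined_system by blast
  have x0: "x i = 0" if "i < n" "\<not> f i > 0" for i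
    using x(2)[of "\<lambda>j. if j = i then 1 else 0"] that by (simp add: R1_def if_distrib[of "\<lambda>a. a * _"] cong: if_cong)
  define y where "y = (\<lambda>k. \<Sum>i<n. G i k * x i)"
  have y0: "y k = 0" if "k < n" "d k > 0" for k
    using x(2)[of "\<lambda>i. G i k"] that by (auto simp: R2_def y_def)
  have "complex_of_real (\<Sum>k<n. d k * (cmod (y k))\<^sup>2) = (\<Sum>k<n. complex_of_real (d k) * (y k * cnj (y k)))"
    unfolding of_real_sum of_real_mult complex_norm_square ..
  also have "\<dots> = (\<Sum>k<n. \<Sum>i<n. \<Sum>j<n. x i * cnj (x j) * (G i k * complex_of_real (d k) * cnj (G j k)))"
    unfolding y_def cnj_sum sum_product by (simp add: sum_distrib_left ac_simps)
  also have "\<dots> = (\<Sum>i<n. \<Sum>j<n. x i * cnj (x j) * (\<Sum>k<n. G i k * complex_of_real (d k) * cnj (G j k)))"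
  proof -
    have "(\<Sum>k<n. \<Sum>i<n. \<Sum>j<n. H i j k) = (\<Sum>i<n. \<Sum>j<n. \<Sum>k<n. H i j k)" for H :: "nat \<Rightarrow> nat \<Rightarrow> nat \<Rightarrow> complex"
      by (subst sum.swap) (intro sum.cong refl sum.swap)
    then show ?thesis by (simp only: sum_distrib_left)
  qed
  also have "\<dots> = (\<Sum>i<n. \<Sum>j<n. x i * cnj (x j) * (if i = j then complex_of_real (f i) else 0))"
    by (intro sum.cong refl) (simp add: eq)
  also have "\<dots> = (\<Sum>i<n. x i * cnj (x i) * complex_of_real (f i))"
    by (simp add: if_distrib cong: if_cong)
  also have "\<dots> = complex_of_real (\<Sum>i<n. f i * (cmod (x i))\<^sup>2)"
    unfolding of_real_sum of_real_mult complex_norm_square by (intro sum.cong refl) (simp only: ac_simps)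
  finally have "(\<Sum>k<n. d k * (cmod (y k))\<^sup>2) = (\<Sum>i<n. f i * (cmod (x i))\<^sup>2)"
    by (simp only: of_real_eq_iff)
  moreover have "(\<Sum>k<n. d k * (cmod (y k))\<^sup>2) \<le> 0"
    using y0 by (intro sum_nonpos) (force simp: mult_le_0_iff)
  moreover have "(\<Sum>i<n. f i * (cmod (x i))\<^sup>2) > 0"
  proof -
    obtain j where j: "j < n" "x j \<noteq> 0" using x(1) by blast
    then have "f j > 0" using x0 by blast
    then show ?thesis using j x0 by (intro sum_pos2[of _ j]) (force simp: zero_le_mult_iff)+
  qed
  ultimately show False by linarith
qed

text \<open>\<open>M\<close> writes the basis with Gram matrix \<open>A\<close> in an orthogonal
  basis with norms \<open>d\<close>, and \<open>M'\<close> goes back. Each direction yields one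
  inequality of \<open>inertia_le\<close>.\<close>

lemma signature_congruent_diagonal:
  fixes d :: "nat \<Rightarrow> real" and M M' :: "nat \<Rightarrow> nat \<Rightarrow> complex"
  assumes A: "A \<in> carrier_mat n n"
    and M: "\<And>i j. i < n \<Longrightarrow> j < n \<Longrightarrow> A $$ (i, j) = (\<Sum>k<n. M i k * complex_of_real (d k) * cnj (M j k))"
    and M': "\<And>i j. i < n \<Longrightarrow> j < n \<Longrightarrow>
      (\<Sum>k<n. \<Sum>l<n. M' i k * A $$ (k, l) * cnj (M' j l)) = (if i = j then complex_of_real (d i) else 0)"
  shows "signature A = int (card {k. k < n \<and> d k > 0}) - int (card {k. k < n \<and> d k < 0})"
proof -
  obtain es where es: "char_poly A = (\<Prod>e\<leftarrow>es. [:- e, 1:])" "length es = n"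
    using char_poly_factorized[OF A] by blast
  have herm: "adj A = A"
    using A M by (intro eq_matI) (auto simp: ac_simps)
  obtain U where U: "U \<in> carrier_mat n n" "adj U * U = 1\<^sub>m n" "adj U * A * U = mat_diag n (\<lambda>i. es ! i)"
    using hermitian_diagonalization[OF A herm es(1)] by blast
  have U': "adj U \<in> carrier_mat n n" using U by simp
  have UU': "U * adj U = 1\<^sub>m n" using mat_mult_left_right_inverse[OF U' U(1) U(2)] .
  define E where "E = mat_diag n (\<lambda>i. es ! i)"
  have E: "E \<in> carrier_mat n n" by (simp add: E_def mat_diag_def)
  define f where "f = (\<lambda>i. Re (es ! i))"
  have E_adj: "adj E = E"
    unfolding E_def U(3)[symmetric] by (rule adj_conjugate_hermitian[OF A U(1) herm])
  have real: "es ! i = complex_of_real (f i)" if "i < n" for i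
  proof -
    have "adj E $$ (i, i) = E $$ (i, i)" by (simp add: E_adj)
    then show ?thesis using that by (auto simp: E_def mat_diag_def f_def complex_eq_iff)
  qed
  have E_index: "E $$ (i, j) = (if i = j then complex_of_real (f i) else 0)" if "i < n" "j < n" for i j
    using that real[of j] by (auto simp: E_def mat_diag_def)
  have triple: "(adj V * B * V) $$ (i, j) = (\<Sum>k<n. \<Sum>l<n. cnj (V $$ (k, i)) * B $$ (k, l) * V $$ (l, j))"
    if "V \<in> carrier_mat n n" "B \<in> carrier_mat n n" "i < n" "j < n" for V B i j
  proof -
    have "(adj V * B * V) $$ (i, j) = (\<Sum>l<n. (\<Sum>k<n. cnj (V $$ (k, i)) * B $$ (k, l)) * V $$ (l, j))"
      using that mult_carrier_mat[of "adj V" n n B n] by (subst mult_index[of _ n n _ n]) (auto intro!: sum.cong simp: mult_index[of "adj V" n n B n] simp del: index_mult_mat)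
    then show ?thesis by (simp add: sum_distrib_right) (rule sum.swap)
  qed
  have "A = U * E * adj U"
  proof -
    have "adj (U * adj U) * A * (U * adj U) = U * (adj U * A * U) * adj U"
      using adj_conjugate[OF A U(1) U'] by simp
    then show ?thesis using A unfolding UU' U(3) E_def by simp
  qed
  then have A_E: "A $$ (k, l) = (\<Sum>a<n. U $$ (k, a) * complex_of_real (f a) * cnj (U $$ (l, a)))" if "k < n" "l < n" for k l
  proof -
    have "A $$ (k, l) = (adj (adj U) * E * adj U) $$ (k, l)"
      by (subst \<open>A = U * E * adj U\<close>) simp
    also have "\<dots> = (\<Sum>a<n. \<Sum>b<n. cnj (adj U $$ (a, k)) * E $$ (a, b) * adj U $$ (b, l))"
      by (rule triple[OF U' E that])
    also have "\<dots> = (\<Sum>a<n. \<Sum>b<n. if a = b then U $$ (k, a) * complex_of_real (f a) * cnj (U $$ (l, a)) else 0)"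
      using U(1) that by (intro sum.cong refl) (simp add: E_index)
    finally show ?thesis by simp
  qed
  \<comment> \<open>Both base changes are composed with the diagonalizing unitary, so that
    \<open>d\<close> is compared with the eigenvalues \<open>f\<close> instead of with
    \<open>A\<close>.\<close>
  define G where "G = (\<lambda>i a. \<Sum>k<n. cnj (U $$ (k, i)) * M k a)"
  define G' where "G' = (\<lambda>i a. \<Sum>k<n. M' i k * U $$ (k, a))"
  have G: "(\<Sum>k<n. G i k * complex_of_real (d k) * cnj (G j k)) = (if i = j then complex_of_real (f i) else 0)"
    if ij: "i < n" "j < n" for i j
  proof -
    have "(if i = j then complex_of_real (f i) else 0) = (\<Sum>k<n. \<Sum>l<n. cnj (U $$ (k, i)) * A $$ (k, l) * U $$ (l, j))"
      using triple[OF U(1) A ij] E_index[OF ij] unfolding U(3) E_def by simp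
    also have "\<dots> = (\<Sum>k<n. \<Sum>l<n. \<Sum>a<n. (cnj (U $$ (k, i)) * M k a) * complex_of_real (d a) * cnj (cnj (U $$ (l, j)) * M l a))"
      by (intro sum.cong refl) (simp add: M sum_distrib_left sum_distrib_right ac_simps)
    also have "\<dots> = (\<Sum>a<n. \<Sum>k<n. \<Sum>l<n. (cnj (U $$ (k, i)) * M k a) * complex_of_real (d a) * cnj (cnj (U $$ (l, j)) * M l a))"
      by (rule sum_rotate)
    also have "\<dots> = (\<Sum>a<n. G i a * complex_of_real (d a) * cnj (G j a))"
      unfolding G_def cnj_sum by (simp add: sum_distrib_left sum_distrib_right ac_simps)
    finally show ?thesis ..
  qed
  have G': "(\<Sum>k<n. G' i k * complex_of_real (f k) * cnj (G' j k)) = (if i = j then complex_of_real (d i) else 0)"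
    if ij: "i < n" "j < n" for i j
  proof -
    have "(if i = j then complex_of_real (d i) else 0) = (\<Sum>k<n. \<Sum>l<n. M' i k * A $$ (k, l) * cnj (M' j l))"
      using M'[OF ij] by simp
    also have "\<dots> = (\<Sum>k<n. \<Sum>l<n. \<Sum>a<n. (M' i k * U $$ (k, a)) * complex_of_real (f a) * cnj (M' j l * U $$ (l, a)))"
      by (intro sum.cong refl) (simp add: A_E sum_distrib_left sum_distrib_right ac_simps)
    also have "\<dots> = (\<Sum>a<n. \<Sum>k<n. \<Sum>l<n. (M' i k * U $$ (k, a)) * complex_of_real (f a) * cnj (M' j l * U $$ (l, a)))"
      by (rule sum_rotate)
    also have "\<dots> = (\<Sum>a<n. G' i a * complex_of_real (f a) * cnj (G' j a))"
      unfolding G'_def cnj_sum by (simp add: sum_distrib_left sum_distrib_right ac_simps)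
    finally show ?thesis ..
  qed
  have pos: "card {i. i < n \<and> f i > 0} = card {k. k < n \<and> d k > 0}"
    using inertia_le[of n G d f, OF G] inertia_le[of n G' f d, OF G'] by linarith
  \<comment> \<open>Negative entries are the positive entries of the negated form.\<close>
  have neg: "card {i. i < n \<and> f i < 0} = card {k. k < n \<and> d k < 0}"
  proof -
    have 1: "(\<Sum>k<n. G i k * complex_of_real (- d k) * cnj (G j k)) = (if i = j then complex_of_real (- f i) else 0)"
      if "i < n" "j < n" for i j
      using G[OF that] by (simp add: sum_negf split: if_splits)
    have 2: "(\<Sum>k<n. G' i k * complex_of_real (- f k) * cnj (G' j k)) = (if i = j then complex_of_real (- d i) else 0)"
      if "i < n" "j < n" for i j
      using G'[OF that] by (simp add: sum_negf split: if_splits)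
    show ?thesis
      using inertia_le[of n G "\<lambda>k. - d k" "\<lambda>i. - f i", OF 1] inertia_le[of n G' "\<lambda>k. - f k" "\<lambda>i. - d i", OF 2]
      by simp
  qed
  have "proots (char_poly A) = mset es"
    unfolding es(1)
  proof (induction es)
    case (Cons e es)
    have "(\<Prod>e\<leftarrow>es. [:- e, 1:]) \<noteq> 0" by (auto simp: prod_list_zero_iff)
    then have "proots ([:- e, 1:] * (\<Prod>e\<leftarrow>es. [:- e, 1:])) = proots [:- e, 1:] + proots (\<Prod>e\<leftarrow>es. [:- e, 1:])"
      by (intro proots_mult) auto
    then show ?case using Cons by simp
  qed simp
  moreover have "size (filter_mset P (mset es)) = card {i. i < n \<and> P (es ! i)}" for P
    by (simp add: mset_filter[symmetric] length_filter_conv_card es(2) del: mset_filter)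
  ultimately show ?thesis
    unfolding signature_def f_def[symmetric] using pos neg by (simp add: f_def)
qed

section \<open>Weight vectors for the degenerate affine Hecke algebra\<close>

declare One_nat_def [simp del]

text \<open>The operators act on an ambient vector space and the form is controlled on the subspace
  \<open>V\<close> only. This covers both the group algebra, where \<open>V\<close> is everything,
  and the copy of the quotient module inside the free one. No definiteness is imposed, since the
  signature is the object of study.\<close>

locale hermitian_space = vector_space sc
  for sc :: "complex \<Rightarrow> 'v \<Rightarrow> 'v::ab_group_add" (infixr "*s" 75) +
  fixes V :: "'v set" and B :: "'v \<Rightarrow> 'v \<Rightarrow> complex"
  assumes subspace_V: "subspace V"
    and B_add_left: "u \<in> V \<Longrightarrow> v \<in> V \<Longrightarrow> w \<in> V \<Longrightarrow> B (u + v) w = B u w + B v w"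
    and B_scale_left: "u \<in> V \<Longrightarrow> v \<in> V \<Longrightarrow> B (a *s u) v = a * B u v"
    and B_herm: "u \<in> V \<Longrightarrow> v \<in> V \<Longrightarrow> B v u = cnj (B u v)"
begin

lemma V_closed [simp, intro]:
  "0 \<in> V" "u \<in> V \<Longrightarrow> v \<in> V \<Longrightarrow> u + v \<in> V" "u \<in> V \<Longrightarrow> v \<in> V \<Longrightarrow> u - v \<in> V" "u \<in> V \<Longrightarrow> a *s u \<in> V"
  using subspace_V by (auto simp: subspace_0 subspace_add subspace_diff subspace_scale)

lemma V_sum [intro]: "(\<And>i. i \<in> I \<Longrightarrow> f i \<in> V) \<Longrightarrow> (\<Sum>i\<in>I. f i) \<in> V"
  using subspace_V by (rule subspace_sum)

lemma B_add_right: "u \<in> V \<Longrightarrow> v \<in> V \<Longrightarrow> w \<in> V \<Longrightarrow> B w (u + v) = B w u + B w v"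
  by (metis B_add_left B_herm V_closed(2) complex_cnj_add)

lemma B_scale_right: "u \<in> V \<Longrightarrow> v \<in> V \<Longrightarrow> B v (a *s u) = cnj a * B v u"
  by (metis B_scale_left B_herm V_closed(4) complex_cnj_mult)

lemma B_zero [simp]: "v \<in> V \<Longrightarrow> B 0 v = 0" "v \<in> V \<Longrightarrow> B v 0 = 0"
  using B_scale_left[of 0 v 0] B_scale_right[of 0 v 0] by auto

lemma B_sum_left: "(\<And>i. i \<in> I \<Longrightarrow> f i \<in> V) \<Longrightarrow> v \<in> V \<Longrightarrow> B (\<Sum>i\<in>I. f i) v = (\<Sum>i\<in>I. B (f i) v)"
  by (induction I rule: infinite_finite_induct) (auto simp: B_add_left V_sum)

lemma B_sum_right: "(\<And>i. i \<in> I \<Longrightarrow> f i \<in> V) \<Longrightarrow> v \<in> V \<Longrightarrow> B v (\<Sum>i\<in>I. f i) = (\<Sum>i\<in>I. B v (f i))"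
  by (induction I rule: infinite_finite_induct) (auto simp: B_add_right V_sum)

lemma B_real: "v \<in> V \<Longrightarrow> B v v = complex_of_real (Re (B v v))"
  using B_herm[of v v] by (simp add: complex_eq_iff)

definition weight :: "nat \<Rightarrow> (nat \<Rightarrow> 'v \<Rightarrow> 'v) \<Rightarrow> (nat \<Rightarrow> real) \<Rightarrow> 'v \<Rightarrow> bool" where
  "weight n u a f \<longleftrightarrow> f \<in> V \<and> (\<forall>k\<in>{1..n}. u k f = complex_of_real (a k) *s f)"

lemma weight_orthogonal:
  assumes "weight n u a f" "weight n u b g" and k: "k \<in> {1..n}" "a k \<noteq> b k"
    and adj: "B (u k f) g = B f (u k g)"
  shows "B f g = 0"
proof -
  have "f \<in> V" "g \<in> V" "u k f = complex_of_real (a k) *s f" "u k g = complex_of_real (b k) *s g"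
    using assms by (auto simp: weight_def)
  then have "complex_of_real (a k) * B f g = complex_of_real (b k) * B f g"
    using adj by (simp add: B_scale_left B_scale_right)
  then show ?thesis using k by simp
qed

end

text \<open>The commutation relations of the degenerate affine Hecke algebra, in a representation where
  the simple reflections \<open>s i\<close> are isometries and the \<open>u k\<close> are self-adjoint.\<close>

locale degenerate_hecke = hermitian_space sc V B
  for sc :: "complex \<Rightarrow> 'v \<Rightarrow> 'v::ab_group_add" (infixr "*s" 75) and V B +
  fixes n :: nat and \<kappa> :: real and s u :: "nat \<Rightarrow> 'v \<Rightarrow> 'v"
  assumes s_V: "i \<in> {1..<n} \<Longrightarrow> v \<in> V \<Longrightarrow> s i v \<in> V"
    and s_add: "i \<in> {1..<n} \<Longrightarrow> v \<in> V \<Longrightarrow> w \<in> V \<Longrightarrow> s i (v + w) = s i v + s i w"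
    and s_scale: "i \<in> {1..<n} \<Longrightarrow> v \<in> V \<Longrightarrow> s i (a *s v) = a *s s i v"
    and s_s: "i \<in> {1..<n} \<Longrightarrow> v \<in> V \<Longrightarrow> s i (s i v) = v"
    and B_s: "i \<in> {1..<n} \<Longrightarrow> v \<in> V \<Longrightarrow> w \<in> V \<Longrightarrow> B (s i v) (s i w) = B v w"
    and u_V: "k \<in> {1..n} \<Longrightarrow> v \<in> V \<Longrightarrow> u k v \<in> V"
    and u_add: "k \<in> {1..n} \<Longrightarrow> v \<in> V \<Longrightarrow> w \<in> V \<Longrightarrow> u k (v + w) = u k v + u k w"
    and u_scale: "k \<in> {1..n} \<Longrightarrow> v \<in> V \<Longrightarrow> u k (a *s v) = a *s u k v"
    and B_u: "k \<in> {1..n} \<Longrightarrow> v \<in> V \<Longrightarrow> w \<in> V \<Longrightarrow> B (u k v) w = B v (u k w)"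
    and s_u: "i \<in> {1..<n} \<Longrightarrow> v \<in> V \<Longrightarrow> s i (u i v) = u (Suc i) (s i v) - complex_of_real \<kappa> *s v"
    and s_u_other: "i \<in> {1..<n} \<Longrightarrow> k \<in> {1..n} \<Longrightarrow> k \<noteq> i \<Longrightarrow> k \<noteq> Suc i \<Longrightarrow> v \<in> V \<Longrightarrow> s i (u k v) = u k (s i v)"
begin

lemma orthogonal:
  assumes "weight n u a f" "weight n u b g" "k \<in> {1..n}" "a k \<noteq> b k"
  shows "B f g = 0"
  by (rule weight_orthogonal[OF assms], rule B_u) (use assms in \<open>auto simp: weight_def\<close>)

text \<open>On the span of \<open>f\<close> and \<open>s i f\<close> the operator \<open>u i\<close>
  is triangular with eigenvalues \<open>a i\<close> and \<open>a (Suc i)\<close>; this is the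
  eigenvector for the second one with coefficient 1 at \<open>s i f\<close>.\<close>

definition intertwiner :: "nat \<Rightarrow> (nat \<Rightarrow> real) \<Rightarrow> 'v \<Rightarrow> 'v" where
  "intertwiner i a f = s i f + complex_of_real (\<kappa> / (a i - a (Suc i))) *s f"

context
  fixes i a f
  assumes i: "i \<in> {1..<n}" and f: "weight n u a f" and ne: "a i \<noteq> a (Suc i)"
begin

private lemma fV: "f \<in> V" and uf: "k \<in> {1..n} \<Longrightarrow> u k f = complex_of_real (a k) *s f"
    and ii: "i \<in> {1..n}" "Suc i \<in> {1..n}"
  using f i by (auto simp: weight_def)

lemma weight_intertwiner: "weight n u (a \<circ> Transposition.transpose i (Suc i)) (intertwiner i a f)"
proof -
  define \<theta> where "\<theta> = \<kappa> / (a i - a (Suc i))"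
  \<comment> \<open>The second equation is the eigenvector condition for \<open>u i\<close> at the
    coefficient of \<open>f\<close>, the first one that for \<open>u (Suc i)\<close>.\<close>
  have th: "\<kappa> + \<theta> * a (Suc i) = \<theta> * a i" "- \<kappa> + \<theta> * a i = \<theta> * a (Suc i)"
    using ne by (simp_all add: \<theta>_def field_simps)
  note sV = s_V[OF i fV]
  have u1: "u (Suc i) (s i f) = complex_of_real (a i) *s s i f + complex_of_real \<kappa> *s f"
    using s_u[OF i fV] uf[OF ii(1)] s_scale[OF i fV] by (simp add: algebra_simps)
  have "s i (u i (s i f)) = complex_of_real (a (Suc i)) *s f + complex_of_real (-\<kappa>) *s s i f"
    using s_u[OF i sV] s_s[OF i fV] uf[OF ii(2)] by (simp add: scale_minus_left)
  then have "s i (s i (u i (s i f))) = s i (complex_of_real (a (Suc i)) *s f + complex_of_real (-\<kappa>) *s s i f)"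
    by simp
  also have "\<dots> = complex_of_real (a (Suc i)) *s s i f + complex_of_real (-\<kappa>) *s f"
    by (simp only: s_add[OF i V_closed(4)[OF fV] V_closed(4)[OF sV]] s_scale[OF i fV] s_scale[OF i sV] s_s[OF i fV])
  finally have u2: "u i (s i f) = complex_of_real (a (Suc i)) *s s i f + complex_of_real (-\<kappa>) *s f"
    using s_s[OF i u_V[OF ii(1) sV]] by simp
  have uk: "u k (intertwiner i a f) = u k (s i f) + complex_of_real \<theta> *s (complex_of_real (a k) *s f)"
    if "k \<in> {1..n}" for k
    unfolding intertwiner_def \<theta>_def[symmetric]
    using that by (simp only: u_add[OF that sV V_closed(4)[OF fV]] u_scale[OF that fV] uf)
  show ?thesis
    unfolding weight_def
  proof (intro conjI ballI)
    show "intertwiner i a f \<in> V" using fV sV by (auto simp: intertwiner_def)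
    fix k assume k: "k \<in> {1..n}"
    consider "k = i" | "k = Suc i" | "k \<noteq> i" "k \<noteq> Suc i" by blast
    then show "u k (intertwiner i a f) =
        complex_of_real ((a \<circ> Transposition.transpose i (Suc i)) k) *s intertwiner i a f"
    proof cases
      case 1
      have "u k (intertwiner i a f) = complex_of_real (a (Suc i)) *s s i f + complex_of_real (- \<kappa> + \<theta> * a i) *s f"
        using uk[OF k] u2 1 by (simp add: scale_left_distrib scale_left_diff_distrib mult.commute)
      then show ?thesis
        using 1 unfolding th by (simp add: intertwiner_def \<theta>_def[symmetric] scale_right_distrib mult.commute)
    next
      case 2
      have "u k (intertwiner i a f) = complex_of_real (a i) *s s i f + complex_of_real (\<kappa> + \<theta> * a (Suc i)) *s f"
        using uk[OF k] u1 2 by (simp add: scale_left_distrib scale_left_diff_distrib mult.commute)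
      then show ?thesis
        using 2 unfolding th by (simp add: intertwiner_def \<theta>_def[symmetric] scale_right_distrib mult.commute)
    next
      case 3
      have "u k (s i f) = complex_of_real (a k) *s s i f"
        using s_u_other[OF i k 3 fV] s_scale[OF i fV] uf[OF k] by simp
      then show ?thesis
        using uk[OF k] 3 by (simp add: intertwiner_def \<theta>_def[symmetric] scale_right_distrib mult.commute)
    qed
  qed
qed

text \<open>The intertwined vector has another weight than \<open>f\<close> and is therefore
  orthogonal to it, which determines this pairing.\<close>

lemma B_s_weight: "B (s i f) f = - complex_of_real (\<kappa> / (a i - a (Suc i))) * B f f"
proof -
  have "B (intertwiner i a f) f = 0"
    by (rule orthogonal[OF weight_intertwiner f ii(1)]) (use ne in simp)
  moreover have "B (intertwiner i a f) f = B (s i f) f + complex_of_real (\<kappa> / (a i - a (Suc i))) * B f f"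
    unfolding intertwiner_def using fV s_V[OF i fV] by (simp only: B_add_left V_closed B_scale_left)
  ultimately show ?thesis by (simp add: add_eq_0_iff)
qed

lemma B_intertwiner:
  "B (intertwiner i a f) (intertwiner i a f) = complex_of_real (1 - (\<kappa> / (a i - a (Suc i)))\<^sup>2) * B f f"
proof -
  define \<theta> where "\<theta> = \<kappa> / (a i - a (Suc i))"
  note sV = s_V[OF i fV]
  have "B f (s i f) = cnj (B (s i f) f)"
    by (rule B_herm[OF sV fV])
  also have "\<dots> = - complex_of_real \<theta> * B f f"
    using B_s_weight B_herm[OF fV fV] unfolding \<theta>_def by simp
  finally have 1: "B f (s i f) = - complex_of_real \<theta> * B f f" .
  have 2: "B (s i f) f = - complex_of_real \<theta> * B f f"
    using B_s_weight unfolding \<theta>_def .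
  have "B (intertwiner i a f) (intertwiner i a f)
      = B (s i f) (s i f) + cnj (complex_of_real \<theta>) * B (s i f) f
        + complex_of_real \<theta> * (B f (s i f) + cnj (complex_of_real \<theta>) * B f f)"
    unfolding intertwiner_def \<theta>_def[symmetric] using fV sV
    by (simp only: B_add_left B_add_right V_closed B_scale_left B_scale_right) (simp add: algebra_simps)
  then show ?thesis
    unfolding 1 2 \<theta>_def[symmetric] B_s[OF i fV fV] by (simp add: algebra_simps power2_eq_square)
qed

text \<open>Makes the intertwiner invertible between two weight spaces when the factor is nonzero;
  uniqueness of weight vectors is carried from tableau to tableau this way.\<close>

lemma intertwiner_intertwiner:
  "intertwiner i (a \<circ> Transposition.transpose i (Suc i)) (intertwiner i a f) =
    complex_of_real (1 - (\<kappa> / (a i - a (Suc i)))\<^sup>2) *s f"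
proof -
  define \<theta> where "\<theta> = \<kappa> / (a i - a (Suc i))"
  have th: "\<kappa> / (a (Suc i) - a i) = - \<theta>"
    using ne by (simp add: \<theta>_def field_simps)
  note sV = s_V[OF i fV]
  have "s i (s i f + complex_of_real \<theta> *s f) = f + complex_of_real \<theta> *s s i f"
    by (simp only: s_add[OF i sV V_closed(4)[OF fV]] s_scale[OF i fV] s_s[OF i fV])
  then show ?thesis
    unfolding intertwiner_def by (simp add: \<theta>_def[symmetric] th algebra_simps power2_eq_square)
qed

end

end

section \<open>Unitary representations of the symmetric group and Jucys-Murphy elements\<close>

locale symmetric_group_rep = hermitian_space sc V B
  for sc :: "complex \<Rightarrow> 'v \<Rightarrow> 'v::ab_group_add" (infixr "*s" 75) and V B +
  fixes n :: nat and act :: "(nat \<Rightarrow> nat) \<Rightarrow> 'v \<Rightarrow> 'v"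
  assumes act_add: "p permutes {1..n} \<Longrightarrow> act p (v + w) = act p v + act p w"
    and act_scale: "p permutes {1..n} \<Longrightarrow> act p (a *s v) = a *s act p v"
    and act_V: "p permutes {1..n} \<Longrightarrow> v \<in> V \<Longrightarrow> act p v \<in> V"
    and act_id: "v \<in> V \<Longrightarrow> act id v = v"
    and act_act: "p permutes {1..n} \<Longrightarrow> q permutes {1..n} \<Longrightarrow> v \<in> V \<Longrightarrow> act p (act q v) = act (p \<circ> q) v"
    and B_act: "p permutes {1..n} \<Longrightarrow> v \<in> V \<Longrightarrow> w \<in> V \<Longrightarrow> B (act p v) (act p w) = B v w"
begin

lemma transpose_permutes: "j \<in> {1..n} \<Longrightarrow> k \<in> {1..n} \<Longrightarrow> Transposition.transpose j k permutes {1..n}"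
  by (rule permutes_swap_id)

lemma act_zero: "p permutes {1..n} \<Longrightarrow> act p 0 = 0"
  using act_scale[of p 0 0] by simp

lemma act_sum: "p permutes {1..n} \<Longrightarrow> act p (\<Sum>i\<in>I. f i) = (\<Sum>i\<in>I. act p (f i))"
  by (induction I rule: infinite_finite_induct) (simp_all add: act_zero act_add)

lemma act_transpose_transpose:
  "j \<in> {1..n} \<Longrightarrow> k \<in> {1..n} \<Longrightarrow> v \<in> V \<Longrightarrow>
    act (Transposition.transpose j k) (act (Transposition.transpose j k) v) = v"
  by (simp only: act_act transpose_permutes transpose_comp_involutory act_id)

definition jucys_murphy :: "nat \<Rightarrow> 'v \<Rightarrow> 'v" where
  "jucys_murphy k v = (\<Sum>j\<in>{1..<k}. act (Transposition.transpose j k) v)"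

lemma jm_V: "k \<in> {1..n} \<Longrightarrow> v \<in> V \<Longrightarrow> jucys_murphy k v \<in> V"
  unfolding jucys_murphy_def by (intro V_sum act_V transpose_permutes) auto

lemma jm_add: "k \<in> {1..n} \<Longrightarrow> jucys_murphy k (v + w) = jucys_murphy k v + jucys_murphy k w"
  unfolding jucys_murphy_def sum.distrib[symmetric]
  by (intro sum.cong refl act_add transpose_permutes) auto

lemma jm_scale: "k \<in> {1..n} \<Longrightarrow> jucys_murphy k (a *s v) = a *s jucys_murphy k v"
  unfolding jucys_murphy_def scale_sum_right
  by (intro sum.cong refl act_scale transpose_permutes) auto

lemma B_transpose:
  assumes "j \<in> {1..n}" "k \<in> {1..n}" "v \<in> V" "w \<in> V"
  shows "B (act (Transposition.transpose j k) v) w = B v (act (Transposition.transpose j k) w)"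
  using B_act[OF transpose_permutes[OF assms(1,2)] act_V[OF transpose_permutes[OF assms(1,2)] assms(3)] assms(4)]
    act_transpose_transpose[OF assms(1-3)] by simp

lemma B_jm:
  assumes k: "k \<in> {1..n}" and v: "v \<in> V" and w: "w \<in> V"
  shows "B (jucys_murphy k v) w = B v (jucys_murphy k w)"
proof -
  have j: "j \<in> {1..n}" if "j \<in> {1..<k}" for j using that k by auto
  have "B (jucys_murphy k v) w = (\<Sum>j\<in>{1..<k}. B (act (Transposition.transpose j k) v) w)"
    unfolding jucys_murphy_def by (intro B_sum_left act_V transpose_permutes j k v w)
  also have "\<dots> = (\<Sum>j\<in>{1..<k}. B v (act (Transposition.transpose j k) w))"
    by (intro sum.cong refl B_transpose j k v w)
  also have "\<dots> = B v (jucys_murphy k w)"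
    unfolding jucys_murphy_def by (intro B_sum_right[symmetric] act_V transpose_permutes j k v w)
  finally show ?thesis .
qed

lemma transpose_conj: "p permutes A \<Longrightarrow> p \<circ> Transposition.transpose j k = Transposition.transpose (p j) (p k) \<circ> p"
  by (auto simp: fun_eq_iff Transposition.transpose_def dest: permutes_inj injD)

lemma act_conj:
  assumes "p permutes {1..n}" "j \<in> {1..n}" "k \<in> {1..n}" "v \<in> V"
  shows "act p (act (Transposition.transpose j k) v) = act (Transposition.transpose (p j) (p k)) (act p v)"
proof -
  have "p j \<in> {1..n}" "p k \<in> {1..n}" using assms permutes_in_image[OF assms(1)] by blast+
  then show ?thesis using assms transpose_conj[OF assms(1), of j k]
    by (simp add: act_act transpose_permutes)
qed

text \<open>Conjugation turns the summands of one Jucys-Murphy element into those of the next,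
  except for the transposition of i and Suc i itself; its product with the same transposition is the
  identity, which is the correction term.\<close>

lemma jm_commute:
  assumes i: "i \<in> {1..<n}" and v: "v \<in> V"
  shows "act (Transposition.transpose i (Suc i)) (jucys_murphy i v) =
    jucys_murphy (Suc i) (act (Transposition.transpose i (Suc i)) v) - v"
proof -
  let ?s = "Transposition.transpose i (Suc i)"
  have ii: "i \<in> {1..n}" "Suc i \<in> {1..n}" using i by auto
  have s: "?s permutes {1..n}" by (rule transpose_permutes[OF ii])
  have "act ?s (jucys_murphy i v) = (\<Sum>j\<in>{1..<i}. act ?s (act (Transposition.transpose j i) v))"
    unfolding jucys_murphy_def by (rule act_sum[OF s])
  also have "\<dots> = (\<Sum>j\<in>{1..<i}. act (Transposition.transpose j (Suc i)) (act ?s v))"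
  proof (rule sum.cong[OF refl])
    fix j assume j: "j \<in> {1..<i}"
    then have "j \<in> {1..n}" using i by auto
    then show "act ?s (act (Transposition.transpose j i) v) = act (Transposition.transpose j (Suc i)) (act ?s v)"
      using act_conj[OF s _ ii(1) v] j by (auto simp: Transposition.transpose_def)
  qed
  also have "\<dots> = jucys_murphy (Suc i) (act ?s v) - act ?s (act ?s v)"
    using i by (simp add: jucys_murphy_def atLeastLessThanSuc)
  finally show ?thesis using act_transpose_transpose[OF ii v] by simp
qed

lemma jm_commute_other:
  assumes i: "i \<in> {1..<n}" and k: "k \<in> {1..n}" "k \<noteq> i" "k \<noteq> Suc i" and v: "v \<in> V"
  shows "act (Transposition.transpose i (Suc i)) (jucys_murphy k v) =
    jucys_murphy k (act (Transposition.transpose i (Suc i)) v)"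
proof -
  let ?s = "Transposition.transpose i (Suc i)"
  have ii: "i \<in> {1..n}" "Suc i \<in> {1..n}" using i by auto
  have s: "?s permutes {1..n}" by (rule transpose_permutes[OF ii])
  have sk: "?s k = k" using k by (simp add: Transposition.transpose_def)
  have "act ?s (jucys_murphy k v) = (\<Sum>j\<in>{1..<k}. act ?s (act (Transposition.transpose j k) v))"
    unfolding jucys_murphy_def by (rule act_sum[OF s])
  also have "\<dots> = (\<Sum>j\<in>{1..<k}. act (Transposition.transpose (?s j) k) (act ?s v))"
    using act_conj[OF s _ k(1) v] k(1) unfolding sk by (intro sum.cong refl) auto
  also have "\<dots> = (\<Sum>j\<in>{1..<k}. act (Transposition.transpose j k) (act ?s v))"
  proof (rule sum.reindex_bij_betw)
    have "?s permutes {1..<k}" if "Suc i < k"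
      using that i by (intro permutes_swap_id) auto
    moreover have "bij_betw ?s {1..<k} {1..<k}" if "k < i"
      using that by (intro bij_betw_cong[THEN iffD2, OF _ bij_betw_id]) (auto simp: Transposition.transpose_def)
    ultimately show "bij_betw ?s {1..<k} {1..<k}"
      using k permutes_imp_bij by (metis linorder_neqE_nat not_less_eq)
  qed
  finally show ?thesis by (simp add: jucys_murphy_def)
qed

text \<open>In degree 0 the Dunkl-Opdam operators are \<kappa> times the Jucys-Murphy elements. With
  parameter 1 the intertwiner lemmas serve for the Young basis of \<lambda>, and with parameter
  \<kappa> for the standard module.\<close>

lemma degenerate_hecke_jm:
  "degenerate_hecke sc V B n 1 (\<lambda>i. act (Transposition.transpose i (Suc i))) jucys_murphy"
proof
  fix i assume "i \<in> {1..<n}"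
  then have "i \<in> {1..n}" "Suc i \<in> {1..n}" by auto
  note p = transpose_permutes[OF this] and t = act_transpose_transpose[OF this]
  show "v \<in> V \<Longrightarrow> act (Transposition.transpose i (Suc i)) v \<in> V" for v by (rule act_V[OF p])
  show "act (Transposition.transpose i (Suc i)) (v + w) =
      act (Transposition.transpose i (Suc i)) v + act (Transposition.transpose i (Suc i)) w" for v w
    by (rule act_add[OF p])
  show "act (Transposition.transpose i (Suc i)) (a *s v) = a *s act (Transposition.transpose i (Suc i)) v" for a v
    by (rule act_scale[OF p])
  show "v \<in> V \<Longrightarrow> w \<in> V \<Longrightarrow>
      B (act (Transposition.transpose i (Suc i)) v) (act (Transposition.transpose i (Suc i)) w) = B v w" for v w
    by (rule B_act[OF p])
  show "v \<in> V \<Longrightarrow> act (Transposition.transpose i (Suc i)) (act (Transposition.transpose i (Suc i)) v) = v" for v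
    by (rule t)
qed (simp_all add: jm_V jm_add jm_scale B_jm jm_commute jm_commute_other)

end

section \<open>Dunkl-Opdam operators and signs of norms\<close>

text \<open>The pairs whose exchange flips the sign of the norm; those inverted by \<sigma> form
  \<open>J_set\<close>.\<close>

definition exponent_pairs :: "nat \<Rightarrow> (nat \<Rightarrow> int) \<Rightarrow> (nat \<times> nat) set" where
  "exponent_pairs n d = {(s, t). 1 \<le> s \<and> s < t \<and> t \<le> n \<and> d t - d s \<in> {0, -1}}"

lemma finite_exponent_pairs [simp]: "finite (exponent_pairs n d)"
  by (rule finite_subset[of _ "{1..n} \<times> {1..n}"]) (auto simp: exponent_pairs_def)

text \<open>The sign of the norm of the weight vector with exponents \<open>p\<close> sorted by \<open>\<sigma>\<close>, once \<open>- c\<close> exceeds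
  the degree.\<close>

definition norm_sign :: "nat \<Rightarrow> (nat \<Rightarrow> int) \<Rightarrow> (nat \<Rightarrow> nat) \<Rightarrow> (nat \<Rightarrow> nat) \<Rightarrow> real" where
  "norm_sign n d \<sigma> p = (\<Prod>k\<in>{1..n}. if d k < 0 then (-1) ^ p k else 1) *
     (\<Prod>(k, l)\<in>exponent_pairs n d. (-1) ^ (p k + p l + of_bool (\<sigma> k > \<sigma> l)))"

text \<open>Exponents are indexed by the entries of the tableau, and \<open>\<sigma> k\<close> is
  the position of entry k in the weight. Ties are broken by position, so each assignment of
  exponents to positions is sorted by exactly one \<sigma>.\<close>

definition sorts :: "nat \<Rightarrow> (nat \<Rightarrow> nat) \<Rightarrow> (nat \<Rightarrow> nat) \<Rightarrow> bool" where
  "sorts n \<sigma> p \<longleftrightarrow> \<sigma> permutes {1..n} \<and>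
     (\<forall>k l. 1 \<le> k \<longrightarrow> k < l \<longrightarrow> l \<le> n \<longrightarrow> p k < p l \<or> p k = p l \<and> \<sigma> k < \<sigma> l)"

definition cycle :: "nat \<Rightarrow> nat \<Rightarrow> nat" where
  "cycle n i = (if i = n then 1 else if 1 \<le> i \<and> i < n then Suc i else i)"

lemma cycle_permutes: "1 \<le> n \<Longrightarrow> cycle n permutes {1..n}"
proof (rule bij_imp_permutes)
  assume n: "1 \<le> n"
  have "inj_on (cycle n) {1..n}"
    by (rule inj_onI) (auto simp: cycle_def split: if_splits)
  moreover have "cycle n ` {1..n} \<subseteq> {1..n}"
    using n by (auto simp: cycle_def)
  ultimately show "bij_betw (cycle n) {1..n} {1..n}"
    by (simp add: bij_betw_def endo_inj_surj)
qed (auto simp: cycle_def)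

text \<open>Strict growth gives \<open>k \<le> \<sigma> k\<close> throughout, and both sides have
  the same sum.\<close>

lemma permutes_strict_mono_imp_id:
  fixes \<sigma> :: "nat \<Rightarrow> nat"
  assumes \<sigma>: "\<sigma> permutes {1..n}" and mono: "\<And>k l. 1 \<le> k \<Longrightarrow> k < l \<Longrightarrow> l \<le> n \<Longrightarrow> \<sigma> k < \<sigma> l"
  shows "\<sigma> = id"
proof -
  have ge: "k \<le> n \<Longrightarrow> k \<le> \<sigma> k" for k
  proof (induction k)
    case (Suc k)
    show ?case
    proof (cases "k = 0")
      case True
      then have "\<sigma> (Suc k) \<in> {1..n}" using Suc.prems permutes_in_image[OF \<sigma>, of "Suc k"] by auto
      then show ?thesis using True by auto
    next
      case False
      then show ?thesis using Suc mono[of k "Suc k"] by auto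
    qed
  qed simp
  have "(\<Sum>k\<in>{1..n}. \<sigma> k) = (\<Sum>k\<in>{1..n}. k)"
    using sum.permute[OF \<sigma>, of "\<lambda>k. k"] by (simp add: comp_def)
  then have "(\<Sum>k\<in>{1..n}. \<sigma> k - k) = 0"
    using ge by (subst sum_subtractf_nat) auto
  then have "\<sigma> k = k" if "k \<in> {1..n}" for k
    using ge[of k] that by (auto simp: sum_eq_0_iff dest!: bspec[of _ _ k])
  then show ?thesis
    using \<sigma> by (auto simp: fun_eq_iff permutes_def)
qed

text \<open>Here \<open>\<kappa>\<close> is the paper's \<open>- c\<close>, and \<open>L\<close> is the copy of \<open>\<lambda>\<close> in degree 0.\<close>

locale cherednik_rep = symmetric_group_rep sc V B n act
  for sc :: "complex \<Rightarrow> 'v \<Rightarrow> 'v::ab_group_add" (infixr "*s" 75) and V B n act +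
  fixes x y :: "nat \<Rightarrow> 'v \<Rightarrow> 'v" and \<kappa> :: real and L :: "'v set"
  assumes n_pos: "1 \<le> n"
    and x_add: "i \<in> {1..n} \<Longrightarrow> x i (v + w) = x i v + x i w"
    and x_scale: "i \<in> {1..n} \<Longrightarrow> x i (a *s v) = a *s x i v"
    and x_V: "i \<in> {1..n} \<Longrightarrow> v \<in> V \<Longrightarrow> x i v \<in> V"
    and y_add: "i \<in> {1..n} \<Longrightarrow> y i (v + w) = y i v + y i w"
    and y_scale: "i \<in> {1..n} \<Longrightarrow> y i (a *s v) = a *s y i v"
    and y_V: "i \<in> {1..n} \<Longrightarrow> v \<in> V \<Longrightarrow> y i v \<in> V"
    and x_comm: "i \<in> {1..n} \<Longrightarrow> j \<in> {1..n} \<Longrightarrow> v \<in> V \<Longrightarrow> x i (x j v) = x j (x i v)"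
    and act_x: "p permutes {1..n} \<Longrightarrow> i \<in> {1..n} \<Longrightarrow> v \<in> V \<Longrightarrow> act p (x i v) = x (p i) (act p v)"
    and act_y: "p permutes {1..n} \<Longrightarrow> i \<in> {1..n} \<Longrightarrow> v \<in> V \<Longrightarrow> act p (y i v) = y (p i) (act p v)"
    and y_x_neq: "i \<in> {1..n} \<Longrightarrow> j \<in> {1..n} \<Longrightarrow> i \<noteq> j \<Longrightarrow> v \<in> V \<Longrightarrow>
      y i (x j v) = x j (y i v) - complex_of_real \<kappa> *s act (Transposition.transpose i j) v"
    and y_x_eq: "i \<in> {1..n} \<Longrightarrow> v \<in> V \<Longrightarrow>
      y i (x i v) = x i (y i v) + v + complex_of_real \<kappa> *s (\<Sum>j\<in>{1..n} - {i}. act (Transposition.transpose i j) v)"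
    and B_x: "i \<in> {1..n} \<Longrightarrow> v \<in> V \<Longrightarrow> w \<in> V \<Longrightarrow> B (x i v) w = B v (y i w)"
    and L_V: "L \<subseteq> V"
    and L_act: "p permutes {1..n} \<Longrightarrow> v \<in> L \<Longrightarrow> act p v \<in> L"
begin

lemma x_zero: "i \<in> {1..n} \<Longrightarrow> x i 0 = 0"
  using x_scale[of i 0 0] by simp

lemma x_sum: "i \<in> {1..n} \<Longrightarrow> x i (\<Sum>j\<in>I. f j) = (\<Sum>j\<in>I. x i (f j))"
  by (induction I rule: infinite_finite_induct) (simp_all add: x_zero x_add)

lemma x_diff: "i \<in> {1..n} \<Longrightarrow> x i (v - w) = x i v - x i w"
  using x_add[of i "v - w" w] by (simp add: algebra_simps)

fun monomial :: "nat list \<Rightarrow> 'v \<Rightarrow> 'v" where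
  "monomial [] v = v"
| "monomial (i # w) v = x i (monomial w v)"

lemma monomial_V: "set w \<subseteq> {1..n} \<Longrightarrow> v \<in> V \<Longrightarrow> monomial w v \<in> V"
  by (induction w) (simp_all add: x_V)

definition degree_space :: "nat \<Rightarrow> 'v set" where
  "degree_space m = span {monomial w v | w v. length w = m \<and> set w \<subseteq> {1..n} \<and> v \<in> L}"

lemma degree_space_V: "degree_space m \<subseteq> V"
  unfolding degree_space_def
  by (rule span_minimal) (use subspace_V L_V monomial_V in auto)

lemma degree_space_closed [intro]:
  "v \<in> degree_space m \<Longrightarrow> w \<in> degree_space m \<Longrightarrow> v + w \<in> degree_space m"
  "v \<in> degree_space m \<Longrightarrow> a *s v \<in> degree_space m"
  unfolding degree_space_def by (simp_all add: span_add span_scale)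

lemma degree_space_0: "v \<in> L \<Longrightarrow> v \<in> degree_space 0"
  unfolding degree_space_def by (rule span_base) force

lemma degree_space_image:
  assumes add: "\<And>v w. f (v + w) = f v + f w" and scale: "\<And>a v. f (a *s v) = a *s f v"
    and mon: "\<And>w v. length w = m \<Longrightarrow> set w \<subseteq> {1..n} \<Longrightarrow> v \<in> L \<Longrightarrow> f (monomial w v) \<in> degree_space m'"
    and v: "v \<in> degree_space m"
  shows "f v \<in> degree_space m'"
  using v unfolding degree_space_def
proof (induction rule: span_induct)
  show "subspace {a. f a \<in> span {monomial w v |w v. length w = m' \<and> set w \<subseteq> {1..n} \<and> v \<in> L}}"
    using scale[of 0 0] by (intro subspaceI) (auto simp: add scale span_zero span_add span_scale)
qed (use mon in \<open>auto simp: degree_space_def\<close>)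

lemma degree_space_x: "i \<in> {1..n} \<Longrightarrow> v \<in> degree_space m \<Longrightarrow> x i v \<in> degree_space (Suc m)"
  by (rule degree_space_image[of "x i" m])
    (auto simp: x_add x_scale degree_space_def intro!: span_base exI[of _ "i # _"])

lemma act_monomial:
  "p permutes {1..n} \<Longrightarrow> set w \<subseteq> {1..n} \<Longrightarrow> v \<in> V \<Longrightarrow> act p (monomial w v) = monomial (map p w) (act p v)"
  by (induction w) (simp_all add: act_x monomial_V)

lemma degree_space_act:
  assumes p: "p permutes {1..n}" and v: "v \<in> degree_space m"
  shows "act p v \<in> degree_space m"
proof (rule degree_space_image[of "act p" m, OF act_add[OF p] act_scale[OF p] _ v])
  fix w v assume w: "length w = m" "set w \<subseteq> {1..n}" "v \<in> L"
  have "set (map p w) \<subseteq> {1..n}" using w permutes_image[OF p] by auto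
  then show "act p (monomial w v) \<in> degree_space m"
    using w L_act[OF p] act_monomial[OF p w(2)] L_V unfolding degree_space_def
    by (intro span_base) (use length_map[of p w] in blast)
qed

definition dunkl_opdam :: "nat \<Rightarrow> 'v \<Rightarrow> 'v" where
  "dunkl_opdam k v = x k (y k v) + complex_of_real \<kappa> *s jucys_murphy k v"

lemma B_x_right: "i \<in> {1..n} \<Longrightarrow> v \<in> V \<Longrightarrow> w \<in> V \<Longrightarrow> B v (x i w) = B (y i v) w"
  by (metis B_x B_herm x_V y_V)

lemma act_x_y:
  "p permutes {1..n} \<Longrightarrow> k \<in> {1..n} \<Longrightarrow> v \<in> V \<Longrightarrow> act p (x k (y k v)) = x (p k) (y (p k) (act p v))"
  by (simp add: act_x act_y y_V)

lemma degenerate_hecke_dunkl_opdam: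
  "degenerate_hecke sc V B n \<kappa> (\<lambda>i. act (Transposition.transpose i (Suc i))) dunkl_opdam"
proof -
  interpret jm: degenerate_hecke sc V B n 1 "\<lambda>i. act (Transposition.transpose i (Suc i))" jucys_murphy
    by (rule degenerate_hecke_jm)
  show ?thesis
  proof
    fix k v w assume k: "k \<in> {1..n}" and v: "v \<in> V" and w: "w \<in> V"
    show "B (dunkl_opdam k v) w = B v (dunkl_opdam k w)"
      using k v w by (simp add: dunkl_opdam_def B_add_left B_add_right B_scale_left B_scale_right
          x_V y_V jm_V B_jm B_x B_x_right)
  next
    fix i v assume i: "i \<in> {1..<n}" and v: "v \<in> V"
    then have ii: "i \<in> {1..n}" "Suc i \<in> {1..n}" by auto
    note s = transpose_permutes[OF ii]
    show "act (Transposition.transpose i (Suc i)) (dunkl_opdam i v) =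
        dunkl_opdam (Suc i) (act (Transposition.transpose i (Suc i)) v) - complex_of_real \<kappa> *s v"
      by (simp add: dunkl_opdam_def act_add[OF s] act_scale[OF s] act_x_y[OF s ii(1) v] jm_commute[OF i v] algebra_simps)
    fix k assume k: "k \<in> {1..n}" "k \<noteq> i" "k \<noteq> Suc i"
    then have "Transposition.transpose i (Suc i) k = k" by (simp add: Transposition.transpose_def)
    then show "act (Transposition.transpose i (Suc i)) (dunkl_opdam k v) =
        dunkl_opdam k (act (Transposition.transpose i (Suc i)) v)"
      by (simp add: dunkl_opdam_def act_add[OF s] act_scale[OF s] act_x_y[OF s k(1) v] jm_commute_other[OF i k v])
  qed (simp_all add: jm.s_V jm.s_add jm.s_scale jm.s_s jm.B_s dunkl_opdam_def x_V y_V jm_V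
      x_add y_add x_scale y_scale jm_add jm_scale scale_right_distrib ac_simps)
qed

sublocale dunkl: degenerate_hecke sc V B n \<kappa> "\<lambda>i. act (Transposition.transpose i (Suc i))" dunkl_opdam
  by (rule degenerate_hecke_dunkl_opdam)

definition raising :: "'v \<Rightarrow> 'v" where
  "raising v = x 1 (act (cycle n) v)"

lemmas cycle = cycle_permutes[OF n_pos]

lemma raising_V: "v \<in> V \<Longrightarrow> raising v \<in> V"
  using n_pos by (auto simp: raising_def intro!: x_V act_V cycle)

text \<open>For the last index, the sum over all other j in the commutator of \<open>y n\<close> and
  \<open>x n\<close> is exactly the Jucys-Murphy element, so \<open>y n\<close> after
  \<open>x n\<close> is the Dunkl-Opdam operator plus 1. The cycle, which sends n to 1, transports
  this to index 1.\<close>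

lemma y_raising: "v \<in> V \<Longrightarrow> y 1 (raising v) = act (cycle n) (dunkl_opdam n v + v)"
proof -
  assume v: "v \<in> V"
  have n: "n \<in> {1..n}" and n1: "{1..n} - {n} = {1..<n}" and c: "cycle n n = 1"
    using n_pos by (auto simp: cycle_def)
  have "y 1 (raising v) = act (cycle n) (y n (x n v))"
    unfolding raising_def using act_y[OF cycle n x_V[OF n v]] act_x[OF cycle n v] c by simp
  also have "y n (x n v) = dunkl_opdam n v + v"
    unfolding y_x_eq[OF n v] n1 by (simp add: dunkl_opdam_def jucys_murphy_def transpose_commute ac_simps)
  finally show ?thesis .
qed

lemma dunkl_opdam_raising_1:
  assumes v: "v \<in> V"
  shows "dunkl_opdam 1 (raising v) = raising (dunkl_opdam n v + v)"
  unfolding dunkl_opdam_def[of 1] y_raising[OF v] by (simp add: jucys_murphy_def raising_def)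

text \<open>Moving \<open>y (Suc i)\<close> past \<open>x 1\<close> leaves a term with the
  transposition of 1 and Suc i. It cancels the summand j = 1 of the Jucys-Murphy element; the other
  summands are those of index i conjugated by the cycle.\<close>

lemma dunkl_opdam_raising_Suc:
  assumes i: "i \<in> {1..<n}" and v: "v \<in> V"
  shows "dunkl_opdam (Suc i) (raising v) = raising (dunkl_opdam i v)"
proof -
  let ?w = "act (cycle n) v" and ?t = "\<lambda>j. act (Transposition.transpose j (Suc i))"
  have ii: "i \<in> {1..n}" "Suc i \<in> {1..n}" "1 \<in> {1..n}" "Suc i \<noteq> 1" using i by auto
  have w: "?w \<in> V" by (rule act_V[OF cycle v])
  have ci: "cycle n i = Suc i" using i by (auto simp: cycle_def)
  have "x (Suc i) (y (Suc i) (x 1 ?w)) =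
      x 1 (x (Suc i) (y (Suc i) ?w)) - complex_of_real \<kappa> *s x (Suc i) (?t 1 ?w)"
    using y_x_neq[OF ii(2,3,4) w] x_comm[OF ii(2,3) y_V[OF ii(2) w]]
    by (simp add: x_diff[OF ii(2)] x_scale[OF ii(2)] transpose_commute)
  moreover have "x (Suc i) (y (Suc i) ?w) = act (cycle n) (x i (y i v))"
    using act_x_y[OF cycle ii(1) v] ci by simp
  moreover have "jucys_murphy (Suc i) (x 1 ?w) = x (Suc i) (?t 1 ?w) + x 1 (act (cycle n) (jucys_murphy i v))"
  proof -
    have "{1..<Suc i} = insert 1 {Suc 1..<Suc i}" using i by auto
    then have "jucys_murphy (Suc i) (x 1 ?w) = ?t 1 (x 1 ?w) + (\<Sum>j\<in>{Suc 1..<Suc i}. ?t j (x 1 ?w))"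
      by (simp add: jucys_murphy_def)
    also have "(\<Sum>j\<in>{Suc 1..<Suc i}. ?t j (x 1 ?w)) = (\<Sum>j\<in>{1..<i}. ?t (Suc j) (x 1 ?w))"
      by (rule sum.shift_bounds_Suc_ivl)
    also have "\<dots> = (\<Sum>j\<in>{1..<i}. x 1 (act (cycle n) (act (Transposition.transpose j i) v)))"
    proof (rule sum.cong[OF refl])
      fix j assume j: "j \<in> {1..<i}"
      then have jj: "j \<in> {1..n}" "Suc j \<in> {1..n}" and cj: "cycle n j = Suc j" using i by (auto simp: cycle_def)
      have "Transposition.transpose (Suc j) (Suc i) 1 = 1"
        using j by (simp add: Transposition.transpose_def)
      then have "?t (Suc j) (x 1 ?w) = x 1 (?t (Suc j) ?w)"
        using act_x[OF transpose_permutes[OF jj(2) ii(2)] ii(3) w] by simp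
      then show "?t (Suc j) (x 1 ?w) = x 1 (act (cycle n) (act (Transposition.transpose j i) v))"
        using act_conj[OF cycle jj(1) ii(1) v] ci cj by simp
    qed
    also have "\<dots> = x 1 (act (cycle n) (jucys_murphy i v))"
      unfolding jucys_murphy_def act_sum[OF cycle] x_sum[OF ii(3)] ..
    also have "?t 1 (x 1 ?w) = x (Suc i) (?t 1 ?w)"
      using act_x[OF transpose_permutes[OF ii(3,2)] ii(3) w] by simp
    finally show ?thesis .
  qed
  ultimately show ?thesis
    unfolding raising_def dunkl_opdam_def
    by (simp add: act_add[OF cycle] act_scale[OF cycle] x_add[OF ii(3)] x_scale[OF ii(3)] scale_right_distrib)
qed

lemma raising_linear: "raising (v + w) = raising v + raising w" "raising (a *s v) = a *s raising v"
  using n_pos by (auto simp: raising_def act_add act_scale cycle x_add x_scale)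

lemma weight_raising:
  assumes f: "weight n dunkl_opdam a f"
  shows "weight n dunkl_opdam (\<lambda>i. if i = 1 then a n + 1 else a (i - 1)) (raising f)"
proof -
  have fV: "f \<in> V" and uf: "\<And>k. k \<in> {1..n} \<Longrightarrow> dunkl_opdam k f = complex_of_real (a k) *s f"
    using f by (auto simp: weight_def)
  have "dunkl_opdam k (raising f) = complex_of_real (if k = 1 then a n + 1 else a (k - 1)) *s raising f"
    if k: "k \<in> {1..n}" for k
  proof (cases "k = 1")
    case True
    have "n \<in> {1..n}" using n_pos by simp
    then show ?thesis
      using True dunkl_opdam_raising_1[OF fV] uf[of n] by (simp add: raising_linear scale_left_distrib)
  next
    case False
    then obtain i where i: "k = Suc i" "i \<in> {1..<n}" using k by (cases k) auto
    then show ?thesis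
      using False dunkl_opdam_raising_Suc[OF i(2) fV] uf[of i] by (simp add: raising_linear)
  qed
  then show ?thesis using raising_V[OF fV] by (auto simp: weight_def)
qed

lemma B_raising:
  assumes f: "weight n dunkl_opdam a f"
  shows "B (raising f) (raising f) = complex_of_real (a n + 1) * B f f"
proof -
  have fV: "f \<in> V" and n: "n \<in> {1..n}" "1 \<in> {1..n}" and uf: "dunkl_opdam n f = complex_of_real (a n) *s f"
    using f n_pos by (auto simp: weight_def)
  have "B (raising f) (raising f) = B (act (cycle n) f) (act (cycle n) (dunkl_opdam n f + f))"
    using B_x[OF n(2) act_V[OF cycle fV] raising_V[OF fV]] y_raising[OF fV] by (simp add: raising_def)
  also have "\<dots> = B f (dunkl_opdam n f + f)"
    using uf fV by (intro B_act[OF cycle]) auto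
  also have "\<dots> = complex_of_real (a n + 1) * B f f"
    unfolding uf using fV by (simp add: B_add_right B_scale_right algebra_simps)
  finally show ?thesis .
qed

lemma weight_cong: "weight n u a f \<Longrightarrow> (\<And>k. k \<in> {1..n} \<Longrightarrow> a k = b k) \<Longrightarrow> weight n u b f"
  by (auto simp: weight_def)

end

section \<open>How the sign of a norm changes under exchange and rotation\<close>

abbreviation "perm_inv \<equiv> inv_into UNIV"

text \<open>Compare the denominator with \<kappa>: for e = 0 and e = -1 its absolute value is q or
  \<kappa> - q, below \<kappa>, while e \<ge> 1 or e \<le> -2 pushes it above.\<close>

lemma norm_factor_sign:
  fixes \<kappa> q :: real and e :: int
  assumes q: "0 < q" "q < \<kappa>"
  shows "q + \<kappa> * e \<noteq> 0"
    and "(if e \<in> {0, -1} then -1 else 1) * (1 - (\<kappa> / (q + \<kappa> * e))\<^sup>2) > 0"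
proof -
  have \<kappa>: "\<kappa> > 0" using q by linarith
  consider "e = 0" | "e = -1" | "e \<ge> 1" | "e \<le> -2" by linarith
  then have "q + \<kappa> * e \<noteq> 0 \<and> (if e \<in> {0, -1} then \<bar>q + \<kappa> * e\<bar> < \<kappa> else \<bar>q + \<kappa> * e\<bar> > \<kappa>)"
  proof cases
    case 3
    then have "\<kappa> * e \<ge> \<kappa> * 1" using \<kappa> by (intro mult_left_mono) auto
    then have "q + \<kappa> * e > \<kappa>" using q by linarith
    then show ?thesis using 3 \<kappa> by auto
  next
    case 4
    then have "\<kappa> * e \<le> \<kappa> * (-2)" using \<kappa> by (intro mult_left_mono) auto
    then show ?thesis using 4 q by auto
  qed (use q in auto)
  then show ne: "q + \<kappa> * e \<noteq> 0" and "(if e \<in> {0, -1} then -1 else 1) * (1 - (\<kappa> / (q + \<kappa> * e))\<^sup>2) > 0"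
  proof -
    assume *: "q + \<kappa> * e \<noteq> 0 \<and> (if e \<in> {0, -1} then \<bar>q + \<kappa> * e\<bar> < \<kappa> else \<bar>q + \<kappa> * e\<bar> > \<kappa>)"
    show "q + \<kappa> * e \<noteq> 0" using * by blast
    have sq: "(\<kappa> / (q + \<kappa> * e))\<^sup>2 = \<kappa>\<^sup>2 / (q + \<kappa> * e)\<^sup>2" "(q + \<kappa> * e)\<^sup>2 > 0"
      using * by (simp_all add: power_divide)
    show "(if e \<in> {0, -1} then -1 else 1) * (1 - (\<kappa> / (q + \<kappa> * e))\<^sup>2) > 0"
    proof (cases "e \<in> {0, -1}")
      case True
      then have "\<bar>q + \<kappa> * e\<bar> < \<bar>\<kappa>\<bar>" using * \<kappa> by auto
      then have "(q + \<kappa> * e)\<^sup>2 < \<kappa>\<^sup>2" by (metis abs_square_less_1 abs_le_square_iff not_le)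
      then show ?thesis using True sq by (simp add: less_divide_eq)
    next
      case False
      then have "\<bar>\<kappa>\<bar> < \<bar>q + \<kappa> * e\<bar>" using * \<kappa> by auto
      then have "\<kappa>\<^sup>2 < (q + \<kappa> * e)\<^sup>2" by (metis abs_le_square_iff not_le)
      then show ?thesis using False sq by (simp add: divide_less_eq)
    qed
  qed
qed

lemma transpose_adjacent_less:
  fixes a b k l :: nat
  assumes "a \<noteq> b" "l = Suc k \<or> k = Suc l" "\<not> (a = k \<and> b = l)" "\<not> (a = l \<and> b = k)"
  shows "Transposition.transpose k l b < Transposition.transpose k l a \<longleftrightarrow> b < a"
  using assms unfolding Transposition.transpose_def by (auto split: if_splits)

text \<open>Exchanging adjacent positions alters the relative order of k and l only, so no other
  pair factor can flip.\<close>

lemma norm_sign_swap: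
  assumes \<sigma>: "\<sigma> permutes {1..n}" and kl: "1 \<le> k" "k < l" "l \<le> n"
    and adj: "\<sigma> l = Suc (\<sigma> k) \<or> \<sigma> k = Suc (\<sigma> l)"
  shows "norm_sign n d (Transposition.transpose (\<sigma> k) (\<sigma> l) \<circ> \<sigma>) p =
    (if d l - d k \<in> {0, -1} then -1 else 1) * norm_sign n d \<sigma> p"
proof -
  let ?\<sigma> = "Transposition.transpose (\<sigma> k) (\<sigma> l) \<circ> \<sigma>"
  let ?g = "\<lambda>\<sigma>. \<lambda>(k, l). (-1::real) ^ (p k + p l + of_bool (\<sigma> k > \<sigma> l))"
  have inj: "\<sigma> a = \<sigma> b \<longleftrightarrow> a = b" for a b
    using \<sigma> by (auto dest: permutes_inj injD)
  have other: "?g ?\<sigma> ab = ?g \<sigma> ab" if "ab \<in> exponent_pairs n d" "ab \<noteq> (k, l)" for ab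
  proof -
    obtain a b where ab: "ab = (a, b)" "a < b" using \<open>ab \<in> _\<close> by (auto simp: exponent_pairs_def)
    have "?\<sigma> a > ?\<sigma> b \<longleftrightarrow> \<sigma> a > \<sigma> b"
      unfolding comp_def using ab kl that(2) adj
      by (intro transpose_adjacent_less) (auto simp: inj)
    then show ?thesis using ab by simp
  qed
  have flip: "?g ?\<sigma> (k, l) = - ?g \<sigma> (k, l)"
    using adj by (auto simp: Transposition.transpose_def inj One_nat_def)
  have "prod (?g ?\<sigma>) (exponent_pairs n d) = (if (k, l) \<in> exponent_pairs n d then -1 else 1) * prod (?g \<sigma>) (exponent_pairs n d)"
  proof (cases "(k, l) \<in> exponent_pairs n d")
    case True
    have "prod (?g ?\<sigma>) (exponent_pairs n d - {(k, l)}) = prod (?g \<sigma>) (exponent_pairs n d - {(k, l)})"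
      by (intro prod.cong refl other) auto
    then show ?thesis
      unfolding prod.remove[OF finite_exponent_pairs True] flip using True by simp
  next
    case False
    then have "prod (?g ?\<sigma>) (exponent_pairs n d) = prod (?g \<sigma>) (exponent_pairs n d)"
      using other by (intro prod.cong refl) blast
    with False show ?thesis by simp
  qed
  moreover have "(k, l) \<in> exponent_pairs n d \<longleftrightarrow> d l - d k \<in> {0, -1}"
    using kl by (auto simp: exponent_pairs_def)
  ultimately show ?thesis
    by (auto simp: norm_sign_def)
qed

text \<open>Entry k goes from the last position to the first: each pair containing k reverses its
  order while its exponent sum grows by 1, so the pair factors are unchanged. Only the factor for
  negative contents reacts.\<close>

lemma norm_sign_cycle:
  assumes \<sigma>: "\<sigma> permutes {1..n}" and k: "k \<in> {1..n}" "\<sigma> k = n"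
  shows "norm_sign n d (cycle n \<circ> \<sigma>) (p(k := Suc (p k))) = (if d k < 0 then -1 else 1) * norm_sign n d \<sigma> p"
proof -
  let ?\<sigma> = "cycle n \<circ> \<sigma>" and ?p = "p(k := Suc (p k))"
  have n: "1 \<le> n" using k by auto
  have inj: "\<sigma> a = \<sigma> b \<longleftrightarrow> a = b" for a b
    using \<sigma> by (auto dest: permutes_inj injD)
  have range: "1 \<le> \<sigma> a \<and> \<sigma> a \<le> n" if "1 \<le> a" "a \<le> n" for a
    using permutes_in_image[OF \<sigma>, of a] that by auto
  have "(-1::real) ^ (?p a + ?p b + of_bool (?\<sigma> a > ?\<sigma> b)) = (-1) ^ (p a + p b + of_bool (\<sigma> a > \<sigma> b))"
    if "(a, b) \<in> exponent_pairs n d" for a b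
  proof -
    have ab: "1 \<le> a" "a < b" "b \<le> n" using that by (auto simp: exponent_pairs_def)
    have ra: "1 \<le> \<sigma> a" "\<sigma> a \<le> n" "1 \<le> \<sigma> b" "\<sigma> b \<le> n" using range ab by auto
    have sn: "\<sigma> c = n \<longleftrightarrow> c = k" for c using inj[of c k] k by simp
    consider "a = k" | "b = k" | "a \<noteq> k" "b \<noteq> k" by blast
    then show ?thesis
    proof cases
      case 1
      then have "\<sigma> b < \<sigma> a" "b \<noteq> k" "\<not> ?\<sigma> a > ?\<sigma> b" using ab ra sn[of b] k by (auto simp: cycle_def)
      then show ?thesis using 1 by (simp add: One_nat_def)
    next
      case 2
      then have "\<not> \<sigma> b < \<sigma> a" "a \<noteq> k" "?\<sigma> a > ?\<sigma> b" using ab ra sn[of a] k by (auto simp: cycle_def)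
      then show ?thesis using 2 by (simp add: One_nat_def)
    next
      case 3
      then have "?\<sigma> a > ?\<sigma> b \<longleftrightarrow> \<sigma> a > \<sigma> b" using ra sn[of a] sn[of b] by (auto simp: cycle_def)
      then show ?thesis using 3 by simp
    qed
  qed
  then have "(\<Prod>(a, b)\<in>exponent_pairs n d. (-1::real) ^ (?p a + ?p b + of_bool (?\<sigma> a > ?\<sigma> b))) =
      (\<Prod>(a, b)\<in>exponent_pairs n d. (-1) ^ (p a + p b + of_bool (\<sigma> a > \<sigma> b)))"
    by (intro prod.cong refl) (simp only: split_paired_all split)
  moreover have "(\<Prod>a\<in>{1..n}. if d a < 0 then (-1::real) ^ ?p a else 1) =
      (if d k < 0 then -1 else 1) * (\<Prod>a\<in>{1..n}. if d a < 0 then (-1) ^ p a else 1)"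
  proof -
    have "(\<Prod>a\<in>{1..n} - {k}. if d a < 0 then (-1::real) ^ ?p a else 1) =
        (\<Prod>a\<in>{1..n} - {k}. if d a < 0 then (-1) ^ p a else 1)"
      by (intro prod.cong refl) auto
    then show ?thesis unfolding prod.remove[OF finite_atLeastAtMost k(1)] by simp
  qed
  ultimately show ?thesis
    by (simp add: norm_sign_def)
qed

lemma norm_sign_zero: "(\<And>k. k \<in> {1..n} \<Longrightarrow> p k = 0) \<Longrightarrow> norm_sign n d id p = 1"
  unfolding norm_sign_def
  by (subst (1 2) prod.neutral) (auto simp: exponent_pairs_def)

section \<open>Construction of the weight vectors\<close>

context cherednik_rep
begin

text \<open>Outer induction on the degree, inner induction on a position with positive exponent. If
  the preceding position has a positive exponent too, it is treated instead; if its exponent is 0,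
  the two are exchanged and an intertwiner undoes this. At position 1 the vector is the raising of
  one of lower degree.\<close>

lemma ex_weight_vector:
  fixes d :: "nat \<Rightarrow> int"
  assumes v: "v \<in> L" "weight n dunkl_opdam (\<lambda>k. \<kappa> * d k) v" "0 < Re (B v v)"
  shows "sorts n \<sigma> p \<Longrightarrow> real (\<Sum>k\<in>{1..n}. p k) < \<kappa> \<Longrightarrow>
    \<exists>f \<in> degree_space (\<Sum>k\<in>{1..n}. p k).
      weight n dunkl_opdam (\<lambda>i. p (perm_inv \<sigma> i) + \<kappa> * d (perm_inv \<sigma> i)) f \<and> 0 < norm_sign n d \<sigma> p * Re (B f f)"
proof (induction "\<Sum>k\<in>{1..n}. p k" arbitrary: \<sigma> p)
  case 0
  then have p: "\<And>k. k \<in> {1..n} \<Longrightarrow> p k = 0" by auto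
  \<comment> \<open>All exponents are equal, so sortedness leaves no inversion.\<close>
  have "\<sigma> = id"
    using 0(2) p by (intro permutes_strict_mono_imp_id) (auto simp: sorts_def)
  then show ?case
    using v p norm_sign_zero[of n p d, unfolded id_def] 0(1)[symmetric] degree_space_0[OF v(1)]
    by (intro bexI[of _ v] conjI weight_cong[OF v(2)]) simp_all
next
  case (Suc m)
  have step: "\<exists>f \<in> degree_space (\<Sum>k\<in>{1..n}. p k).
      weight n dunkl_opdam (\<lambda>i. p (perm_inv \<sigma> i) + \<kappa> * d (perm_inv \<sigma> i)) f \<and> 0 < norm_sign n d \<sigma> p * Re (B f f)"
    if "sorts n \<sigma> p" "i \<in> {1..n}" "0 < p (perm_inv \<sigma> i)" for i \<sigma>
    using that
  proof (induction i arbitrary: \<sigma>)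
    case (Suc i)
    have \<sigma>: "\<sigma> permutes {1..n}" using Suc.prems by (simp add: sorts_def)
    have inj: "\<sigma> a = \<sigma> b \<longleftrightarrow> a = b" for a b
      using \<sigma> by (auto dest: permutes_inj injD)
    note inv_in = permutes_in_image[OF permutes_inv[OF \<sigma>]] and inv_\<sigma> = permutes_inverses[OF \<sigma>]
    show ?case
    proof (cases "i = 0")
      case True
      define k where "k = perm_inv \<sigma> 1"
      have k: "k \<in> {1..n}" "\<sigma> k = 1" "0 < p k"
        using inv_in[of 1] n_pos inv_\<sigma>(1)[of 1] Suc.prems(3) True by (auto simp: k_def One_nat_def)
      \<comment> \<open>Undoing the last raising: entry k returns from position 1 to position n and
        its exponent drops by 1.\<close>
      define p' where "p' = p(k := p k - 1)"
      define \<sigma>' where "\<sigma>' = perm_inv (cycle n) \<circ> \<sigma>"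
      have c: "cycle n n = 1" by (simp add: cycle_def)
      have \<sigma>': "\<sigma>' permutes {1..n}" and \<sigma>_eq: "\<sigma> = cycle n \<circ> \<sigma>'"
        using \<sigma> cycle permutes_inverses[OF cycle] unfolding \<sigma>'_def
        by (auto intro!: permutes_compose permutes_inv simp: fun_eq_iff)
      have \<sigma>'k: "\<sigma>' k = n"
        using k c permutes_inverses[OF cycle] by (metis \<sigma>'_def comp_apply)
      have p_eq: "p = p'(k := Suc (p' k))" using k by (auto simp: p'_def fun_eq_iff)
      have sum: "(\<Sum>k\<in>{1..n}. p k) = Suc (\<Sum>k\<in>{1..n}. p' k)"
      proof -
        have "sum p ({1..n} - {k}) = sum p' ({1..n} - {k})"
          by (intro sum.cong refl) (auto simp: p'_def)
        then show ?thesis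
          using k by (simp add: sum.remove[OF finite_atLeastAtMost k(1)] p'_def)
      qed
      have \<sigma>'_eq: "\<sigma>' a = \<sigma> a - 1" if "a \<noteq> k" "1 \<le> a" "a \<le> n" for a
      proof -
        have "\<sigma>' a \<noteq> n" using that \<sigma>'k \<sigma>' by (metis permutes_inj injD)
        moreover have "\<sigma>' a \<in> {1..n}" using permutes_in_image[OF \<sigma>', of a] that by auto
        ultimately show ?thesis unfolding \<sigma>_eq by (auto simp: cycle_def)
      qed
      \<comment> \<open>Entry k held position 1, so entries before it have strictly smaller
        exponents. After lowering they may tie with k, which is correct because k now holds the last
        position.\<close>
      have "sorts n \<sigma>' p'"
        unfolding sorts_def
      proof (intro conjI allI impI \<sigma>')
        fix a b assume ab: "1 \<le> a" "a < b" "b \<le> n"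
        have o: "p a < p b \<or> p a = p b \<and> \<sigma> a < \<sigma> b"
          using Suc.prems(1) ab by (auto simp: sorts_def)
        have r: "1 \<le> \<sigma> a" "1 \<le> \<sigma> b" "\<sigma>' a \<le> n"
          using permutes_in_image[OF \<sigma>, of a] permutes_in_image[OF \<sigma>, of b] permutes_in_image[OF \<sigma>', of a] ab by auto
        consider "a = k" | "b = k" | "a \<noteq> k" "b \<noteq> k" by blast
        then show "p' a < p' b \<or> p' a = p' b \<and> \<sigma>' a < \<sigma>' b"
        proof cases
          case 1
          then show ?thesis using o k ab by (auto simp: p'_def)
        next
          case 2
          have "\<sigma>' a \<noteq> n" using 2 ab \<sigma>'k \<sigma>' by (metis permutes_inj injD less_irrefl)
          then show ?thesis using 2 o k ab r \<sigma>'k by (auto simp: p'_def)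
        next
          case 3
          then show ?thesis using o ab r \<sigma>'_eq[of a] \<sigma>'_eq[of b] by (auto simp: p'_def)
        qed
      qed
      moreover have "m = (\<Sum>k\<in>{1..n}. p' k)" "real (\<Sum>k\<in>{1..n}. p' k) < \<kappa>"
        using sum Suc.hyps(2) \<open>real (\<Sum>k\<in>{1..n}. p k) < \<kappa>\<close> by auto
      ultimately obtain f where f: "f \<in> degree_space (\<Sum>k\<in>{1..n}. p' k)"
          "weight n dunkl_opdam (\<lambda>i. p' (perm_inv \<sigma>' i) + \<kappa> * d (perm_inv \<sigma>' i)) f"
          "0 < norm_sign n d \<sigma>' p' * Re (B f f)"
        using Suc.hyps(1)[of p' \<sigma>'] by blast
      have inv'n: "perm_inv \<sigma>' n = k" using \<sigma>'k permutes_inverses(2)[OF \<sigma>'] by metis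
      \<comment> \<open>The gap of 1 ensures that \<open>p' k + 1\<close> cannot outweigh
        \<open>\<kappa> * d k\<close> when the content is negative.\<close>
      have p'k: "real (p' k) < \<kappa> - 1"
      proof -
        have "p k \<le> (\<Sum>k\<in>{1..n}. p k)" using k by (intro member_le_sum) auto
        then show ?thesis using \<open>real (\<Sum>k\<in>{1..n}. p k) < \<kappa>\<close> k by (auto simp: p'_def simp del: of_nat_sum)
      qed
      have inv'_Suc: "perm_inv \<sigma> j = perm_inv \<sigma>' (j - 1)" if "j \<in> {1..n}" "j \<noteq> 1" for j
      proof -
        have "cycle n (j - 1) = j" using that by (auto simp: cycle_def)
        then have "\<sigma> (perm_inv \<sigma>' (j - 1)) = j" using permutes_inverses(1)[OF \<sigma>'] by (simp add: \<sigma>_eq)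
        then show ?thesis using inv_\<sigma>(2) by metis
      qed
      have inv'_ne: "perm_inv \<sigma> j \<noteq> k" if "j \<noteq> 1" for j
        using that k inv_\<sigma>(1) by metis
      have "weight n dunkl_opdam (\<lambda>i. p (perm_inv \<sigma> i) + \<kappa> * d (perm_inv \<sigma> i)) (raising f)"
      proof (rule weight_cong[OF weight_raising[OF f(2)]])
        fix j assume j: "j \<in> {1..n}"
        show "(if j = 1 then real (p' (perm_inv \<sigma>' n)) + \<kappa> * real_of_int (d (perm_inv \<sigma>' n)) + 1
          else real (p' (perm_inv \<sigma>' (j - 1))) + \<kappa> * real_of_int (d (perm_inv \<sigma>' (j - 1)))) =
          real (p (perm_inv \<sigma> j)) + \<kappa> * real_of_int (d (perm_inv \<sigma> j))"
          using inv'n inv'_Suc[OF j] inv'_ne[of j] k(3) by (auto simp: k_def[symmetric] p'_def)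
      qed
      moreover have "raising f \<in> degree_space (\<Sum>k\<in>{1..n}. p k)"
        unfolding raising_def sum using n_pos by (intro degree_space_x degree_space_act cycle f) auto
      moreover have "0 < norm_sign n d \<sigma> p * Re (B (raising f) (raising f))"
      proof -
        define e :: real where "e = (if d k < 0 then -1 else 1)"
        have ns: "norm_sign n d \<sigma> p = e * norm_sign n d \<sigma>' p'"
          using norm_sign_cycle[OF \<sigma>' k(1) \<sigma>'k, of d p'] by (simp only: p_eq[symmetric] \<sigma>_eq[symmetric] e_def)
        have "Re (B (raising f) (raising f)) = (p' k + \<kappa> * d k + 1) * Re (B f f)"
          using B_raising[OF f(2)] by (simp add: inv'n)
        then have "norm_sign n d \<sigma> p * Re (B (raising f) (raising f)) =
            (e * (p' k + \<kappa> * d k + 1)) * (norm_sign n d \<sigma>' p' * Re (B f f))"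
          by (simp add: ns)
        moreover have "0 < e * (p' k + \<kappa> * d k + 1)"
        proof (cases "d k < 0")
          case True
          then have "\<kappa> * d k \<le> \<kappa> * (-1)" using p'k by (intro mult_left_mono) auto
          then show ?thesis using p'k True by (simp add: e_def)
        next
          case False
          then have "0 \<le> \<kappa> * d k" using p'k by simp
          then show ?thesis using False by (simp add: e_def)
        qed
        ultimately show ?thesis using f(3) by simp
      qed
      ultimately show ?thesis by blast
    next
      case False
      then have i: "i \<in> {1..<n}" "i \<in> {1..n}" "Suc i \<in> {1..n}" using Suc.prems(2) by auto
      show ?thesis
      proof (cases "0 < p (perm_inv \<sigma> i)")
        case True
        then show ?thesis using Suc.IH[OF Suc.prems(1) i(2)] by blast
      next
        case p0: False
        define k where "k = perm_inv \<sigma> i"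
        define l where "l = perm_inv \<sigma> (Suc i)"
        have kl: "\<sigma> k = i" "\<sigma> l = Suc i" "k \<in> {1..n}" "l \<in> {1..n}" "p k = 0" "0 < p l" "k \<noteq> l"
          using inv_\<sigma>(1) inv_in[of i] inv_in[of "Suc i"] i p0 Suc.prems(3) unfolding k_def l_def
          by (auto dest: arg_cong[of _ _ \<sigma>])
        have less: "k < l"
          using Suc.prems(1) kl unfolding sorts_def by (metis atLeastAtMost_iff linorder_neqE_nat not_less_zero)
        let ?s = "Transposition.transpose i (Suc i)"
        define \<sigma>' where "\<sigma>' = ?s \<circ> \<sigma>"
        have \<sigma>': "\<sigma>' permutes {1..n}"
          unfolding \<sigma>'_def using \<sigma> transpose_permutes[OF i(2,3)] by (rule permutes_compose)
        \<comment> \<open>Only the order of k and l changes, and their exponents 0 and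
          \<open>p l\<close> are not tied.\<close>
        have sort': "sorts n \<sigma>' p"
          unfolding sorts_def
        proof (intro conjI allI impI \<sigma>')
          fix a b assume ab: "1 \<le> a" "a < b" "b \<le> n"
          have o: "p a < p b \<or> p a = p b \<and> \<sigma> a < \<sigma> b"
            using Suc.prems(1) ab by (auto simp: sorts_def)
          have ne: "\<sigma> a \<noteq> \<sigma> b" using ab inj[of a b] by simp
          have "\<sigma> a = i \<longleftrightarrow> a = k" "\<sigma> a = Suc i \<longleftrightarrow> a = l" "\<sigma> b = i \<longleftrightarrow> b = k" "\<sigma> b = Suc i \<longleftrightarrow> b = l"
            using inj kl by metis+
          then show "p a < p b \<or> p a = p b \<and> \<sigma>' a < \<sigma>' b"
            using o kl less ne by (auto simp: \<sigma>'_def Transposition.transpose_def)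
        qed
        have inv': "perm_inv \<sigma>' = perm_inv \<sigma> \<circ> ?s"
          unfolding \<sigma>'_def using \<sigma> by (simp add: o_inv_distrib permutes_bij)
        have "0 < p (perm_inv \<sigma>' i)" using kl by (simp add: inv' l_def)
        then obtain f where f: "f \<in> degree_space (\<Sum>k\<in>{1..n}. p k)"
          "weight n dunkl_opdam (\<lambda>i. p (perm_inv \<sigma>' i) + \<kappa> * d (perm_inv \<sigma>' i)) f"
          "0 < norm_sign n d \<sigma>' p * Re (B f f)"
          using Suc.IH[OF sort' i(2)] by blast
        define a where "a = (\<lambda>i. p (perm_inv \<sigma>' i) + \<kappa> * d (perm_inv \<sigma>' i))"
        define e :: real where "e = (if d l - d k \<in> {0, -1} then -1 else 1)"
        have a: "a i - a (Suc i) = p l + \<kappa> * (d l - d k)"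
          using kl by (simp add: a_def inv' k_def[symmetric] l_def[symmetric] algebra_simps)
        have "p l \<le> (\<Sum>k\<in>{1..n}. p k)" using kl by (intro member_le_sum) auto
        then have q: "0 < real (p l)" "real (p l) < \<kappa>"
          using \<open>real (\<Sum>k\<in>{1..n}. p k) < \<kappa>\<close> kl by (auto simp del: of_nat_sum)
        have ne: "a i \<noteq> a (Suc i)" and pos: "0 < e * (1 - (\<kappa> / (a i - a (Suc i)))\<^sup>2)"
          using norm_factor_sign[OF q, of "d l - d k"] a by (auto simp: e_def)
        have w: "weight n dunkl_opdam a f" using f(2) by (simp add: a_def)
        note fV = subsetD[OF degree_space_V f(1)]
        have "weight n dunkl_opdam (\<lambda>i. p (perm_inv \<sigma> i) + \<kappa> * d (perm_inv \<sigma> i)) (dunkl.intertwiner i a f)"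
          by (rule weight_cong[OF dunkl.weight_intertwiner[OF i(1) w ne]]) (simp add: a_def inv')
        moreover have "dunkl.intertwiner i a f \<in> degree_space (\<Sum>k\<in>{1..n}. p k)"
          unfolding dunkl.intertwiner_def
          by (intro degree_space_closed degree_space_act transpose_permutes f(1) i(2,3))
        moreover have "0 < norm_sign n d \<sigma> p * Re (B (dunkl.intertwiner i a f) (dunkl.intertwiner i a f))"
        proof -
          have "norm_sign n d \<sigma>' p = e * norm_sign n d \<sigma> p"
            using norm_sign_swap[OF \<sigma>, of k l d p] kl less by (simp add: \<sigma>'_def e_def)
          then have "norm_sign n d \<sigma> p = e * norm_sign n d \<sigma>' p"
            by (simp add: e_def)
          then have "norm_sign n d \<sigma> p * Re (B (dunkl.intertwiner i a f) (dunkl.intertwiner i a f)) =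
              (e * (1 - (\<kappa> / (a i - a (Suc i)))\<^sup>2)) * (norm_sign n d \<sigma>' p * Re (B f f))"
            unfolding dunkl.B_intertwiner[OF i(1) w ne] by simp
          then show ?thesis using pos f(3) by simp
        qed
        ultimately show ?thesis by blast
      qed
    qed
  qed simp
  have "\<exists>k\<in>{1..n}. 0 < p k"
    using Suc.hyps(2) by (metis Zero_not_Suc sum.neutral not_gr_zero)
  then obtain k where k: "k \<in> {1..n}" "0 < p k" by blast
  have \<sigma>: "\<sigma> permutes {1..n}" using Suc.prems by (simp add: sorts_def)
  have "perm_inv \<sigma> (\<sigma> k) = k" by (rule permutes_inverses(2)[OF \<sigma>])
  then have "0 < p (perm_inv \<sigma> (\<sigma> k))" using k(2) by simp
  moreover have "\<sigma> k \<in> {1..n}" using permutes_in_image[OF \<sigma>] k(1) by blast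
  ultimately show ?case using step[OF Suc.prems(1)] by blast
qed

end

section \<open>The generating function\<close>

lemma geometric_factor:
  fixes \<epsilon> :: "'a::field"
  assumes "0 < D" and F: "(1 - fps_const \<epsilon> * fps_X ^ D) * F = G"
  shows "1 / (1 - fps_const \<epsilon> * fps_X ^ D) * G = F"
proof -
  let ?u = "1 - fps_const \<epsilon> * fps_X ^ D :: 'a fps"
  have u: "fps_nth ?u 0 \<noteq> 0" using assms by simp
  then have "inverse ?u * ?u = 1" by (rule inverse_mult_eq_1)
  then show ?thesis
    unfolding F[symmetric] fps_divide_unit[OF u] by (simp add: mult.assoc[symmetric])
qed

definition solutions :: "nat set \<Rightarrow> (nat \<Rightarrow> nat) \<Rightarrow> nat \<Rightarrow> (nat \<Rightarrow> nat) set" where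
  "solutions J D m = {h \<in> J \<rightarrow>\<^sub>E UNIV. (\<Sum>j\<in>J. D j * h j) = m}"

lemma finite_solutions:
  assumes "finite J" "\<And>j. j \<in> J \<Longrightarrow> 0 < D j"
  shows "finite (solutions J D m)"
proof (rule finite_subset)
  show "solutions J D m \<subseteq> J \<rightarrow>\<^sub>E {..m}"
  proof
    fix h assume h: "h \<in> solutions J D m"
    have "h j \<le> m" if j: "j \<in> J" for j
    proof -
      have "h j \<le> D j * h j" using assms(2)[OF j] by simp
      also have "\<dots> \<le> (\<Sum>j\<in>J. D j * h j)" using assms(1) j by (intro member_le_sum) auto
      finally show ?thesis using h by (simp add: solutions_def)
    qed
    then show "h \<in> J \<rightarrow>\<^sub>E {..m}" using h by (auto simp: solutions_def PiE_iff)
  qed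
qed (use assms in \<open>auto intro: finite_PiE\<close>)

text \<open>Multiplying by the new denominator removes the solutions with \<open>h i\<close>
  positive, as lowering \<open>h i\<close> by 1 matches them with the solutions of degree m - D i.
  What remains is the series for J.\<close>

lemma prod_geometric_series:
  fixes \<epsilon> :: "nat \<Rightarrow> 'a::field"
  assumes "finite J" "\<And>j. j \<in> J \<Longrightarrow> 0 < D j"
  shows "(\<Prod>j\<in>J. 1 / (1 - fps_const (\<epsilon> j) * fps_X ^ D j)) =
    Abs_fps (\<lambda>m. \<Sum>h\<in>solutions J D m. \<Prod>j\<in>J. \<epsilon> j ^ h j)"
  using assms
proof (induction J rule: finite_induct)
  case empty
  have "solutions {} D m = (if m = 0 then {\<lambda>_. undefined} else {})" for m
    by (auto simp: solutions_def)
  then show ?case by (intro fps_ext) simp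
next
  case (insert i J)
  let ?F = "\<lambda>J. Abs_fps (\<lambda>m. \<Sum>h\<in>solutions J D m. \<Prod>j\<in>J. \<epsilon> j ^ h j)"
  let ?S = "solutions (insert i J) D"
  have Di: "0 < D i" using insert.prems by simp
  have fin: "finite (?S m)" for m using insert by (intro finite_solutions) auto
  have "(1 - fps_const (\<epsilon> i) * fps_X ^ D i) * ?F (insert i J) = ?F J"
  proof (rule fps_ext)
    fix m
    let ?w = "\<lambda>h. \<Prod>j\<in>insert i J. \<epsilon> j ^ h j"
    have sum: "(\<Sum>j\<in>J. D j * (h(i := c)) j) = (\<Sum>j\<in>J. D j * h j)" for h c
      using insert.hyps by (intro sum.cong) auto
    note sum' = sum[unfolded fun_upd_apply]
    have prod: "(\<Prod>j\<in>J. \<epsilon> j ^ (h(i := c)) j) = (\<Prod>j\<in>J. \<epsilon> j ^ h j)" for h c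
      using insert.hyps by (intro prod.cong) auto
    have "(\<Sum>h\<in>?S m. ?w h) = (\<Sum>h\<in>{h \<in> ?S m. h i = 0}. ?w h) + (\<Sum>h\<in>{h \<in> ?S m. h i \<noteq> 0}. ?w h)"
      by (subst sum.union_disjoint[symmetric]) (auto simp: fin intro!: sum.cong)
    also have "(\<Sum>h\<in>{h \<in> ?S m. h i = 0}. ?w h) = (\<Sum>h\<in>solutions J D m. \<Prod>j\<in>J. \<epsilon> j ^ h j)"
    proof (rule sum.reindex_bij_witness[of _ "\<lambda>h. h(i := 0)" "\<lambda>h. h(i := undefined)"])
      fix h assume h: "h \<in> {h \<in> ?S m. h i = 0}"
      then show "(h(i := undefined))(i := 0) = h" by auto
      show "h(i := undefined) \<in> solutions J D m"
      proof -
        have "h(i := undefined) \<in> J \<rightarrow>\<^sub>E UNIV"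
          using h by (auto simp: solutions_def PiE_iff extensional_def)
        moreover have "(\<Sum>j\<in>J. D j * (h(i := undefined)) j) = m"
          using h insert.hyps by (subst sum) (auto simp: solutions_def)
        ultimately show ?thesis by (simp only: solutions_def mem_Collect_eq)
      qed
      show "(\<Prod>j\<in>J. \<epsilon> j ^ (h(i := undefined)) j) = ?w h"
        unfolding prod using h insert.hyps by simp
    next
      fix h assume h: "h \<in> solutions J D m"
      then show "(h(i := 0))(i := undefined) = h"
        using insert.hyps by (auto simp: solutions_def PiE_iff extensional_def)
      show "h(i := 0) \<in> {h \<in> ?S m. h i = 0}"
        using h insert.hyps by (auto simp: solutions_def sum' PiE_iff extensional_def)
    qed
    also have "(\<Sum>h\<in>{h \<in> ?S m. h i \<noteq> 0}. ?w h) = (if m < D i then 0 else \<epsilon> i * (\<Sum>h\<in>?S (m - D i). ?w h))"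
    proof (cases "m < D i")
      case True
      have "{h \<in> ?S m. h i \<noteq> 0} = {}"
      proof -
        have False if "h \<in> ?S m" "h i \<noteq> 0" for h
        proof -
          have "D i \<le> D i * h i" using that by simp
          also have "\<dots> \<le> m" using that insert.hyps by (auto simp: solutions_def)
          finally show False using True by simp
        qed
        then show ?thesis by blast
      qed
      then show ?thesis using True by (simp only: sum.empty if_True)
    next
      case False
      have "(\<Sum>h\<in>{h \<in> ?S m. h i \<noteq> 0}. ?w h) = (\<Sum>h\<in>?S (m - D i). \<epsilon> i * ?w h)"
      proof (rule sum.reindex_bij_witness[of _ "\<lambda>h. h(i := Suc (h i))" "\<lambda>h. h(i := h i - 1)"])
        fix h assume h: "h \<in> {h \<in> ?S m. h i \<noteq> 0}"
        then obtain c where c: "h i = Suc c" by (cases "h i") auto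
        show "(h(i := h i - 1))(i := Suc ((h(i := h i - 1)) i)) = h" using c by (auto simp: One_nat_def)
        show "h(i := h i - 1) \<in> ?S (m - D i)"
          using h c insert.hyps by (auto simp: solutions_def sum' PiE_iff extensional_def One_nat_def)
        show "\<epsilon> i * ?w (h(i := h i - 1)) = ?w h"
          using c insert.hyps by (simp add: prod One_nat_def del: fun_upd_apply) (simp add: One_nat_def)
      next
        fix h assume h: "h \<in> ?S (m - D i)"
        show "(h(i := Suc (h i)))(i := (h(i := Suc (h i))) i - 1) = h" by (auto simp: One_nat_def)
        show "h(i := Suc (h i)) \<in> {h \<in> ?S m. h i \<noteq> 0}"
          using h False insert.hyps by (auto simp: solutions_def sum' PiE_iff extensional_def)
      qed
      then show ?thesis using False by (simp add: sum_distrib_left)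
    qed
    finally have *: "(\<Sum>h\<in>?S m. ?w h) = (\<Sum>h\<in>solutions J D m. \<Prod>j\<in>J. \<epsilon> j ^ h j) +
        (if m < D i then 0 else \<epsilon> i * (\<Sum>h\<in>?S (m - D i). ?w h))" .
    show "fps_nth ((1 - fps_const (\<epsilon> i) * fps_X ^ D i) * ?F (insert i J)) m = fps_nth (?F J) m"
      using * by (simp add: left_diff_distrib mult.assoc fps_X_power_mult_nth del: prod.insert)
  qed
  then have "1 / (1 - fps_const (\<epsilon> i) * fps_X ^ D i) * ?F J = ?F (insert i J)"
    by (rule geometric_factor[OF Di])
  then show ?case
    using insert by simp
qed

lemma prod_fps_monomials:
  fixes c :: "'a \<Rightarrow> 'b::comm_ring_1"
  shows "(\<Prod>i\<in>I. fps_const (c i) * fps_X ^ D i) = fps_const (\<Prod>i\<in>I. c i) * fps_X ^ (\<Sum>i\<in>I. D i)"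
proof (induction I rule: infinite_finite_induct)
  case (insert i I)
  have "fps_const (c i) * fps_X ^ D i * (fps_const (\<Prod>i\<in>I. c i) * fps_X ^ (\<Sum>i\<in>I. D i)) =
      (fps_const (c i) * fps_const (\<Prod>i\<in>I. c i)) * (fps_X ^ D i * fps_X ^ (\<Sum>i\<in>I. D i))"
    by (simp only: ac_simps)
  then show ?case
    by (simp only: prod.insert[OF insert.hyps] sum.insert[OF insert.hyps] insert.IH power_add fps_const_mult)
qed auto

text \<open>The exponents sorted by \<open>\<sigma>\<close> have to jump at the descents of \<open>\<sigma>\<close>; \<open>h\<close> records the remaining,
  arbitrary increments. An increment after position \<open>j\<close> contributes \<open>n - j\<close> to the degree.\<close>

definition exponents :: "nat \<Rightarrow> (nat \<Rightarrow> nat) \<Rightarrow> (nat \<Rightarrow> nat) \<Rightarrow> nat \<Rightarrow> nat" where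
  "exponents n \<sigma> h k = (\<Sum>j<k. h j + of_bool (j \<in> I_set n \<sigma>))"

lemma I_set_iff: "j \<in> I_set n \<sigma> \<longleftrightarrow> 1 \<le> j \<and> j < n \<and> \<sigma> (Suc j) < \<sigma> j"
  by (auto simp: I_set_def One_nat_def)

lemma I_set_subset: "I_set n \<sigma> \<subseteq> {..<n}"
  by (auto simp: I_set_def)

lemma exponents_Suc: "exponents n \<sigma> h (Suc k) = exponents n \<sigma> h k + h k + of_bool (k \<in> I_set n \<sigma>)"
  by (simp add: exponents_def)

lemma sorts_exponents:
  assumes \<sigma>: "\<sigma> permutes {1..n}"
  shows "sorts n \<sigma> (exponents n \<sigma> h)"
  unfolding sorts_def
proof (intro conjI allI impI \<sigma>)
  fix k l assume k: "1 \<le> k" and "k < l" "l \<le> n"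
  then show "exponents n \<sigma> h k < exponents n \<sigma> h l \<or> exponents n \<sigma> h k = exponents n \<sigma> h l \<and> \<sigma> k < \<sigma> l"
  proof (induction l)
    case (Suc l)
    have step: "exponents n \<sigma> h l < exponents n \<sigma> h (Suc l) \<or> exponents n \<sigma> h l = exponents n \<sigma> h (Suc l) \<and> \<sigma> l < \<sigma> (Suc l)"
      if "k \<le> l"
    proof (cases "l \<in> I_set n \<sigma>")
      case False
      have "\<sigma> l \<noteq> \<sigma> (Suc l)" using \<sigma> by (metis n_not_Suc_n permutes_inj injD)
      then have "\<sigma> l < \<sigma> (Suc l)" using False k Suc.prems that by (auto simp: I_set_iff)
      then show ?thesis using False by (auto simp: exponents_Suc)
    qed (auto simp: exponents_Suc)
    show ?case
      using Suc step by (cases "k = l") (auto dest: less_trans)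
  qed simp
qed

lemma sum_exponents: "(\<Sum>k\<in>{1..n}. exponents n \<sigma> h k) = (\<Sum>j<n. (n - j) * (h j + of_bool (j \<in> I_set n \<sigma>)))"
proof -
  let ?g = "\<lambda>j. h j + of_bool (j \<in> I_set n \<sigma>)"
  have "(\<Sum>k\<in>{1..n}. \<Sum>j<k. ?g j) = (\<Sum>k\<in>{1..n}. \<Sum>j\<in>{j\<in>{..<n}. j < k}. ?g j)"
    by (intro sum.cong refl) auto
  also have "\<dots> = (\<Sum>j<n. \<Sum>k\<in>{k\<in>{1..n}. j < k}. ?g j)"
    by (rule sum.swap_restrict) auto
  also have "\<dots> = (\<Sum>j<n. (n - j) * ?g j)"
  proof (rule sum.cong[OF refl])
    fix j assume "j \<in> {..<n}"
    have "{k \<in> {1..n}. j < k} = {Suc j..n}" by auto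
    then show "(\<Sum>k\<in>{k\<in>{1..n}. j < k}. ?g j) = (n - j) * ?g j" by simp
  qed
  finally show ?thesis by (simp add: exponents_def)
qed

text \<open>The parity of p k + p l is that of p l - p k, the sum of the increments at k \<le> j <
  l. Hence the increment at j is counted once for each entry beyond j with negative content and once
  for each exponent pair that j separates, \<open>k_stat n d j\<close> times in all.\<close>

lemma norm_sign_exponents:
  "norm_sign n d \<sigma> (exponents n \<sigma> h) =
    (-1) ^ card (J_set n d \<sigma>) * (\<Prod>j<n. ((-1) ^ k_stat n d j) ^ (h j + of_bool (j \<in> I_set n \<sigma>)))"
proof -
  let ?g = "\<lambda>j. h j + of_bool (j \<in> I_set n \<sigma>)" and ?p = "exponents n \<sigma> h"
  let ?P = "exponent_pairs n d"
  have "(\<Prod>k\<in>{1..n}. if d k < 0 then (-1::real) ^ ?p k else 1) = (-1) ^ (\<Sum>k\<in>{k\<in>{1..n}. d k < 0}. ?p k)"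
    unfolding power_sum by (rule prod.inter_filter[symmetric]) simp
  also have "(\<Sum>k\<in>{k\<in>{1..n}. d k < 0}. ?p k) = (\<Sum>k\<in>{k\<in>{1..n}. d k < 0}. \<Sum>j\<in>{j\<in>{..<n}. j < k}. ?g j)"
    unfolding exponents_def by (intro sum.cong refl) auto
  also have "\<dots> = (\<Sum>j<n. \<Sum>k\<in>{k\<in>{k\<in>{1..n}. d k < 0}. j < k}. ?g j)"
    by (rule sum.swap_restrict) auto
  also have "\<dots> = (\<Sum>j<n. card {i. 1 \<le> i \<and> i \<le> n \<and> d i < 0 \<and> i > j} * ?g j)"
  proof (rule sum.cong[OF refl])
    fix j
    have "{k\<in>{k\<in>{1..n}. d k < 0}. j < k} = {i. 1 \<le> i \<and> i \<le> n \<and> d i < 0 \<and> i > j}" by auto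
    then show "(\<Sum>k\<in>{k\<in>{k\<in>{1..n}. d k < 0}. j < k}. ?g j) = card {i. 1 \<le> i \<and> i \<le> n \<and> d i < 0 \<and> i > j} * ?g j"
      by simp
  qed
  finally have 1: "(\<Prod>k\<in>{1..n}. if d k < 0 then (-1::real) ^ ?p k else 1) =
      (-1) ^ (\<Sum>j<n. card {i. 1 \<le> i \<and> i \<le> n \<and> d i < 0 \<and> i > j} * ?g j)" .
  have pair: "(-1::real) ^ (?p k + ?p l + of_bool (\<sigma> k > \<sigma> l)) = (-1) ^ (\<Sum>j\<in>{j\<in>{..<n}. k \<le> j \<and> j < l}. ?g j) * (-1) ^ of_bool (\<sigma> k > \<sigma> l)"
    if "(k, l) \<in> ?P" for k l
  proof -
    have kl: "k < l" "l \<le> n" using that by (auto simp: exponent_pairs_def)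
    then have l: "{..<l} = {..<k} \<union> {j\<in>{..<n}. k \<le> j \<and> j < l}" by auto
    have "?p l = ?p k + (\<Sum>j\<in>{j\<in>{..<n}. k \<le> j \<and> j < l}. ?g j)"
      unfolding exponents_def l by (rule sum.union_disjoint) auto
    then have "?p k + ?p l + of_bool (\<sigma> k > \<sigma> l) =
        2 * ?p k + ((\<Sum>j\<in>{j\<in>{..<n}. k \<le> j \<and> j < l}. ?g j) + of_bool (\<sigma> k > \<sigma> l))"
      by simp
    then show ?thesis by (simp only: power_add power_mult) simp
  qed
  have "(\<Prod>(k, l)\<in>?P. (-1::real) ^ (?p k + ?p l + of_bool (\<sigma> k > \<sigma> l))) =
      (\<Prod>kl\<in>?P. (-1) ^ (\<Sum>j\<in>{j\<in>{..<n}. fst kl \<le> j \<and> j < snd kl}. ?g j) * (-1) ^ of_bool (\<sigma> (fst kl) > \<sigma> (snd kl)))"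
  proof (rule prod.cong[OF refl])
    fix kl assume "kl \<in> ?P"
    moreover obtain k l where "kl = (k, l)" by fastforce
    ultimately show "(case kl of (k, l) \<Rightarrow> (-1::real) ^ (?p k + ?p l + of_bool (\<sigma> k > \<sigma> l))) =
        (-1) ^ (\<Sum>j\<in>{j\<in>{..<n}. fst kl \<le> j \<and> j < snd kl}. ?g j) * (-1) ^ of_bool (\<sigma> (fst kl) > \<sigma> (snd kl))"
      using pair[of k l] by (simp only: split fst_conv snd_conv)
  qed
  also have "\<dots> = (-1) ^ (\<Sum>kl\<in>?P. \<Sum>j\<in>{j\<in>{..<n}. fst kl \<le> j \<and> j < snd kl}. ?g j) *
      (-1) ^ (\<Sum>kl\<in>?P. of_bool (\<sigma> (fst kl) > \<sigma> (snd kl)))"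
    unfolding prod.distrib power_sum ..
  also have "(\<Sum>kl\<in>?P. of_bool (\<sigma> (fst kl) > \<sigma> (snd kl))) = card (J_set n d \<sigma>)"
  proof -
    have "J_set n d \<sigma> = ?P \<inter> {kl. \<sigma> (fst kl) > \<sigma> (snd kl)}"
      by (auto simp: J_set_def exponent_pairs_def)
    then show ?thesis by (simp add: sum_of_bool_eq)
  qed
  also have "(\<Sum>kl\<in>?P. \<Sum>j\<in>{j\<in>{..<n}. fst kl \<le> j \<and> j < snd kl}. ?g j) =
      (\<Sum>j<n. \<Sum>kl\<in>{kl\<in>?P. fst kl \<le> j \<and> j < snd kl}. ?g j)"
    by (rule sum.swap_restrict) auto
  also have "\<dots> = (\<Sum>j<n. card {(s, t). 1 \<le> s \<and> s \<le> j \<and> j < t \<and> t \<le> n \<and> d t - d s \<in> {0, -1}} * ?g j)"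
  proof (rule sum.cong[OF refl])
    fix j
    have "{kl\<in>?P. fst kl \<le> j \<and> j < snd kl} = {(s, t). 1 \<le> s \<and> s \<le> j \<and> j < t \<and> t \<le> n \<and> d t - d s \<in> {0, -1}}"
      by (auto simp: exponent_pairs_def)
    then show "(\<Sum>kl\<in>{kl\<in>?P. fst kl \<le> j \<and> j < snd kl}. ?g j) =
        card {(s, t). 1 \<le> s \<and> s \<le> j \<and> j < t \<and> t \<le> n \<and> d t - d s \<in> {0, -1}} * ?g j"
      by (simp only: sum_constant) simp
  qed
  finally have 2: "(\<Prod>(k, l)\<in>?P. (-1::real) ^ (?p k + ?p l + of_bool (\<sigma> k > \<sigma> l))) =
      (-1) ^ (\<Sum>j<n. card {(s, t). 1 \<le> s \<and> s \<le> j \<and> j < t \<and> t \<le> n \<and> d t - d s \<in> {0, -1}} * ?g j) *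
      (-1) ^ card (J_set n d \<sigma>)" .
  have "(\<Prod>j<n. ((-1::real) ^ k_stat n d j) ^ ?g j) = (-1) ^ (\<Sum>j<n. k_stat n d j * ?g j)"
    by (simp add: power_sum power_mult)
  then show ?thesis
    unfolding norm_sign_def 1 2 by (simp add: k_stat_def distrib_right sum.distrib power_add)
qed

text \<open>Each tableau contributes one weight vector of degree m for every such pair. Functions
  are extensional, so that h is determined by its n increments.\<close>

definition degree_index :: "nat \<Rightarrow> nat \<Rightarrow> ((nat \<Rightarrow> nat) \<times> (nat \<Rightarrow> nat)) set" where
  "degree_index n m = {(\<sigma>, h). \<sigma> permutes {1..n} \<and> h \<in> {..<n} \<rightarrow>\<^sub>E UNIV \<and> (\<Sum>k\<in>{1..n}. exponents n \<sigma> h k) = m}"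

text \<open>A descent at j forces one increment, which costs n - j; the remaining degree is
  distributed freely.\<close>

lemma degree_index_eq:
  "degree_index n m = (SIGMA \<sigma>:{\<sigma>. \<sigma> permutes {1..n}}.
    (if (\<Sum>j\<in>I_set n \<sigma>. n - j) \<le> m then solutions {..<n} (\<lambda>j. n - j) (m - (\<Sum>j\<in>I_set n \<sigma>. n - j)) else {}))"
proof -
  have "(\<Sum>j<n. (n - j) * (h j + of_bool (j \<in> I_set n \<sigma>))) = (\<Sum>j<n. (n - j) * h j) + (\<Sum>j\<in>I_set n \<sigma>. n - j)" for h \<sigma>
  proof -
    have "(\<Sum>j<n. (n - j) * of_bool (j \<in> I_set n \<sigma>)) = (\<Sum>j\<in>{..<n} \<inter> I_set n \<sigma>. n - j)"
      by (simp add: sum.inter_restrict of_bool_def if_distrib cong: if_cong)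
    then show ?thesis
      using I_set_subset[of n \<sigma>] by (simp only: distrib_left sum.distrib Int_absorb1)
  qed
  then show ?thesis
    unfolding degree_index_def sum_exponents solutions_def by (auto split: if_splits)
qed

lemma finite_degree_index: "finite (degree_index n m)"
  unfolding degree_index_eq by (intro finite_SigmaI finite_permutations) (auto intro!: finite_solutions)

text \<open>The product over the descents is a single monomial and accounts for the forced
  increments; the geometric series account for the free ones.\<close>

lemma generating_function:
  assumes n: "1 \<le> n"
  shows "fps_nth ((\<Prod>j=0..n-1. 1 / (1 - fps_const ((-1) ^ k_stat n d j) * fps_X ^ (n - j))) *
        (\<Sum>\<sigma> | \<sigma> permutes {1..n}.
          fps_const ((-1) ^ card (J_set n d \<sigma>)) *
          (\<Prod>i\<in>I_set n \<sigma>. fps_const ((-1) ^ k_stat n d i) * fps_X ^ (n - i)))) m =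
    (\<Sum>(\<sigma>, h)\<in>degree_index n m. norm_sign n d \<sigma> (exponents n \<sigma> h) :: real)"
proof -
  let ?e = "\<lambda>j. (-1::real) ^ k_stat n d j" and ?D = "\<lambda>j. n - j"
  let ?F = "Abs_fps (\<lambda>m. \<Sum>h\<in>solutions {..<n} ?D m. \<Prod>j<n. ?e j ^ h j)"
  let ?s = "\<lambda>\<sigma>. \<Sum>j\<in>I_set n \<sigma>. n - j"
  have "{0..n-1} = {..<n}" using n by auto
  then have F: "(\<Prod>j=0..n-1. 1 / (1 - fps_const (?e j) * fps_X ^ (n - j))) = ?F"
    using prod_geometric_series[of "{..<n}" ?D ?e] by simp
  have "fps_nth (?F * (fps_const ((-1) ^ card (J_set n d \<sigma>)) * (\<Prod>i\<in>I_set n \<sigma>. fps_const (?e i) * fps_X ^ (n - i)))) m =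
      (\<Sum>h\<in>(if ?s \<sigma> \<le> m then solutions {..<n} ?D (m - ?s \<sigma>) else {}). norm_sign n d \<sigma> (exponents n \<sigma> h))"
    if \<sigma>: "\<sigma> permutes {1..n}" for \<sigma>
  proof -
    let ?c = "(-1) ^ card (J_set n d \<sigma>) * (\<Prod>i\<in>I_set n \<sigma>. ?e i)"
    have "fps_const ((-1) ^ card (J_set n d \<sigma>)) * (\<Prod>i\<in>I_set n \<sigma>. fps_const (?e i) * fps_X ^ (n - i)) =
        fps_const ?c * fps_X ^ ?s \<sigma>"
      by (simp only: prod_fps_monomials fps_const_mult[symmetric] mult.assoc)
    then have "?F * (fps_const ((-1) ^ card (J_set n d \<sigma>)) * (\<Prod>i\<in>I_set n \<sigma>. fps_const (?e i) * fps_X ^ (n - i))) =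
        fps_const ?c * (fps_X ^ ?s \<sigma> * ?F)"
      by (simp only: ac_simps)
    then have "fps_nth (?F * (fps_const ((-1) ^ card (J_set n d \<sigma>)) * (\<Prod>i\<in>I_set n \<sigma>. fps_const (?e i) * fps_X ^ (n - i)))) m =
        fps_nth (fps_const ?c * (fps_X ^ ?s \<sigma> * ?F)) m"
      by (rule arg_cong)
    also have "\<dots> = (\<Sum>h\<in>(if ?s \<sigma> \<le> m then solutions {..<n} ?D (m - ?s \<sigma>) else {}). ?c * (\<Prod>j<n. ?e j ^ h j))"
    proof (cases "m < ?s \<sigma>")
      case True
      then show ?thesis by (simp add: fps_X_power_mult_nth)
    next
      case False
      then have "?s \<sigma> \<le> m" by simp
      then show ?thesis
        by (simp only: fps_mult_left_const_nth fps_X_power_mult_nth False if_False if_True fps_nth_Abs_fps sum_distrib_left)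
    qed
    also have "\<dots> = (\<Sum>h\<in>(if ?s \<sigma> \<le> m then solutions {..<n} ?D (m - ?s \<sigma>) else {}). norm_sign n d \<sigma> (exponents n \<sigma> h))"
    proof (rule sum.cong[OF refl])
      fix h
      have "(\<Prod>j<n. ?e j ^ of_bool (j \<in> I_set n \<sigma>)) = (\<Prod>i\<in>I_set n \<sigma>. ?e i)"
      proof -
        have "(\<Prod>j<n. ?e j ^ of_bool (j \<in> I_set n \<sigma>)) = (\<Prod>j\<in>{..<n} \<inter> I_set n \<sigma>. ?e j)"
          unfolding prod.inter_restrict[OF finite_lessThan] by (intro prod.cong refl) (simp add: One_nat_def)
        then show ?thesis using I_set_subset[of n \<sigma>] by (simp only: Int_absorb1)
      qed
      then have "norm_sign n d \<sigma> (exponents n \<sigma> h) =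
          (-1) ^ card (J_set n d \<sigma>) * ((\<Prod>j<n. ?e j ^ h j) * (\<Prod>i\<in>I_set n \<sigma>. ?e i))"
        by (simp only: norm_sign_exponents power_add prod.distrib)
      then show "?c * (\<Prod>j<n. ?e j ^ h j) = norm_sign n d \<sigma> (exponents n \<sigma> h)"
        by (simp only: mult.assoc mult.commute mult.left_commute)
    qed
    finally show ?thesis .
  qed
  note coeff = this
  have "fps_nth (?F * (\<Sum>\<sigma> | \<sigma> permutes {1..n}.
          fps_const ((-1) ^ card (J_set n d \<sigma>)) * (\<Prod>i\<in>I_set n \<sigma>. fps_const (?e i) * fps_X ^ (n - i)))) m =
      (\<Sum>\<sigma> | \<sigma> permutes {1..n}. \<Sum>h\<in>(if ?s \<sigma> \<le> m then solutions {..<n} ?D (m - ?s \<sigma>) else {}).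
        norm_sign n d \<sigma> (exponents n \<sigma> h))"
    unfolding sum_distrib_left fps_sum_nth by (intro sum.cong refl coeff) simp
  also have "\<dots> = (\<Sum>(\<sigma>, h)\<in>degree_index n m. norm_sign n d \<sigma> (exponents n \<sigma> h))"
    unfolding degree_index_eq
    by (rule sum.Sigma) (auto simp: finite_permutations intro: finite_solutions)
  finally show ?thesis unfolding F .
qed

section \<open>Sorting permutations and multidegrees\<close>

lemma ex_sorting:
  fixes \<alpha> :: "nat \<Rightarrow> nat"
  obtains \<sigma> where "sorts n \<sigma> (\<alpha> \<circ> \<sigma>)"
proof -
  \<comment> \<open>Orders {1..n} lexicographically by (\<alpha> i, i); i is recovered modulo n +
    1.\<close>
  define key where "key = (\<lambda>i. \<alpha> i * (n + 1) + i)"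
  have key_mod: "key i mod (n + 1) = i" if "i \<in> {1..n}" for i
    using that by (simp add: key_def)
  then have inj: "inj_on key {1..n}" by (metis inj_onI)
  have card: "card (key ` {1..n}) = n" by (simp add: card_image inj)
  obtain g where g: "bij_betw g {..<n} (key ` {1..n})" "strict_mono_on {..<n} g"
    using ex_bij_betw_strict_mono_card[of "key ` {1..n}"] unfolding card by auto
  define \<sigma> where "\<sigma> = (\<lambda>k. if k \<in> {1..n} then g (k - 1) mod (n + 1) else k)"
  have key_\<sigma>: "key (\<sigma> k) = g (k - 1)" and \<sigma>_in: "\<sigma> k \<in> {1..n}" if "k \<in> {1..n}" for k
  proof -
    have "k - 1 \<in> {..<n}" using that by auto
    then obtain i where "i \<in> {1..n}" "g (k - 1) = key i"
      using bij_betwE[OF g(1)] by blast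
    then show "key (\<sigma> k) = g (k - 1)" "\<sigma> k \<in> {1..n}" using that key_mod by (auto simp: \<sigma>_def)
  qed
  have mono: "key (\<sigma> k) < key (\<sigma> l)" if "1 \<le> k" "k < l" "l \<le> n" for k l
    using strict_mono_onD[OF g(2), of "k - 1" "l - 1"] that key_\<sigma>[of k] key_\<sigma>[of l] by auto
  have "\<sigma> permutes {1..n}"
  proof (rule bij_imp_permutes)
    have "inj_on \<sigma> {1..n}"
      by (rule inj_onI) (metis atLeastAtMost_iff less_irrefl linorder_neqE_nat mono)
    moreover have "\<sigma> ` {1..n} \<subseteq> {1..n}" using \<sigma>_in by blast
    ultimately show "bij_betw \<sigma> {1..n} {1..n}"
      by (simp add: bij_betw_def endo_inj_surj)
  qed (auto simp: \<sigma>_def)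
  moreover have "\<alpha> (\<sigma> k) < \<alpha> (\<sigma> l) \<or> \<alpha> (\<sigma> k) = \<alpha> (\<sigma> l) \<and> \<sigma> k < \<sigma> l" if "1 \<le> k" "k < l" "l \<le> n" for k l
  proof (rule ccontr)
    assume "\<not> ?thesis"
    then consider "Suc (\<alpha> (\<sigma> l)) \<le> \<alpha> (\<sigma> k)" | "\<alpha> (\<sigma> k) = \<alpha> (\<sigma> l)" "\<sigma> l \<le> \<sigma> k" by linarith
    then show False
    proof cases
      case 1
      then have "Suc (\<alpha> (\<sigma> l)) * (n + 1) \<le> \<alpha> (\<sigma> k) * (n + 1)" by (rule mult_le_mono1)
      then show False using mono[OF that] \<sigma>_in[of l] that by (simp add: key_def)
    next
      case 2
      then show False using mono[OF that] by (simp add: key_def)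
    qed
  qed
  ultimately have "sorts n \<sigma> (\<alpha> \<circ> \<sigma>)" by (auto simp: sorts_def)
  then show ?thesis by (rule that)
qed

lemma sorts_imp_exponents:
  assumes s: "sorts n \<sigma> p"
  obtains h where "h \<in> {..<n} \<rightarrow>\<^sub>E UNIV" "\<And>k. k \<in> {1..n} \<Longrightarrow> exponents n \<sigma> h k = p k"
proof -
  \<comment> \<open>The value 0 at index 0 makes the first increment \<open>h 0\<close> equal to p
    1.\<close>
  define q where "q = (\<lambda>k. if k = 0 then 0 else p k)"
  define h where "h = (\<lambda>j\<in>{..<n}. q (Suc j) - q j - of_bool (j \<in> I_set n \<sigma>))"
  have "exponents n \<sigma> h k = q k" if "k \<le> n" for k
    using that
  proof (induction k)
    case (Suc k)
    have "q k + of_bool (k \<in> I_set n \<sigma>) \<le> q (Suc k)"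
    proof (cases "k = 0")
      case False
      then have "p k < p (Suc k) \<or> p k = p (Suc k) \<and> \<sigma> k < \<sigma> (Suc k)"
        using s Suc.prems by (auto simp: sorts_def)
      then show ?thesis using False by (auto simp: q_def I_set_iff)
    qed (auto simp: q_def I_set_iff)
    then show ?case using Suc by (simp add: exponents_Suc h_def)
  qed (simp add: exponents_def q_def)
  moreover have "h \<in> {..<n} \<rightarrow>\<^sub>E UNIV" by (simp add: h_def)
  ultimately show ?thesis by (intro that[of h]) (auto simp: q_def)
qed

text \<open>The permutation \<tau> comparing the two sortings preserves exponents and, among equal
  exponents, the order of positions. It is thus increasing, hence the identity.\<close>

lemma sorts_unique:
  assumes s: "sorts n \<sigma> p" "sorts n \<sigma>' p'"
    and eq: "\<And>i. i \<in> {1..n} \<Longrightarrow> p (perm_inv \<sigma> i) = p' (perm_inv \<sigma>' i)"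
  shows "\<sigma> = \<sigma>'"
proof -
  have \<sigma>: "\<sigma> permutes {1..n}" and \<sigma>': "\<sigma>' permutes {1..n}" using s by (auto simp: sorts_def)
  define \<tau> where "\<tau> = perm_inv \<sigma>' \<circ> \<sigma>"
  have \<tau>: "\<tau> permutes {1..n}" unfolding \<tau>_def by (intro permutes_compose \<sigma> permutes_inv \<sigma>')
  have \<sigma>'\<tau>: "\<sigma>' (\<tau> k) = \<sigma> k" for k by (simp add: \<tau>_def permutes_inverses[OF \<sigma>'])
  have p: "p' (\<tau> k) = p k" if "k \<in> {1..n}" for k
    using eq[of "\<sigma> k"] that permutes_in_image[OF \<sigma>, of k] by (simp add: \<tau>_def permutes_inverses[OF \<sigma>])
  have "\<tau> = id"
  proof (rule permutes_strict_mono_imp_id[OF \<tau>])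
    fix k l assume kl: "1 \<le> k" "k < l" "l \<le> n"
    have "\<tau> k \<noteq> \<tau> l" using kl \<tau> by (metis permutes_inj injD less_irrefl)
    moreover have "\<not> \<tau> l < \<tau> k"
    proof
      assume less: "\<tau> l < \<tau> k"
      have "\<tau> k \<in> {1..n}" "\<tau> l \<in> {1..n}" using permutes_in_image[OF \<tau>] kl by auto
      then have "p' (\<tau> l) < p' (\<tau> k) \<or> p' (\<tau> l) = p' (\<tau> k) \<and> \<sigma>' (\<tau> l) < \<sigma>' (\<tau> k)"
        using s(2) less unfolding sorts_def by (meson atLeastAtMost_iff)
      moreover have "p' (\<tau> k) = p k" "p' (\<tau> l) = p l" using p kl by auto
      ultimately have "p l < p k \<or> p l = p k \<and> \<sigma> l < \<sigma> k" by (simp only: \<sigma>'\<tau>)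
      moreover have "p k < p l \<or> p k = p l \<and> \<sigma> k < \<sigma> l" using s(1) kl by (auto simp: sorts_def)
      ultimately show False by linarith
    qed
    ultimately show "\<tau> k < \<tau> l" by linarith
  qed
  then have "\<sigma> k = \<sigma>' k" for k using \<sigma>'\<tau>[of k] by simp
  then show ?thesis by (rule ext)
qed

lemma exponents_unique:
  assumes "h \<in> {..<n} \<rightarrow>\<^sub>E UNIV" "h' \<in> {..<n} \<rightarrow>\<^sub>E UNIV"
    and eq: "\<And>k. k \<in> {1..n} \<Longrightarrow> exponents n \<sigma> h k = exponents n \<sigma> h' k"
  shows "h = h'"
proof (rule PiE_ext[OF assms(1,2)])
  fix j assume j: "j \<in> {..<n}"
  have "exponents n \<sigma> h j = exponents n \<sigma> h' j"
    using eq[of j] j by (cases "j = 0") (auto simp: exponents_def)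
  then show "h j = h' j" using eq[of "Suc j"] j by (auto simp: exponents_Suc)
qed

definition multidegrees :: "nat \<Rightarrow> nat \<Rightarrow> (nat \<Rightarrow> nat) set" where
  "multidegrees n m = {\<alpha> \<in> {1..n} \<rightarrow>\<^sub>E UNIV. (\<Sum>i\<in>{1..n}. \<alpha> i) = m}"

text \<open>Sorting assigns to every multidegree a pair from which it can be recovered, so monomials
  are at most as numerous as weight vectors. Equality comes out later, from independence.\<close>

lemma card_multidegrees: "finite (multidegrees n m)" "card (multidegrees n m) \<le> card (degree_index n m)"
proof -
  let ?f = "\<lambda>(\<sigma>, h). \<lambda>i\<in>{1..n}. exponents n \<sigma> h (perm_inv \<sigma> i)"
  have "multidegrees n m \<subseteq> ?f ` degree_index n m"
  proof
    fix \<alpha> assume \<alpha>: "\<alpha> \<in> multidegrees n m"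
    obtain \<sigma> where s: "sorts n \<sigma> (\<alpha> \<circ> \<sigma>)" using ex_sorting[of n \<alpha>] by auto
    then have \<sigma>: "\<sigma> permutes {1..n}" by (simp add: sorts_def)
    obtain h where h: "h \<in> {..<n} \<rightarrow>\<^sub>E UNIV" "\<And>k. k \<in> {1..n} \<Longrightarrow> exponents n \<sigma> h k = \<alpha> (\<sigma> k)"
      using sorts_imp_exponents[OF s] by auto
    have "(\<Sum>k\<in>{1..n}. exponents n \<sigma> h k) = (\<Sum>k\<in>{1..n}. \<alpha> (\<sigma> k))" using h by (intro sum.cong) auto
    also have "\<dots> = m" using sum.permute[OF \<sigma>, of \<alpha>] \<alpha> by (simp add: multidegrees_def comp_def)
    finally have "(\<sigma>, h) \<in> degree_index n m" using h \<sigma> by (simp add: degree_index_def)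
    moreover have "\<alpha> = ?f (\<sigma>, h)"
    proof
      fix i
      show "\<alpha> i = ?f (\<sigma>, h) i"
      proof (cases "i \<in> {1..n}")
        case True
        then have "perm_inv \<sigma> i \<in> {1..n}" using permutes_in_image[OF permutes_inv[OF \<sigma>]] by blast
        then show ?thesis using True by (simp only: split restrict_apply if_True h(2) permutes_inverses(1)[OF \<sigma>])
      next
        case False
        then show ?thesis using \<alpha> by (auto simp: multidegrees_def PiE_iff extensional_def)
      qed
    qed
    ultimately show "\<alpha> \<in> ?f ` degree_index n m" by blast
  qed
  then show "finite (multidegrees n m)" "card (multidegrees n m) \<le> card (degree_index n m)"
    using finite_degree_index[of n m] finite_surj surj_card_le by blast+
qed

section \<open>Orthogonal bases of the graded pieces\<close>

context vector_space
begin

lemma span_image_coeffs: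
  assumes I: "finite I" and x: "x \<in> span (f ` I)"
  obtains a where "x = (\<Sum>i\<in>I. scale (a i) (f i))"
proof -
  have "\<exists>a. x = (\<Sum>i\<in>I. scale (a i) (f i))"
    using x
  proof (induction rule: span_induct)
    show "subspace {x. \<exists>a. x = (\<Sum>i\<in>I. scale (a i) (f i))}"
    proof (rule subspaceI)
      show "0 \<in> {x. \<exists>a. x = (\<Sum>i\<in>I. scale (a i) (f i))}"
        by (auto intro!: exI[of _ "\<lambda>i. 0"])
    next
      fix x y assume "x \<in> {x. \<exists>a. x = (\<Sum>i\<in>I. scale (a i) (f i))}" "y \<in> {x. \<exists>a. x = (\<Sum>i\<in>I. scale (a i) (f i))}"
      then obtain a b where "x = (\<Sum>i\<in>I. scale (a i) (f i))" "y = (\<Sum>i\<in>I. scale (b i) (f i))" by blast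
      then have "x + y = (\<Sum>i\<in>I. scale (a i + b i) (f i))" by (simp add: scale_left_distrib sum.distrib)
      then show "x + y \<in> {x. \<exists>a. x = (\<Sum>i\<in>I. scale (a i) (f i))}" by (intro CollectI exI)
    next
      fix c x assume "x \<in> {x. \<exists>a. x = (\<Sum>i\<in>I. scale (a i) (f i))}"
      then obtain a where "x = (\<Sum>i\<in>I. scale (a i) (f i))" by blast
      then have "scale c x = (\<Sum>i\<in>I. scale (c * a i) (f i))" by (simp add: scale_sum_right)
      then show "scale c x \<in> {x. \<exists>a. x = (\<Sum>i\<in>I. scale (a i) (f i))}" by (intro CollectI exI)
    qed
  next
    fix x assume "x \<in> f ` I"
    then obtain j where j: "j \<in> I" "x = f j" by blast
    have "(\<Sum>i\<in>I. scale (of_bool (i = j)) (f i)) = (\<Sum>i\<in>I. if i = j then f i else 0)"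
      by (intro sum.cong) auto
    then have "x = (\<Sum>i\<in>I. scale (of_bool (i = j)) (f i))" using I j by simp
    then show "\<exists>a. x = (\<Sum>i\<in>I. scale (a i) (f i))" by (intro exI)
  qed
  then show ?thesis using that by blast
qed

lemma independent_family:
  assumes I: "finite I" and zero: "\<And>a. (\<Sum>i\<in>I. scale (a i) (f i)) = 0 \<Longrightarrow> \<forall>i\<in>I. a i = 0"
  shows "inj_on f I" "independent (f ` I)"
proof -
  show inj: "inj_on f I"
  proof (rule inj_onI, rule ccontr)
    fix i j assume ij: "i \<in> I" "j \<in> I" "f i = f j" "i \<noteq> j"
    have "(\<Sum>k\<in>I. scale (of_bool (k = i) - of_bool (k = j)) (f k)) =
        (\<Sum>k\<in>I. if k = i then f k else 0) - (\<Sum>k\<in>I. if k = j then f k else 0)"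
      unfolding sum_subtractf[symmetric] by (intro sum.cong) (auto simp: scale_left_diff_distrib)
    also have "\<dots> = 0" using I ij by simp
    finally show False using zero[of "\<lambda>k. of_bool (k = i) - of_bool (k = j)"] ij by auto
  qed
  show "independent (f ` I)"
  proof (rule independent_if_scalars_zero)
    fix a x assume "(\<Sum>x\<in>f ` I. scale (a x) x) = 0" "x \<in> f ` I"
    then show "a x = 0" using zero[of "\<lambda>i. a (f i)"] by (auto simp: sum.reindex[OF inj])
  qed (use I in simp)
qed

lemma card_eq_of_span_eq:
  assumes "finite A" "finite B" "independent A" "independent B" "span A = span B"
  shows "card A = card B"
  using independent_span_bound[OF assms(2,3)] independent_span_bound[OF assms(1,4)] assms(5) span_superset
  by (metis order_antisym)

end

section \<open>Signature of a Gram matrix via an orthogonal family\<close>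

lemma sum_sgn: "finite K \<Longrightarrow> (\<Sum>k\<in>K. sgn (d k)) = real (card {k\<in>K. d k > 0}) - real (card {k\<in>K. d k < (0::real)})"
proof -
  assume K: "finite K"
  have "(\<Sum>k\<in>K. sgn (d k)) = (\<Sum>k\<in>K. of_bool (d k > 0) - of_bool (d k < 0))"
    by (intro sum.cong) (auto simp: sgn_if)
  then show ?thesis using K by (simp add: sum_subtractf of_bool_def sum.If_cases Collect_conj_eq Int_commute)
qed

context hermitian_space
begin

lemma orthogonal_family_coeffs:
  assumes K: "finite K" "\<And>a. a \<in> K \<Longrightarrow> f a \<in> V"
    and orth: "\<And>a b. a \<in> K \<Longrightarrow> b \<in> K \<Longrightarrow> a \<noteq> b \<Longrightarrow> B (f a) (f b) = 0"
    and nz: "\<And>a. a \<in> K \<Longrightarrow> Re (B (f a) (f a)) \<noteq> 0"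
    and zero: "(\<Sum>a\<in>K. c a *s f a) = 0"
  shows "\<forall>a\<in>K. c a = 0"
proof
  fix b assume b: "b \<in> K"
  have "0 = B (\<Sum>a\<in>K. c a *s f a) (f b)" using zero K(2)[OF b] by simp
  also have "\<dots> = (\<Sum>a\<in>K. c a * B (f a) (f b))"
    using K b by (subst B_sum_left) (auto simp: B_scale_left)
  also have "\<dots> = (\<Sum>a\<in>K. if a = b then c b * B (f b) (f b) else 0)"
    using orth b by (intro sum.cong) auto
  also have "\<dots> = c b * B (f b) (f b)" using K b by simp
  finally show "c b = 0" using nz[OF b] by auto
qed

text \<open>\<open>us\<close> is any basis and \<open>f\<close> an orthogonal one of the same span;
  expanding each in the other supplies the two base changes of
  \<open>signature_congruent_diagonal\<close>.\<close>

lemma signature_gram: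
  fixes us :: "'v list"
  assumes us: "set us \<subseteq> V" "\<And>a. (\<Sum>i<length us. a i *s us ! i) = 0 \<Longrightarrow> \<forall>i<length us. a i = 0"
    and K: "finite K" "\<And>a. a \<in> K \<Longrightarrow> f a \<in> V"
    and orth: "\<And>a b. a \<in> K \<Longrightarrow> b \<in> K \<Longrightarrow> a \<noteq> b \<Longrightarrow> B (f a) (f b) = 0"
    and nz: "\<And>a. a \<in> K \<Longrightarrow> Re (B (f a) (f a)) \<noteq> 0"
    and sp: "span (set us) = span (f ` K)"
  shows "real_of_int (signature (mat (length us) (length us) (\<lambda>(i, j). B (us ! i) (us ! j)))) =
    (\<Sum>a\<in>K. sgn (Re (B (f a) (f a))))"
proof -
  define N where "N = length us"
  have us_image: "(!) us ` {..<N} = set us" by (auto simp: N_def in_set_conv_nth)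
  have "\<forall>a\<in>K. c a = 0" if "(\<Sum>a\<in>K. c a *s f a) = 0" for c
    by (rule orthogonal_family_coeffs[OF K orth nz that])
  note fi = independent_family[where f = f, OF K(1) this]
  have "\<forall>i\<in>{..<N}. a i = 0" if "(\<Sum>i\<in>{..<N}. a i *s us ! i) = 0" for a
    using us(2) that by (simp add: N_def)
  note ui = independent_family[where f = "(!) us", OF finite_lessThan this, unfolded us_image]
  have "card (set us) = N" using card_image[OF ui(1)] us_image by simp
  moreover have "card (set us) = card (f ` K)"
    using ui(2) fi(2) K sp by (intro card_eq_of_span_eq) auto
  ultimately have "card K = N" using card_image[OF fi(1)] by simp
  then obtain e where e: "bij_betw e {..<N} K"
    using ex_bij_betw_nat_finite[OF K(1)] by (auto simp: atLeast0LessThan)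
  have eK: "e k \<in> K" if "k < N" for k using bij_betwE[OF e] that by auto
  have e_image: "(\<lambda>k. f (e k)) ` {..<N} = f ` K"
    using bij_betw_imp_surj_on[OF e] by (metis image_image)
  have usV: "us ! i \<in> V" if "i < N" for i using us(1) that by (auto simp: N_def)
  have "\<exists>a. us ! i = (\<Sum>k<N. a k *s f (e k))" if "i < N" for i
  proof -
    have "us ! i \<in> span ((\<lambda>k. f (e k)) ` {..<N})"
      unfolding e_image using that sp span_base[of "us ! i" "set us"] by (simp add: N_def)
    then show ?thesis by (rule span_image_coeffs[rotated]) auto
  qed
  then obtain M where M: "\<And>i. i < N \<Longrightarrow> us ! i = (\<Sum>k<N. M i k *s f (e k))" by metis
  have "\<exists>a. f (e i) = (\<Sum>k<N. a k *s us ! k)" if "i < N" for i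
  proof -
    have "f (e i) \<in> span ((!) us ` {..<N})"
      using eK[OF that] sp span_base[of "f (e i)" "f ` K"] by (auto simp: us_image)
    then show ?thesis by (rule span_image_coeffs[rotated]) auto
  qed
  then obtain M' where M': "\<And>i. i < N \<Longrightarrow> f (e i) = (\<Sum>k<N. M' i k *s us ! k)" by metis
  define d where "d = (\<lambda>k. Re (B (f (e k)) (f (e k))))"
  have Bee: "B (f (e i)) (f (e j)) = (if i = j then complex_of_real (d i) else 0)" if "i < N" "j < N" for i j
  proof (cases "i = j")
    case True
    then show ?thesis using B_real[OF K(2)[OF eK[OF that(1)]]] by (simp add: d_def)
  next
    case False
    then have "e i \<noteq> e j" using e that by (auto simp: bij_betw_def inj_on_def)
    then show ?thesis using orth[OF eK[OF that(1)] eK[OF that(2)]] False by simp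
  qed
  have double: "B (\<Sum>k<N. a k *s g k) (\<Sum>l<N. b l *s g l) = (\<Sum>k<N. \<Sum>l<N. a k * B (g k) (g l) * cnj (b l))"
    if g: "\<And>k. k < N \<Longrightarrow> g k \<in> V" for a b g
  proof -
    have "B (\<Sum>k<N. a k *s g k) (\<Sum>l<N. b l *s g l) = (\<Sum>k<N. \<Sum>l<N. B (a k *s g k) (b l *s g l))"
      using g by (subst B_sum_left, force, force) (intro sum.cong refl B_sum_right; force)
    also have "\<dots> = (\<Sum>k<N. \<Sum>l<N. a k * B (g k) (g l) * cnj (b l))"
      using g by (intro sum.cong refl) (simp add: B_scale_left B_scale_right)
    finally show ?thesis .
  qed
  let ?A = "mat N N (\<lambda>(i, j). B (us ! i) (us ! j))"
  have "signature ?A = int (card {k. k < N \<and> d k > 0}) - int (card {k. k < N \<and> d k < 0})"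
  proof (rule signature_congruent_diagonal)
    fix i j assume ij: "i < N" "j < N"
    have "B (us ! i) (us ! j) = (\<Sum>k<N. \<Sum>l<N. M i k * B (f (e k)) (f (e l)) * cnj (M j l))"
      unfolding M[OF ij(1)] M[OF ij(2)] by (rule double) (use eK K in blast)
    also have "\<dots> = (\<Sum>k<N. \<Sum>l<N. if k = l then M i k * complex_of_real (d k) * cnj (M j k) else 0)"
      by (intro sum.cong refl) (simp add: Bee)
    finally show "?A $$ (i, j) = (\<Sum>k<N. M i k * complex_of_real (d k) * cnj (M j k))"
      using ij by simp
    have "(\<Sum>k<N. \<Sum>l<N. M' i k * ?A $$ (k, l) * cnj (M' j l)) = B (f (e i)) (f (e j))"
      unfolding M'[OF ij(1)] M'[OF ij(2)] using usV by (subst double) (auto intro!: sum.cong)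
    then show "(\<Sum>k<N. \<Sum>l<N. M' i k * ?A $$ (k, l) * cnj (M' j l)) = (if i = j then complex_of_real (d i) else 0)"
      using Bee ij by simp
  qed simp
  then have "real_of_int (signature ?A) = (\<Sum>k<N. sgn (d k))"
    by (simp add: sum_sgn)
  also have "\<dots> = (\<Sum>a\<in>K. sgn (Re (B (f a) (f a))))"
    unfolding d_def by (rule sum.reindex_bij_betw[OF e])
  finally show ?thesis by (simp add: N_def)
qed

end

text \<open>Two exponents, both at most m, cannot differ by a nonzero integer multiple of \<kappa> >
  m. So a weight determines exponents and contents at each position, and sorting then recovers
  \<sigma> and h.\<close>

lemma weight_index_unique:
  fixes d d' :: "nat \<Rightarrow> int" and \<kappa> :: real
  assumes a: "(\<sigma>, h) \<in> degree_index n m" "(\<sigma>', h') \<in> degree_index n m" and \<kappa>: "real m < \<kappa>"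
    and eq: "\<And>i. i \<in> {1..n} \<Longrightarrow> exponents n \<sigma> h (perm_inv \<sigma> i) + \<kappa> * d (perm_inv \<sigma> i) =
      exponents n \<sigma>' h' (perm_inv \<sigma>' i) + \<kappa> * d' (perm_inv \<sigma>' i)"
  shows "\<sigma> = \<sigma>' \<and> h = h' \<and> (\<forall>i\<in>{1..n}. d i = d' i)"
proof -
  have \<sigma>: "\<sigma> permutes {1..n}" "\<sigma>' permutes {1..n}" and h: "h \<in> {..<n} \<rightarrow>\<^sub>E UNIV" "h' \<in> {..<n} \<rightarrow>\<^sub>E UNIV"
    using a by (auto simp: degree_index_def)
  have le: "exponents n \<sigma> h k \<le> m" if "(\<sigma>, h) \<in> degree_index n m" "k \<in> {1..n}" for k \<sigma> h
    using that member_le_sum[of k "{1..n}" "exponents n \<sigma> h"] by (auto simp: degree_index_def)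
  have small: "e = 0 \<and> b = 0" if "real_of_int e + \<kappa> * real_of_int b = 0" "\<bar>e\<bar> \<le> int m" for e b
  proof -
    have "b = 0"
    proof (rule ccontr)
      assume "b \<noteq> 0"
      then have "1 \<le> \<bar>real_of_int b\<bar>" by linarith
      then have "\<kappa> \<le> \<kappa> * \<bar>real_of_int b\<bar>" using \<kappa> by (simp add: mult_le_cancel_left1)
      also have "\<dots> = \<bar>\<kappa> * real_of_int b\<bar>" using \<kappa> by (simp only: abs_mult)
      also have "\<kappa> * real_of_int b = - real_of_int e" using that(1) by linarith
      finally show False using that(2) \<kappa> by linarith
    qed
    then show ?thesis using that by simp
  qed
  have both: "exponents n \<sigma> h (perm_inv \<sigma> i) = exponents n \<sigma>' h' (perm_inv \<sigma>' i) \<and>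
      d (perm_inv \<sigma> i) = d' (perm_inv \<sigma>' i)" if i: "i \<in> {1..n}" for i
  proof -
    have "perm_inv \<sigma> i \<in> {1..n}" "perm_inv \<sigma>' i \<in> {1..n}"
      using i by (simp_all only: permutes_in_image[OF permutes_inv[OF \<sigma>(1)]] permutes_in_image[OF permutes_inv[OF \<sigma>(2)]])
    then have "exponents n \<sigma> h (perm_inv \<sigma> i) \<le> m" "exponents n \<sigma>' h' (perm_inv \<sigma>' i) \<le> m"
      using le a by blast+
    then show ?thesis
      using small[of "int (exponents n \<sigma> h (perm_inv \<sigma> i)) - int (exponents n \<sigma>' h' (perm_inv \<sigma>' i))"
          "d (perm_inv \<sigma> i) - d' (perm_inv \<sigma>' i)"] eq[OF i] by (simp add: algebra_simps)
  qed
  have s: "\<sigma> = \<sigma>'"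
    using both by (intro sorts_unique[OF sorts_exponents[OF \<sigma>(1), of h] sorts_exponents[OF \<sigma>(2), of h']]) blast
  have "exponents n \<sigma> h k = exponents n \<sigma> h' k \<and> d k = d' k" if k: "k \<in> {1..n}" for k
  proof -
    have "\<sigma> k \<in> {1..n}" using permutes_in_image[OF \<sigma>(1)] k by blast
    from both[OF this] show ?thesis
      unfolding s[symmetric] permutes_inverses(2)[OF \<sigma>(1)] .
  qed
  then show ?thesis using s exponents_unique[OF h] by blast
qed

section \<open>Orthogonal weight bases of the graded pieces\<close>

context cherednik_rep
begin

lemma monomial_linear: "set w \<subseteq> {1..n} \<Longrightarrow> monomial w (u + v) = monomial w u + monomial w v"
    "set w \<subseteq> {1..n} \<Longrightarrow> monomial w (a *s v) = a *s monomial w v"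
  by (induction w) (simp_all add: x_add x_scale)

lemma monomial_remove1:
  "i \<in> set w \<Longrightarrow> set w \<subseteq> {1..n} \<Longrightarrow> v \<in> V \<Longrightarrow> monomial w v = x i (monomial (remove1 i w) v)"
proof (induction w)
  case (Cons j w)
  show ?case
  proof (cases "i = j")
    case False
    have "set (remove1 i w) \<subseteq> {1..n}" using Cons.prems(2) set_remove1_subset[of i w] by auto
    then have "x j (x i (monomial (remove1 i w) v)) = x i (x j (monomial (remove1 i w) v))"
      using Cons.prems by (intro x_comm monomial_V) auto
    then show ?thesis using Cons False by auto
  qed simp
qed simp

lemma monomial_perm:
  "mset w = mset w' \<Longrightarrow> set w \<subseteq> {1..n} \<Longrightarrow> v \<in> V \<Longrightarrow> monomial w v = monomial w' v"
proof (induction w arbitrary: w')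
  case (Cons i w)
  have i: "i \<in> set w'" using Cons.prems(1) by (metis list.set_intros(1) set_mset_mset)
  have "mset w = mset (remove1 i w')" using Cons.prems(1)[symmetric] by simp
  then have "monomial w v = monomial (remove1 i w') v" using Cons by auto
  moreover have "set w' \<subseteq> {1..n}" using Cons.prems(1,2) by (metis set_mset_mset)
  ultimately show ?case using monomial_remove1[OF i _ Cons.prems(3)] by simp
qed simp

text \<open>As the x_i commute, a monomial depends on its multidegree only, so one representative
  word per multidegree is enough. This is the upper bound for the dimension.\<close>

lemma degree_space_spanning_set:
  assumes I: "finite I" and v: "\<And>T. T \<in> I \<Longrightarrow> v T \<in> L" and sp: "L \<subseteq> span (v ` I)"
  obtains S where "finite S" "card S \<le> card (degree_index n m) * card I" "degree_space m \<subseteq> span S"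
proof -
  define rep where "rep = (\<lambda>\<alpha>. SOME w. set w \<subseteq> {1..n} \<and> (\<forall>i\<in>{1..n}. count_list w i = \<alpha> i))"
  define S where "S = (\<lambda>(\<alpha>, T). monomial (rep \<alpha>) (v T)) ` (multidegrees n m \<times> I)"
  have "card S \<le> card (multidegrees n m) * card I"
    unfolding S_def using card_multidegrees(1) I by (metis card_cartesian_product card_image_le finite_cartesian_product)
  also have "\<dots> \<le> card (degree_index n m) * card I" using card_multidegrees(2) by simp
  finally have card: "card S \<le> card (degree_index n m) * card I" .
  have base: "monomial w (v T) \<in> S" if w: "length w = m" "set w \<subseteq> {1..n}" and T: "T \<in> I" for w T
  proof -
    define \<alpha> where "\<alpha> = restrict (count_list w) {1..n}"
    have "sum \<alpha> {1..n} = m"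
      using sum_count_set[OF w(2)] w(1) by (simp add: \<alpha>_def)
    then have \<alpha>: "\<alpha> \<in> multidegrees n m" by (simp add: multidegrees_def \<alpha>_def)
    have "set (rep \<alpha>) \<subseteq> {1..n} \<and> (\<forall>i\<in>{1..n}. count_list (rep \<alpha>) i = \<alpha> i)"
      unfolding rep_def by (rule someI[of _ w]) (use w in \<open>simp add: \<alpha>_def\<close>)
    note \<alpha>_rep = this
    have "count_list w i = count_list (rep \<alpha>) i" for i
    proof (cases "i \<in> {1..n}")
      case False
      then have "i \<notin> set w" "i \<notin> set (rep \<alpha>)" using w(2) \<alpha>_rep by blast+
      then show ?thesis by simp
    qed (use \<alpha>_rep in \<open>simp add: \<alpha>_def\<close>)
    then have "mset w = mset (rep \<alpha>)" by (intro multiset_eqI) (simp add: count_mset)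
    then have "monomial w (v T) = monomial (rep \<alpha>) (v T)"
      using w(2) v[OF T] L_V by (intro monomial_perm) blast+
    then show ?thesis using \<alpha> T unfolding S_def by (intro rev_image_eqI[of "(\<alpha>, T)"]) simp_all
  qed
  have "monomial w l \<in> span S" if w: "length w = m" "set w \<subseteq> {1..n}" and l: "l \<in> L" for w l
  proof -
    have "l \<in> span (v ` I)" using l sp by auto
    then show ?thesis
    proof (induction rule: span_induct)
      show "subspace {l. monomial w l \<in> span S}"
        using monomial_linear(2)[OF w(2), of 0 0]
        by (intro subspaceI) (auto simp: monomial_linear[OF w(2)] span_zero span_add span_scale)
      show "monomial w l \<in> span S" if "l \<in> v ` I" for l
        using that base[OF w] by (auto intro: span_base)
    qed
  qed
  then have "degree_space m \<subseteq> span S"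
    unfolding degree_space_def by (intro span_minimal subspace_span) auto
  moreover have "finite S"
    unfolding S_def using card_multidegrees(1) I by (intro finite_imageI finite_cartesian_product)
  ultimately show ?thesis using card by (intro that)
qed

lemma ex_orthogonal_basis:
  fixes d :: "'t \<Rightarrow> nat \<Rightarrow> int"
  assumes I: "finite I" and v: "\<And>T. T \<in> I \<Longrightarrow> v T \<in> L" and sp: "L \<subseteq> span (v ` I)"
    and wt: "\<And>T. T \<in> I \<Longrightarrow> weight n dunkl_opdam (\<lambda>k. \<kappa> * d T k) (v T)"
    and pos: "\<And>T. T \<in> I \<Longrightarrow> 0 < Re (B (v T) (v T))"
    and inj: "\<And>T T'. T \<in> I \<Longrightarrow> T' \<in> I \<Longrightarrow> (\<And>k. k \<in> {1..n} \<Longrightarrow> d T k = d T' k) \<Longrightarrow> T = T'"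
    and \<kappa>: "real m < \<kappa>"
  obtains f where "\<And>a. a \<in> degree_index n m \<times> I \<Longrightarrow> f a \<in> V"
    "\<And>a b. a \<in> degree_index n m \<times> I \<Longrightarrow> b \<in> degree_index n m \<times> I \<Longrightarrow> a \<noteq> b \<Longrightarrow> B (f a) (f b) = 0"
    "\<And>\<sigma> h T. (\<sigma>, h) \<in> degree_index n m \<Longrightarrow> T \<in> I \<Longrightarrow>
      0 < norm_sign n (d T) \<sigma> (exponents n \<sigma> h) * Re (B (f ((\<sigma>, h), T)) (f ((\<sigma>, h), T)))"
    "span (f ` (degree_index n m \<times> I)) = degree_space m"
proof -
  let ?K = "degree_index n m \<times> I"
  let ?wt = "\<lambda>\<sigma> h T i. exponents n \<sigma> h (perm_inv \<sigma> i) + \<kappa> * d T (perm_inv \<sigma> i)"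
  define good where "good \<sigma> h T f \<longleftrightarrow> f \<in> degree_space m \<and> weight n dunkl_opdam (?wt \<sigma> h T) f \<and>
      0 < norm_sign n (d T) \<sigma> (exponents n \<sigma> h) * Re (B f f)" for \<sigma> h T f
  have ex: "\<exists>f. good \<sigma> h T f"
    if "(\<sigma>, h) \<in> degree_index n m" "T \<in> I" for \<sigma> h T
  proof -
    have \<sigma>: "\<sigma> permutes {1..n}" and sum: "(\<Sum>k\<in>{1..n}. exponents n \<sigma> h k) = m"
      using that(1) by (auto simp: degree_index_def)
    have "real (\<Sum>k\<in>{1..n}. exponents n \<sigma> h k) < \<kappa>" unfolding sum by (rule \<kappa>)
    from ex_weight_vector[OF v[OF that(2)] wt[OF that(2)] pos[OF that(2)] sorts_exponents[OF \<sigma>] this]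
    show ?thesis unfolding sum good_def by blast
  qed
  define f where "f = (\<lambda>((\<sigma>, h), T). SOME f. good \<sigma> h T f)"
  have g: "good \<sigma> h T (f ((\<sigma>, h), T))" if "(\<sigma>, h) \<in> degree_index n m" "T \<in> I" for \<sigma> h T
    unfolding f_def prod.case by (rule someI_ex) (rule ex[OF that])
  have fD: "f a \<in> degree_space m" if "a \<in> ?K" for a
    using that g by (auto simp: good_def)
  then have fV: "f a \<in> V" if "a \<in> ?K" for a using that degree_space_V by blast
  have orth: "B (f a) (f b) = 0" if ab: "a \<in> ?K" "b \<in> ?K" "a \<noteq> b" for a b
  proof -
    obtain \<sigma> h T \<sigma>' h' T' where a: "a = ((\<sigma>, h), T)" and b: "b = ((\<sigma>', h'), T')" by (metis prod.exhaust)
    have K: "(\<sigma>, h) \<in> degree_index n m" "T \<in> I" "(\<sigma>', h') \<in> degree_index n m" "T' \<in> I"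
      using ab a b by auto
    have "\<exists>i\<in>{1..n}. ?wt \<sigma> h T i \<noteq> ?wt \<sigma>' h' T' i"
    proof (rule ccontr)
      assume "\<not> ?thesis"
      then have "\<sigma> = \<sigma>' \<and> h = h' \<and> (\<forall>i\<in>{1..n}. d T i = d T' i)"
        by (intro weight_index_unique[OF K(1,3) \<kappa>]) blast
      then show False using inj[OF K(2,4)] ab(3) a b by blast
    qed
    then obtain i where i: "i \<in> {1..n}" "?wt \<sigma> h T i \<noteq> ?wt \<sigma>' h' T' i" by blast
    show ?thesis
      unfolding a b
    proof (rule dunkl.orthogonal[where a = "?wt \<sigma> h T" and b = "?wt \<sigma>' h' T'" and k = i])
      show "weight n dunkl_opdam (?wt \<sigma> h T) (f ((\<sigma>, h), T))"
        "weight n dunkl_opdam (?wt \<sigma>' h' T') (f ((\<sigma>', h'), T'))"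
        using g[OF K(1,2)] g[OF K(3,4)] unfolding good_def by blast+
    qed (rule i)+
  qed
  have nz: "Re (B (f a) (f a)) \<noteq> 0" if "a \<in> ?K" for a
  proof -
    obtain \<sigma> h T where a: "a = ((\<sigma>, h), T)" by (metis prod.exhaust)
    then have "(\<sigma>, h) \<in> degree_index n m" "T \<in> I" using that by auto
    from g[OF this] have "0 < norm_sign n (d T) \<sigma> (exponents n \<sigma> h) * Re (B (f a) (f a))"
      unfolding good_def a by blast
    then show ?thesis by auto
  qed
  have K: "finite ?K" using finite_degree_index I by simp
  have "\<forall>a\<in>?K. c a = 0" if "(\<Sum>a\<in>?K. c a *s f a) = 0" for c
    by (rule orthogonal_family_coeffs[OF K fV orth nz that])
  note fi = independent_family[where f = f, OF K this]
  obtain S where S: "finite S" "card S \<le> card (degree_index n m) * card I" "degree_space m \<subseteq> span S"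
    using degree_space_spanning_set[OF I v sp] by blast
  have sub: "f ` ?K \<subseteq> degree_space m" using fD by blast
  \<comment> \<open>A vector outside the span would give more independent vectors than the spanning
    set S has elements.\<close>
  have "degree_space m \<subseteq> span (f ` ?K)"
  proof (rule subsetI, rule ccontr)
    fix u assume u: "u \<in> degree_space m" "u \<notin> span (f ` ?K)"
    then have "independent (insert u (f ` ?K))" using fi(2) by (simp add: independent_insertI)
    moreover have "insert u (f ` ?K) \<subseteq> span S" using u sub S(3) by blast
    ultimately have "card (insert u (f ` ?K)) \<le> card S"
      using independent_span_bound[OF S(1)] by blast
    moreover have "u \<notin> f ` ?K" by (rule notI) (use u(2) span_base[of u "f ` ?K"] in simp)
    ultimately show False
      using S(2) K card_image[OF fi(1)] by (simp add: card_cartesian_product)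
  qed
  moreover have "span (f ` ?K) \<subseteq> degree_space m"
    using sub unfolding degree_space_def by (intro span_minimal subspace_span)
  ultimately have span: "span (f ` ?K) = degree_space m" by blast
  show ?thesis
  proof (rule that)
    show "f a \<in> V" if "a \<in> ?K" for a using fV that .
    show "B (f a) (f b) = 0" if "a \<in> ?K" "b \<in> ?K" "a \<noteq> b" for a b using orth that .
    show "0 < norm_sign n (d T) \<sigma> (exponents n \<sigma> h) * Re (B (f ((\<sigma>, h), T)) (f ((\<sigma>, h), T)))"
      if "(\<sigma>, h) \<in> degree_index n m" "T \<in> I" for \<sigma> h T using g[OF that] unfolding good_def by blast
    show "span (f ` ?K) = degree_space m" by (rule span)
  qed
qed

end

section \<open>The group algebra and standard tableaux\<close>

abbreviation coord :: "('a \<Rightarrow>\<^sub>0 'b::zero) \<Rightarrow> 'a \<Rightarrow> 'b" where "coord \<equiv> Poly_Mapping.lookup"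
abbreviation pure :: "'a \<Rightarrow> 'b \<Rightarrow> 'a \<Rightarrow>\<^sub>0 'b::zero" where "pure \<equiv> Poly_Mapping.single"
abbreviation support :: "('a \<Rightarrow>\<^sub>0 'b::zero) \<Rightarrow> 'a set" where "support \<equiv> Poly_Mapping.keys"

text \<open>All operators on group algebra elements and on words are additive extensions from single
  terms, which reduces their identities to one key at a time.\<close>

definition lin_ext :: "('a \<Rightarrow> 'b \<Rightarrow> 'c) \<Rightarrow> ('a \<Rightarrow>\<^sub>0 'b::zero) \<Rightarrow> 'c::comm_monoid_add" where
  "lin_ext f u = (\<Sum>w\<in>support u. f w (coord u w))"

lemma lin_ext_superset:
  assumes "finite S" "support u \<subseteq> S" "\<And>w. f w 0 = 0"
  shows "lin_ext f u = (\<Sum>w\<in>S. f w (coord u w))"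
  unfolding lin_ext_def
  by (rule sum.mono_neutral_left) (use assms in \<open>auto simp: in_keys_iff\<close>)

lemma lin_ext_single: "f w 0 = 0 \<Longrightarrow> lin_ext f (pure w a) = f w a"
  by (simp add: lin_ext_def)

lemma lin_ext_zero [simp]: "lin_ext f 0 = 0"
  by (simp add: lin_ext_def)

lemma lin_ext_add:
  fixes f :: "'a \<Rightarrow> 'b::monoid_add \<Rightarrow> 'c::ab_group_add"
  assumes add: "\<And>w a b. f w (a + b) = f w a + f w b"
  shows "lin_ext f (u + v) = lin_ext f u + lin_ext f v"
proof -
  have 0: "f w 0 = 0" for w using add[of w 0 0] by simp
  let ?S = "support u \<union> support v"
  have "support (u + v) \<subseteq> ?S" by (rule Poly_Mapping.keys_add)
  then show ?thesis
    by (simp add: lin_ext_superset[of ?S] 0 lookup_add add sum.distrib)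
qed

lemma poly_mapping_decompose: "u = (\<Sum>w\<in>support u. pure w (coord u w))"
  by (rule poly_mapping_eqI) (auto simp: lookup_sum lookup_single when_def in_keys_iff)

lemma poly_mapping_additive_induct [case_names zero add single]:
  assumes "P 0" "\<And>u v. P u \<Longrightarrow> P v \<Longrightarrow> P (u + v)" "\<And>w a. P (pure w a)"
  shows "P (u :: 'a \<Rightarrow>\<^sub>0 'b::comm_monoid_add)"
proof -
  have "P (\<Sum>w\<in>S. pure w (coord u w))" if "finite S" for S
    using that by induction (auto intro: assms)
  then show ?thesis using poly_mapping_decompose[of u] by (metis finite_keys)
qed

definition gscale :: "complex \<Rightarrow> galg \<Rightarrow> galg" where
  "gscale a v = Poly_Mapping.map ((*) a) v"

lemma coord_gscale [simp]: "coord (gscale a v) p = a * coord v p"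
  by (simp add: gscale_def Poly_Mapping.map.rep_eq when_def)

lemma gscale_pure [simp]: "gscale a (pure p b) = pure p (a * b)"
  by (rule poly_mapping_eqI) (simp add: lookup_single when_def)

lemma gscale_vector_space: "vector_space gscale"
  by unfold_locales (auto intro!: poly_mapping_eqI simp: lookup_add algebra_simps)

interpretation G: vector_space gscale by (rule gscale_vector_space)

abbreviation gact :: "(nat \<Rightarrow> nat) \<Rightarrow> galg \<Rightarrow> galg" where
  "gact p \<equiv> gmult (pure p 1)"

lemma gact_eq: "gact p v = (\<Sum>q\<in>support v. pure (p \<circ> q) (coord v q))"
  by (simp add: gmult_def)

lemma coord_gact: "bij p \<Longrightarrow> coord (gact p v) q = coord v (perm_inv p \<circ> q)"
proof -
  assume p: "bij p"
  have "p \<circ> r = q \<longleftrightarrow> r = perm_inv p \<circ> q" for r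
    using bij_inv_eq_iff[OF p] unfolding fun_eq_iff comp_def by metis
  then have "coord (gact p v) q = (\<Sum>r\<in>support v. coord v r when r = perm_inv p \<circ> q)"
    by (simp add: gact_eq lookup_sum lookup_single)
  then show ?thesis by (simp add: when_def in_keys_iff)
qed

lemma gact_pure: "gact p (pure q a) = pure (p \<circ> q) a"
  by (cases "a = 0") (simp_all add: gact_eq)

lemma gact_lin_ext: "gact p v = lin_ext (\<lambda>q a. pure (p \<circ> q) a) v"
  by (simp add: gact_eq lin_ext_def)

lemma gact_add: "gact p (u + v) = gact p u + gact p v"
  unfolding gact_lin_ext by (rule lin_ext_add) (rule single_add)

lemma gact_zero [simp]: "gact p 0 = 0"
  by (simp add: gact_lin_ext)

lemma gact_gscale: "gact p (gscale a v) = gscale a (gact p v)"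
proof (induction v rule: poly_mapping_additive_induct)
  case (single q b)
  show ?case by (simp add: gact_pure)
qed (simp_all add: G.scale_right_distrib gact_add)

lemma gact_id [simp]: "gact id v = v"
  by (rule poly_mapping_eqI) (simp add: coord_gact del: id_apply)

lemma gact_gact: "bij p \<Longrightarrow> bij q \<Longrightarrow> gact p (gact q v) = gact (p \<circ> q) v"
  by (rule poly_mapping_eqI) (simp add: coord_gact bij_comp o_inv_distrib comp_assoc)

lemma gmult_eq: "gmult a v = (\<Sum>p\<in>support a. gscale (coord a p) (gact p v))"
  by (simp add: gmult_def gact_eq G.scale_sum_right)

text \<open>Positive definite and invariant under left multiplication: it turns vanishing norm
  factors into vanishing vectors and provides the contravariant form in degree 0.\<close>

definition gprod :: "galg \<Rightarrow> galg \<Rightarrow> complex" where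
  "gprod a b = (\<Sum>p\<in>support a. coord a p * cnj (coord b p))"

lemma gprod_superset: "finite S \<Longrightarrow> support a \<subseteq> S \<Longrightarrow> gprod a b = (\<Sum>p\<in>S. coord a p * cnj (coord b p))"
  unfolding gprod_def by (rule sum.mono_neutral_left) (auto simp: in_keys_iff)

lemma gprod_self: "gprod v v = complex_of_real (\<Sum>p\<in>support v. (cmod (coord v p))\<^sup>2)"
  unfolding gprod_def of_real_sum complex_norm_square ..

lemma gprod_pos: "v \<noteq> 0 \<Longrightarrow> 0 < Re (gprod v v)"
proof -
  assume "v \<noteq> 0"
  then have "support v \<noteq> {}" by simp
  then show ?thesis unfolding gprod_self by (auto intro!: sum_pos simp: in_keys_iff)
qed

lemma gprod_gact:
  assumes p: "bij p"
  shows "gprod (gact p a) (gact p b) = gprod a b"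
proof -
  have "p \<circ> (perm_inv p \<circ> q) = q" "perm_inv p \<circ> (p \<circ> q) = q" for q :: "nat \<Rightarrow> nat"
    using p by (auto simp: fun_eq_iff bij_is_inj bij_is_surj surj_f_inv_f)
  then show ?thesis
    unfolding gprod_def
    by (intro sum.reindex_bij_witness[of _ "\<lambda>q. p \<circ> q" "\<lambda>q. perm_inv p \<circ> q"]) (auto simp: in_keys_iff coord_gact p)
qed

lemma symmetric_group_rep_galg: "symmetric_group_rep gscale UNIV gprod n gact"
proof
  show "gprod (u + v) w = gprod u w + gprod v w" for u v w
  proof -
    let ?S = "support u \<union> support v"
    have "support (u + v) \<subseteq> ?S" by (rule Poly_Mapping.keys_add)
    then show ?thesis
      by (simp add: gprod_superset[of ?S] lookup_add distrib_right sum.distrib)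
  qed
  show "gprod (gscale a u) v = a * gprod u v" for a u v
  proof -
    have "support (gscale a u) \<subseteq> support u" by (auto simp: in_keys_iff)
    then show ?thesis
      by (simp add: gprod_superset[of "support u"] sum_distrib_left mult.assoc)
  qed
  show "gprod v u = cnj (gprod u v)" for u v
    by (simp add: gprod_superset[of "support u \<union> support v"] mult.commute)
  fix p assume "p permutes {1..n}"
  then have p: "bij p" by (rule permutes_bij)
  show "gact p (v + w) = gact p v + gact p w" for v w by (rule gact_add)
  show "gact p (gscale a v) = gscale a (gact p v)" for a v by (rule gact_gscale)
  show "gprod (gact p v) (gact p w) = gprod v w" for v w by (rule gprod_gact[OF p])
  show "gact p (gact q v) = gact (p \<circ> q) v" if "q permutes {1..n}" for q v
    using that by (intro gact_gact p permutes_bij)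
qed (simp_all add: G.subspace_UNIV)

section \<open>Standard tableaux and exchanges of consecutive entries\<close>

lemma boxes_iff [simp]: "(r, c) \<in> boxes lam \<longleftrightarrow> r < length lam \<and> c < lam ! r"
  by (simp add: boxes_def)

lemma boxes_Sigma: "boxes lam = (SIGMA r:{..<length lam}. {..<lam ! r})"
  by (auto simp: boxes_def)

lemma finite_boxes [simp]: "finite (boxes lam)"
  by (simp add: boxes_Sigma)

lemma card_boxes: "card (boxes lam) = sum_list lam"
  by (simp add: boxes_Sigma sum_list_sum_nth atLeast0LessThan)

locale partition =
  fixes lam :: "nat list" and n :: nat
  assumes is_part: "is_partition lam n"
begin

lemma sum_lam: "sum_list lam = n"
  using is_part by (simp add: is_partition_def)

lemma boxes_down:
  assumes "(r, c) \<in> boxes lam" "r' \<le> r" "c' \<le> c"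
  shows "(r', c') \<in> boxes lam"
proof -
  have "lam ! r \<le> lam ! r'"
    using is_part assms unfolding is_partition_def by (cases "r' = r") (auto simp: sorted_wrt_iff_nth_less)
  then show ?thesis using assms by auto
qed

abbreviation rt :: "nat \<times> nat \<Rightarrow> nat" where "rt \<equiv> row_tableau lam"

lemma rt_Suc: "rt (r, Suc c) = Suc (rt (r, c))"
  by (simp add: row_tableau_def)

lemma rt_less:
  assumes "(r, c) \<in> boxes lam" "r < r'"
  shows "rt (r, c) < rt (r', c')"
proof -
  have "sum_list (take (Suc r) lam) = sum_list (take r lam) + lam ! r"
    using assms by (simp add: take_Suc_conv_app_nth)
  moreover have "sum_list (take r' lam) = sum_list (take (Suc r) lam) + sum_list (drop (Suc r) (take r' lam))"
  proof -
    have "take (Suc r) (take r' lam) = take (Suc r) lam" using assms(2) by (simp add: min_def)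
    then show ?thesis by (metis append_take_drop_id sum_list_append)
  qed
  ultimately show ?thesis using assms by (simp add: row_tableau_def)
qed

lemma rt_bij: "bij_betw rt (boxes lam) {1..n}"
proof -
  have inj: "inj_on rt (boxes lam)"
  proof (rule inj_onI)
    fix a b assume ab: "a \<in> boxes lam" "b \<in> boxes lam" "rt a = rt b"
    obtain r c r' c' where rc: "a = (r, c)" "b = (r', c')" by fastforce
    have "r = r'" using rt_less[of r c r' c'] rt_less[of r' c' r c] ab unfolding rc by (metis less_irrefl linorder_neqE_nat)
    then show "a = b" using ab rc by (simp add: row_tableau_def)
  qed
  moreover have "rt ` boxes lam \<subseteq> {1..n}"
  proof -
    have "rt (r, c) \<le> n" if "(r, c) \<in> boxes lam" for r c
    proof -
      have "rt (r, c) < rt (length lam, 0)" using that by (intro rt_less) auto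
      then show ?thesis by (simp add: row_tableau_def sum_lam)
    qed
    then show ?thesis by (auto simp: row_tableau_def)
  qed
  moreover have "card (boxes lam) = card {1..n}" by (simp add: card_boxes sum_lam)
  ultimately show ?thesis
    by (metis bij_betw_def card_image card_subset_eq finite_atLeastAtMost)
qed

lemma rt_in: "b \<in> boxes lam \<Longrightarrow> rt b \<in> {1..n}"
  using rt_bij by (auto simp: bij_betw_def)

lemma rt_eq_iff: "a \<in> boxes lam \<Longrightarrow> b \<in> boxes lam \<Longrightarrow> rt a = rt b \<longleftrightarrow> a = b"
  using rt_bij by (auto simp: bij_betw_def dest: inj_onD)

lemma rt_surj: "k \<in> {1..n} \<Longrightarrow> \<exists>r c. (r, c) \<in> boxes lam \<and> k = rt (r, c)"
  using rt_bij unfolding bij_betw_def by (metis imageE surj_pair)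

lemma Std_iff: "T \<in> Std lam \<longleftrightarrow> T \<in> boxes lam \<rightarrow>\<^sub>E {1..n} \<and> bij_betw T (boxes lam) {1..n} \<and>
     (\<forall>r c c'. (r, c) \<in> boxes lam \<longrightarrow> (r, c') \<in> boxes lam \<longrightarrow> c < c' \<longrightarrow> T (r, c) < T (r, c')) \<and>
     (\<forall>r r' c. (r, c) \<in> boxes lam \<longrightarrow> (r', c) \<in> boxes lam \<longrightarrow> r < r' \<longrightarrow> T (r, c) < T (r', c))"
  by (auto simp: Std_def sum_lam)

lemma finite_Std: "finite (Std lam)"
proof (rule finite_subset)
  show "Std lam \<subseteq> boxes lam \<rightarrow>\<^sub>E {1..n}" using Std_iff by blast
qed (simp add: finite_PiE)

lemma Std_undefined: "T \<in> Std lam \<Longrightarrow> b \<notin> boxes lam \<Longrightarrow> T b = undefined"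
  unfolding Std_iff by (metis PiE_arb)

definition box_of :: "(nat \<times> nat \<Rightarrow> nat) \<Rightarrow> nat \<Rightarrow> nat \<times> nat" where
  "box_of T k = inv_into (boxes lam) T k"

lemma box_content_eq: "box_content lam T k = int (snd (box_of T k)) - int (fst (box_of T k))"
  by (simp add: box_content_def box_of_def case_prod_unfold Let_def)

lemma box_of:
  assumes "T \<in> Std lam"
  shows "b \<in> boxes lam \<Longrightarrow> box_of T (T b) = b" "k \<in> {1..n} \<Longrightarrow> T (box_of T k) = k"
    "k \<in> {1..n} \<Longrightarrow> box_of T k \<in> boxes lam" "b \<in> boxes lam \<Longrightarrow> T b \<in> {1..n}"
  using assms unfolding Std_iff box_of_def bij_betw_def
  by (auto simp: inv_into_f_f f_inv_into_f inv_into_into)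

lemma Std_row: "T \<in> Std lam \<Longrightarrow> (r, c') \<in> boxes lam \<Longrightarrow> c < c' \<Longrightarrow> T (r, c) < T (r, c')"
  unfolding Std_iff by (meson boxes_down le_refl less_imp_le)

lemma Std_col: "T \<in> Std lam \<Longrightarrow> (r', c) \<in> boxes lam \<Longrightarrow> r < r' \<Longrightarrow> T (r, c) < T (r', c)"
  unfolding Std_iff by (meson boxes_down le_refl less_imp_le)

lemma Std_less:
  assumes T: "T \<in> Std lam" "(r', c') \<in> boxes lam" "r \<le> r'" "c \<le> c'" "(r, c) \<noteq> (r', c')"
  shows "T (r, c) < T (r', c')"
proof (cases "r = r'")
  case True
  then show ?thesis using assms Std_row[of T r' c' c] by auto
next
  case False
  have "(r', c) \<in> boxes lam" using boxes_down[OF T(2) le_refl T(4)] .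
  then have "T (r, c) < T (r', c)" using False assms Std_col[of T r' c r] by auto
  also have "\<dots> \<le> T (r', c')" using assms Std_row[of T r' c' c] by (cases "c = c'") auto
  finally show ?thesis .
qed

definition row_tab :: "nat \<times> nat \<Rightarrow> nat" where
  "row_tab = restrict rt (boxes lam)"

lemma row_tab_Std: "row_tab \<in> Std lam"
proof -
  have "row_tab (r, c) < row_tab (r, c')" if "(r, c) \<in> boxes lam" "(r, c') \<in> boxes lam" "c < c'" for r c c'
    using that by (simp add: row_tab_def row_tableau_def)
  moreover have "row_tab (r, c) < row_tab (r', c)" if "(r, c) \<in> boxes lam" "(r', c) \<in> boxes lam" "r < r'" for r r' c
    using that rt_less[OF that(1,3)] by (simp add: row_tab_def)
  moreover have "bij_betw row_tab (boxes lam) {1..n}"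
    using rt_bij by (rule bij_betw_cong[THEN iffD1, rotated]) (simp add: row_tab_def)
  moreover have "row_tab \<in> boxes lam \<rightarrow>\<^sub>E {1..n}"
    using rt_in by (auto simp: row_tab_def)
  ultimately show ?thesis unfolding Std_iff by blast
qed

lemma box_of_row_tab: "b \<in> boxes lam \<Longrightarrow> box_of row_tab (rt b) = b"
  using box_of(1)[OF row_tab_Std, of b] by (simp add: row_tab_def)

definition swap_tab :: "nat \<Rightarrow> (nat \<times> nat \<Rightarrow> nat) \<Rightarrow> nat \<times> nat \<Rightarrow> nat" where
  "swap_tab i T = restrict (Transposition.transpose i (Suc i) \<circ> T) (boxes lam)"

lemma swap_tab_Std_aux:
  assumes T: "T \<in> Std lam" and i: "i \<in> {1..<n}"
    and b: "box_of T i = (r, c)" "box_of T (Suc i) = (r', c')" and ne: "r \<noteq> r'" "c \<noteq> c'"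
  shows "swap_tab i T \<in> Std lam"
proof -
  let ?s = "Transposition.transpose i (Suc i)"
  have ii: "i \<in> {1..n}" "Suc i \<in> {1..n}" using i by auto
  have s: "?s permutes {1..n}" using ii by (rule permutes_swap_id)
  have mono: "?s (T d) < ?s (T e)" if "d \<in> boxes lam" "e \<in> boxes lam" "T d < T e" "fst d = fst e \<or> snd d = snd e" for d e
  proof -
    have "\<not> (T d = i \<and> T e = Suc i)"
      using box_of(1)[OF T that(1)] box_of(1)[OF T that(2)] b ne that(4) by auto
    then show ?thesis using that(3) by (auto simp: Transposition.transpose_def)
  qed
  have "bij_betw T (boxes lam) {1..n}" using T by (simp add: Std_iff)
  then have bij: "bij_betw (?s \<circ> T) (boxes lam) {1..n}"
    using permutes_imp_bij[OF s] by (rule bij_betw_trans)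
  then have "bij_betw (swap_tab i T) (boxes lam) {1..n}"
    by (rule bij_betw_cong[THEN iffD1, rotated]) (simp add: swap_tab_def)
  moreover have "swap_tab i T \<in> boxes lam \<rightarrow>\<^sub>E {1..n}"
    unfolding swap_tab_def using bij by (auto simp: bij_betw_def)
  moreover have "swap_tab i T (r, c) < swap_tab i T (r, c')" if "(r, c) \<in> boxes lam" "(r, c') \<in> boxes lam" "c < c'" for r c c'
    using that mono[OF that(1,2) Std_row[OF T that(2,3)]] by (simp add: swap_tab_def)
  moreover have "swap_tab i T (r, c) < swap_tab i T (r', c)" if "(r, c) \<in> boxes lam" "(r', c) \<in> boxes lam" "r < r'" for r r' c
    using that mono[OF that(1,2) Std_col[OF T that(2,3)]] by (simp add: swap_tab_def)
  ultimately show ?thesis unfolding Std_iff by blast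
qed

text \<open>No entry fits between i and Suc i, so their boxes are neighbours in a row or column, or
  one lies strictly above and to the right of the other. In the last case the contents differ by at
  least 2 and the exchange keeps the tableau standard.\<close>

lemma swap_tab_cases:
  assumes T: "T \<in> Std lam" and i: "i \<in> {1..<n}"
  obtains (row) r c where "box_of T i = (r, c)" "box_of T (Suc i) = (r, Suc c)"
  | (col) r c where "box_of T i = (r, c)" "box_of T (Suc i) = (Suc r, c)"
  | (swap) "swap_tab i T \<in> Std lam" "\<bar>box_content lam T (Suc i) - box_content lam T i\<bar> \<ge> 2"
proof -
  obtain r c r' c' where b: "box_of T i = (r, c)" "box_of T (Suc i) = (r', c')" by fastforce
  have ii: "i \<in> {1..n}" "Suc i \<in> {1..n}" using i by auto
  have bb: "(r, c) \<in> boxes lam" "(r', c') \<in> boxes lam" and Tb: "T (r, c) = i" "T (r', c') = Suc i"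
    using box_of(2,3)[OF T ii(1)] box_of(2,3)[OF T ii(2)] b by auto
  note less = Std_less[OF T]
  have gap: "\<not> (T (r, c) < T d \<and> T d < T (r', c'))" for d using Tb by simp
  have not_above: "\<not> (r' \<le> r \<and> c' \<le> c)"
  proof
    assume le: "r' \<le> r \<and> c' \<le> c"
    have "(r', c') \<noteq> (r, c)" using Tb by auto
    then show False using less[OF bb(1), of r' c'] le Tb by simp
  qed
  consider "r = r'" "c < c'" | "c = c'" "r < r'" | "r < r'" "c < c'" | "r < r'" "c' < c" | "r' < r" "c < c'"
    using not_above by linarith
  then show ?thesis
  proof cases
    case 1
    have "c' = Suc c"
    proof (rule ccontr)
      assume "c' \<noteq> Suc c"
      then have "Suc c < c'" using 1 by simp
      moreover from this have "(r, Suc c) \<in> boxes lam" using bb(2) 1 by (intro boxes_down[OF bb(2)]) auto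
      ultimately show False using gap[of "(r, Suc c)"] less[OF bb(2), of r "Suc c"] less[of r "Suc c" r c] 1 by auto
    qed
    then show ?thesis using row b 1 by blast
  next
    case 2
    have "r' = Suc r"
    proof (rule ccontr)
      assume "r' \<noteq> Suc r"
      then have "Suc r < r'" using 2 by simp
      moreover from this have "(Suc r, c) \<in> boxes lam" using 2 by (intro boxes_down[OF bb(2)]) auto
      ultimately show False using gap[of "(Suc r, c)"] less[OF bb(2), of "Suc r" c] less[of "Suc r" c r c] 2 by auto
    qed
    then show ?thesis using col b 2 by blast
  next
    \<comment> \<open>The corner (r, c') would carry an entry strictly between i and Suc i.\<close>
    case 3
    have "(r, c') \<in> boxes lam" using 3 by (intro boxes_down[OF bb(2)]) auto
    then show ?thesis using gap[of "(r, c')"] less[OF bb(2), of r c'] less[of r c' r c] 3 by auto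
  next
    case far: 4
    have "\<bar>box_content lam T (Suc i) - box_content lam T i\<bar> \<ge> 2" using far by (simp add: box_content_eq b)
    moreover have "swap_tab i T \<in> Std lam" using swap_tab_Std_aux[OF T i b] far by auto
    ultimately show ?thesis using swap by blast
  next
    case far: 5
    have "\<bar>box_content lam T (Suc i) - box_content lam T i\<bar> \<ge> 2" using far by (simp add: box_content_eq b)
    moreover have "swap_tab i T \<in> Std lam" using swap_tab_Std_aux[OF T i b] far by auto
    ultimately show ?thesis using swap by blast
  qed
qed

lemma box_of_swap_tab:
  assumes T: "T \<in> Std lam" and T': "swap_tab i T \<in> Std lam" and i: "i \<in> {1..<n}" and k: "k \<in> {1..n}"
  shows "box_of (swap_tab i T) k = box_of T (Transposition.transpose i (Suc i) k)"
proof -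
  let ?s = "Transposition.transpose i (Suc i)"
  have "i \<in> {1..n}" "Suc i \<in> {1..n}" using i by auto
  then have "?s permutes {1..n}" by (rule permutes_swap_id)
  then have sk: "?s k \<in> {1..n}" using permutes_in_image k by metis
  then have "swap_tab i T (box_of T (?s k)) = k"
    using box_of(2,3)[OF T sk] by (simp add: swap_tab_def)
  then show ?thesis using box_of(1)[OF T' box_of(3)[OF T sk]] by metis
qed

lemma swap_tab_swap_tab: "T \<in> Std lam \<Longrightarrow> swap_tab i (swap_tab i T) = T"
  unfolding swap_tab_def Std_iff by (auto simp: fun_eq_iff PiE_iff extensional_def)

text \<open>The row-reading positions of the entries 1, ..., n form a word that is bubble-sorted;
  sorted, it belongs to the row tableau. The distance of the contents is recorded because it makes
  the intertwiners invertible.\<close>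

lemma Std_induct [consumes 1, case_names row_tab swap]:
  assumes "T \<in> Std lam" "P row_tab"
    and step: "\<And>T i. T \<in> Std lam \<Longrightarrow> i \<in> {1..<n} \<Longrightarrow> swap_tab i T \<in> Std lam \<Longrightarrow>
      \<bar>box_content lam T (Suc i) - box_content lam T i\<bar> \<ge> 2 \<Longrightarrow> P T \<Longrightarrow> P (swap_tab i T)"
  shows "P T"
  using assms(1)
\<comment> \<open>The coefficients n - k decrease by 1, so exchanging an adjacent descent lowers the
  sum by the size of the descent.\<close>
proof (induction "\<Sum>k\<in>{1..n}. (n - k) * rt (box_of T k)" arbitrary: T rule: less_induct)
  case less
  note T = less.prems
  let ?\<mu> = "\<lambda>k. rt (box_of T k)"
  have inj: "k = l" if "k \<in> {1..n}" "l \<in> {1..n}" "?\<mu> k = ?\<mu> l" for k l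
    using that rt_eq_iff box_of(2,3)[OF T] by metis
  show ?case
  proof (cases "\<exists>i\<in>{1..<n}. ?\<mu> (Suc i) < ?\<mu> i")
    case True
    then obtain i where i: "i \<in> {1..<n}" "?\<mu> (Suc i) < ?\<mu> i" by blast
    have ii: "i \<in> {1..n}" "Suc i \<in> {1..n}" "i \<noteq> Suc i" using i by auto
    \<comment> \<open>Neighbours in a row or column are excluded: there the later entry has the
      larger reading position.\<close>
    have "swap_tab i T \<in> Std lam \<and> \<bar>box_content lam T (Suc i) - box_content lam T i\<bar> \<ge> 2"
    proof (rule swap_tab_cases[OF T i(1)])
      fix r c assume "box_of T i = (r, c)" "box_of T (Suc i) = (r, Suc c)"
      then show ?thesis using i(2) by (simp add: rt_Suc)
    next
      fix r c assume "box_of T i = (r, c)" "box_of T (Suc i) = (Suc r, c)"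
      then show ?thesis using i(2) rt_less[of r c "Suc r" c] box_of(3)[OF T ii(1)] by simp
    qed simp
    then have T': "swap_tab i T \<in> Std lam" and far: "\<bar>box_content lam T (Suc i) - box_content lam T i\<bar> \<ge> 2" by auto
    let ?T = "swap_tab i T"
    have b: "box_of ?T k = box_of T (Transposition.transpose i (Suc i) k)" if "k \<in> {1..n}" for k
      by (rule box_of_swap_tab[OF T T' i(1) that])
    have split: "(\<Sum>k\<in>{1..n}. f k) = f i + f (Suc i) + (\<Sum>k\<in>{1..n} - {i, Suc i}. f k)" for f :: "nat \<Rightarrow> nat"
    proof -
      have "{1..n} - {i} - {Suc i} = {1..n} - {i, Suc i}" by auto
      then show ?thesis
        using sum.remove[of "{1..n}" i f] sum.remove[of "{1..n} - {i}" "Suc i" f] ii by (simp add: add.assoc)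
    qed
    have rest: "(\<Sum>k\<in>{1..n} - {i, Suc i}. (n - k) * rt (box_of ?T k)) = (\<Sum>k\<in>{1..n} - {i, Suc i}. (n - k) * ?\<mu> k)"
      by (intro sum.cong refl) (auto simp: b)
    have "(\<Sum>k\<in>{1..n}. (n - k) * rt (box_of ?T k)) < (\<Sum>k\<in>{1..n}. (n - k) * ?\<mu> k)"
    proof -
      obtain m where m: "n - i = Suc m" "n - Suc i = m" using i(1) by (cases "n - i") auto
      show ?thesis
        unfolding split[of "\<lambda>k. (n - k) * rt (box_of ?T k)"] split[of "\<lambda>k. (n - k) * ?\<mu> k"] rest
        using i(2) by (simp add: b[OF ii(1)] b[OF ii(2)] m)
    qed
    then have "P ?T" using less.hyps T' by blast
    moreover have "\<bar>box_content lam ?T (Suc i) - box_content lam ?T i\<bar> \<ge> 2"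
      using far by (simp add: box_content_eq b[OF ii(1)] b[OF ii(2)])
    ultimately have "P (swap_tab i ?T)"
      using step[OF T' i(1)] T by (simp add: swap_tab_swap_tab[OF T])
    then show ?thesis by (simp add: swap_tab_swap_tab[OF T])
  next
    case False
    have Suc_less: "?\<mu> i < ?\<mu> (Suc i)" if "i \<in> {1..<n}" for i
    proof -
      have "?\<mu> i \<noteq> ?\<mu> (Suc i)" using inj[of i "Suc i"] that by auto
      then show ?thesis using False that by (meson linorder_neqE_nat)
    qed
    define \<tau> where "\<tau> = (\<lambda>k. if k \<in> {1..n} then ?\<mu> k else k)"
    have "\<tau> permutes {1..n}"
    proof (rule bij_imp_permutes)
      have "inj_on \<tau> {1..n}" using inj by (auto simp: \<tau>_def intro!: inj_onI)
      moreover have "\<tau> ` {1..n} \<subseteq> {1..n}"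
        using rt_in[OF box_of(3)[OF T]] unfolding \<tau>_def by (simp add: image_subset_iff)
      ultimately show "bij_betw \<tau> {1..n} {1..n}" by (simp add: bij_betw_def endo_inj_surj)
    qed (auto simp: \<tau>_def)
    moreover have "\<tau> k < \<tau> l" if "1 \<le> k" "k < l" "l \<le> n" for k l
      using that(2,3)
    proof (induction l)
      case (Suc l)
      have "\<tau> l < \<tau> (Suc l)" using Suc_less[of l] Suc.prems \<open>1 \<le> k\<close> by (simp add: \<tau>_def)
      then show ?case using Suc by (cases "k = l") auto
    qed simp
    ultimately have "\<tau> = id" by (rule permutes_strict_mono_imp_id)
    have "T b = row_tab b" for b
    proof (cases "b \<in> boxes lam")
      case True
      then have "T b \<in> {1..n}" "box_of T (T b) = b" using box_of[OF T] by auto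
      then have "\<tau> (T b) = rt b" by (simp add: \<tau>_def)
      then show ?thesis using \<open>\<tau> = id\<close> True by (simp add: row_tab_def)
    next
      case False
      then show ?thesis using Std_undefined[OF T] Std_undefined[OF row_tab_Std] by metis
    qed
    then have "T = row_tab" by (rule ext)
    then show ?thesis using assms(2) by simp
  qed
qed

text \<open>Entry by entry: equal contents put both boxes of k on one diagonal. If they differed,
  the tableau using the lower box would contain an entry below k in the upper one, and by induction
  the other tableau has that entry there too, where it should have k.\<close>

lemma content_injective:
  assumes T: "T \<in> Std lam" "T' \<in> Std lam"
    and eq: "\<And>k. k \<in> {1..n} \<Longrightarrow> box_content lam T k = box_content lam T' k"
  shows "T = T'"
proof -
  have "box_of T k = box_of T' k" if "k \<in> {1..n}" for k
    using that
  proof (induction k rule: less_induct)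
    case (less k)
    have aux: False if S: "S \<in> Std lam" "S' \<in> Std lam" and IH: "\<And>j. j < k \<Longrightarrow> j \<in> {1..n} \<Longrightarrow> box_of S j = box_of S' j"
      and rc: "box_of S k = (r, c)" "box_of S' k = (r', c')" "r < r'" "c < c'" for S S' r c r' c'
    proof -
      have b: "(r', c') \<in> boxes lam" "(r, c) \<in> boxes lam" "S' (r', c') = k" "S (r, c) = k"
        using box_of(2,3)[OF S(2) less.prems] box_of(2,3)[OF S(1) less.prems] rc by auto
      have "S' (r, c) < k" using Std_less[OF S(2) b(1), of r c] b(3) rc by simp
      moreover have "S' (r, c) \<in> {1..n}" using box_of(4)[OF S(2) b(2)] .
      ultimately have "box_of S (S' (r, c)) = (r, c)" using IH[of "S' (r, c)"] box_of(1)[OF S(2) b(2)] by simp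
      then have "S (r, c) = S' (r, c)" using box_of(2)[OF S(1) \<open>S' (r, c) \<in> {1..n}\<close>] by simp
      then show False using b \<open>S' (r, c) < k\<close> by simp
    qed
    obtain r c r' c' where rc: "box_of T k = (r, c)" "box_of T' k = (r', c')" by fastforce
    have d: "int c - int r = int c' - int r'" using eq[OF less.prems] by (simp add: box_content_eq rc)
    have "\<not> (r < r' \<and> c < c')" using aux[OF T _ rc] less.IH by blast
    moreover have "\<not> (r' < r \<and> c' < c)" using aux[OF T(2,1) _ rc(2,1)] less.IH by (metis (no_types))
    ultimately have "r = r'" "c = c'" using d by linarith+
    then show ?case using rc by simp
  qed
  then have *: "T (box_of T k) = T' (box_of T k)" if "k \<in> {1..n}" for k
    using that box_of(2)[OF T(1) that] box_of(2)[OF T(2) that] by simp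
  show ?thesis
  proof
    fix b show "T b = T' b"
    proof (cases "b \<in> boxes lam")
      case True
      then show ?thesis using *[OF box_of(4)[OF T(1) True]] box_of(1)[OF T(1) True] by simp
    next
      case False
      then show ?thesis using Std_undefined[OF T(1)] Std_undefined[OF T(2)] by metis
    qed
  qed
qed

end

section \<open>The Young symmetrizer\<close>

text \<open>Composing with the transposition of x and p x fixes x and keeps all fixed points, so the
  number of moved points drops. Classes will be the rows of the row tableau, or a single class for
  the full symmetric group.\<close>

lemma permutes_by_class_transpositions:
  fixes cls :: "nat \<Rightarrow> 'c"
  assumes p: "p permutes {1..n}" "\<And>x. x \<in> {1..n} \<Longrightarrow> cls (p x) = cls x"
    and K: "id \<in> K" "\<And>p q. p \<in> K \<Longrightarrow> q \<in> K \<Longrightarrow> p \<circ> q \<in> K"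
      "\<And>x y. x \<in> {1..n} \<Longrightarrow> y \<in> {1..n} \<Longrightarrow> x \<noteq> y \<Longrightarrow> cls x = cls y \<Longrightarrow> Transposition.transpose x y \<in> K"
  shows "p \<in> K"
  using p
proof (induction "card {x\<in>{1..n}. p x \<noteq> x}" arbitrary: p rule: less_induct)
  case less
  show ?case
  proof (cases "\<exists>x\<in>{1..n}. p x \<noteq> x")
    case False
    then have "p = id" using less.prems(1) by (auto simp: fun_eq_iff permutes_def)
    then show ?thesis using K(1) by simp
  next
    case True
    then obtain x where x: "x \<in> {1..n}" "p x \<noteq> x" by blast
    let ?t = "Transposition.transpose x (p x)"
    have px: "p x \<in> {1..n}" using permutes_in_image[OF less.prems(1)] x by blast
    have t: "?t permutes {1..n}" using x(1) px by (rule permutes_swap_id)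
    define q where "q = ?t \<circ> p"
    have q: "q permutes {1..n}" unfolding q_def using less.prems(1) t by (rule permutes_compose)
    have qx: "q x = x" by (simp add: q_def)
    have keep: "q y = y" if "p y = y" for y
    proof -
      have "y \<noteq> x" using that x by auto
      then have "y \<noteq> p x" using that permutes_inj[OF less.prems(1)] by (metis injD)
      then show ?thesis using that \<open>y \<noteq> x\<close> by (simp add: q_def)
    qed
    have "{y\<in>{1..n}. q y \<noteq> y} \<subset> {y\<in>{1..n}. p y \<noteq> y}"
      using keep qx x by blast
    then have "card {y\<in>{1..n}. q y \<noteq> y} < card {y\<in>{1..n}. p y \<noteq> y}"
      by (intro psubset_card_mono) auto
    moreover have "cls (q y) = cls y" if "y \<in> {1..n}" for y
      using less.prems(2)[OF that] less.prems(2)[OF x(1)] by (auto simp: q_def Transposition.transpose_def)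
    ultimately have "q \<in> K" using less.hyps q by blast
    moreover have "?t \<in> K" using K(3)[OF x(1) px] x(2) less.prems(2)[OF x(1)] by simp
    moreover have "p = ?t \<circ> q" by (simp add: q_def fun_eq_iff)
    ultimately show ?thesis using K(2) by metis
  qed
qed

text \<open>The recursion conjugates by the transposition of y and Suc y, hence stays between x and
  y. For two entries of one row of the row tableau this confines all factors to that row.\<close>

lemma adjacent_transpositions_generate:
  fixes K :: "(nat \<Rightarrow> nat) set"
  assumes K: "\<And>p q. p \<in> K \<Longrightarrow> q \<in> K \<Longrightarrow> p \<circ> q \<in> K"
    and adj: "\<And>i. x \<le> i \<Longrightarrow> i < y \<Longrightarrow> Transposition.transpose i (Suc i) \<in> K"
  shows "x < y \<Longrightarrow> Transposition.transpose x y \<in> K"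
  using adj
proof (induction y)
  case (Suc y)
  show ?case
  proof (cases "x = y")
    case False
    then have "Transposition.transpose x (Suc y) =
        Transposition.transpose y (Suc y) \<circ> (Transposition.transpose x y \<circ> Transposition.transpose y (Suc y))"
      using Suc.prems(1) by (auto simp: fun_eq_iff Transposition.transpose_def)
    moreover have "Transposition.transpose x y \<in> K" "Transposition.transpose y (Suc y) \<in> K"
      using Suc False by auto
    ultimately show ?thesis using K by presburger
  qed (use Suc.prems in auto)
qed simp

text \<open>As many elements of A lie outside {..<h} as are missing from it; the former are at least
  h and the latter at most h - 1, so any exchange increases the sum.\<close>

lemma sum_distinct_nat_ge:
  fixes A :: "nat set"
  assumes A: "finite A" "card A = h" and le: "(\<Sum>x\<in>A. x) \<le> (\<Sum>x<h. x)"
  shows "A = {..<h}"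
proof -
  have card: "card (A - {..<h}) = card ({..<h} - A)"
    using A by (simp add: card_Diff_subset_Int Int_commute)
  have s1: "(\<Sum>x\<in>A. x) = (\<Sum>x\<in>A \<inter> {..<h}. x) + (\<Sum>x\<in>A - {..<h}. x)"
    using A(1) by (rule sum.Int_Diff)
  have s2: "(\<Sum>x<h. x) = (\<Sum>x\<in>A \<inter> {..<h}. x) + (\<Sum>x\<in>{..<h} - A. x)"
    using sum.Int_Diff[of "{..<h}" "\<lambda>x. x" A] by (simp add: Int_commute)
  have "card (A - {..<h}) * h \<le> (\<Sum>x\<in>A - {..<h}. x)"
    using sum_bounded_below[of "A - {..<h}" h "\<lambda>x. x"] by simp
  moreover have "(\<Sum>x\<in>{..<h} - A. x) \<le> card ({..<h} - A) * (h - 1)"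
  proof -
    have "(\<Sum>x\<in>{..<h} - A. x) \<le> of_nat (card ({..<h} - A)) * (h - 1)"
      by (rule sum_bounded_above) auto
    then show ?thesis by simp
  qed
  moreover have "(\<Sum>x\<in>A - {..<h}. x) \<le> (\<Sum>x\<in>{..<h} - A. x)"
    using le unfolding s1 s2 by simp
  ultimately have "card (A - {..<h}) * h \<le> card (A - {..<h}) * (h - 1)"
    unfolding card by (meson le_trans)
  then have "card (A - {..<h}) = 0 \<or> h = 0" by (auto simp: One_nat_def)
  then have "A - {..<h} = {}" using A by auto
  then show ?thesis using A by (metis Diff_eq_empty_iff card_lessThan card_subset_eq finite_lessThan)
qed

text \<open>The terms for p and for p composed with the transposition are opposite, so the sum
  equals its own negative.\<close>

lemma sum_gact_antisymmetric:
  assumes S: "\<And>p. p \<in> S \<Longrightarrow> bij p" "\<And>p. p \<in> S \<Longrightarrow> p \<circ> Transposition.transpose x y \<in> S"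
    and w: "gact (Transposition.transpose x y) w = - w"
  shows "(\<Sum>p\<in>S. gact p w) = 0"
proof -
  let ?t = "Transposition.transpose x y"
  have "(\<Sum>p\<in>S. gact p w) = (\<Sum>p\<in>S. gact (p \<circ> ?t) w)"
    by (rule sum.reindex_bij_witness[of _ "\<lambda>p. p \<circ> ?t" "\<lambda>p. p \<circ> ?t"]) (simp_all add: S comp_assoc)
  also have "\<dots> = (\<Sum>p\<in>S. - gact p w)"
  proof (rule sum.cong[OF refl])
    fix p assume p: "p \<in> S"
    have "gact (p \<circ> ?t) w = gact p (gscale (-1) w)"
      using gact_gact[OF S(1)[OF p], of ?t w] w by simp
    also have "\<dots> = - gact p w" unfolding gact_gscale by simp
    finally show "gact (p \<circ> ?t) w = - gact p w" .
  qed
  finally have "(\<Sum>p\<in>S. gact p w) = - (\<Sum>p\<in>S. gact p w)" by (simp add: sum_negf)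
  then have "(\<Sum>p\<in>S. gact p w) + (\<Sum>p\<in>S. gact p w) = 0" by (simp only: eq_neg_iff_add_eq_0)
  then have "gscale 2 (\<Sum>p\<in>S. gact p w) = 0"
    using G.scale_left_distrib[of 1 1 "\<Sum>p\<in>S. gact p w"] by simp
  then show ?thesis by simp
qed

section \<open>Row group, column group and the contents of the Young symmetrizer\<close>

context partition
begin

sublocale S: symmetric_group_rep gscale UNIV gprod n gact
  by (rule symmetric_group_rep_galg)

sublocale H: degenerate_hecke gscale UNIV gprod n 1 "\<lambda>i. gact (Transposition.transpose i (Suc i))" S.jucys_murphy
  by (rule S.degenerate_hecke_jm)

definition Rg where "Rg = row_group lam"
definition Cg where "Cg = column_group lam"

lemma Rg_iff: "p \<in> Rg \<longleftrightarrow> p permutes {1..n} \<and> (\<forall>r c. (r, c) \<in> boxes lam \<longrightarrow> (\<exists>c'. (r, c') \<in> boxes lam \<and> p (rt (r, c)) = rt (r, c')))"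
  unfolding Rg_def row_group_def sum_lam by blast

lemma Cg_iff: "p \<in> Cg \<longleftrightarrow> p permutes {1..n} \<and> (\<forall>r c. (r, c) \<in> boxes lam \<longrightarrow> (\<exists>r'. (r', c) \<in> boxes lam \<and> p (rt (r, c)) = rt (r', c)))"
  unfolding Cg_def column_group_def sum_lam by blast

lemma RgD: "p \<in> Rg \<Longrightarrow> (r, c) \<in> boxes lam \<Longrightarrow> \<exists>c'. (r, c') \<in> boxes lam \<and> p (rt (r, c)) = rt (r, c')"
  unfolding Rg_iff by blast

lemma group_bij: "p \<in> Rg \<Longrightarrow> bij p" "p \<in> Cg \<Longrightarrow> bij p"
  by (auto simp: Rg_iff Cg_iff dest: permutes_bij)

lemma group_permutes: "p \<in> Rg \<Longrightarrow> p permutes {1..n}" "p \<in> Cg \<Longrightarrow> p permutes {1..n}"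
  unfolding Rg_iff Cg_iff by blast+

lemma finite_groups: "finite Rg" "finite Cg"
  by (rule finite_subset[OF _ finite_permutations[of "{1..n}"]]; auto simp: Rg_iff Cg_iff)+

lemma group_comp: "p \<in> Rg \<Longrightarrow> q \<in> Rg \<Longrightarrow> p \<circ> q \<in> Rg" "p \<in> Cg \<Longrightarrow> q \<in> Cg \<Longrightarrow> p \<circ> q \<in> Cg"
proof -
  assume p: "p \<in> Rg" and q: "q \<in> Rg"
  have "\<exists>c'. (r, c') \<in> boxes lam \<and> p (q (rt (r, c))) = rt (r, c')" if b: "(r, c) \<in> boxes lam" for r c
  proof -
    obtain c1 where c1: "(r, c1) \<in> boxes lam" "q (rt (r, c)) = rt (r, c1)" using q b unfolding Rg_iff by blast
    then show ?thesis using p unfolding Rg_iff by auto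
  qed
  moreover have "p \<circ> q permutes {1..n}" using p q by (auto simp: Rg_iff intro: permutes_compose)
  ultimately show "p \<circ> q \<in> Rg" unfolding Rg_iff comp_apply by blast
next
  assume p: "p \<in> Cg" and q: "q \<in> Cg"
  have "\<exists>r'. (r', c) \<in> boxes lam \<and> p (q (rt (r, c))) = rt (r', c)" if b: "(r, c) \<in> boxes lam" for r c
  proof -
    obtain r1 where r1: "(r1, c) \<in> boxes lam" "q (rt (r, c)) = rt (r1, c)" using q b unfolding Cg_iff by blast
    then show ?thesis using p unfolding Cg_iff by auto
  qed
  moreover have "p \<circ> q permutes {1..n}" using p q by (auto simp: Cg_iff intro: permutes_compose)
  ultimately show "p \<circ> q \<in> Cg" unfolding Cg_iff comp_apply by blast
qed

lemma transpose_permutes_rt: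
  "a \<in> boxes lam \<Longrightarrow> b \<in> boxes lam \<Longrightarrow> Transposition.transpose (rt a) (rt b) permutes {1..n}"
  by (intro permutes_swap_id rt_in)

lemma transpose_Rg:
  assumes "(r, c) \<in> boxes lam" "(r, c') \<in> boxes lam"
  shows "Transposition.transpose (rt (r, c)) (rt (r, c')) \<in> Rg"
  unfolding Rg_iff
proof (intro conjI allI impI transpose_permutes_rt assms)
  fix r0 c0 assume b: "(r0, c0) \<in> boxes lam"
  show "\<exists>c1. (r0, c1) \<in> boxes lam \<and> Transposition.transpose (rt (r, c)) (rt (r, c')) (rt (r0, c0)) = rt (r0, c1)"
  proof -
    consider "(r0, c0) = (r, c)" | "(r0, c0) = (r, c')" | "(r0, c0) \<noteq> (r, c)" "(r0, c0) \<noteq> (r, c')" by blast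
    then show ?thesis
    proof cases
      case 3
      then have "rt (r0, c0) \<noteq> rt (r, c)" "rt (r0, c0) \<noteq> rt (r, c')" using rt_eq_iff b assms by blast+
      then show ?thesis using b by (intro exI[of _ c0]) simp
    qed (use assms in auto)
  qed
qed

lemma transpose_Cg:
  assumes "(r, c) \<in> boxes lam" "(r', c) \<in> boxes lam"
  shows "Transposition.transpose (rt (r, c)) (rt (r', c)) \<in> Cg"
  unfolding Cg_iff
proof (intro conjI allI impI transpose_permutes_rt assms)
  fix r0 c0 assume b: "(r0, c0) \<in> boxes lam"
  show "\<exists>r1. (r1, c0) \<in> boxes lam \<and> Transposition.transpose (rt (r, c)) (rt (r', c)) (rt (r0, c0)) = rt (r1, c0)"
  proof -
    consider "(r0, c0) = (r, c)" | "(r0, c0) = (r', c)" | "(r0, c0) \<noteq> (r, c)" "(r0, c0) \<noteq> (r', c)" by blast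
    then show ?thesis
    proof cases
      case 3
      then have "rt (r0, c0) \<noteq> rt (r, c)" "rt (r0, c0) \<noteq> rt (r', c)" using rt_eq_iff b assms by blast+
      then show ?thesis using b by (intro exI[of _ r0]) simp
    qed (use assms in auto)
  qed
qed

lemma Rg_row_surj:
  assumes p: "p \<in> Rg" and b: "(r, c) \<in> boxes lam"
  obtains c' where "(r, c') \<in> boxes lam" "p (rt (r, c')) = rt (r, c)"
proof -
  define f where "f = (\<lambda>c. SOME c'. (r, c') \<in> boxes lam \<and> p (rt (r, c)) = rt (r, c'))"
  have f: "(r, f c0) \<in> boxes lam \<and> p (rt (r, c0)) = rt (r, f c0)" if "(r, c0) \<in> boxes lam" for c0
    unfolding f_def by (rule someI_ex[OF RgD[OF p that]])
  let ?A = "{..<lam ! r}"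
  have mem: "c0 \<in> ?A \<longleftrightarrow> (r, c0) \<in> boxes lam" for c0 using b by simp
  have inj: "inj_on f ?A"
  proof (rule inj_onI)
    fix a a' assume a: "a \<in> ?A" "a' \<in> ?A" "f a = f a'"
    then have "p (rt (r, a)) = p (rt (r, a'))" using f mem by metis
    then have "rt (r, a) = rt (r, a')" using permutes_inj[OF group_permutes(1)[OF p]] by (metis injD)
    then show "a = a'" by (simp add: row_tableau_def)
  qed
  have "f ` ?A \<subseteq> ?A" using f mem by blast
  then have "f ` ?A = ?A" by (rule endo_inj_surj[OF finite_lessThan _ inj])
  then have "c \<in> f ` ?A" using mem b by blast
  then obtain c' where "c' \<in> ?A" "c = f c'" by blast
  then show ?thesis using that[of c'] f[of c'] mem[of c'] by blast
qed

definition col_antisym :: galg where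
  "col_antisym = (\<Sum>q\<in>Cg. pure q (of_int (sign q)))"

definition young :: galg where "young = young_symmetrizer lam"

lemma young_eq: "young = (\<Sum>p\<in>Rg. gact p col_antisym)"
proof -
  have "gact p col_antisym = (\<Sum>q\<in>Cg. pure (p \<circ> q) (of_int (sign q)))" if "p \<in> Rg" for p
    unfolding col_antisym_def S.act_sum[OF group_permutes(1)[OF that]] gact_pure ..
  then show ?thesis
    unfolding young_def young_symmetrizer_def Rg_def[symmetric] Cg_def[symmetric] by simp
qed

lemma Cg_permutation: "q \<in> Cg \<Longrightarrow> permutation q"
  by (auto simp: Cg_iff permutation_permutes)

lemma gact_col_antisym: "q \<in> Cg \<Longrightarrow> gact q col_antisym = gscale (of_int (sign q)) col_antisym"
proof -
  assume q: "q \<in> Cg"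
  have inj: "inj_on ((\<circ>) q) Cg"
    using fun.inj_map[OF bij_is_inj[OF group_bij(2)[OF q]]] by (rule inj_on_subset) simp
  have "(\<circ>) q ` Cg \<subseteq> Cg" using group_comp(2)[OF q] by blast
  then have img: "(\<circ>) q ` Cg = Cg" using inj finite_groups(2) by (simp add: endo_inj_surj)
  have sgn: "sign (q \<circ> q') = sign q * sign q'" if "q' \<in> Cg" for q'
    by (rule sign_compose[OF Cg_permutation[OF q] Cg_permutation[OF that]])
  have ss: "complex_of_int (sign q) * complex_of_int (sign q) = 1"
    by (simp add: sign_def)
  have "gscale (of_int (sign q)) col_antisym = (\<Sum>q'\<in>Cg. pure q' (of_int (sign q) * of_int (sign q')))"
    unfolding col_antisym_def G.scale_sum_right by simp
  also have "\<dots> = (\<Sum>q'\<in>(\<circ>) q ` Cg. pure q' (of_int (sign q) * of_int (sign q')))"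
    unfolding img ..
  also have "\<dots> = (\<Sum>q'\<in>Cg. pure (q \<circ> q') (of_int (sign q) * of_int (sign (q \<circ> q'))))"
    unfolding sum.reindex[OF inj] by (intro sum.cong refl) (simp add: sgn mult.assoc[symmetric] ss)
  also have "\<dots> = (\<Sum>q'\<in>Cg. pure (q \<circ> q') (of_int (sign q')))"
    by (intro sum.cong refl) (simp add: sgn mult.assoc[symmetric] ss)
  also have "\<dots> = gact q col_antisym"
    unfolding col_antisym_def S.act_sum[OF group_permutes(2)[OF q]] gact_pure ..
  finally show ?thesis ..
qed

lemma gact_transpose_col_antisym:
  assumes "(r, c) \<in> boxes lam" "(r', c) \<in> boxes lam" "r \<noteq> r'"
  shows "gact (Transposition.transpose (rt (r, c)) (rt (r', c))) col_antisym = - col_antisym"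
proof -
  have "rt (r, c) \<noteq> rt (r', c)" using rt_eq_iff[OF assms(1,2)] assms(3) by blast
  then have "sign (Transposition.transpose (rt (r, c)) (rt (r', c))) = -1" by (simp add: sign_swap_id)
  then show ?thesis using gact_col_antisym[OF transpose_Cg[OF assms(1,2)]] by simp
qed

lemma gact_young: "p \<in> Rg \<Longrightarrow> gact p young = young"
proof -
  assume p: "p \<in> Rg"
  have inj: "inj_on ((\<circ>) p) Rg"
    using fun.inj_map[OF bij_is_inj[OF group_bij(1)[OF p]]] by (rule inj_on_subset) simp
  have "(\<circ>) p ` Rg \<subseteq> Rg" using group_comp(1)[OF p] by blast
  then have img: "(\<circ>) p ` Rg = Rg" using inj finite_groups(1) by (simp add: endo_inj_surj)
  have "gact p young = (\<Sum>p'\<in>Rg. gact (p \<circ> p') col_antisym)"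
    unfolding young_eq S.act_sum[OF group_permutes(1)[OF p]]
    by (intro sum.cong refl gact_gact group_bij(1) p)
  also have "\<dots> = (\<Sum>p'\<in>(\<circ>) p ` Rg. gact p' col_antisym)"
    unfolding sum.reindex[OF inj] by (intro sum.cong refl) simp
  finally show ?thesis unfolding img young_eq .
qed

text \<open>Only p = q = id contributes: if the product is the identity, the row permutation must
  return each entry moved by the column permutation, but it cannot change the row.\<close>

lemma coord_young_id: "coord young id = 1"
proof -
  have idg: "id \<in> Rg" "id \<in> Cg" by (auto simp: Rg_iff Cg_iff permutes_id)
  have "coord young id = (\<Sum>p\<in>Rg. \<Sum>q\<in>Cg. of_int (sign q) when p \<circ> q = id)"
    by (simp add: young_def young_symmetrizer_def Rg_def Cg_def lookup_sum lookup_single)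
  also have "\<dots> = (\<Sum>p\<in>Rg. \<Sum>q\<in>Cg. if p = id \<and> q = id then 1 else 0)"
  proof (intro sum.cong refl)
    fix p q assume p: "p \<in> Rg" and q: "q \<in> Cg"
    have "p = id \<and> q = id" if e: "p \<circ> q = id"
    proof -
      have pp: "p permutes {1..n}" "q permutes {1..n}" using p q by (auto simp: Rg_iff Cg_iff)
      have "q k = k" for k
      proof (cases "k \<in> {1..n}")
        case True
        then obtain r c where k: "(r, c) \<in> boxes lam" "k = rt (r, c)" using rt_surj by blast
        obtain r1 where r1: "(r1, c) \<in> boxes lam" "q k = rt (r1, c)" using q k unfolding Cg_iff by blast
        obtain c2 where c2: "(r1, c2) \<in> boxes lam" "p (rt (r1, c)) = rt (r1, c2)" using p r1 unfolding Rg_iff by blast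
        have "p (q k) = k" using e by (metis comp_apply id_apply)
        then show ?thesis using rt_eq_iff[OF c2(1) k(1)] c2 r1 k by auto
      qed (use pp in \<open>auto simp: permutes_def\<close>)
      then have "q = id" by auto
      then show ?thesis using e by simp
    qed
    then show "(complex_of_int (sign q) when p \<circ> q = id) = (if p = id \<and> q = id then 1 else 0)"
      by (auto simp: when_def)
  qed
  also have "\<dots> = (\<Sum>p\<in>Rg. if p = id then (\<Sum>q\<in>Cg. if q = id then 1 else 0) else 0)"
    by (intro sum.cong refl) auto
  also have "\<dots> = 1" using idg finite_groups by simp
  finally show ?thesis .
qed

lemma young_nonzero: "young \<noteq> 0"
  using coord_young_id by auto

text \<open>A relation of Garnir type. The sum over all permutations of row r' and one lower entry k
  kills the Young symmetrizer. Its invariance under permutations of row r' reduces this sum to coset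
  representatives: the identity and the transpositions of k with the entries of row r'.\<close>

lemma sum_row_young:
  assumes b: "(r, c) \<in> boxes lam" and r': "r' < r"
  shows "(\<Sum>c'<lam ! r'. gact (Transposition.transpose (rt (r', c')) (rt (r, c))) young) = - young"
proof -
  let ?k = "rt (r, c)" and ?Row = "(\<lambda>c'. rt (r', c')) ` {..<lam ! r'}"
  let ?S = "insert ?k ?Row"
  have rl: "r' < length lam" and row_box: "\<And>c'. c' < lam ! r' \<Longrightarrow> (r', c') \<in> boxes lam" using b r' by auto
  have k_notin: "?k \<notin> ?Row"
  proof
    assume "?k \<in> ?Row"
    then obtain c' where c': "c' < lam ! r'" "rt (r, c) = rt (r', c')" by blast
    then have "(r, c) = (r', c')" using rt_eq_iff[OF b row_box[OF c'(1)]] by simp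
    then show False using r' by simp
  qed
  have SS: "?S \<subseteq> {1..n}" using rt_in b row_box by blast
  have inj: "inj_on (\<lambda>c'. rt (r', c')) {..<lam ! r'}" by (auto intro!: inj_onI simp: rt_eq_iff rl)
  have perm: "p permutes {1..n}" if "p permutes ?S" for p using permutes_subset[OF that SS] .
  have vanish: "(\<Sum>g | g permutes ?S. gact g (gact p col_antisym)) = 0" if p: "p \<in> Rg" for p
  proof -
    \<comment> \<open>p moves box (r, c2) to k and the box (r', c2) above it into row r'. Conjugated
      by p, the transposition of these two boxes of one column becomes one within \<open>?S\<close>,
      which makes the term antisymmetric.\<close>
    obtain c2 where c2: "(r, c2) \<in> boxes lam" "p (rt (r, c2)) = ?k" using Rg_row_surj[OF p b] .
    have b2: "(r', c2) \<in> boxes lam" by (rule boxes_down[OF c2(1)]) (use r' in auto)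
    obtain c3 where c3: "(r', c3) \<in> boxes lam" "p (rt (r', c2)) = rt (r', c3)" using p b2 unfolding Rg_iff by blast
    have pp: "p permutes {1..n}" using p by (simp add: Rg_iff)
    have "Transposition.transpose (rt (r', c3)) ?k permutes ?S"
      using c3 by (intro permutes_swap_id) auto
    moreover have "gact (Transposition.transpose (rt (r', c3)) ?k) (gact p col_antisym) = - gact p col_antisym"
    proof -
      have "gact (Transposition.transpose (rt (r', c3)) ?k) (gact p col_antisym) =
          gact p (gact (Transposition.transpose (rt (r', c2)) (rt (r, c2))) col_antisym)"
        using S.act_conj[OF pp rt_in[OF b2] rt_in[OF c2(1)]] c2 c3 by simp
      also have "\<dots> = gact p (gscale (-1) col_antisym)"
        using gact_transpose_col_antisym[OF b2 c2(1)] r' by simp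
      finally show ?thesis using S.act_scale[OF pp, of "-1"] by simp
    qed
    ultimately show ?thesis
      by (intro sum_gact_antisymmetric) (auto intro: permutes_bij permutes_compose)
  qed
  have rowfix: "gact h young = young" if h: "h permutes ?Row" for h
  proof (rule gact_young)
    have "h permutes {1..n}" using h SS by (auto intro: permutes_subset)
    moreover have "\<exists>c1. (r0, c1) \<in> boxes lam \<and> h (rt (r0, c0)) = rt (r0, c1)" if b0: "(r0, c0) \<in> boxes lam" for r0 c0
    proof (cases "rt (r0, c0) \<in> ?Row")
      case True
      then have "r0 = r'" using rt_eq_iff[OF b0 row_box] by auto
      moreover have "h (rt (r0, c0)) \<in> ?Row" using permutes_in_image[OF h] True by blast
      ultimately show ?thesis using row_box by auto
    next
      case False
      then have "h (rt (r0, c0)) = rt (r0, c0)" using h by (simp add: permutes_def)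
      then show ?thesis using b0 by blast
    qed
    ultimately show "h \<in> Rg" unfolding Rg_iff by blast
  qed
  have "(\<Sum>g | g permutes ?S. gact g young) = (\<Sum>p\<in>Rg. \<Sum>g | g permutes ?S. gact g (gact p col_antisym))"
    unfolding young_eq by (subst sum.swap) (intro sum.cong refl S.act_sum perm, simp)
  also have "\<dots> = 0" using vanish by simp
  finally have "0 = (\<Sum>g | g permutes ?S. gact g young)" by simp
  also have "\<dots> = (\<Sum>a\<in>?S. \<Sum>h | h permutes ?Row. gact (Transposition.transpose ?k a \<circ> h) young)"
    by (rule sum_over_permutations_insert) (use k_notin in auto)
  also have "\<dots> = (\<Sum>a\<in>?S. \<Sum>h | h permutes ?Row. gact (Transposition.transpose ?k a) young)"
  proof (intro sum.cong refl)
    fix a h assume a: "a \<in> ?S" and h: "h \<in> {h. h permutes ?Row}"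
    have "gact (Transposition.transpose ?k a \<circ> h) young = gact (Transposition.transpose ?k a) (gact h young)"
      using h by (intro gact_gact[symmetric]) (auto intro: permutes_bij)
    then show "gact (Transposition.transpose ?k a \<circ> h) young = gact (Transposition.transpose ?k a) young"
      using rowfix h by simp
  qed
  also have "\<dots> = gscale (of_nat (fact (card ?Row))) (\<Sum>a\<in>?S. gact (Transposition.transpose ?k a) young)"
  proof -
    have "(\<Sum>h | h permutes ?Row. v) = gscale (of_nat (fact (card ?Row))) v" for v :: galg
    proof -
      have "(\<Sum>h | h permutes ?Row. v) = (\<Sum>h | h permutes ?Row. gscale 1 v)" by simp
      also have "\<dots> = gscale (\<Sum>h | h permutes ?Row. 1) v" by (rule G.scale_sum_left[symmetric])
      finally show ?thesis by (simp add: card_permutations[OF refl])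
    qed
    then show ?thesis by (simp add: G.scale_sum_right)
  qed
  finally have "(\<Sum>a\<in>?S. gact (Transposition.transpose ?k a) young) = 0"
    by (simp add: G.scale_eq_0_iff del: of_nat_fact)
  then have "young + (\<Sum>a\<in>?Row. gact (Transposition.transpose ?k a) young) = 0"
    using k_notin by simp
  then have "(\<Sum>a\<in>?Row. gact (Transposition.transpose ?k a) young) = - young"
    by (simp add: add_eq_0_iff)
  then show ?thesis
    by (simp add: sum.reindex[OF inj] transpose_commute)
qed

text \<open>The smaller entries are the c boxes to the left, whose transpositions fix the Young
  symmetrizer, and r complete rows above, each contributing -1 by
  \<open>sum_row_young\<close>.\<close>

lemma jm_young:
  assumes b: "(r, c) \<in> boxes lam"
  shows "S.jucys_murphy (rt (r, c)) young = gscale (of_int (int c - int r)) young"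
proof -
  let ?g = "\<lambda>j. gact (Transposition.transpose j (rt (r, c))) young"
  have set: "{1..<rt (r, c)} = rt ` (SIGMA r':{..<r}. {..<lam ! r'}) \<union> rt ` ({r} \<times> {..<c})"
  proof (rule Set.set_eqI)
    fix j
    have "j \<in> {1..<rt (r, c)} \<longleftrightarrow> (\<exists>r1 c1. (r1, c1) \<in> boxes lam \<and> j = rt (r1, c1) \<and> (r1 < r \<or> r1 = r \<and> c1 < c))"
    proof
      assume j: "j \<in> {1..<rt (r, c)}"
      then have "j \<in> {1..n}" using rt_in[OF b] by auto
      then obtain r1 c1 where rc: "(r1, c1) \<in> boxes lam" "j = rt (r1, c1)" using rt_surj by blast
      have "\<not> r < r1" using rt_less[OF b, of r1 c1] j rc by auto
      moreover have "c1 < c" if "r1 = r" using j rc that by (simp add: row_tableau_def)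
      ultimately show "\<exists>r1 c1. (r1, c1) \<in> boxes lam \<and> j = rt (r1, c1) \<and> (r1 < r \<or> r1 = r \<and> c1 < c)"
        using rc by (intro exI[of _ r1] exI[of _ c1] conjI) auto
    next
      assume "\<exists>r1 c1. (r1, c1) \<in> boxes lam \<and> j = rt (r1, c1) \<and> (r1 < r \<or> r1 = r \<and> c1 < c)"
      then obtain r1 c1 where rc: "(r1, c1) \<in> boxes lam" "j = rt (r1, c1)" "r1 < r \<or> r1 = r \<and> c1 < c" by blast
      have "rt (r1, c1) < rt (r, c)"
        using rc(3) rt_less[OF rc(1), of r c] by (auto simp: row_tableau_def)
      then show "j \<in> {1..<rt (r, c)}" using rt_in[OF rc(1)] rc(2) by auto
    qed
    also have "\<dots> \<longleftrightarrow> j \<in> rt ` (SIGMA r':{..<r}. {..<lam ! r'}) \<union> rt ` ({r} \<times> {..<c})"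
    proof
      assume "\<exists>r1 c1. (r1, c1) \<in> boxes lam \<and> j = rt (r1, c1) \<and> (r1 < r \<or> r1 = r \<and> c1 < c)"
      then obtain r1 c1 where rc: "(r1, c1) \<in> boxes lam" "j = rt (r1, c1)" "r1 < r \<or> r1 = r \<and> c1 < c" by blast
      then have "(r1, c1) \<in> (SIGMA r':{..<r}. {..<lam ! r'}) \<union> {r} \<times> {..<c}" by auto
      then show "j \<in> rt ` (SIGMA r':{..<r}. {..<lam ! r'}) \<union> rt ` ({r} \<times> {..<c})" using rc(2) by blast
    next
      assume "j \<in> rt ` (SIGMA r':{..<r}. {..<lam ! r'}) \<union> rt ` ({r} \<times> {..<c})"
      then obtain x where x: "x \<in> (SIGMA r':{..<r}. {..<lam ! r'}) \<union> {r} \<times> {..<c}" "j = rt x" by blast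
      then have "(fst x, snd x) \<in> boxes lam \<and> j = rt (fst x, snd x) \<and> (fst x < r \<or> fst x = r \<and> snd x < c)"
        using b by auto
      then show "\<exists>r1 c1. (r1, c1) \<in> boxes lam \<and> j = rt (r1, c1) \<and> (r1 < r \<or> r1 = r \<and> c1 < c)" by blast
    qed
    finally show "j \<in> {1..<rt (r, c)} \<longleftrightarrow> \<dots>" .
  qed
  have sub: "(SIGMA r':{..<r}. {..<lam ! r'}) \<subseteq> boxes lam" "{r} \<times> {..<c} \<subseteq> boxes lam"
    using b by auto
  have inj: "inj_on rt A" if "A \<subseteq> boxes lam" for A
    using inj_on_subset[OF bij_betw_imp_inj_on[OF rt_bij] that] .
  have disj: "rt ` (SIGMA r':{..<r}. {..<lam ! r'}) \<inter> rt ` ({r} \<times> {..<c}) = {}"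
    using inj_on_image_Int[OF bij_betw_imp_inj_on[OF rt_bij] sub] by auto
  have "S.jucys_murphy (rt (r, c)) young =
      (\<Sum>j\<in>rt ` (SIGMA r':{..<r}. {..<lam ! r'}). ?g j) + (\<Sum>j\<in>rt ` ({r} \<times> {..<c}). ?g j)"
    unfolding S.jucys_murphy_def set by (rule sum.union_disjoint) (use disj in auto)
  also have "(\<Sum>j\<in>rt ` (SIGMA r':{..<r}. {..<lam ! r'}). ?g j) = (\<Sum>r'<r. \<Sum>c'<lam ! r'. ?g (rt (r', c')))"
    by (subst sum.reindex[OF inj[OF sub(1)]], subst sum.Sigma) (auto simp: case_prod_unfold)
  also have "\<dots> = (\<Sum>r'<r. - young)"
    by (intro sum.cong refl sum_row_young[OF b]) auto
  also have "(\<Sum>j\<in>rt ` ({r} \<times> {..<c}). ?g j) = (\<Sum>x\<in>{r} \<times> {..<c}. young)"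
  proof (subst sum.reindex[OF inj[OF sub(2)]], rule sum.cong[OF refl])
    fix x assume "x \<in> {r} \<times> {..<c}"
    then show "(?g \<circ> rt) x = young"
      using gact_young[OF transpose_Rg[of r _ c]] b by auto
  qed
  finally have "S.jucys_murphy (rt (r, c)) young = (\<Sum>r'<r. gscale (-1) young) + (\<Sum>x\<in>{r} \<times> {..<c}. gscale 1 young)"
    by simp
  then show ?thesis
    unfolding G.scale_sum_left[symmetric] by (simp add: G.scale_left_distrib[symmetric] del: G.scale_minus_left)
qed

end

section \<open>Young bases of Specht modules\<close>

context partition
begin

definition T_content :: "(nat \<times> nat \<Rightarrow> nat) \<Rightarrow> nat \<Rightarrow> real" where
  "T_content T k = real_of_int (box_content lam T k)"

definition tab_weight :: "(nat \<times> nat \<Rightarrow> nat) \<Rightarrow> galg \<Rightarrow> bool" where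
  "tab_weight T v \<longleftrightarrow> S.weight n S.jucys_murphy (T_content T) v"

lemma tab_weight_cong:
  "S.weight n S.jucys_murphy a v \<Longrightarrow> (\<And>k. k \<in> {1..n} \<Longrightarrow> a k = T_content T k) \<Longrightarrow> tab_weight T v"
  by (simp add: tab_weight_def S.weight_def)

lemma tab_weight_young: "tab_weight row_tab young"
  unfolding tab_weight_def S.weight_def
proof (intro conjI ballI)
  fix k assume "k \<in> {1..n}"
  then obtain r c where rc: "(r, c) \<in> boxes lam" "k = rt (r, c)" using rt_surj by blast
  then have "T_content row_tab k = of_int (int c - int r)"
    by (simp add: T_content_def box_content_eq box_of_row_tab[OF rc(1)])
  then show "S.jucys_murphy k young = gscale (complex_of_real (T_content row_tab k)) young"
    using jm_young[OF rc(1)] rc(2) by simp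
qed simp

definition specht_space :: "galg set" where "specht_space = specht lam"

lemma gmult_sum: "support a \<subseteq> {p. p permutes {1..n}} \<Longrightarrow>
    gmult a v = (\<Sum>p | p permutes {1..n}. gscale (coord a p) (gact p v))"
  by (rule trans[OF gmult_eq sum.mono_neutral_left]) (auto simp: finite_permutations in_keys_iff)

lemma galg_iff: "a \<in> galg n \<longleftrightarrow> support a \<subseteq> {p. p permutes {1..n}}"
  by (auto simp: galg_def)

lemma specht_iff: "v \<in> specht_space \<longleftrightarrow> (\<exists>f. v = (\<Sum>p | p permutes {1..n}. gscale (f p) (gact p young)))"
proof
  assume "v \<in> specht_space"
  then obtain a where "a \<in> galg n" "v = gmult a young"
    by (auto simp: specht_space_def specht_def young_def sum_lam)
  then show "\<exists>f. v = (\<Sum>p | p permutes {1..n}. gscale (f p) (gact p young))"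
    using gmult_sum galg_iff by blast
next
  assume "\<exists>f. v = (\<Sum>p | p permutes {1..n}. gscale (f p) (gact p young))"
  then obtain f where f: "v = (\<Sum>p | p permutes {1..n}. gscale (f p) (gact p young))" by blast
  define a where "a = (\<Sum>p | p permutes {1..n}. pure p (f p))"
  have coord_a: "coord a p = (if p permutes {1..n} then f p else 0)" for p
    by (simp add: a_def lookup_sum lookup_single when_def finite_permutations)
  have "a \<in> galg n" unfolding galg_iff by (auto simp: in_keys_iff coord_a split: if_splits)
  moreover have "v = gmult a young"
    using gmult_sum[of a young] \<open>a \<in> galg n\<close> unfolding galg_iff f by (simp add: coord_a)
  ultimately show "v \<in> specht_space"
    by (auto simp: specht_space_def specht_def young_def sum_lam)
qed

lemma specht_eq_span: "specht_space = G.span ((\<lambda>p. gact p young) ` {p. p permutes {1..n}})"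
proof (rule subset_antisym)
  show "specht_space \<subseteq> G.span ((\<lambda>p. gact p young) ` {p. p permutes {1..n}})"
  proof
    fix v assume "v \<in> specht_space"
    then obtain f where f: "v = (\<Sum>p | p permutes {1..n}. gscale (f p) (gact p young))" using specht_iff by blast
    show "v \<in> G.span ((\<lambda>p. gact p young) ` {p. p permutes {1..n}})"
      unfolding f by (intro G.span_sum G.span_scale, rule G.span_base) blast
  qed
  have "G.subspace specht_space"
  proof (rule G.subspaceI)
    show "0 \<in> specht_space" unfolding specht_iff by (rule exI[of _ "\<lambda>_. 0"]) simp
    show "u + v \<in> specht_space" if "u \<in> specht_space" "v \<in> specht_space" for u v
      using that unfolding specht_iff by (auto simp: sum.distrib[symmetric] G.scale_left_distrib[symmetric])
    show "gscale a v \<in> specht_space" if "v \<in> specht_space" for a v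
      using that unfolding specht_iff by (auto simp: G.scale_sum_right)
  qed
  moreover have "gact q young \<in> specht_space" if q: "q permutes {1..n}" for q
    unfolding specht_iff
  proof (rule exI)
    have "(\<Sum>p | p permutes {1..n}. gscale (if p = q then 1 else 0) (gact p young)) =
        (\<Sum>p | p permutes {1..n}. if p = q then gact q young else 0)"
      by (intro sum.cong refl) auto
    also have "\<dots> = gact q young" using q by (simp add: finite_permutations)
    finally show "gact q young = (\<Sum>p | p permutes {1..n}. gscale (if p = q then 1 else 0) (gact p young))" ..
  qed
  ultimately show "G.span ((\<lambda>p. gact p young) ` {p. p permutes {1..n}}) \<subseteq> specht_space"
    by (intro G.span_minimal) auto
qed

lemma specht_subspace: "G.subspace specht_space"
  unfolding specht_eq_span by (rule G.subspace_span)

lemma gact_span: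
  assumes q: "q permutes {1..n}" and A: "\<And>a. a \<in> A \<Longrightarrow> gact q a \<in> G.span A" and v: "v \<in> G.span A"
  shows "gact q v \<in> G.span A"
  using v
proof (induction rule: G.span_induct)
  show "G.subspace {v. gact q v \<in> G.span A}"
    by (rule G.subspaceI)
      (auto simp: S.act_zero[OF q] S.act_add[OF q] S.act_scale[OF q] G.span_zero G.span_add G.span_scale)
qed (rule A)

lemma specht_gact: "q permutes {1..n} \<Longrightarrow> v \<in> specht_space \<Longrightarrow> gact q v \<in> specht_space"
  unfolding specht_eq_span
  by (rule gact_span) (auto simp: gact_gact permutes_bij intro!: G.span_base imageI permutes_compose)

lemma young_specht: "young \<in> specht_space"
  unfolding specht_eq_span by (rule G.span_base, rule image_eqI[of _ _ id]) (auto simp: permutes_id)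

lemma specht_intertwiner: "i \<in> {1..<n} \<Longrightarrow> v \<in> specht_space \<Longrightarrow> H.intertwiner i a v \<in> specht_space"
  unfolding H.intertwiner_def
  by (intro G.subspace_add[OF specht_subspace] G.subspace_scale[OF specht_subspace] specht_gact permutes_swap_id) auto

text \<open>Positive definiteness enters here: a vector whose norm factor vanishes is itself
  zero.\<close>

lemma intertwiner_zero:
  assumes i: "i \<in> {1..<n}" and w: "tab_weight T v" and ne: "T_content T i \<noteq> T_content T (Suc i)"
    and z: "1 - (1 / (T_content T i - T_content T (Suc i)))\<^sup>2 = 0"
  shows "H.intertwiner i (T_content T) v = 0"
proof (rule ccontr)
  assume "H.intertwiner i (T_content T) v \<noteq> 0"
  then have "0 < Re (gprod (H.intertwiner i (T_content T) v) (H.intertwiner i (T_content T) v))"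
    by (rule gprod_pos)
  moreover have "gprod (H.intertwiner i (T_content T) v) (H.intertwiner i (T_content T) v) = 0"
    using H.B_intertwiner[OF i w[unfolded tab_weight_def] ne] z by simp
  ultimately show False by simp
qed

text \<open>Horizontal neighbours have contents differing by 1, so the intertwined vector vanishes,
  and its defining formula reveals the action of the transposition.\<close>

lemma gact_row_adjacent:
  assumes T: "T \<in> Std lam" and i: "i \<in> {1..<n}" and w: "tab_weight T v"
    and b: "box_of T i = (r, c)" "box_of T (Suc i) = (r, Suc c)"
  shows "gact (Transposition.transpose i (Suc i)) v = v"
proof -
  have d: "T_content T i - T_content T (Suc i) = -1" by (simp add: T_content_def box_content_eq b)
  then have "H.intertwiner i (T_content T) v = 0" by (intro intertwiner_zero[OF i w]) auto
  then show ?thesis by (simp add: H.intertwiner_def d)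
qed

lemma gact_col_adjacent:
  assumes T: "T \<in> Std lam" and i: "i \<in> {1..<n}" and w: "tab_weight T v"
    and b: "box_of T i = (r, c)" "box_of T (Suc i) = (Suc r, c)"
  shows "gact (Transposition.transpose i (Suc i)) v = - v"
proof -
  have d: "T_content T i - T_content T (Suc i) = 1" by (simp add: T_content_def box_content_eq b)
  then have "H.intertwiner i (T_content T) v = 0" by (intro intertwiner_zero[OF i w]) auto
  then show ?thesis by (simp add: H.intertwiner_def d eq_neg_iff_add_eq_0)
qed

text \<open>Entries of a row of the row tableau are consecutive, so the row group is generated by
  adjacent transpositions of horizontal neighbours, which act trivially.\<close>

lemma Rg_fixes_weight:
  assumes w: "tab_weight row_tab v" and p: "p \<in> Rg"
  shows "gact p v = v"
proof -
  define K where "K = {p. p permutes {1..n} \<and> gact p v = v}"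
  have Kc: "p \<circ> q \<in> K" if "p \<in> K" "q \<in> K" for p q
  proof -
    have pq: "p permutes {1..n}" "q permutes {1..n}" "gact p v = v" "gact q v = v" using that by (auto simp: K_def)
    have "gact (p \<circ> q) v = gact p (gact q v)" by (rule gact_gact[symmetric]) (auto intro: permutes_bij pq)
    then show ?thesis using pq by (auto simp: K_def intro: permutes_compose)
  qed
  have less: "Transposition.transpose (rt (r, c)) (rt (r, c')) \<in> K"
    if b: "(r, c') \<in> boxes lam" and cc: "c < c'" for r c c'
  proof (rule adjacent_transpositions_generate[OF Kc])
    show "rt (r, c) < rt (r, c')" using cc by (simp add: row_tableau_def)
    fix i assume i: "rt (r, c) \<le> i" "i < rt (r, c')"
    define c0 where "c0 = c + (i - rt (r, c))"
    have i_eq: "i = rt (r, c0)" "Suc i = rt (r, Suc c0)" using i by (simp_all add: c0_def row_tableau_def)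
    have "c0 < c'" using i by (simp add: i_eq row_tableau_def)
    then have bb: "(r, c0) \<in> boxes lam" "(r, Suc c0) \<in> boxes lam" using b by auto
    have ii: "i \<in> {1..<n}" using rt_in[OF bb(1)] rt_in[OF bb(2)] by (simp add: i_eq(1)[symmetric] i_eq(2)[symmetric])
    have "gact (Transposition.transpose i (Suc i)) v = v"
      by (rule gact_row_adjacent[OF row_tab_Std ii w])
        (simp_all only: i_eq(2), simp_all only: i_eq(1) box_of_row_tab[OF bb(1)] box_of_row_tab[OF bb(2)])
    then show "Transposition.transpose i (Suc i) \<in> K"
      using ii unfolding K_def by (auto intro!: permutes_swap_id)
  qed
  have "p \<in> K"
  proof (rule permutes_by_class_transpositions[of p n "\<lambda>k. fst (box_of row_tab k)" K])
    show "p permutes {1..n}" by (rule group_permutes(1)[OF p])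
    show "id \<in> K" by (simp add: K_def permutes_id del: id_apply)
    fix x assume "x \<in> {1..n}"
    then obtain r c where rc: "(r, c) \<in> boxes lam" "x = rt (r, c)" using rt_surj by blast
    obtain c' where c': "(r, c') \<in> boxes lam" "p (rt (r, c)) = rt (r, c')" using RgD[OF p rc(1)] by blast
    show "fst (box_of row_tab (p x)) = fst (box_of row_tab x)"
      unfolding rc(2) c'(2) box_of_row_tab[OF rc(1)] box_of_row_tab[OF c'(1)] by simp
  next
    fix x y assume xy: "x \<in> {1..n}" "y \<in> {1..n}" "x \<noteq> y" "fst (box_of row_tab x) = fst (box_of row_tab y)"
    obtain r c where rc: "(r, c) \<in> boxes lam" "x = rt (r, c)" using rt_surj xy by blast
    obtain r' c' where rc': "(r', c') \<in> boxes lam" "y = rt (r', c')" using rt_surj xy by blast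
    have rr: "r' = r" using xy(4) unfolding rc rc' box_of_row_tab[OF rc(1)] box_of_row_tab[OF rc'(1)] by simp
    have "c \<noteq> c'" using xy(3) rc rc' rr by auto
    then consider "c < c'" | "c' < c" by linarith
    then show "Transposition.transpose x y \<in> K"
    proof cases
      case 1
      then show ?thesis using less[of r c' c] rc rc' rr by simp
    next
      case 2
      then show ?thesis using less[of r c c'] rc rc' rr by (simp add: transpose_commute)
    qed
  qed (rule Kc)
  then show ?thesis by (simp add: K_def)
qed

text \<open>If no transposition of the row group is turned into one of the column group by conjugation
  with \<open>g\<close>, then the entries of each column of the tableau \<open>g \<circ> rt\<close> lie in distinct rows of \<open>rt\<close>;
  comparing the sums of all row numbers shows that a column with \<open>h\<close> boxes meets exactly the
  first \<open>h\<close> rows, so that \<open>g\<close> is a product of a row and a column permutation.\<close>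

lemma row_column_factorization:
  assumes g: "g permutes {1..n}"
    and distinct: "\<And>r r' c r0 c0 r0' c0'. (r, c) \<in> boxes lam \<Longrightarrow> (r', c) \<in> boxes lam \<Longrightarrow> r \<noteq> r' \<Longrightarrow>
      (r0, c0) \<in> boxes lam \<Longrightarrow> (r0', c0') \<in> boxes lam \<Longrightarrow>
      g (rt (r, c)) = rt (r0, c0) \<Longrightarrow> g (rt (r', c)) = rt (r0', c0') \<Longrightarrow> r0 \<noteq> r0'"
  obtains p q where "p \<in> Rg" "q \<in> Cg" "g = p \<circ> q"
proof -
  define bx where "bx = box_of row_tab"
  have bx: "bx (rt b) = b" if "b \<in> boxes lam" for b using box_of_row_tab[OF that] by (simp add: bx_def)
  have bx_box: "bx k \<in> boxes lam" and rt_bx: "rt (bx k) = k" if "k \<in> {1..n}" for k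
  proof -
    obtain r c where rc: "(r, c) \<in> boxes lam" "k = rt (r, c)" using rt_surj[OF \<open>k \<in> {1..n}\<close>] by blast
    then show "bx k \<in> boxes lam" "rt (bx k) = k" using bx by auto
  qed
  define G where "G = (\<lambda>b. bx (g (rt b)))"
  have gin: "g (rt b) \<in> {1..n}" if "b \<in> boxes lam" for b
    using permutes_in_image[OF g] rt_in[OF that] by blast
  have G_box: "G b \<in> boxes lam" and rt_G: "rt (G b) = g (rt b)" if "b \<in> boxes lam" for b
    using bx_box[OF gin[OF that]] rt_bx[OF gin[OF that]] by (auto simp: G_def)
  have G_inj: "inj_on G (boxes lam)"
  proof (rule inj_onI)
    fix a b assume ab: "a \<in> boxes lam" "b \<in> boxes lam" "G a = G b"
    then have "g (rt a) = g (rt b)" using rt_G by metis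
    then have "rt a = rt b" using permutes_inj[OF g] by (metis injD)
    then show "a = b" using rt_eq_iff ab by blast
  qed
  have "G ` boxes lam \<subseteq> boxes lam" using G_box by blast
  then have G_img: "G ` boxes lam = boxes lam" using G_inj by (intro endo_inj_surj finite_boxes)
  define \<rho> where "\<rho> = (\<lambda>b. fst (G b))"
  define h where "h = (\<lambda>c. card {r. (r, c) \<in> boxes lam})"
  have fin_col: "finite {r. (r, c) \<in> boxes lam}" for c
    by (rule finite_subset[of _ "{..<length lam}"]) auto
  have col: "{r. (r, c) \<in> boxes lam} = {..<h c}" for c
  proof -
    have "\<exists>m. \<forall>r. (r, c) \<in> boxes lam \<longleftrightarrow> r < m"
    proof -
      define m where "m = (LEAST m. (m, c) \<notin> boxes lam)"
      have "(length lam, c) \<notin> boxes lam" by simp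
      then have m: "(m, c) \<notin> boxes lam" unfolding m_def by (rule LeastI)
      have "(r, c) \<in> boxes lam \<longleftrightarrow> r < m" for r
        using m boxes_down[of r c m c] not_less_Least[of r "\<lambda>m. (m, c) \<notin> boxes lam"] unfolding m_def
        by (meson le_refl not_less)
      then show ?thesis by blast
    qed
    then obtain m where "\<And>r. (r, c) \<in> boxes lam \<longleftrightarrow> r < m" by metis
    then have "{r. (r, c) \<in> boxes lam} = {..<m}" by (simp only: lessThan_def)
    then show ?thesis by (simp only: h_def card_lessThan)
  qed
  have \<rho>_inj: "inj_on (\<lambda>r. \<rho> (r, c)) {..<h c}" for c
  proof (rule inj_onI)
    fix r r' assume r: "r \<in> {..<h c}" "r' \<in> {..<h c}" and eq: "\<rho> (r, c) = \<rho> (r', c)"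
    have b: "(r, c) \<in> boxes lam" "(r', c) \<in> boxes lam" using r col[of c] by blast+
    obtain r0 c0 r0' c0' where G: "G (r, c) = (r0, c0)" "G (r', c) = (r0', c0')" by fastforce
    show "r = r'"
    proof (rule ccontr)
      assume ne: "r \<noteq> r'"
      have "r0 \<noteq> r0'"
        by (rule distinct[OF b ne, of r0 c0 r0' c0'])
          (use G_box[OF b(1)] G_box[OF b(2)] rt_G[OF b(1)] rt_G[OF b(2)] in \<open>simp_all only: G\<close>)
      then show False using eq by (simp add: \<rho>_def G)
    qed
  qed
  define C where "C = snd ` boxes lam"
  have finC: "finite C" by (simp add: C_def)
  have memb: "x \<in> (SIGMA c:C. {..<h c}) \<longleftrightarrow> (snd x, fst x) \<in> boxes lam" for x
  proof -
    have "snd x < h (fst x) \<longleftrightarrow> (snd x, fst x) \<in> boxes lam" using col[of "fst x"] by blast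
    moreover have "fst x \<in> C" if "(snd x, fst x) \<in> boxes lam"
      unfolding C_def using that by (rule rev_image_eqI) simp
    ultimately show ?thesis by (cases x) auto
  qed
  have by_columns: "(\<Sum>b\<in>boxes lam. f b) = (\<Sum>c\<in>C. \<Sum>r<h c. f (r, c))" for f :: "nat \<times> nat \<Rightarrow> nat"
  proof -
    have "(\<Sum>b\<in>boxes lam. f b) = (\<Sum>x\<in>(SIGMA c:C. {..<h c}). f (snd x, fst x))"
      by (rule sum.reindex_bij_witness[of _ "\<lambda>x. (snd x, fst x)" "\<lambda>x. (snd x, fst x)"])
        (simp_all only: memb fst_conv snd_conv prod.collapse)
    then show ?thesis by (simp add: sum.Sigma finC case_prod_unfold)
  qed
  have le: "(\<Sum>r<h c. r) \<le> (\<Sum>r<h c. \<rho> (r, c))" for c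
  proof (rule ccontr)
    let ?A = "(\<lambda>r. \<rho> (r, c)) ` {..<h c}"
    assume "\<not> ?thesis"
    then have less: "(\<Sum>x\<in>?A. x) < (\<Sum>r<h c. r)" by (simp add: sum.reindex[OF \<rho>_inj])
    then have "?A = {..<h c}" by (intro sum_distinct_nat_ge) (auto simp: card_image[OF \<rho>_inj])
    then show False using less by simp
  qed
  have "(\<Sum>c\<in>C. \<Sum>r<h c. \<rho> (r, c)) = (\<Sum>b\<in>boxes lam. fst (G b))"
    by (simp add: by_columns \<rho>_def)
  also have "\<dots> = (\<Sum>b\<in>G ` boxes lam. fst b)" by (simp add: sum.reindex[OF G_inj])
  also have "\<dots> = (\<Sum>c\<in>C. \<Sum>r<h c. r)" by (simp add: G_img by_columns)
  finally have total: "(\<Sum>c\<in>C. \<Sum>r<h c. \<rho> (r, c)) = (\<Sum>c\<in>C. \<Sum>r<h c. r)" .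
  have \<rho>_img: "(\<lambda>r. \<rho> (r, c)) ` {..<h c} = {..<h c}" for c
  proof (cases "c \<in> C")
    case True
    have "(\<Sum>r<h c. \<rho> (r, c)) = (\<Sum>r<h c. r)"
    proof (rule ccontr)
      assume "\<not> ?thesis"
      then have "(\<Sum>r<h c. r) < (\<Sum>r<h c. \<rho> (r, c))" using le[of c] by linarith
      then have "(\<Sum>c\<in>C. \<Sum>r<h c. r) < (\<Sum>c\<in>C. \<Sum>r<h c. \<rho> (r, c))"
        using le True finC by (intro sum_strict_mono_ex1) auto
      then show False using total by simp
    qed
    then show ?thesis
      by (intro sum_distinct_nat_ge) (auto simp: card_image[OF \<rho>_inj] sum.reindex[OF \<rho>_inj])
  next
    case False
    then have "{..<h c} = {}" unfolding col[symmetric] C_def by (auto simp: image_iff simp del: boxes_iff)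
    then show ?thesis by simp
  qed
  \<comment> \<open>Each box first moves within its own column to the row where g will put it; what
    is left of g then preserves rows.\<close>
  define q where "q = (\<lambda>k. if k \<in> {1..n} then rt (\<rho> (bx k), snd (bx k)) else k)"
  have q_rt: "q (rt (r, c)) = rt (\<rho> (r, c), c) \<and> (\<rho> (r, c), c) \<in> boxes lam" if b: "(r, c) \<in> boxes lam" for r c
  proof -
    have "\<rho> (r, c) \<in> {..<h c}" using \<rho>_img[of c] b col[of c] by blast
    then show ?thesis using rt_in[OF b] bx[OF b] col[of c] by (auto simp: q_def simp del: boxes_iff)
  qed
  have q_perm: "q permutes {1..n}"
  proof (rule bij_imp_permutes)
    have "inj_on q {1..n}"
    proof (rule inj_onI)
      fix k k' assume k: "k \<in> {1..n}" "k' \<in> {1..n}" "q k = q k'"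
      obtain r c where rc: "(r, c) \<in> boxes lam" "k = rt (r, c)" using rt_surj k by blast
      obtain r' c' where rc': "(r', c') \<in> boxes lam" "k' = rt (r', c')" using rt_surj k by blast
      have "(\<rho> (r, c), c) = (\<rho> (r', c'), c')"
        using q_rt[OF rc(1)] q_rt[OF rc'(1)] k(3) rc rc' rt_eq_iff by metis
      then have cc: "c' = c" "\<rho> (r, c) = \<rho> (r', c)" by auto
      have "r \<in> {..<h c}" "r' \<in> {..<h c}" using rc rc' cc col[of c] by blast+
      then have "r = r'" using \<rho>_inj[of c] cc(2) by (auto dest: inj_onD)
      then show "k = k'" using rc rc' cc by simp
    qed
    moreover have "q ` {1..n} \<subseteq> {1..n}"
    proof (rule image_subsetI)
      fix k assume "k \<in> {1..n}"
      then obtain r c where rc: "(r, c) \<in> boxes lam" "k = rt (r, c)" using rt_surj by blast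
      then show "q k \<in> {1..n}" using q_rt[OF rc(1)] rt_in by simp
    qed
    ultimately show "bij_betw q {1..n} {1..n}" by (simp add: bij_betw_def endo_inj_surj)
  qed (auto simp: q_def)
  have q: "q \<in> Cg" unfolding Cg_iff using q_perm q_rt by blast
  define p where "p = g \<circ> perm_inv q"
  have p_perm: "p permutes {1..n}" unfolding p_def by (intro permutes_compose permutes_inv q_perm g)
  have "\<exists>c'. (r, c') \<in> boxes lam \<and> p (rt (r, c)) = rt (r, c')" if b: "(r, c) \<in> boxes lam" for r c
  proof -
    have "r \<in> (\<lambda>r. \<rho> (r, c)) ` {..<h c}" using \<rho>_img[of c] b col[of c] by blast
    then obtain r1 where r1: "r1 \<in> {..<h c}" "r = \<rho> (r1, c)" by blast
    have b1: "(r1, c) \<in> boxes lam" using r1(1) col[of c] by blast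
    have "q (rt (r1, c)) = rt (r, c)" using q_rt[OF b1] r1 by simp
    then have "perm_inv q (rt (r, c)) = rt (r1, c)" using permutes_inverses(2)[OF q_perm] by metis
    then have "p (rt (r, c)) = rt (G (r1, c))" using rt_G[OF b1] by (simp add: p_def)
    moreover have "G (r1, c) = (r, snd (G (r1, c)))" using r1(2) by (simp add: \<rho>_def)
    ultimately show ?thesis using G_box[OF b1] by metis
  qed
  then have p: "p \<in> Rg" unfolding Rg_iff using p_perm by blast
  have "g = p \<circ> q" using permutes_inverses(2)[OF q_perm] by (simp add: p_def fun_eq_iff)
  then show ?thesis using that p q by blast
qed

text \<open>Von Neumann's dichotomy: either g brings two entries of one column into one row, and the
  sum cancels in pairs, or g is a row times a column permutation, and the sum is the Young
  symmetrizer up to sign.\<close>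

lemma row_sum_col_antisym:
  assumes g: "g permutes {1..n}"
  shows "(\<Sum>p\<in>Rg. gact p (gact g col_antisym)) \<in> G.span {young}"
proof (cases "\<exists>r r' c r0 c0 c0'. (r, c) \<in> boxes lam \<and> (r', c) \<in> boxes lam \<and> r \<noteq> r' \<and>
      (r0, c0) \<in> boxes lam \<and> (r0, c0') \<in> boxes lam \<and> g (rt (r, c)) = rt (r0, c0) \<and> g (rt (r', c)) = rt (r0, c0')")
  case True
  then obtain r r' c r0 c0 c0' where b: "(r, c) \<in> boxes lam" "(r', c) \<in> boxes lam" "r \<noteq> r'"
      "(r0, c0) \<in> boxes lam" "(r0, c0') \<in> boxes lam" "g (rt (r, c)) = rt (r0, c0)" "g (rt (r', c)) = rt (r0, c0')"
    by blast
  have "gact (Transposition.transpose (rt (r0, c0)) (rt (r0, c0'))) (gact g col_antisym) =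
      gact g (gact (Transposition.transpose (rt (r, c)) (rt (r', c))) col_antisym)"
    using S.act_conj[OF g rt_in[OF b(1)] rt_in[OF b(2)]] b by simp
  also have "\<dots> = gact g (gscale (-1) col_antisym)"
    using gact_transpose_col_antisym[OF b(1-3)] by simp
  also have "\<dots> = - gact g col_antisym" using S.act_scale[OF g, of "-1"] by simp
  finally have "(\<Sum>p\<in>Rg. gact p (gact g col_antisym)) = 0"
    by (intro sum_gact_antisymmetric) (auto intro: group_bij group_comp transpose_Rg b)
  then show ?thesis by (simp add: G.span_zero)
next
  case False
  obtain p0 q where pq: "p0 \<in> Rg" "q \<in> Cg" "g = p0 \<circ> q"
    by (rule row_column_factorization[OF g]) (use False in blast)+
  have inj: "inj_on (\<lambda>p. p \<circ> p0) Rg"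
  proof (rule inj_onI)
    fix p p' assume "p \<circ> p0 = p' \<circ> p0"
    then show "p = p'" using bij_is_surj[OF group_bij(1)[OF pq(1)]] by (metis surj_iff comp_assoc comp_id)
  qed
  have "(\<lambda>p. p \<circ> p0) ` Rg \<subseteq> Rg" using group_comp(1) pq(1) by blast
  then have img: "(\<lambda>p. p \<circ> p0) ` Rg = Rg" using inj finite_groups(1) by (intro endo_inj_surj)
  have "(\<Sum>p\<in>Rg. gact p (gact g col_antisym)) = (\<Sum>p\<in>Rg. gscale (of_int (sign q)) (gact (p \<circ> p0) col_antisym))"
  proof (rule sum.cong[OF refl])
    fix p assume p: "p \<in> Rg"
    have "gact p (gact g col_antisym) = gact p (gact p0 (gact q col_antisym))"
      unfolding pq(3) using gact_gact[OF group_bij(1)[OF pq(1)] group_bij(2)[OF pq(2)]] by simp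
    also have "\<dots> = gscale (of_int (sign q)) (gact p (gact p0 col_antisym))"
      by (simp only: gact_col_antisym[OF pq(2)] gact_gscale)
    also have "gact p (gact p0 col_antisym) = gact (p \<circ> p0) col_antisym"
      by (rule gact_gact[OF group_bij(1)[OF p] group_bij(1)[OF pq(1)]])
    finally show "gact p (gact g col_antisym) = gscale (of_int (sign q)) (gact (p \<circ> p0) col_antisym)" .
  qed
  also have "\<dots> = gscale (of_int (sign q)) (\<Sum>p\<in>(\<lambda>p. p \<circ> p0) ` Rg. gact p col_antisym)"
    by (simp add: sum.reindex[OF inj] G.scale_sum_right)
  also have "\<dots> = gscale (of_int (sign q)) young" unfolding img young_eq ..
  finally show ?thesis by (simp add: G.span_scale G.span_base)
qed

text \<open>A vector of this weight is its own average over the row group, and averaging sends the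
  whole Specht module into the line of the Young symmetrizer.\<close>

lemma row_weight_unique:
  assumes v: "v \<in> specht_space" and w: "tab_weight row_tab v"
  shows "v \<in> G.span {young}"
proof -
  have idR: "id \<in> Rg" by (auto simp: Rg_iff permutes_id)
  then have cR: "complex_of_nat (card Rg) \<noteq> 0" using finite_groups(1) by auto
  have v_eq: "gscale (of_nat (card Rg)) v = (\<Sum>p\<in>Rg. gact p v)"
  proof -
    have "(\<Sum>p\<in>Rg. gact p v) = (\<Sum>p\<in>Rg. gscale 1 v)"
      by (intro sum.cong refl) (simp add: Rg_fixes_weight[OF w])
    also have "\<dots> = gscale (of_nat (card Rg)) v" by (simp only: G.scale_sum_left[symmetric]) simp
    finally show ?thesis ..
  qed
  have "(\<Sum>p\<in>Rg. gact p v) \<in> G.span {young}"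
  proof -
    obtain f where f: "v = (\<Sum>g | g permutes {1..n}. gscale (f g) (gact g young))" using v specht_iff by blast
    have "(\<Sum>p\<in>Rg. gact p v) = (\<Sum>p\<in>Rg. \<Sum>g | g permutes {1..n}. gscale (f g) (\<Sum>p'\<in>Rg. gact p (gact (g \<circ> p') col_antisym)))"
    proof (rule sum.cong[OF refl])
      fix p assume p: "p \<in> Rg"
      have "gact p (gact g young) = (\<Sum>p'\<in>Rg. gact p (gact (g \<circ> p') col_antisym))" if g: "g permutes {1..n}" for g
      proof -
        have "gact g young = (\<Sum>p'\<in>Rg. gact (g \<circ> p') col_antisym)"
          unfolding young_eq S.act_sum[OF g] by (intro sum.cong refl gact_gact permutes_bij[OF g] group_bij(1))
        then show ?thesis by (simp add: S.act_sum[OF group_permutes(1)[OF p]])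
      qed
      then show "gact p v = (\<Sum>g | g permutes {1..n}. gscale (f g) (\<Sum>p'\<in>Rg. gact p (gact (g \<circ> p') col_antisym)))"
        unfolding f S.act_sum[OF group_permutes(1)[OF p]] S.act_scale[OF group_permutes(1)[OF p]]
        by (intro sum.cong refl) simp
    qed
    also have "\<dots> = (\<Sum>g | g permutes {1..n}. gscale (f g) (\<Sum>p'\<in>Rg. \<Sum>p\<in>Rg. gact p (gact (g \<circ> p') col_antisym)))"
      by (subst sum.swap, intro sum.cong refl) (subst sum.swap, simp add: G.scale_sum_right)
    also have "\<dots> \<in> G.span {young}"
      by (intro G.span_sum G.span_scale row_sum_col_antisym) (auto intro: permutes_compose group_permutes)
    finally show ?thesis .
  qed
  then have "gscale (inverse (of_nat (card Rg))) (gscale (of_nat (card Rg)) v) \<in> G.span {young}"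
    unfolding v_eq by (rule G.span_scale)
  then show ?thesis using cR by simp
qed

text \<open>One-dimensionality holds for the row tableau and is carried along the exchanges, since
  the intertwiner and its reverse compose to a nonzero scalar.\<close>

lemma tab_weight_space:
  assumes "T \<in> Std lam"
  shows "\<exists>v. v \<in> specht_space \<and> v \<noteq> 0 \<and> tab_weight T v \<and> (\<forall>w. w \<in> specht_space \<longrightarrow> tab_weight T w \<longrightarrow> w \<in> G.span {v})"
  using assms
proof (induction rule: Std_induct)
  case row_tab
  show ?case using young_specht young_nonzero tab_weight_young row_weight_unique by blast
next
  case (swap T i)
  then obtain v where v: "v \<in> specht_space" "v \<noteq> 0" "tab_weight T v"
      "\<And>w. w \<in> specht_space \<Longrightarrow> tab_weight T w \<Longrightarrow> w \<in> G.span {v}" by blast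
  note i = swap(2) and T = swap(1) and T' = swap(3)
  let ?T = "swap_tab i T" and ?s = "Transposition.transpose i (Suc i)"
  have ii: "i \<in> {1..n}" "Suc i \<in> {1..n}" using i by auto
  have content: "T_content ?T k = (T_content T \<circ> ?s) k" if "k \<in> {1..n}" for k
    by (simp add: T_content_def box_content_eq box_of_swap_tab[OF T T' i that])
  let ?d = "T_content T i - T_content T (Suc i)"
  have d: "\<bar>?d\<bar> \<ge> 2" using swap(4) by (simp add: T_content_def)
  have ne: "T_content T i \<noteq> T_content T (Suc i)" using d by auto
  \<comment> \<open>The factor vanishes only for contents at distance 1, but they are at least 2
    apart.\<close>
  have factor: "1 - (1 / ?d)\<^sup>2 \<noteq> 0"
  proof
    assume "1 - (1 / ?d)\<^sup>2 = 0"
    then have "?d\<^sup>2 = 1" by (simp add: power_divide divide_eq_eq split: if_splits)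
    then have "\<bar>?d\<bar> = 1" by (simp add: power2_eq_1_iff abs_if) linarith
    then show False using d by simp
  qed
  have nonzero: "H.intertwiner i a v \<noteq> 0" if w: "S.weight n S.jucys_murphy a v" "v \<noteq> 0"
      and a: "a i \<noteq> a (Suc i)" "1 - (1 / (a i - a (Suc i)))\<^sup>2 \<noteq> 0" for a v
  proof
    assume "H.intertwiner i a v = 0"
    then have "complex_of_real (1 - (1 / (a i - a (Suc i)))\<^sup>2) * gprod v v = 0"
      using H.B_intertwiner[OF i w(1) a(1)] by simp
    then show False using a(2) gprod_pos[OF w(2)] by (simp only: mult_eq_0_iff of_real_eq_0_iff) auto
  qed
  let ?v = "H.intertwiner i (T_content T) v"
  have w: "S.weight n S.jucys_murphy (T_content T) v" using v(3) by (simp add: tab_weight_def)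
  have "tab_weight ?T ?v"
    by (rule tab_weight_cong[OF H.weight_intertwiner[OF i w ne]]) (simp only: content)
  moreover have "?v \<in> specht_space" by (rule specht_intertwiner[OF i v(1)])
  moreover have "?v \<noteq> 0" by (rule nonzero[OF w v(2) ne factor])
  moreover have "u \<in> G.span {?v}" if u: "u \<in> specht_space" "tab_weight ?T u" for u
  proof -
    let ?a = "T_content T \<circ> ?s"
    have wu: "S.weight n S.jucys_murphy ?a u"
      using u(2) content by (simp add: tab_weight_def S.weight_def)
    have ne': "?a i \<noteq> ?a (Suc i)" using ne by simp
    have "tab_weight T (H.intertwiner i ?a u)"
      by (rule tab_weight_cong[OF H.weight_intertwiner[OF i wu ne']]) simp
    then have "H.intertwiner i ?a u \<in> G.span {v}" using v(4) specht_intertwiner[OF i u(1)] by blast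
    then obtain k where k: "H.intertwiner i ?a u = gscale k v"
      by (auto simp: G.span_singleton)
    have lin: "H.intertwiner i (T_content T) (gscale k v) = gscale k ?v"
      unfolding H.intertwiner_def using S.act_scale[OF permutes_swap_id[OF ii]]
      by (simp add: G.scale_right_distrib mult.commute)
    have a_s: "?a \<circ> ?s = T_content T" by (simp add: comp_assoc)
    have "?a i - ?a (Suc i) = - ?d" by simp
    then have sq: "(1 / (?a i - ?a (Suc i)))\<^sup>2 = (1 / ?d)\<^sup>2" by (simp only: divide_minus_right power2_minus)
    have e: "gscale (complex_of_real (1 - (1 / ?d)\<^sup>2)) u = gscale k ?v"
      using H.intertwiner_intertwiner[OF i wu ne'] unfolding a_s k lin sq by (rule sym)
    have "gscale (inverse (complex_of_real (1 - (1 / ?d)\<^sup>2))) (gscale (complex_of_real (1 - (1 / ?d)\<^sup>2)) u) \<in> G.span {?v}"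
      unfolding e by (intro G.span_scale G.span_base) simp
    moreover have "complex_of_real (1 - (1 / ?d)\<^sup>2) \<noteq> 0" using factor by (simp only: of_real_eq_0_iff) simp
    ultimately show ?thesis by (simp only: G.scale_scale left_inverse G.scale_one) simp
  qed
  ultimately show ?case by blast
qed

text \<open>Uniqueness of weight vectors keeps intertwined vectors in the span, which is therefore
  stable under adjacent transpositions and so under the group. It contains the Young symmetrizer,
  which generates the module.\<close>

lemma specht_tableau_basis:
  obtains v where "\<And>T. T \<in> Std lam \<Longrightarrow> v T \<in> specht_space \<and> v T \<noteq> 0 \<and> tab_weight T (v T)"
    "specht_space \<subseteq> G.span (v ` Std lam)"
proof -
  obtain v where v: "\<And>T. T \<in> Std lam \<Longrightarrow> v T \<in> specht_space \<and> v T \<noteq> 0 \<and> tab_weight T (v T) \<and>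
      (\<forall>w. w \<in> specht_space \<longrightarrow> tab_weight T w \<longrightarrow> w \<in> G.span {v T})"
    using tab_weight_space by metis
  let ?U = "G.span (v ` Std lam)"
  have E: "w \<in> ?U" if "T \<in> Std lam" "w \<in> specht_space" "tab_weight T w" for T w
  proof -
    have "w \<in> G.span {v T}" using v that by blast
    moreover have "G.span {v T} \<subseteq> ?U" using that(1) by (intro G.span_mono) auto
    ultimately show ?thesis by blast
  qed
  have adj: "gact (Transposition.transpose i (Suc i)) (v T) \<in> ?U" if T: "T \<in> Std lam" and i: "i \<in> {1..<n}" for T i
  proof -
    have vT: "v T \<in> specht_space" "v T \<noteq> 0" "tab_weight T (v T)" using v[OF T] by auto
    have base: "v T \<in> ?U" using T by (intro G.span_base) auto
    show ?thesis
    proof (rule swap_tab_cases[OF T i])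
      fix r c assume "box_of T i = (r, c)" "box_of T (Suc i) = (r, Suc c)"
      then show ?thesis using gact_row_adjacent[OF T i vT(3)] base by simp
    next
      fix r c assume "box_of T i = (r, c)" "box_of T (Suc i) = (Suc r, c)"
      then show ?thesis using gact_col_adjacent[OF T i vT(3)] G.span_neg[OF base] by simp
    next
      assume T': "swap_tab i T \<in> Std lam" and d: "2 \<le> \<bar>box_content lam T (Suc i) - box_content lam T i\<bar>"
      have ne: "T_content T i \<noteq> T_content T (Suc i)" using d by (auto simp: T_content_def)
      have "tab_weight (swap_tab i T) (H.intertwiner i (T_content T) (v T))"
        by (rule tab_weight_cong[OF H.weight_intertwiner[OF i vT(3)[unfolded tab_weight_def] ne]])
          (simp add: T_content_def box_content_eq box_of_swap_tab[OF T T' i])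
      then have "H.intertwiner i (T_content T) (v T) \<in> ?U"
        using E[OF T'] specht_intertwiner[OF i vT(1)] by blast
      then have "H.intertwiner i (T_content T) (v T) -
          gscale (complex_of_real (1 / (T_content T i - T_content T (Suc i)))) (v T) \<in> ?U"
        by (intro G.span_diff G.span_scale base)
      then show ?thesis by (simp add: H.intertwiner_def)
    qed
  qed
  define K where "K = {p. p permutes {1..n} \<and> (\<forall>u\<in>?U. gact p u \<in> ?U)}"
  have Kc: "p \<circ> q \<in> K" if "p \<in> K" "q \<in> K" for p q
  proof -
    have pq: "p permutes {1..n}" "q permutes {1..n}" "\<And>u. u \<in> ?U \<Longrightarrow> gact p u \<in> ?U" "\<And>u. u \<in> ?U \<Longrightarrow> gact q u \<in> ?U"
      using that by (auto simp: K_def)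
    have "gact (p \<circ> q) u = gact p (gact q u)" for u by (rule gact_gact[symmetric]) (auto intro: permutes_bij pq)
    then show ?thesis unfolding K_def using pq(3,4) permutes_compose[OF pq(2,1)] by simp
  qed
  have less: "Transposition.transpose x y \<in> K" if xy: "x \<in> {1..n}" "y \<in> {1..n}" "x < y" for x y
  proof (rule adjacent_transpositions_generate[OF Kc _ xy(3)])
    fix i assume "x \<le> i" "i < y"
    then have i: "i \<in> {1..<n}" using xy by auto
    then have s: "Transposition.transpose i (Suc i) permutes {1..n}" by (intro permutes_swap_id) auto
    have "gact (Transposition.transpose i (Suc i)) u \<in> ?U" if "u \<in> ?U" for u
      by (rule gact_span[OF s _ that]) (use adj[OF _ i] in blast)
    then show "Transposition.transpose i (Suc i) \<in> K" using s by (simp add: K_def)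
  qed
  have all: "p \<in> K" if p: "p permutes {1..n}" for p
  proof (rule permutes_by_class_transpositions[OF p, of "\<lambda>_. ()" K])
    show "id \<in> K" by (simp add: K_def permutes_id del: id_apply)
    fix x y assume xy: "x \<in> {1..n}" "y \<in> {1..n}" "x \<noteq> y"
    then consider "x < y" | "y < x" by linarith
    then show "Transposition.transpose x y \<in> K"
    proof cases
      case 1
      then show ?thesis using less xy by blast
    next
      case 2
      then show ?thesis using less[OF xy(2,1)] by (simp add: transpose_commute)
    qed
  qed (auto intro: Kc)
  have "young \<in> ?U" using E[OF row_tab_Std young_specht tab_weight_young] .
  then have "specht_space \<subseteq> ?U"
    unfolding specht_eq_span using all by (intro G.span_minimal G.subspace_span) (auto simp: K_def)
  then show ?thesis using that[of v] v by blast
qed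

end

section \<open>Words in the generators and the contravariant form\<close>

lemma coord_fscale [simp]: "coord (fscale a u) w = gscale a (coord u w)"
  by (simp add: fscale_def gscale_def Poly_Mapping.map.rep_eq when_def)
    (auto intro!: poly_mapping_eqI simp: Poly_Mapping.map.rep_eq when_def)

lemma fscale_vector_space: "vector_space fscale"
  by unfold_locales (auto intro!: poly_mapping_eqI simp: lookup_add algebra_simps)

interpretation F: vector_space fscale by (rule fscale_vector_space)

lemma fscale_pure [simp]: "fscale a (pure w v) = pure w (gscale a v)"
  by (rule poly_mapping_eqI) (auto simp: lookup_single when_def)

lemma lin_ext_fscale:
  assumes "\<And>w v. f w (gscale a v) = g (f w v)" "\<And>u v. g (u + v) = g u + g v" "g 0 = 0" "\<And>w. f w 0 = 0"
  shows "lin_ext f (fscale a u) = g (lin_ext f u)"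
proof -
  have "support (fscale a u) \<subseteq> support u" by (auto simp: in_keys_iff)
  then have "lin_ext f (fscale a u) = (\<Sum>w\<in>support u. g (f w (coord u w)))"
    by (simp add: lin_ext_superset[of "support u"] assms)
  also have "\<dots> = g (lin_ext f u)"
  proof -
    have g_sum: "(\<Sum>w\<in>S. g (h w)) = g (\<Sum>w\<in>S. h w)" if "finite S" for S h
      using that by induction (simp_all add: assms)
    show ?thesis unfolding lin_ext_def by (rule g_sum) simp
  qed
  finally show ?thesis .
qed

lemma gen_act_lin_ext: "gen_act g u = lin_ext (\<lambda>w v. pure (g # w) v) u"
  by (simp add: gen_act_def lin_ext_def)

lemma gen_act_pure [simp]: "gen_act g (pure w v) = pure (g # w) v"
  by (simp add: gen_act_lin_ext lin_ext_single)

lemma gen_act_add: "gen_act g (u + v) = gen_act g u + gen_act g v"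
  unfolding gen_act_lin_ext by (rule lin_ext_add) (rule single_add)

lemma gen_act_fscale: "gen_act g (fscale a u) = fscale a (gen_act g u)"
  unfolding gen_act_lin_ext by (rule lin_ext_fscale) (simp_all add: F.scale_right_distrib)

lemma gen_act_zero [simp]: "gen_act g 0 = 0"
  by (simp add: gen_act_lin_ext)

lemma gen_act_diff: "gen_act g (u - v) = gen_act g u - gen_act g v"
  using gen_act_add[of g "u - v" v] by (simp add: algebra_simps)

lemma coord_gen_act: "coord (gen_act g u) w = (case w of [] \<Rightarrow> 0 | h # w' \<Rightarrow> if h = g then coord u w' else 0)"
proof (induction u rule: poly_mapping_additive_induct)
  case (single w' a)
  show ?case by (auto simp: lookup_single when_def split: list.split)
qed (auto simp: gen_act_add lookup_add split: list.split)

text \<open>The module spanned by the words in the \<open>X i\<close>, before the \<open>X i\<close> are made to commute. All other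
  relations of the Cherednik algebra hold in it exactly, with \<open>Y i\<close> acting by the operators below.\<close>

fun relabel :: "(nat \<Rightarrow> nat) \<Rightarrow> gen \<Rightarrow> gen" where
  "relabel p (X i) = X (p i)"
| "relabel p g = g"

definition word_act :: "(nat \<Rightarrow> nat) \<Rightarrow> fmod \<Rightarrow> fmod" where
  "word_act p u = lin_ext (\<lambda>w v. pure (map (relabel p) w) (gact p v)) u"

lemma word_act_pure [simp]: "word_act p (pure w v) = pure (map (relabel p) w) (gact p v)"
  by (simp add: word_act_def lin_ext_single)

lemma word_act_add: "word_act p (u + v) = word_act p u + word_act p v"
  unfolding word_act_def by (rule lin_ext_add) (simp add: gact_add single_add)

lemma word_act_fscale: "word_act p (fscale a u) = fscale a (word_act p u)"
  unfolding word_act_def by (rule lin_ext_fscale) (simp_all add: F.scale_right_distrib gact_gscale)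

lemma word_act_zero [simp]: "word_act p 0 = 0"
  by (simp add: word_act_def)

lemma word_act_diff: "word_act p (u - v) = word_act p u - word_act p v"
  using word_act_add[of p "u - v" v] by (simp add: algebra_simps)

lemma word_act_sum: "word_act p (\<Sum>i\<in>I. f i) = (\<Sum>i\<in>I. word_act p (f i))"
  by (induction I rule: infinite_finite_induct) (simp_all add: word_act_add)

lemma word_act_comp: "bij p \<Longrightarrow> bij q \<Longrightarrow> word_act p (word_act q u) = word_act (p \<circ> q) u"
proof (induction u rule: poly_mapping_additive_induct)
  case (single w v)
  have "relabel p \<circ> relabel q = relabel (p \<circ> q)"
    by (rule ext, rename_tac g, case_tac g) simp_all
  then show ?case by (simp only: word_act_pure list.map_comp gact_gact[OF single])
qed (simp_all add: word_act_add)

lemma word_act_id [simp]: "word_act id u = u"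
proof (induction u rule: poly_mapping_additive_induct)
  case (single w v)
  have "relabel id = id" by (rule ext, rename_tac g, case_tac g) auto
  then show ?case by (simp only: word_act_pure list.map_id gact_id)
qed (simp_all add: word_act_add)

lemma word_act_X: "word_act p (gen_act (X i) u) = gen_act (X (p i)) (word_act p u)"
  by (induction u rule: poly_mapping_additive_induct) (simp_all add: gen_act_add word_act_add)

lemma coord_word_act_Nil: "coord (word_act p u) [] = gact p (coord u [])"
  by (induction u rule: poly_mapping_additive_induct)
    (auto simp: word_act_add lookup_add gact_add lookup_single when_def)

definition yx_comm :: "nat \<Rightarrow> real \<Rightarrow> nat \<Rightarrow> nat \<Rightarrow> fmod \<Rightarrow> fmod" where
  "yx_comm n c i j u = (if i = j
    then u - fscale (of_real c) (\<Sum>l\<in>{1..n} - {i}. word_act (Transposition.transpose i l) u)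
    else fscale (of_real c) (word_act (Transposition.transpose i j) u))"

lemma yx_comm_same: "yx_comm n c i i u =
    u - fscale (of_real c) (\<Sum>l\<in>{1..n} - {i}. word_act (Transposition.transpose i l) u)"
  and yx_comm_neq: "i \<noteq> j \<Longrightarrow> yx_comm n c i j u = fscale (of_real c) (word_act (Transposition.transpose i j) u)"
  by (simp_all only: yx_comm_def if_True if_False refl)

lemma yx_comm_add: "yx_comm n c i j (u + v) = yx_comm n c i j u + yx_comm n c i j v"
  by (simp add: yx_comm_def word_act_add F.scale_right_distrib sum.distrib)

lemma yx_comm_zero [simp]: "yx_comm n c i j 0 = 0"
  by (simp add: yx_comm_def)

lemma yx_comm_fscale: "yx_comm n c i j (fscale a u) = fscale a (yx_comm n c i j u)"
proof -
  have sum: "(\<Sum>l\<in>A. word_act (Transposition.transpose i l) (fscale a u)) =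
      fscale a (\<Sum>l\<in>A. word_act (Transposition.transpose i l) u)" for A
    by (simp only: word_act_fscale F.scale_sum_right)
  show ?thesis
  proof (cases "i = j")
    case True
    then show ?thesis
      unfolding True yx_comm_same by (simp only: sum[unfolded True] F.scale_left_commute[of "of_real c" a] F.scale_right_diff_distrib)
  next
    case False
    then show ?thesis
      by (simp only: yx_comm_neq[OF False] word_act_fscale F.scale_left_commute[of "of_real c" a])
  qed
qed

text \<open>\<open>Y i\<close> is commuted through the word down to the lowest space, which it
  kills. The second equation also serves as a default for words with other letters, which lie
  outside \<open>X_module\<close>.\<close>

fun y_word :: "nat \<Rightarrow> real \<Rightarrow> nat \<Rightarrow> gen list \<Rightarrow> galg \<Rightarrow> fmod" where
  "y_word n c i (X j # w) v = gen_act (X j) (y_word n c i w v) + yx_comm n c i j (pure w v)"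
| "y_word n c i w v = 0"

lemma y_word_add: "y_word n c i w (u + v) = y_word n c i w u + y_word n c i w v"
  by (induction n c i w v rule: y_word.induct) (simp_all add: gen_act_add single_add yx_comm_add)

lemma y_word_zero [simp]: "y_word n c i w 0 = 0"
  using y_word_add[of n c i w 0 0] by simp

lemma y_word_gscale: "y_word n c i w (gscale a v) = fscale a (y_word n c i w v)"
  by (induction n c i w v rule: y_word.induct)
    (simp_all add: gen_act_fscale F.scale_right_distrib yx_comm_fscale[symmetric])

definition y_act :: "nat \<Rightarrow> real \<Rightarrow> nat \<Rightarrow> fmod \<Rightarrow> fmod" where
  "y_act n c i u = lin_ext (y_word n c i) u"

lemma y_act_pure [simp]: "y_act n c i (pure w v) = y_word n c i w v"
  by (simp add: y_act_def lin_ext_single)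

lemma y_act_add: "y_act n c i (u + v) = y_act n c i u + y_act n c i v"
  unfolding y_act_def by (rule lin_ext_add) (rule y_word_add)

lemma y_act_fscale: "y_act n c i (fscale a u) = fscale a (y_act n c i u)"
  unfolding y_act_def by (rule lin_ext_fscale) (simp_all add: F.scale_right_distrib y_word_gscale)

lemma y_act_zero [simp]: "y_act n c i 0 = 0"
  by (simp add: y_act_def)

lemma y_act_diff: "y_act n c i (u - v) = y_act n c i u - y_act n c i v"
  using y_act_add[of n c i "u - v" v] by (simp add: algebra_simps)

lemma y_act_sum: "y_act n c i (\<Sum>l\<in>I. f l) = (\<Sum>l\<in>I. y_act n c i (f l))"
  by (induction I rule: infinite_finite_induct) (simp_all add: y_act_add)

lemma y_act_X: "y_act n c i (gen_act (X j) u) = gen_act (X j) (y_act n c i u) + yx_comm n c i j u"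
  by (induction u rule: poly_mapping_additive_induct) (simp_all add: gen_act_add y_act_add yx_comm_add ac_simps)

lemma word_act_transpose:
  assumes "p permutes {1..n}"
  shows "word_act p (word_act (Transposition.transpose i l) u) =
    word_act (Transposition.transpose (p i) (p l)) (word_act p u)"
proof -
  have "p \<circ> Transposition.transpose i l = Transposition.transpose (p i) (p l) \<circ> p"
    using permutes_inj[OF assms] by (auto simp: fun_eq_iff Transposition.transpose_def dest: injD)
  then show ?thesis using permutes_bij[OF assms] by (simp add: word_act_comp)
qed

lemma word_act_yx_comm:
  assumes p: "p permutes {1..n}"
  shows "word_act p (yx_comm n c i j u) = yx_comm n c (p i) (p j) (word_act p u)"
proof -
  have inj: "p i = p j \<longleftrightarrow> i = j" using permutes_inj[OF p] by (auto dest: injD)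
  have sum: "(\<Sum>l\<in>{1..n} - {i}. word_act p (word_act (Transposition.transpose i l) u)) =
      (\<Sum>l\<in>{1..n} - {p i}. word_act (Transposition.transpose (p i) l) (word_act p u))"
  proof (rule sum.reindex_bij_witness[of _ "perm_inv p" p])
    fix l assume "l \<in> {1..n} - {i}"
    then show "perm_inv p (p l) = l" "p l \<in> {1..n} - {p i}"
      using permutes_inverses(2)[OF p] permutes_in_image[OF p] permutes_inj[OF p] by (auto dest: injD)
  next
    fix l assume l: "l \<in> {1..n} - {p i}"
    show "p (perm_inv p l) = l" by (rule permutes_inverses(1)[OF p])
    moreover have "perm_inv p l \<in> {1..n}" using permutes_in_image[OF permutes_inv[OF p]] l by blast
    ultimately show "perm_inv p l \<in> {1..n} - {i}" using l by auto
  qed (simp add: word_act_transpose[OF p])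
  show ?thesis
  proof (cases "i = j")
    case True
    then show ?thesis
      unfolding True yx_comm_same by (simp only: word_act_diff word_act_fscale word_act_sum sum[unfolded True])
  next
    case False
    then have "p i \<noteq> p j" using inj by simp
    then show ?thesis
      by (simp only: yx_comm_neq[OF False] yx_comm_neq[OF \<open>p i \<noteq> p j\<close>] word_act_fscale word_act_transpose[OF p])
  qed
qed

lemma word_act_y_act:
  assumes p: "p permutes {1..n}"
  shows "word_act p (y_act n c i u) = y_act n c (p i) (word_act p u)"
proof (induction u rule: poly_mapping_additive_induct)
  case (single w v)
  show ?case
  proof (induction w)
    case (Cons g w)
    show ?case
    proof (cases g)
      case (X j)
      then show ?thesis
        using Cons by (simp add: word_act_add word_act_X word_act_yx_comm[OF p])
    qed simp_all
  qed simp
qed (simp_all add: word_act_add y_act_add)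

lemma y_act_transpose:
  assumes "i \<in> {1..n}" "j \<in> {1..n}"
  shows "y_act n c k (word_act (Transposition.transpose i j) u) =
    word_act (Transposition.transpose i j) (y_act n c (Transposition.transpose i j k) u)"
  using word_act_y_act[OF permutes_swap_id[OF assms], of c "Transposition.transpose i j k" u] by simp

text \<open>These are the terms left when \<open>Y i\<close> and \<open>Y j\<close> pass a letter
  \<open>X k\<close>; their symmetry in i and j makes the Y operators commute. If k is different
  from i and j, each transposition commutes with the other operator. If k = i, the terms with the
  transposition of i and j cancel on each side.\<close>

lemma yx_comm_swap:
  assumes ij: "i \<in> {1..n}" "j \<in> {1..n}" "k \<in> {1..n}"
  shows "yx_comm n c i k (y_act n c j u) + y_act n c i (yx_comm n c j k u) =
    yx_comm n c j k (y_act n c i u) + y_act n c j (yx_comm n c i k u)"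
proof -
  have diag: "yx_comm n c i i (y_act n c j u) + y_act n c i (yx_comm n c j i u) =
      yx_comm n c j i (y_act n c i u) + y_act n c j (yx_comm n c i i u)"
    if ne: "i \<noteq> j" and ij: "i \<in> {1..n}" "j \<in> {1..n}" for i j
  proof -
    let ?t = "\<lambda>l. word_act (Transposition.transpose i l)" and ?A = "{1..n} - {i} - {j}"
    have j: "finite ({1..n} - {i})" "j \<in> {1..n} - {i}" using ij ne by auto
    have s1: "(\<Sum>l\<in>{1..n} - {i}. ?t l w) = ?t j w + (\<Sum>l\<in>?A. ?t l w)" for w
      using j by (rule sum.remove)
    have s2: "(\<Sum>l\<in>{1..n} - {i}. y_act n c j (?t l u)) = ?t j (y_act n c i u) + (\<Sum>l\<in>?A. ?t l (y_act n c j u))"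
    proof -
      have "(\<Sum>l\<in>{1..n} - {i}. y_act n c j (?t l u)) = y_act n c j (?t j u) + (\<Sum>l\<in>?A. y_act n c j (?t l u))"
        using j by (rule sum.remove)
      also have "y_act n c j (?t j u) = ?t j (y_act n c i u)" using y_act_transpose[OF ij] by simp
      also have "(\<Sum>l\<in>?A. y_act n c j (?t l u)) = (\<Sum>l\<in>?A. ?t l (y_act n c j u))"
        using ij ne by (intro sum.cong refl) (subst y_act_transpose, auto)
      finally show ?thesis .
    qed
    have s3: "y_act n c i (?t j u) = ?t j (y_act n c j u)" using y_act_transpose[OF ij] by simp
    have ji: "j \<noteq> i" using ne by simp
    have "y_act n c i (yx_comm n c j i u) = fscale (of_real c) (?t j (y_act n c j u))"
      unfolding yx_comm_neq[OF ji] transpose_commute[of j i] y_act_fscale s3 ..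
    moreover have "yx_comm n c j i (y_act n c i u) = fscale (of_real c) (?t j (y_act n c i u))"
      unfolding yx_comm_neq[OF ji] transpose_commute[of j i] ..
    moreover have "y_act n c j (yx_comm n c i i u) =
        y_act n c j u - fscale (of_real c) (?t j (y_act n c i u) + (\<Sum>l\<in>?A. ?t l (y_act n c j u)))"
      unfolding yx_comm_same y_act_diff y_act_fscale y_act_sum s2 ..
    moreover have "yx_comm n c i i (y_act n c j u) =
        y_act n c j u - fscale (of_real c) (?t j (y_act n c j u) + (\<Sum>l\<in>?A. ?t l (y_act n c j u)))"
      unfolding yx_comm_same s1 ..
    ultimately show ?thesis by (simp add: F.scale_right_distrib)
  qed
  consider "i = j" | "i \<noteq> j" "k = i" | "i \<noteq> j" "k = j" | "i \<noteq> j" "k \<noteq> i" "k \<noteq> j" by blast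
  then show ?thesis
  proof cases
    case 2
    then show ?thesis using diag[of i j] ij by simp
  next
    case 3
    then show ?thesis using diag[of j i] ij by simp
  next
    case 4
    then have "y_act n c i (word_act (Transposition.transpose j k) u) = word_act (Transposition.transpose j k) (y_act n c i u)"
      "y_act n c j (word_act (Transposition.transpose i k) u) = word_act (Transposition.transpose i k) (y_act n c j u)"
      using ij by (simp_all add: y_act_transpose)
    then show ?thesis using 4 by (simp add: yx_comm_def y_act_fscale)
  qed simp
qed

section \<open>Words in the letters X i, graded by length\<close>

definition X_words :: "nat \<Rightarrow> nat \<Rightarrow> fmod set" where
  "X_words n k = {u. \<forall>w\<in>support u. length w = k \<and> set w \<subseteq> X ` {1..n}}"

definition X_module :: "nat \<Rightarrow> fmod set" where
  "X_module n = {u. \<forall>w\<in>support u. set w \<subseteq> X ` {1..n}}"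

lemma y_act_comm:
  assumes ij: "i \<in> {1..n}" "j \<in> {1..n}" and u: "u \<in> X_module n"
  shows "y_act n c i (y_act n c j u) = y_act n c j (y_act n c i u)"
proof -
  have "y_act n c i (y_act n c j (pure w v)) = y_act n c j (y_act n c i (pure w v))" if "set w \<subseteq> X ` {1..n}" for w v
    using that
  proof (induction w)
    case (Cons g w)
    then obtain k where k: "g = X k" "k \<in> {1..n}" by auto
    have "y_act n c i (y_act n c j (pure (X k # w) v)) = gen_act (X k) (y_act n c i (y_act n c j (pure w v))) +
        (yx_comm n c i k (y_act n c j (pure w v)) + y_act n c i (yx_comm n c j k (pure w v)))" for i j
      by (simp add: y_act_add y_act_X add.assoc)
    then show ?case using Cons k yx_comm_swap[OF ij k(2), of c "pure w v"] by simp
  qed simp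
  then have "y_act n c i (y_act n c j (\<Sum>w\<in>support u. pure w (coord u w))) =
      y_act n c j (y_act n c i (\<Sum>w\<in>support u. pure w (coord u w)))"
    using u unfolding y_act_sum X_module_def by (intro sum.cong refl) blast
  then show ?thesis by (simp only: poly_mapping_decompose[symmetric])
qed

lemma words_subspace:
  "F.subspace {u::fmod. \<forall>w\<in>support u. P w}"
proof (rule F.subspaceI)
  fix u v :: fmod and a assume "u \<in> {u. \<forall>w\<in>support u. P w}"
  then show "fscale a u \<in> {u. \<forall>w\<in>support u. P w}" by (auto simp: in_keys_iff)
  assume "v \<in> {u. \<forall>w\<in>support u. P w}"
  then show "u + v \<in> {u. \<forall>w\<in>support u. P w}"
    using \<open>u \<in> _\<close> Poly_Mapping.keys_add[of u v] by blast
qed simp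

lemmas X_words_subspace = words_subspace[of "\<lambda>w. length w = k \<and> set w \<subseteq> X ` {1..n}" for k n, folded X_words_def]
lemmas X_module_subspace = words_subspace[of "\<lambda>w. set w \<subseteq> X ` {1..n}" for n, folded X_module_def]

lemma words_induct:
  assumes "\<forall>w\<in>support u. P w" "\<And>w v. P w \<Longrightarrow> Q (pure w v)" "Q 0" "\<And>u v. Q u \<Longrightarrow> Q v \<Longrightarrow> Q (u + v)"
  shows "Q (u::fmod)"
proof -
  have "Q (\<Sum>w\<in>S. pure w (coord u w))" if "finite S" "S \<subseteq> support u" for S
    using that by induction (use assms in auto)
  then show ?thesis using poly_mapping_decompose[of u] by (metis finite_keys subset_refl)
qed

lemma X_words_pure: "length w = k \<Longrightarrow> set w \<subseteq> X ` {1..n} \<Longrightarrow> pure w v \<in> X_words n k"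
  by (auto simp: X_words_def)

lemma X_words_induct [consumes 1, case_names pure zero add]:
  assumes "u \<in> X_words n k" "\<And>w v. length w = k \<Longrightarrow> set w \<subseteq> X ` {1..n} \<Longrightarrow> Q (pure w v)"
    "Q 0" "\<And>u v. Q u \<Longrightarrow> Q v \<Longrightarrow> Q (u + v)"
  shows "Q u"
proof (rule words_induct[of u "\<lambda>w. length w = k \<and> set w \<subseteq> X ` {1..n}"])
  show "\<forall>w\<in>support u. length w = k \<and> set w \<subseteq> X ` {1..n}" using assms(1) unfolding X_words_def by blast
qed (use assms in blast)+

lemma X_words_gen_act:
  assumes i: "i \<in> {1..n}" and u: "u \<in> X_words n k"
  shows "gen_act (X i) u \<in> X_words n (Suc k)"
  using u
proof (induction rule: X_words_induct)
  case (pure w v)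
  then show ?case unfolding gen_act_pure using i by (intro X_words_pure) auto
qed (simp_all add: gen_act_add F.subspace_0[OF X_words_subspace] F.subspace_add[OF X_words_subspace])

lemma X_words_word_act:
  assumes p: "p permutes {1..n}" and u: "u \<in> X_words n k"
  shows "word_act p u \<in> X_words n k"
  using u
proof (induction rule: X_words_induct)
  case (pure w v)
  have "relabel p g \<in> X ` {1..n}" if "g \<in> X ` {1..n}" for g
    using that permutes_in_image[OF p] by auto
  then have "set (map (relabel p) w) \<subseteq> X ` {1..n}" using pure(2) unfolding set_map by blast
  then show ?case unfolding word_act_pure using pure(1) by (intro X_words_pure) auto
qed (simp_all add: word_act_add F.subspace_0[OF X_words_subspace] F.subspace_add[OF X_words_subspace])

lemma X_words_yx_comm:
  "i \<in> {1..n} \<Longrightarrow> j \<in> {1..n} \<Longrightarrow> u \<in> X_words n k \<Longrightarrow> yx_comm n c i j u \<in> X_words n k"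
  unfolding yx_comm_def
  by (auto intro!: F.subspace_diff[OF X_words_subspace] F.subspace_scale[OF X_words_subspace]
      F.subspace_sum[OF X_words_subspace] X_words_word_act permutes_swap_id)

lemma X_words_y_act:
  assumes i: "i \<in> {1..n}"
  shows "u \<in> X_words n (Suc k) \<Longrightarrow> y_act n c i u \<in> X_words n k"
proof -
  have word: "y_word n c i w v \<in> X_words n k" if "length w = Suc k" "set w \<subseteq> X ` {1..n}" for w v k
    using that
  proof (induction w arbitrary: k)
    case (Cons g w)
    then obtain j where j: "g = X j" "j \<in> {1..n}" by auto
    have "gen_act (X j) (y_word n c i w v) \<in> X_words n k"
    proof (cases k)
      case 0
      then have "w = []" using Cons.prems by simp
      then show ?thesis by (simp add: F.subspace_0[OF X_words_subspace])
    next
      case (Suc k')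
      then show ?thesis using Cons by (auto intro!: X_words_gen_act j)
    qed
    moreover have "yx_comm n c i j (pure w v) \<in> X_words n k"
      using Cons.prems by (intro X_words_yx_comm i j X_words_pure) auto
    ultimately show ?case using j by (simp add: F.subspace_add[OF X_words_subspace])
  qed simp
  show "u \<in> X_words n (Suc k) \<Longrightarrow> y_act n c i u \<in> X_words n k"
    by (induction rule: X_words_induct)
      (simp_all add: word y_act_add F.subspace_0[OF X_words_subspace] F.subspace_add[OF X_words_subspace])
qed

lemma y_act_X_words_0: "u \<in> X_words n 0 \<Longrightarrow> y_act n c i u = 0"
  by (induction rule: X_words_induct) (auto simp: y_act_add)

lemma X_module_induct:
  assumes "u \<in> X_module n" "\<And>k u. u \<in> X_words n k \<Longrightarrow> Q u" "\<And>u v. Q u \<Longrightarrow> Q v \<Longrightarrow> Q (u + v)"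
  shows "Q u"
proof (rule words_induct[of u "\<lambda>w. set w \<subseteq> X ` {1..n}"])
  show "\<forall>w\<in>support u. set w \<subseteq> X ` {1..n}" using assms(1) by (simp add: X_module_def)
  show "Q (pure w v)" if "set w \<subseteq> X ` {1..n}" for w v using assms(2) X_words_pure that by blast
  show "Q 0" using assms(2) F.subspace_0[OF X_words_subspace] by blast
qed (rule assms(3))

lemma X_words_X_module: "u \<in> X_words n k \<Longrightarrow> u \<in> X_module n"
  by (auto simp: X_words_def X_module_def)

lemma X_module_gen_act: "i \<in> {1..n} \<Longrightarrow> u \<in> X_module n \<Longrightarrow> gen_act (X i) u \<in> X_module n"
  by (erule X_module_induct)
    (simp_all add: gen_act_add X_words_X_module[OF X_words_gen_act] F.subspace_add[OF X_module_subspace])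

lemma X_module_word_act: "p permutes {1..n} \<Longrightarrow> u \<in> X_module n \<Longrightarrow> word_act p u \<in> X_module n"
  by (erule X_module_induct)
    (simp_all add: word_act_add X_words_X_module[OF X_words_word_act] F.subspace_add[OF X_module_subspace])

lemma X_module_yx_comm: "i \<in> {1..n} \<Longrightarrow> j \<in> {1..n} \<Longrightarrow> u \<in> X_module n \<Longrightarrow> yx_comm n c i j u \<in> X_module n"
  by (erule X_module_induct)
    (simp_all add: yx_comm_add X_words_X_module[OF X_words_yx_comm] F.subspace_add[OF X_module_subspace])

lemma X_module_y_act:
  assumes "i \<in> {1..n}" "u \<in> X_module n"
  shows "y_act n c i u \<in> X_module n"
  using assms(2)
proof (rule X_module_induct)
  fix k u assume u: "u \<in> X_words n k"
  show "y_act n c i u \<in> X_module n"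
  proof (cases k)
    case 0
    then show ?thesis using y_act_X_words_0 u F.subspace_0[OF X_module_subspace] by auto
  next
    case (Suc k')
    then show ?thesis using X_words_y_act[OF assms(1)] u X_words_X_module by blast
  qed
qed (simp add: y_act_add F.subspace_add[OF X_module_subspace])

section \<open>The Hermitian form on words\<close>

fun form_word :: "nat \<Rightarrow> real \<Rightarrow> gen list \<Rightarrow> galg \<Rightarrow> fmod \<Rightarrow> complex" where
  "form_word n c [] v u = gprod v (coord u [])"
| "form_word n c (X i # w) v u = form_word n c w v (y_act n c i u)"
| "form_word n c w v u = 0"

definition word_form :: "nat \<Rightarrow> real \<Rightarrow> fmod \<Rightarrow> fmod \<Rightarrow> complex" where
  "word_form n c u1 u2 = lin_ext (\<lambda>w v. form_word n c w v u2) u1"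

text \<open>Supplies the sesquilinearity of the inner product, which does not involve n; hence the
  value 0.\<close>

interpretation GH: symmetric_group_rep gscale UNIV gprod 0 gact
  by (rule symmetric_group_rep_galg)

lemma form_word_add_left: "form_word n c w (v + v') u = form_word n c w v u + form_word n c w v' u"
  by (induction n c w v u rule: form_word.induct) (simp_all add: GH.B_add_left)

lemma form_word_zero_left [simp]: "form_word n c w 0 u = 0"
  using form_word_add_left[of n c w 0 0 u] by simp

lemma form_word_scale_left: "form_word n c w (gscale a v) u = a * form_word n c w v u"
  by (induction n c w v u rule: form_word.induct) (simp_all add: GH.B_scale_left)

lemma form_word_add_right: "form_word n c w v (u + u') = form_word n c w v u + form_word n c w v u'"
  by (induction n c w v u arbitrary: u' rule: form_word.induct) (simp_all add: GH.B_add_right lookup_add y_act_add)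

lemma form_word_scale_right: "form_word n c w v (fscale a u) = cnj a * form_word n c w v u"
  by (induction n c w v u rule: form_word.induct) (simp_all add: GH.B_scale_right y_act_fscale)

lemma word_form_pure [simp]: "word_form n c (pure w v) u = form_word n c w v u"
  by (simp add: word_form_def lin_ext_single)

lemma word_form_add_left: "word_form n c (u + u') v = word_form n c u v + word_form n c u' v"
  unfolding word_form_def by (rule lin_ext_add) (rule form_word_add_left)

lemma word_form_zero [simp]: "word_form n c 0 v = 0"
  by (simp add: word_form_def)

lemma word_form_scale_left: "word_form n c (fscale a u) v = a * word_form n c u v"
  unfolding word_form_def by (rule lin_ext_fscale) (simp_all add: form_word_scale_left algebra_simps)

lemma word_form_diff_left: "word_form n c (u - u') v = word_form n c u v - word_form n c u' v"
  using word_form_add_left[of n c "u - u'" u' v] by simp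

lemma word_form_add_right: "word_form n c u (v + v') = word_form n c u v + word_form n c u v'"
  by (simp add: word_form_def lin_ext_def form_word_add_right sum.distrib)

lemma word_form_scale_right: "word_form n c u (fscale a v) = cnj a * word_form n c u v"
  by (simp add: word_form_def lin_ext_def form_word_scale_right sum_distrib_left)

lemma word_form_zero_right [simp]: "word_form n c u 0 = 0"
  using word_form_add_right[of n c u 0 0] by simp

lemma word_form_diff_right: "word_form n c u (v - v') = word_form n c u v - word_form n c u v'"
  using word_form_add_right[of n c u "v - v'" v'] by simp

lemma word_form_sum_left: "word_form n c (\<Sum>i\<in>I. f i) v = (\<Sum>i\<in>I. word_form n c (f i) v)"
  by (induction I rule: infinite_finite_induct) (simp_all add: word_form_add_left)

lemma word_form_sum_right: "word_form n c v (\<Sum>i\<in>I. f i) = (\<Sum>i\<in>I. word_form n c v (f i))"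
  by (induction I rule: infinite_finite_induct) (simp_all add: word_form_add_right)

lemma word_form_X: "word_form n c (gen_act (X i) u) v = word_form n c u (y_act n c i v)"
  by (induction u rule: poly_mapping_additive_induct) (simp_all add: gen_act_add word_form_add_left)

lemma word_form_word_act:
  assumes p: "p permutes {1..n}"
  shows "word_form n c (word_act p u) (word_act p v) = word_form n c u v"
proof (induction u rule: poly_mapping_additive_induct)
  case (single w a)
  show ?case
  proof (induction w arbitrary: v)
    case Nil
    show ?case by (simp add: coord_word_act_Nil gprod_gact permutes_bij[OF p])
  next
    case (Cons g w)
    then show ?case by (cases g) (simp_all add: word_act_y_act[OF p, symmetric])
  qed
qed (simp_all add: word_act_add word_form_add_left)

lemma word_form_transpose:
  assumes "i \<in> {1..n}" "j \<in> {1..n}"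
  shows "word_form n c (word_act (Transposition.transpose i j) u) v =
    word_form n c u (word_act (Transposition.transpose i j) v)"
proof -
  have "word_act (Transposition.transpose i j) (word_act (Transposition.transpose i j) v) = v"
    by (simp add: word_act_comp del: id_apply)
  then show ?thesis
    using word_form_word_act[OF permutes_swap_id[OF assms], of c u "word_act (Transposition.transpose i j) v"] by simp
qed

text \<open>Transpositions are isometric involutions, hence self-adjoint, and c is real.\<close>

lemma word_form_yx_comm:
  assumes "i \<in> {1..n}" "j \<in> {1..n}"
  shows "word_form n c (yx_comm n c i j u) v = word_form n c u (yx_comm n c j i v)"
proof (cases "i = j")
  case True
  have "(\<Sum>l\<in>{1..n} - {i}. word_form n c (word_act (Transposition.transpose i l) u) v) =
      (\<Sum>l\<in>{1..n} - {i}. word_form n c u (word_act (Transposition.transpose i l) v))"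
    using assms by (intro sum.cong refl word_form_transpose) auto
  then show ?thesis
    using True by (simp add: yx_comm_def word_form_diff_left word_form_diff_right word_form_scale_left
        word_form_scale_right word_form_sum_left word_form_sum_right)
next
  case False
  then show ?thesis
    using assms by (simp add: yx_comm_def word_form_scale_left word_form_scale_right word_form_transpose transpose_commute[of j i])
qed

text \<open>By construction the form is contravariant on the left only. Pairing x_i a with x_j b
  gives the pairing of a with x_j y_i b plus a commutator term; both are reversed by induction on
  the length of the left word and reassembled into the same expansion for x_j b and x_i a.\<close>

lemma word_form_hermitian_words:
  "u \<in> X_words n k \<Longrightarrow> v \<in> X_module n \<Longrightarrow> word_form n c u v = cnj (word_form n c v u)"
proof (induction k arbitrary: u v rule: less_induct)
  case (less k)
  have pure: "word_form n c (pure w a) (pure w' b) = cnj (word_form n c (pure w' b) (pure w a))"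
    if w: "length w = k" "set w \<subseteq> X ` {1..n}" and w': "set w' \<subseteq> X ` {1..n}" for w w' a b
  proof (cases w)
    case Nil
    show ?thesis
    proof (cases w')
      case Nil
      then show ?thesis using \<open>w = []\<close> GH.B_herm[of a b] by simp
    next
      case (Cons g w2)
      then obtain j where "g = X j" using w' by auto
      then show ?thesis using Cons \<open>w = []\<close> form_word_scale_right[of n c w2 b 0 0] by (simp add: lookup_single when_def)
    qed
  next
    case Cons1: (Cons g w1)
    then obtain i where i: "g = X i" "i \<in> {1..n}" using w by auto
    obtain k' where k': "k = Suc k'" "length w1 = k'" using w Cons1 by auto
    show ?thesis
    proof (cases w')
      case Nil
      then show ?thesis using Cons1 i form_word_scale_right[of n c w1 a 0 0] by (simp add: lookup_single when_def)
    next
      case Cons2: (Cons g' w2)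
      then obtain j where j: "g' = X j" "j \<in> {1..n}" using w' by auto
      let ?a = "pure w1 a" and ?b = "pure w2 b"
      have a: "?a \<in> X_words n k'" using w Cons1 k' by (intro X_words_pure) auto
      have b: "?b \<in> X_module n" using w' Cons2 by (auto simp: X_module_def)
      have aM: "?a \<in> X_module n" by (rule X_words_X_module[OF a])
      note IH = less.IH[of k', OF _ a]
      have lt: "k' < k" using k' by simp
      have yb: "y_act n c i ?b \<in> X_module n" by (rule X_module_y_act[OF i(2) b])
      have hb: "yx_comm n c i j ?b \<in> X_module n"
        by (rule X_module_yx_comm[OF i(2) j(2) b])
      \<comment> \<open>Contravariance in the second argument, from the induction hypothesis for
        \<open>gen_act (X i) (y_act n c j ?a)\<close>, as long as \<open>?a\<close>, and for
        \<open>y_act n c j ?a\<close>, shorter by 1. For an empty word both sides vanish.\<close>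
      have e: "word_form n c ?b (gen_act (X i) (y_act n c j ?a)) = word_form n c (y_act n c i ?b) (y_act n c j ?a)"
      proof (cases k')
        case 0
        then show ?thesis using y_act_X_words_0[of ?a n c j] a by simp
      next
        case (Suc k2)
        have y: "y_act n c j ?a \<in> X_words n k2" by (rule X_words_y_act[OF j(2)]) (use a Suc in simp)
        then have xy: "gen_act (X i) (y_act n c j ?a) \<in> X_words n k'" using X_words_gen_act[OF i(2)] Suc by simp
        have "word_form n c ?b (gen_act (X i) (y_act n c j ?a)) = cnj (word_form n c (gen_act (X i) (y_act n c j ?a)) ?b)"
          using less.IH[OF lt xy b] by simp
        also have "\<dots> = cnj (word_form n c (y_act n c j ?a) (y_act n c i ?b))"
          by (simp only: word_form_X)
        also have "\<dots> = word_form n c (y_act n c i ?b) (y_act n c j ?a)"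
          using less.IH[of k2, OF _ y yb] lt Suc by simp
        finally show ?thesis .
      qed
      have "word_form n c (gen_act (X i) ?a) (gen_act (X j) ?b) =
          word_form n c ?a (gen_act (X j) (y_act n c i ?b)) + word_form n c ?a (yx_comm n c i j ?b)"
        by (simp only: word_form_X y_act_X word_form_add_right)
      also have "\<dots> = cnj (word_form n c (gen_act (X j) (y_act n c i ?b)) ?a) + cnj (word_form n c (yx_comm n c i j ?b) ?a)"
        using IH[OF lt X_module_gen_act[OF j(2) yb]] IH[OF lt hb] by simp
      also have "\<dots> = cnj (word_form n c (y_act n c i ?b) (y_act n c j ?a) + word_form n c ?b (yx_comm n c j i ?a))"
        by (simp only: word_form_X word_form_yx_comm[OF i(2) j(2)] complex_cnj_add)
      also have "\<dots> = cnj (word_form n c (gen_act (X j) ?b) (gen_act (X i) ?a))"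
        by (simp only: word_form_X y_act_X word_form_add_right e)
      finally show ?thesis using Cons1 Cons2 i j by simp
    qed
  qed
  show ?case
    using less.prems(1)
  proof (induction rule: X_words_induct)
    case w: (pure w a)
    show ?case
    proof (rule words_induct[of v "\<lambda>w. set w \<subseteq> X ` {1..n}"])
      show "\<forall>w\<in>support v. set w \<subseteq> X ` {1..n}" using less.prems(2) by (simp add: X_module_def)
    qed (use pure w in \<open>simp_all only: word_form_add_left word_form_add_right word_form_zero word_form_zero_right complex_cnj_add complex_cnj_zero\<close>)
  qed (simp_all only: word_form_add_left word_form_add_right word_form_zero word_form_zero_right complex_cnj_add complex_cnj_zero)
qed

lemma word_form_hermitian:
  assumes "u \<in> X_module n" "v \<in> X_module n"
  shows "word_form n c u v = cnj (word_form n c v u)"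
  using assms(1)
  by (rule X_module_induct) (simp_all add: word_form_hermitian_words[OF _ assms(2)] word_form_add_left word_form_add_right)

section \<open>Evaluating words in all generators\<close>

fun eval_word :: "nat \<Rightarrow> real \<Rightarrow> gen list \<Rightarrow> galg \<Rightarrow> fmod" where
  "eval_word n c [] v = pure [] v"
| "eval_word n c (X i # w) v = gen_act (X i) (eval_word n c w v)"
| "eval_word n c (Y i # w) v = y_act n c i (eval_word n c w v)"
| "eval_word n c (W p # w) v = word_act p (eval_word n c w v)"

lemma eval_word_add: "eval_word n c w (u + v) = eval_word n c w u + eval_word n c w v"
  by (induction n c w u rule: eval_word.induct) (simp_all add: single_add gen_act_add y_act_add word_act_add)

lemma eval_word_zero [simp]: "eval_word n c w 0 = 0"
  using eval_word_add[of n c w 0 0] by simp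

lemma eval_word_gscale: "eval_word n c w (gscale a v) = fscale a (eval_word n c w v)"
  by (induction n c w v rule: eval_word.induct) (simp_all add: gen_act_fscale y_act_fscale word_act_fscale)

text \<open>Maps representatives to the module of words in the X i, where Y and W act as operators.
  The contravariant form is the pullback of the form on words.\<close>

definition word_eval :: "nat \<Rightarrow> real \<Rightarrow> fmod \<Rightarrow> fmod" where
  "word_eval n c u = lin_ext (eval_word n c) u"

lemma word_eval_pure [simp]: "word_eval n c (pure w v) = eval_word n c w v"
  by (simp add: word_eval_def lin_ext_single)

lemma word_eval_add: "word_eval n c (u + v) = word_eval n c u + word_eval n c v"
  unfolding word_eval_def by (rule lin_ext_add) (rule eval_word_add)

lemma word_eval_zero [simp]: "word_eval n c 0 = 0"
  by (simp add: word_eval_def)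

lemma word_eval_diff: "word_eval n c (u - v) = word_eval n c u - word_eval n c v"
  using word_eval_add[of n c "u - v" v] by (simp add: algebra_simps)

lemma word_eval_sum: "word_eval n c (\<Sum>i\<in>I. f i) = (\<Sum>i\<in>I. word_eval n c (f i))"
  by (induction I rule: infinite_finite_induct) (simp_all add: word_eval_add)

lemma word_eval_fscale: "word_eval n c (fscale a u) = fscale a (word_eval n c u)"
  unfolding word_eval_def by (rule lin_ext_fscale) (simp_all add: F.scale_right_distrib eval_word_gscale)

lemma word_eval_X: "word_eval n c (gen_act (X i) u) = gen_act (X i) (word_eval n c u)"
  by (induction u rule: poly_mapping_additive_induct) (simp_all add: gen_act_add word_eval_add)

lemma word_eval_Y: "word_eval n c (gen_act (Y i) u) = y_act n c i (word_eval n c u)"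
  by (induction u rule: poly_mapping_additive_induct) (simp_all add: gen_act_add word_eval_add y_act_add)

lemma word_eval_W: "word_eval n c (gen_act (W p) u) = word_act p (word_eval n c u)"
  by (induction u rule: poly_mapping_additive_induct) (simp_all add: gen_act_add word_eval_add word_act_add)

lemmas word_eval_simps = word_eval_X word_eval_Y word_eval_W word_eval_diff word_eval_fscale word_eval_sum

lemma word_eval_X_module:
  assumes "u \<in> free_module n lam"
  shows "word_eval n c u \<in> X_module n"
proof (rule words_induct[of u "\<lambda>w. set w \<subseteq> gens n"])
  show "\<forall>w\<in>support u. set w \<subseteq> gens n" using assms by (simp add: free_module_def)
  fix w v assume "set w \<subseteq> gens n"
  then show "word_eval n c (pure w v) \<in> X_module n"
  proof (induction w)
    case Nil
    show ?case by (simp add: X_module_def)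
  next
    case (Cons g w)
    then have "g \<in> gens n" and IH: "eval_word n c w v \<in> X_module n" by auto
    then consider i where "g = X i" "i \<in> {1..n}" | i where "g = Y i" "i \<in> {1..n}" | p where "g = W p" "p permutes {1..n}"
      by (auto simp: gens_def)
    then show ?case
      by cases (simp_all add: IH X_module_gen_act X_module_y_act X_module_word_act)
  qed
qed (simp_all add: word_eval_add F.subspace_0[OF X_module_subspace] F.subspace_add[OF X_module_subspace])

context partition
begin

lemma free_module_iff: "u \<in> free_module n lam \<longleftrightarrow>
    (\<forall>w. coord u w \<in> specht_space) \<and> (\<forall>w\<in>support u. set w \<subseteq> gens n)"
  by (auto simp: free_module_def specht_space_def)

lemma free_subspace: "F.subspace (free_module n lam)"
proof (rule F.subspaceI)
  fix u v a assume u: "u \<in> free_module n lam"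
  have "support (fscale a u) \<subseteq> support u" by (auto simp: in_keys_iff)
  then show "fscale a u \<in> free_module n lam"
    using u unfolding free_module_iff coord_fscale by (blast intro: G.subspace_scale[OF specht_subspace])
  assume v: "v \<in> free_module n lam"
  have "support (u + v) \<subseteq> support u \<union> support v" by (rule Poly_Mapping.keys_add)
  then show "u + v \<in> free_module n lam"
    using u v unfolding free_module_iff lookup_add by (blast intro: G.subspace_add[OF specht_subspace])
qed (simp add: free_module_iff G.subspace_0[OF specht_subspace])

lemma free_gen_act:
  assumes u: "u \<in> free_module n lam" and g: "g \<in> gens n"
  shows "gen_act g u \<in> free_module n lam"
  unfolding free_module_iff
proof (intro conjI allI ballI)
  fix w
  show "coord (gen_act g u) w \<in> specht_space"
    using u by (cases w) (simp_all add: coord_gen_act free_module_iff G.subspace_0[OF specht_subspace])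
  assume w: "w \<in> support (gen_act g u)"
  show "set w \<subseteq> gens n"
  proof (cases w)
    case (Cons h w')
    then have "h = g" "w' \<in> support u" using w by (auto simp: in_keys_iff coord_gen_act split: if_splits)
    then show ?thesis using u g Cons unfolding free_module_iff by auto
  qed simp
qed

lemma gens_simps [simp]: "i \<in> {1..n} \<Longrightarrow> X i \<in> gens n" "i \<in> {1..n} \<Longrightarrow> Y i \<in> gens n"
    "p permutes {1..n} \<Longrightarrow> W p \<in> gens n"
  by (auto simp: gens_def)

lemma free_pure: "v \<in> specht_space \<Longrightarrow> set w \<subseteq> gens n \<Longrightarrow> pure w v \<in> free_module n lam"
  by (auto simp: free_module_iff lookup_single when_def G.subspace_0[OF specht_subspace])

lemmas free_closed = F.subspace_0[OF free_subspace] F.subspace_add[OF free_subspace] F.subspace_diff[OF free_subspace]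
  F.subspace_scale[OF free_subspace] F.subspace_sum[OF free_subspace] free_gen_act gens_simps permutes_inv permutes_id
  permutes_compose permutes_swap_id

lemma std_relations_free: "u \<in> std_relations n lam c \<Longrightarrow> u \<in> free_module n lam"
proof (induction rule: std_relations.induct)
  case (W_mult u p q)
  then show ?case by (intro free_closed)
next
  case (W_X u p i)
  then show ?case using permutes_in_image[OF W_X(2)] by (intro free_closed) auto
next
  case (W_Y u p i)
  then show ?case using permutes_in_image[OF W_Y(2)] by (intro free_closed) auto
next
  case (Y_X_eq u i)
  then show ?case by (intro free_closed) auto
next
  case (lam_W v p)
  then have "v \<in> specht_space" by (simp add: specht_space_def)
  then show ?case using lam_W by (intro free_closed free_pure specht_gact) auto
next
  case (lam_Y v i)
  then have "v \<in> specht_space" by (simp add: specht_space_def)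
  then show ?case using lam_Y by (intro free_closed free_pure) auto
qed (auto intro!: free_closed)

definition eval_form :: "real \<Rightarrow> fmod \<Rightarrow> fmod \<Rightarrow> complex" where
  "eval_form c u v = word_form n c (word_eval n c u) (word_eval n c v)"

text \<open>After evaluation all defining relations hold exactly, except that the X i do not
  commute; their commutators lie in the radical because the Y i commute. The radical is stable under
  the generators, as each of them has an adjoint.\<close>

lemma word_form_relations:
  "u \<in> std_relations n lam c \<Longrightarrow> a \<in> X_module n \<Longrightarrow> word_form n c (word_eval n c u) a = 0"
proof (induction arbitrary: a rule: std_relations.induct)
  case zero
  then show ?case by simp
next
  case (add u v)
  then show ?case by (simp add: word_eval_add word_form_add_left)
next
  case (scale u b)
  then show ?case by (simp add: word_eval_fscale word_form_scale_left)
next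
  case (act u g)
  note eu = word_eval_X_module[OF std_relations_free[OF act.hyps(1)], of c]
  from act.hyps(2) consider i where "g = X i" "i \<in> {1..n}" | i where "g = Y i" "i \<in> {1..n}" | p where "g = W p" "p permutes {1..n}"
    by (auto simp: gens_def)
  then show ?case
  proof cases
    case 1
    then show ?thesis using act.IH[OF X_module_y_act[OF 1(2) act.prems]] by (simp add: word_eval_X word_form_X)
  next
    case 2
    have "word_form n c (y_act n c i (word_eval n c u)) a = cnj (word_form n c a (y_act n c i (word_eval n c u)))"
      by (rule word_form_hermitian[OF X_module_y_act[OF 2(2) eu] act.prems])
    also have "\<dots> = cnj (word_form n c (gen_act (X i) a) (word_eval n c u))"
      by (simp only: word_form_X)
    also have "\<dots> = word_form n c (word_eval n c u) (gen_act (X i) a)"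
      by (rule word_form_hermitian[OF eu X_module_gen_act[OF 2(2) act.prems], symmetric])
    also have "\<dots> = 0" by (rule act.IH[OF X_module_gen_act[OF 2(2) act.prems]])
    finally show ?thesis using 2 by (simp add: word_eval_Y)
  next
    case 3
    note p = 3(2)
    have ip: "perm_inv p permutes {1..n}" by (rule permutes_inv[OF p])
    have "word_act p (word_act (perm_inv p) a) = a"
      using p ip by (simp add: word_act_comp permutes_bij permutes_inv_o(1)[OF p] del: id_apply)
    then have "word_form n c (word_act p (word_eval n c u)) a = word_form n c (word_eval n c u) (word_act (perm_inv p) a)"
      using word_form_word_act[OF p, of c "word_eval n c u" "word_act (perm_inv p) a"] by simp
    then show ?thesis using 3 act.IH[OF X_module_word_act[OF ip act.prems]] by (simp add: word_eval_W)
  qed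
next
  case (W_one u)
  then show ?case by (simp add: word_eval_simps del: id_apply)
next
  case (W_mult u p q)
  then show ?case by (simp add: word_eval_simps word_act_comp permutes_bij)
next
  case (X_comm u i j)
  have "y_act n c j (y_act n c i a) = y_act n c i (y_act n c j a)"
    by (rule y_act_comm) (use X_comm in auto)
  then show ?case by (simp only: word_eval_diff word_eval_X word_form_diff_left word_form_X) simp
next
  case (Y_comm u i j)
  have "y_act n c i (y_act n c j (word_eval n c u)) = y_act n c j (y_act n c i (word_eval n c u))"
    by (rule y_act_comm) (use Y_comm word_eval_X_module in auto)
  then show ?case by (simp add: word_eval_simps)
next
  case (W_X u p i)
  have "word_act p (word_act (perm_inv p) (word_eval n c u)) = word_eval n c u"
    using W_X permutes_inv[OF W_X(2)] by (simp add: word_act_comp permutes_bij permutes_inv_o(1)[OF W_X(2)] del: id_apply)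
  then show ?case by (simp add: word_eval_simps word_act_X)
next
  case (W_Y u p i)
  have "word_act p (word_act (perm_inv p) (word_eval n c u)) = word_eval n c u"
    using W_Y permutes_inv[OF W_Y(2)] by (simp add: word_act_comp permutes_bij permutes_inv_o(1)[OF W_Y(2)] del: id_apply)
  then show ?case by (simp add: word_eval_simps word_act_y_act[OF W_Y(2)])
next
  case (Y_X_neq u i j)
  then show ?case by (simp add: word_eval_simps y_act_X yx_comm_neq)
next
  case (Y_X_eq u i)
  then show ?case by (simp add: word_eval_simps y_act_X yx_comm_same)
next
  case (lam_W v p)
  then show ?case by (simp add: word_eval_simps)
next
  case (lam_Y v i)
  then show ?case by (simp add: word_eval_simps)
qed

lemma eval_form_contravariant: "is_contravariant_form n lam c (eval_form c)"
  unfolding is_contravariant_form_def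
proof (intro conjI ballI allI impI)
  fix u v assume u: "u \<in> free_module n lam" and v: "v \<in> free_module n lam"
  show "eval_form c (u + v) w = eval_form c u w + eval_form c v w" for w
    by (simp add: eval_form_def word_eval_add word_form_add_left)
  show "eval_form c (fscale a u) v = a * eval_form c u v" for a
    by (simp add: eval_form_def word_eval_fscale word_form_scale_left)
  show "eval_form c v u = cnj (eval_form c u v)"
    unfolding eval_form_def by (rule word_form_hermitian) (rule word_eval_X_module u v)+
  show "eval_form c (gen_act (W p) u) (gen_act (W p) v) = eval_form c u v" if "p permutes {1..n}" for p
    by (simp add: eval_form_def word_eval_W word_form_word_act[OF that])
  show "eval_form c (gen_act (X i) u) v = eval_form c u (gen_act (Y i) v)" for i
    by (simp add: eval_form_def word_eval_simps word_form_X)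
next
  fix u v assume "u \<in> std_relations n lam c" "v \<in> free_module n lam"
  then show "eval_form c u v = 0"
    unfolding eval_form_def by (intro word_form_relations word_eval_X_module)
next
  fix v assume "v \<in> specht lam" "v \<noteq> 0"
  then show "0 < Re (eval_form c (pure [] v) (pure [] v))"
    by (simp add: eval_form_def gprod_pos)
qed

lemma contravariant_form: "is_contravariant_form n lam c (contravariant_form n lam c)"
  unfolding contravariant_form_def by (rule someI[of "is_contravariant_form n lam c", OF eval_form_contravariant])

end

section \<open>The standard module\<close>

text \<open>Realizes the quotient by R inside the space itself: P kills a basis of R and fixes the
  vectors that extend it to a full basis.\<close>

lemma (in vector_space) ex_quotient_map:
  assumes R: "subspace R"
  obtains P where "\<And>u v. P (u + v) = P u + P v" "\<And>a u. P (scale a u) = scale a (P u)"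
    "\<And>u. P u - u \<in> R" "\<And>u. u \<in> R \<Longrightarrow> P u = 0"
proof -
  interpret pair: vector_space_pair scale scale by unfold_locales
  obtain b where b: "b \<subseteq> R" "independent b" "R \<subseteq> span b"
    by (metis maximal_independent_subset)
  obtain P where P: "Vector_Spaces.linear scale scale P" "\<And>x. x \<in> extend_basis b \<Longrightarrow> P x = (if x \<in> b then 0 else x)"
    using pair.linear_independent_extend[OF independent_extend_basis[OF b(2)], of "\<lambda>x. if x \<in> b then 0 else x"] by auto
  note lin = pair.linear_add[OF P(1)] pair.linear_scale[OF P(1)] pair.linear_0[OF P(1)]
  have "P u - u \<in> R" for u
  proof -
    have "u \<in> span (extend_basis b)" using span_extend_basis[OF b(2)] by simp
    then show ?thesis
    proof (induction rule: span_induct)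
      show "subspace {u. P u - u \<in> R}"
      proof (rule subspaceI)
        fix x y a assume x: "x \<in> {u. P u - u \<in> R}"
        have "P (scale a x) - scale a x = scale a (P x - x)" by (simp add: lin scale_right_diff_distrib)
        then show "scale a x \<in> {u. P u - u \<in> R}" using x subspace_scale[OF R] by simp
        assume y: "y \<in> {u. P u - u \<in> R}"
        have "P (x + y) - (x + y) = (P x - x) + (P y - y)" by (simp add: lin)
        then show "x + y \<in> {u. P u - u \<in> R}"
          using subspace_add[OF R, of "P x - x" "P y - y"] x y by (simp only: mem_Collect_eq)
      qed (simp add: lin subspace_0[OF R])
      show "P x - x \<in> R" if "x \<in> extend_basis b" for x
        using that b(1) subspace_neg[OF R, of x] by (auto simp: P(2) subspace_0[OF R])
    qed
  qed
  moreover have "P u = 0" if "u \<in> R" for u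
  proof -
    have "u \<in> span b" using that b(3) by blast
    then show ?thesis
    proof (induction rule: span_induct)
      show "subspace {u. P u = 0}" by (rule subspaceI) (simp_all add: lin)
      show "P x = 0" if "x \<in> b" for x
        using that P(2)[of x] extend_basis_superset[OF b(2)] by auto
    qed
  qed
  ultimately show ?thesis using that lin by blast
qed

lemma pure_sum: "pure w (\<Sum>i\<in>I. f i) = (\<Sum>i\<in>I. pure w (f i))"
  by (induction I rule: infinite_finite_induct) (simp_all add: single_add)

lemma norm_sign_abs: "\<bar>norm_sign n d \<sigma> p\<bar> = 1"
proof -
  have "\<bar>\<Prod>(k, l)\<in>exponent_pairs n d. (- 1 :: real) ^ (p k + p l + of_bool (\<sigma> l < \<sigma> k))\<bar> = 1"
    unfolding abs_prod by (rule prod.neutral) (auto simp: power_abs)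
  moreover have "\<bar>\<Prod>k\<in>{1..n}. if d k < 0 then (- 1 :: real) ^ p k else 1\<bar> = 1"
    unfolding abs_prod by (rule prod.neutral) (auto simp: power_abs)
  ultimately show ?thesis by (simp add: norm_sign_def abs_mult)
qed

section \<open>The quotient as a representation of the Cherednik algebra\<close>

locale standard_module = partition +
  fixes c :: real
  assumes n_pos: "1 \<le> n"
begin

abbreviation R :: "fmod set" where "R \<equiv> std_relations n lam c"

lemma R_subspace: "F.subspace R"
  by (rule F.subspaceI) (rule std_relations.zero std_relations.add std_relations.scale; assumption)+

text \<open>A linear idempotent with kernel \<open>R\<close>: its image serves as the quotient module.\<close>

definition proj :: "fmod \<Rightarrow> fmod" where
  "proj = (SOME P. (\<forall>u v. P (u + v) = P u + P v) \<and> (\<forall>a u. P (fscale a u) = fscale a (P u)) \<and>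
     (\<forall>u. P u - u \<in> R) \<and> (\<forall>u\<in>R. P u = 0))"

lemma proj: "proj (u + v) = proj u + proj v" "proj (fscale a u) = fscale a (proj u)"
    "proj u - u \<in> R" "u \<in> R \<Longrightarrow> proj u = 0"
proof -
  have "\<exists>P. (\<forall>u v. P (u + v) = P u + P v) \<and> (\<forall>a u. P (fscale a u) = fscale a (P u)) \<and>
     (\<forall>u. P u - u \<in> R) \<and> (\<forall>u\<in>R. P u = 0)"
    by (rule F.ex_quotient_map[OF R_subspace]) blast
  from someI_ex[OF this]
  show "proj (u + v) = proj u + proj v" "proj (fscale a u) = fscale a (proj u)"
    "proj u - u \<in> R" "u \<in> R \<Longrightarrow> proj u = 0"
    unfolding proj_def[symmetric] by blast+
qed

lemma proj_zero [simp]: "proj 0 = 0"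
  using proj(2)[of 0 0] by simp

lemma proj_diff: "proj (u - v) = proj u - proj v"
  using proj(1)[of "u - v" v] by (simp add: algebra_simps)

lemma proj_sum: "proj (\<Sum>i\<in>I. f i) = (\<Sum>i\<in>I. proj (f i))"
  by (induction I rule: infinite_finite_induct) (simp_all add: proj(1))

lemma proj_eq: "u - v \<in> R \<Longrightarrow> proj u = proj v"
  using proj(4)[of "u - v"] by (simp add: proj_diff)

lemma proj_proj [simp]: "proj (proj u) = proj u"
  by (rule proj_eq) (rule proj(3))

lemma proj_eq_0: "proj u = 0 \<longleftrightarrow> u \<in> R"
  using proj(3)[of u] F.subspace_neg[OF R_subspace, of "- u"] proj(4) by auto

lemma proj_gen_act: "g \<in> gens n \<Longrightarrow> proj (gen_act g (proj u)) = proj (gen_act g u)"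
  by (rule proj_eq) (simp only: gen_act_diff[symmetric] std_relations.act proj(3))

lemma proj_free: "u \<in> free_module n lam \<Longrightarrow> proj u \<in> free_module n lam"
  using F.subspace_add[OF free_subspace std_relations_free[OF proj(3)], of u u] by simp

definition module_space :: "fmod set" where "module_space = proj ` free_module n lam"

definition lowest_space :: "fmod set" where "lowest_space = (\<lambda>v. proj (pure [] v)) ` specht_space"

definition quot_act :: "gen \<Rightarrow> fmod \<Rightarrow> fmod" where "quot_act g u = proj (gen_act g u)"

lemma module_space_iff: "u \<in> module_space \<longleftrightarrow> u \<in> free_module n lam \<and> proj u = u"
  unfolding module_space_def using proj_free by (auto intro: rev_image_eqI)

lemma proj_module_space: "u \<in> free_module n lam \<Longrightarrow> proj u \<in> module_space"
  by (auto simp: module_space_def)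

lemma quot_act_proj: "g \<in> gens n \<Longrightarrow> quot_act g (proj u) = proj (gen_act g u)"
  by (simp add: quot_act_def proj_gen_act)

lemma quot_act_quot_act: "g \<in> gens n \<Longrightarrow> quot_act g (quot_act h u) = proj (gen_act g (gen_act h u))"
  unfolding quot_act_def[of h] by (rule quot_act_proj)

lemma quot_act_linear: "quot_act g (u + v) = quot_act g u + quot_act g v"
    "quot_act g (fscale a u) = fscale a (quot_act g u)"
  by (simp_all add: quot_act_def gen_act_add gen_act_fscale proj)

lemma quot_act_closed: "g \<in> gens n \<Longrightarrow> u \<in> module_space \<Longrightarrow> quot_act g u \<in> module_space"
  unfolding quot_act_def by (intro proj_module_space free_gen_act) (simp_all add: module_space_iff)

lemma pure_free: "v \<in> specht_space \<Longrightarrow> pure [] v \<in> free_module n lam"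
  by (rule free_pure) simp_all

lemma quot_act_lowest:
  "v \<in> specht_space \<Longrightarrow> p permutes {1..n} \<Longrightarrow> quot_act (W p) (proj (pure [] v)) = proj (pure [] (gact p v))"
  using std_relations.lam_W[of v lam p n c] by (simp add: quot_act_proj proj_eq specht_space_def)

definition form :: "fmod \<Rightarrow> fmod \<Rightarrow> complex" where "form = contravariant_form n lam c"

lemma form:
  assumes "u \<in> free_module n lam" "v \<in> free_module n lam"
  shows "w \<in> free_module n lam \<Longrightarrow> form (u + w) v = form u v + form w v"
    "form (fscale a u) v = a * form u v" "form v u = cnj (form u v)"
    "w \<in> R \<Longrightarrow> form w v = 0"
    "p permutes {1..n} \<Longrightarrow> form (gen_act (W p) u) (gen_act (W p) v) = form u v"
    "i \<in> {1..n} \<Longrightarrow> form (gen_act (X i) u) v = form u (gen_act (Y i) v)"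
  using contravariant_form[of c] assms unfolding is_contravariant_form_def form_def by blast+

lemma form_pos: "v \<in> specht_space \<Longrightarrow> v \<noteq> 0 \<Longrightarrow> 0 < Re (form (pure [] v) (pure [] v))"
  using contravariant_form[of c] unfolding is_contravariant_form_def form_def specht_space_def by blast

lemma form_proj_left:
  assumes u: "u \<in> free_module n lam" and v: "v \<in> free_module n lam"
  shows "form (proj u) v = form u v"
  using form(1)[OF u v std_relations_free[OF proj(3)], of u] form(4)[OF u v proj(3), of u] by simp

lemma form_proj:
  assumes u: "u \<in> free_module n lam" and v: "v \<in> free_module n lam"
  shows "form (proj u) (proj v) = form u v"
  using form_proj_left[OF u proj_free[OF v]] form_proj_left[OF v u]
    form(3)[OF proj_free[OF v] u] form(3)[OF v u] by simp

text \<open>Two representatives have the same projection when their difference is a relation, so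
  each identity of operators is read off from one clause of \<open>std_relations\<close>.\<close>

lemma cherednik_rep_quotient:
  "cherednik_rep fscale module_space form n (\<lambda>p. quot_act (W p)) (\<lambda>i. quot_act (X i)) (\<lambda>i. quot_act (Y i)) (- c) lowest_space"
proof
  show "F.subspace module_space"
  proof (rule F.subspaceI)
    fix u v a assume u: "u \<in> module_space"
    then show "fscale a u \<in> module_space"
      by (simp add: module_space_iff F.subspace_scale[OF free_subspace] proj)
    assume "v \<in> module_space"
    then show "u + v \<in> module_space"
      using u by (simp add: module_space_iff F.subspace_add[OF free_subspace] proj)
  qed (simp add: module_space_iff F.subspace_0[OF free_subspace])
next
  fix u v w a assume u: "u \<in> module_space" and v: "v \<in> module_space"
  then have uv: "u \<in> free_module n lam" "v \<in> free_module n lam" "proj u = u" "proj v = v"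
    by (simp_all add: module_space_iff)
  show "form (fscale a u) v = a * form u v" "form v u = cnj (form u v)"
    using form uv by blast+
  show "form (quot_act (W p) u) (quot_act (W p) v) = form u v" if "p permutes {1..n}" for p
    using that uv by (simp add: quot_act_def form_proj free_gen_act form(5))
  show "form (quot_act (X i) u) v = form u (quot_act (Y i) v)" if "i \<in> {1..n}" for i
    using that uv form_proj[of "gen_act (X i) u" v] form_proj[of u "gen_act (Y i) v"]
    by (simp add: quot_act_def free_gen_act form(6))
  assume "w \<in> module_space"
  then show "form (u + v) w = form u w + form v w"
    using form(1)[of u w v] uv by (simp add: module_space_iff)
next
  fix v assume "v \<in> module_space"
  then have v: "v \<in> free_module n lam" "proj v = v" by (simp_all add: module_space_iff)
  show "quot_act (W id) v = v"
    using proj_eq[OF std_relations.W_one[OF v(1)]] v(2) by (simp add: quot_act_def del: id_apply)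
  show "quot_act (W p) (quot_act (W q) v) = quot_act (W (p \<circ> q)) v"
    if "p permutes {1..n}" "q permutes {1..n}" for p q
    using proj_eq[OF std_relations.W_mult[OF v(1) that]] that by (simp add: quot_act_quot_act) (simp add: quot_act_def)
  show "quot_act (X i) (quot_act (X j) v) = quot_act (X j) (quot_act (X i) v)"
    if "i \<in> {1..n}" "j \<in> {1..n}" for i j
    using proj_eq[OF std_relations.X_comm[OF v(1) that]] that by (simp add: quot_act_quot_act)
  show "quot_act (Y i) (quot_act (X j) v) =
      quot_act (X j) (quot_act (Y i) v) - fscale (complex_of_real (- c)) (quot_act (W (Transposition.transpose i j)) v)"
    if "i \<in> {1..n}" "j \<in> {1..n}" "i \<noteq> j" for i j
    using proj(4)[OF std_relations.Y_X_neq[OF v(1) that]] that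
    by (simp add: quot_act_quot_act) (simp add: quot_act_def proj_diff proj(1,2) algebra_simps)
  show "quot_act (Y i) (quot_act (X i) v) = quot_act (X i) (quot_act (Y i) v) + v +
      fscale (complex_of_real (- c)) (\<Sum>j\<in>{1..n} - {i}. quot_act (W (Transposition.transpose i j)) v)"
    if "i \<in> {1..n}" for i
    using proj(4)[OF std_relations.Y_X_eq[OF v(1) that]] that v(2)
    by (simp add: quot_act_quot_act) (simp add: quot_act_def proj_diff proj(1,2) proj_sum algebra_simps)
  \<comment> \<open>The relations prescribe w g w^-1. Applied to \<open>gen_act (W p) v\<close>, on
    which the inverse of p undoes p modulo relations, they give the commutation rule.\<close>
  have conj: "quot_act (W p) (quot_act (g i) v) = quot_act (g (p i)) (quot_act (W p) v)"
    if p: "p permutes {1..n}" and i: "i \<in> {1..n}" "g i \<in> gens n" "g (p i) \<in> gens n"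
      and rel: "\<And>u. u \<in> free_module n lam \<Longrightarrow>
        gen_act (W p) (gen_act (g i) (gen_act (W (perm_inv p)) u)) - gen_act (g (p i)) u \<in> R" for p i g
  proof -
    let ?v = "gen_act (W p) v"
    have fv: "?v \<in> free_module n lam" using v(1) p by (intro free_gen_act) simp_all
    have ip: "perm_inv p permutes {1..n}" by (rule permutes_inv[OF p])
    have "proj (gen_act (W (perm_inv p)) ?v) = proj (gen_act (W (perm_inv p \<circ> p)) v)"
      by (rule proj_eq[OF std_relations.W_mult[OF v(1) ip p]])
    also have "\<dots> = proj v"
      unfolding permutes_inv_o(2)[OF p] by (rule proj_eq[OF std_relations.W_one[OF v(1)]])
    finally have pv: "proj (gen_act (W (perm_inv p)) ?v) = proj v" .
    have "quot_act (W p) (quot_act (g i) v) = quot_act (W p) (quot_act (g i) (proj (gen_act (W (perm_inv p)) ?v)))"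
      by (simp only: pv v(2))
    also have "\<dots> = proj (gen_act (W p) (gen_act (g i) (gen_act (W (perm_inv p)) ?v)))"
      using p i by (simp add: quot_act_proj)
    also have "\<dots> = proj (gen_act (g (p i)) ?v)" by (rule proj_eq[OF rel[OF fv]])
    finally show ?thesis by (simp only: quot_act_quot_act[OF i(3)])
  qed
  show "quot_act (W p) (quot_act (X i) v) = quot_act (X (p i)) (quot_act (W p) v)"
    "quot_act (W p) (quot_act (Y i) v) = quot_act (Y (p i)) (quot_act (W p) v)"
    if "p permutes {1..n}" "i \<in> {1..n}" for p i
    using that permutes_in_image[OF that(1), of i]
    by (auto intro!: conj std_relations.W_X std_relations.W_Y)
next
  show "lowest_space \<subseteq> module_space"
    unfolding lowest_space_def using pure_free proj_module_space by blast
next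
  fix p v assume p: "p permutes {1..n}" and "v \<in> lowest_space"
  then obtain u where u: "v = proj (pure [] u)" "u \<in> specht_space" by (auto simp: lowest_space_def)
  then have "quot_act (W p) v = proj (pure [] (gact p u))" using quot_act_lowest p by simp
  then show "quot_act (W p) v \<in> lowest_space"
    unfolding lowest_space_def using specht_gact[OF p u(2)] by blast
qed (simp_all add: n_pos quot_act_linear quot_act_closed)

sublocale C: cherednik_rep fscale module_space form n "\<lambda>p. quot_act (W p)" "\<lambda>i. quot_act (X i)" "\<lambda>i. quot_act (Y i)" "- c" lowest_space
  by (rule cherednik_rep_quotient)

text \<open>The Y k kill the copy of \<lambda>, so there the Dunkl-Opdam operators reduce to - c
  times the Jucys-Murphy elements.\<close>

lemma lowest_weight:
  assumes v: "v \<in> specht_space" "tab_weight T v"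
  shows "C.weight n C.dunkl_opdam (\<lambda>k. - c * box_content lam T k) (proj (pure [] v))"
  unfolding C.weight_def
proof (intro conjI ballI)
  show "proj (pure [] v) \<in> module_space" by (rule proj_module_space[OF pure_free[OF v(1)]])
  fix k assume k: "k \<in> {1..n}"
  have "quot_act (Y k) (proj (pure [] v)) = 0"
    using proj(4)[OF std_relations.lam_Y[of v lam k n c]] v(1) k by (simp add: quot_act_proj specht_space_def)
  moreover have "C.jucys_murphy k (proj (pure [] v)) = proj (pure [] (S.jucys_murphy k v))"
  proof -
    have "C.jucys_murphy k (proj (pure [] v)) =
        (\<Sum>j\<in>{1..<k}. proj (pure [] (gact (Transposition.transpose j k) v)))"
      unfolding C.jucys_murphy_def
      using k by (intro sum.cong refl quot_act_lowest[OF v(1)] permutes_swap_id) auto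
    also have "\<dots> = proj (\<Sum>j\<in>{1..<k}. pure [] (gact (Transposition.transpose j k) v))"
      by (rule proj_sum[symmetric])
    also have "(\<Sum>j\<in>{1..<k}. pure [] (gact (Transposition.transpose j k) v)) = pure [] (S.jucys_murphy k v)"
      unfolding S.jucys_murphy_def by (rule pure_sum[symmetric])
    finally show ?thesis .
  qed
  moreover have "S.jucys_murphy k v = gscale (complex_of_real (box_content lam T k)) v"
    using v(2) k by (simp add: tab_weight_def S.weight_def T_content_def)
  ultimately show "C.dunkl_opdam k (proj (pure [] v)) =
      fscale (complex_of_real (- c * box_content lam T k)) (proj (pure [] v))"
    using C.x_zero[OF k] by (simp add: C.dunkl_opdam_def fscale_pure[symmetric] proj(2) del: fscale_pure)
qed

lemma monomial_proj:
  "set w \<subseteq> {1..n} \<Longrightarrow> C.monomial w (proj (pure [] v)) = proj (pure (map X w) v)"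
  by (induction w) (simp_all add: quot_act_proj)

lemma degree_part_iff: "u \<in> degree_part n lam m \<longleftrightarrow> u \<in> free_module n lam \<and> u \<in> X_words n m"
  by (auto simp: degree_part_def X_words_def)

lemma degree_part_pure:
  "v \<in> specht_space \<Longrightarrow> length w = m \<Longrightarrow> set w \<subseteq> {1..n} \<Longrightarrow> pure (map X w) v \<in> degree_part n lam m"
  unfolding degree_part_iff by (intro conjI free_pure X_words_pure) (auto simp: gens_def)

lemma degree_space_eq: "C.degree_space m = proj ` degree_part n lam m"
proof
  have "F.subspace (proj ` degree_part n lam m)"
  proof (rule F.subspaceI)
    have "0 \<in> degree_part n lam m"
      by (simp add: degree_part_iff F.subspace_0[OF free_subspace] F.subspace_0[OF X_words_subspace])
    then show "0 \<in> proj ` degree_part n lam m" by (rule rev_image_eqI) simp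
  next
    fix u v a assume "u \<in> proj ` degree_part n lam m"
    then obtain u' where u: "u = proj u'" "u' \<in> degree_part n lam m" by blast
    then have "fscale a u' \<in> degree_part n lam m"
      by (simp add: degree_part_iff F.subspace_scale[OF free_subspace] F.subspace_scale[OF X_words_subspace])
    then show "fscale a u \<in> proj ` degree_part n lam m" by (rule rev_image_eqI) (simp add: u proj(2))
    assume "v \<in> proj ` degree_part n lam m"
    then obtain v' where v: "v = proj v'" "v' \<in> degree_part n lam m" by blast
    then have "u' + v' \<in> degree_part n lam m"
      using u by (simp add: degree_part_iff F.subspace_add[OF free_subspace] F.subspace_add[OF X_words_subspace])
    then show "u + v \<in> proj ` degree_part n lam m" by (rule rev_image_eqI) (simp add: u v proj(1))
  qed
  moreover have "C.monomial w v \<in> proj ` degree_part n lam m"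
    if "length w = m" "set w \<subseteq> {1..n}" "v \<in> lowest_space" for w v
  proof -
    obtain v' where v: "v = proj (pure [] v')" "v' \<in> specht_space" using \<open>v \<in> lowest_space\<close> by (auto simp: lowest_space_def)
    show ?thesis
      unfolding v(1) monomial_proj[OF that(2)] by (rule imageI[OF degree_part_pure[OF v(2) that(1,2)]])
  qed
  ultimately show "C.degree_space m \<subseteq> proj ` degree_part n lam m"
    unfolding C.degree_space_def by (intro F.span_minimal) blast+
next
  show "proj ` degree_part n lam m \<subseteq> C.degree_space m"
  proof
    fix u assume "u \<in> proj ` degree_part n lam m"
    then obtain u' where u: "u = proj u'" "u' \<in> degree_part n lam m" by blast
    have "proj (pure w (coord u' w)) \<in> C.degree_space m" if "w \<in> support u'" for w
    proof -
      have "length w = m" "set w \<subseteq> X ` {1..n}" "coord u' w \<in> specht_space"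
        using u(2) that by (auto simp: degree_part_def free_module_def specht_space_def)
      moreover have "w \<in> map X ` lists {1..n}"
        using \<open>set w \<subseteq> X ` {1..n}\<close> unfolding lists_image[symmetric] by (rule lists_eq_set[THEN equalityD2, THEN subsetD, OF CollectI])
      then obtain w' where "w = map X w'" "set w' \<subseteq> {1..n}"
        by (auto simp: lists_eq_set)
      ultimately have "proj (pure w (coord u' w)) = C.monomial w' (proj (pure [] (coord u' w)))"
        "length w' = m" "set w' \<subseteq> {1..n}" "proj (pure [] (coord u' w)) \<in> lowest_space"
        by (simp_all add: monomial_proj lowest_space_def)
      then show ?thesis
        unfolding C.degree_space_def by (intro F.span_base CollectI exI conjI)
    qed
    then have "(\<Sum>w\<in>support u'. proj (pure w (coord u' w))) \<in> C.degree_space m"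
      unfolding C.degree_space_def by (rule F.span_sum)
    then show "u \<in> C.degree_space m"
      using u(1) poly_mapping_decompose[of u'] proj_sum[of "\<lambda>w. pure w (coord u' w)" "support u'"] by simp
  qed
qed

section \<open>Signatures of the graded pieces and the limit\<close>

lemma degree_signature_eq:
  assumes c: "real m < - c"
  shows "real_of_int (degree_signature n lam c m) =
    (\<Sum>T\<in>Std lam. \<Sum>(\<sigma>, h)\<in>degree_index n m. norm_sign n (box_content lam T) \<sigma> (exponents n \<sigma> h))"
proof -
  obtain v where v: "\<And>T. T \<in> Std lam \<Longrightarrow> v T \<in> specht_space \<and> v T \<noteq> 0 \<and> tab_weight T (v T)"
    and sp: "specht_space \<subseteq> G.span (v ` Std lam)"
    using specht_tableau_basis by blast
  define w where "w = (\<lambda>T. proj (pure [] (v T)))"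
  have w_lowest: "w T \<in> lowest_space" if "T \<in> Std lam" for T
    using v[OF that] by (auto simp: w_def lowest_space_def)
  have w_span: "lowest_space \<subseteq> F.span (w ` Std lam)"
  proof
    fix u assume "u \<in> lowest_space"
    then obtain u' where u: "u = proj (pure [] u')" "u' \<in> G.span (v ` Std lam)"
      using sp by (auto simp: lowest_space_def)
    from u(2) obtain a where a: "u' = (\<Sum>T\<in>Std lam. gscale (a T) (v T))"
      by (rule vector_space.span_image_coeffs[OF gscale_vector_space finite_Std])
    have "pure [] u' = (\<Sum>T\<in>Std lam. fscale (a T) (pure [] (v T)))"
      by (simp add: a pure_sum)
    then have "u = (\<Sum>T\<in>Std lam. fscale (a T) (w T))"
      by (simp only: u(1) proj_sum proj(2) w_def)
    then show "u \<in> F.span (w ` Std lam)"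
      by (simp add: F.span_sum F.span_scale F.span_base)
  qed
  have w_pos: "0 < Re (form (w T) (w T))" if "T \<in> Std lam" for T
    using v[OF that] form_pos pure_free form_proj by (simp add: w_def)
  have w_weight: "C.weight n C.dunkl_opdam (\<lambda>k. - c * box_content lam T k) (w T)" if "T \<in> Std lam" for T
    unfolding w_def using v[OF that] by (intro lowest_weight) blast+
  let ?K = "degree_index n m \<times> Std lam"
  obtain f where fV: "\<And>a. a \<in> ?K \<Longrightarrow> f a \<in> module_space"
    and orth: "\<And>a b. a \<in> ?K \<Longrightarrow> b \<in> ?K \<Longrightarrow> a \<noteq> b \<Longrightarrow> form (f a) (f b) = 0"
    and sign: "\<And>\<sigma> h T. (\<sigma>, h) \<in> degree_index n m \<Longrightarrow> T \<in> Std lam \<Longrightarrow>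
      0 < norm_sign n (box_content lam T) \<sigma> (exponents n \<sigma> h) * Re (form (f ((\<sigma>, h), T)) (f ((\<sigma>, h), T)))"
    and span: "F.span (f ` ?K) = C.degree_space m"
    using C.ex_orthogonal_basis[where v = w and d = "box_content lam", OF finite_Std w_lowest w_span w_weight w_pos content_injective c]
    by blast
  have K: "finite ?K" using finite_degree_index finite_Std by simp
  have nz: "Re (form (f a) (f a)) \<noteq> 0" if a: "a \<in> ?K" for a
  proof -
    obtain \<sigma> h T where a': "a = ((\<sigma>, h), T)" by (metis prod.exhaust)
    show ?thesis using sign[of \<sigma> h T] a unfolding a' by auto
  qed
  have proj_comb: "proj (\<Sum>i\<in>I. fscale (a i) (g i)) = (\<Sum>i\<in>I. fscale (a i) (proj (g i)))" for I a and g :: "nat \<Rightarrow> fmod"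
    by (simp only: proj_sum proj(2))
  \<comment> \<open>\<open>degree_signature\<close> refers to a chosen basis. Lifting the orthogonal
    vectors through the projection shows that a basis exists, so the choice really is one.\<close>
  have "\<exists>bs. is_degree_basis n lam c m bs"
  proof -
    obtain ks where ks: "set ks = ?K" "distinct ks" using finite_distinct_list[OF K] by blast
    have "\<exists>u. u \<in> degree_part n lam m \<and> proj u = f a" if "a \<in> ?K" for a
    proof -
      have "f a \<in> proj ` degree_part n lam m"
        unfolding degree_space_eq[symmetric] span[symmetric] using that by (intro F.span_base imageI)
      then show ?thesis by auto
    qed
    then obtain g where g: "\<And>a. a \<in> ?K \<Longrightarrow> g a \<in> degree_part n lam m \<and> proj (g a) = f a" by metis
    have ksK: "ks ! i \<in> ?K" if "i < length ks" for i using that ks(1) nth_mem by blast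
    have comb: "proj (\<Sum>i<length ks. fscale (a i) (map g ks ! i)) = (\<Sum>i<length ks. fscale (a i) (f (ks ! i)))" for a
      unfolding proj_comb by (intro sum.cong refl) (use g ksK in simp)
    have "is_degree_basis n lam c m (map g ks)"
      unfolding is_degree_basis_def length_map
    proof (intro conjI allI impI ballI)
      show "set (map g ks) \<subseteq> degree_part n lam m" using g ks(1) by auto
    next
      fix a i assume "(\<Sum>i<length ks. fscale (a i) (map g ks ! i)) \<in> R" and i: "i < length ks"
      then have zero: "(\<Sum>i\<in>{..<length ks}. fscale (a i) (f (ks ! i))) = 0"
        using comb[of a] proj(4) by simp
      have "\<forall>i\<in>{..<length ks}. a i = 0"
        by (rule C.orthogonal_family_coeffs[OF _ _ _ _ zero])
          (use ks ksK fV orth nz in \<open>auto simp: nth_eq_iff_index_eq\<close>)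
      then show "a i = 0" using i by blast
    next
      fix u assume "u \<in> degree_part n lam m"
      moreover have "f ` ?K = (\<lambda>i. f (ks ! i)) ` {..<length ks}"
        unfolding ks(1)[symmetric] by (auto simp: set_conv_nth)
      ultimately have "proj u \<in> F.span ((\<lambda>i. f (ks ! i)) ` {..<length ks})"
        using span degree_space_eq by auto
      then obtain a where "proj u = (\<Sum>i<length ks. fscale (a i) (f (ks ! i)))"
        by (rule vector_space.span_image_coeffs[OF fscale_vector_space finite_lessThan])
      then have "proj (u - (\<Sum>i<length ks. fscale (a i) (map g ks ! i))) = 0"
        by (simp only: proj_diff comb diff_self)
      then show "\<exists>a. u - (\<Sum>i<length ks. fscale (a i) (map g ks ! i)) \<in> R"
        unfolding proj_eq_0 by blast
    qed
    then show ?thesis by blast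
  qed
  define bs where "bs = (SOME bs. is_degree_basis n lam c m bs)"
  have bs: "is_degree_basis n lam c m bs"
    unfolding bs_def by (rule someI_ex) fact
  define us where "us = map proj bs"
  have len: "length us = length bs" and us_nth: "\<And>i. i < length bs \<Longrightarrow> us ! i = proj (bs ! i)"
    by (simp_all add: us_def)
  have comb: "proj (\<Sum>i<length bs. fscale (a i) (bs ! i)) = (\<Sum>i<length us. fscale (a i) (us ! i))" for a
    unfolding proj_comb len by (intro sum.cong refl) (simp add: us_nth)
  have bs_free: "bs ! i \<in> free_module n lam" if "i < length bs" for i
    using bs nth_mem[OF that] unfolding is_degree_basis_def degree_part_def by blast
  have us_sub: "set us \<subseteq> C.degree_space m"
    using bs unfolding us_def degree_space_eq is_degree_basis_def by auto
  have us_span: "F.span (set us) = C.degree_space m"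
  proof
    show "F.span (set us) \<subseteq> C.degree_space m"
      using us_sub unfolding C.degree_space_def by (intro F.span_minimal F.subspace_span)
    show "C.degree_space m \<subseteq> F.span (set us)"
    proof
      fix u assume "u \<in> C.degree_space m"
      then obtain u' where u: "u = proj u'" "u' \<in> degree_part n lam m" by (auto simp: degree_space_eq)
      obtain a where "u' - (\<Sum>i<length bs. fscale (a i) (bs ! i)) \<in> R"
        using bs u(2) unfolding is_degree_basis_def by blast
      then have "u = (\<Sum>i<length us. fscale (a i) (us ! i))"
        unfolding u(1) comb[symmetric] by (rule proj_eq)
      then show "u \<in> F.span (set us)"
        by (simp only:) (intro F.span_sum F.span_scale F.span_base nth_mem; simp)
    qed
  qed
  have "gram_matrix (contravariant_form n lam c) bs =
      mat (length us) (length us) (\<lambda>(i, j). form (us ! i) (us ! j))"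
    unfolding gram_matrix_def len
    by (rule cong_mat) (auto simp: us_nth bs_free form_proj form_def[symmetric])
  then have "real_of_int (degree_signature n lam c m) =
      real_of_int (signature (mat (length us) (length us) (\<lambda>(i, j). form (us ! i) (us ! j))))"
    unfolding degree_signature_def bs_def[symmetric] by simp
  also have "\<dots> = (\<Sum>a\<in>?K. sgn (Re (form (f a) (f a))))"
  proof (rule C.signature_gram[OF _ _ K fV orth nz])
    show "set us \<subseteq> module_space" using us_sub C.degree_space_V by blast
    show "\<forall>i<length us. a i = 0" if "(\<Sum>i<length us. fscale (a i) (us ! i)) = 0" for a
    proof -
      have "(\<Sum>i<length bs. fscale (a i) (bs ! i)) \<in> R"
        using that by (simp only: comb[symmetric] proj_eq_0)
      then show ?thesis using bs unfolding is_degree_basis_def len by blast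
    qed
    show "F.span (set us) = F.span (f ` ?K)" using us_span span by simp
  qed
  also have "\<dots> = (\<Sum>a\<in>?K. norm_sign n (box_content lam (snd a)) (fst (fst a)) (exponents n (fst (fst a)) (snd (fst a))))"
  proof (rule sum.cong[OF refl])
    fix a assume a: "a \<in> ?K"
    obtain \<sigma> h T where a': "a = ((\<sigma>, h), T)" by (metis prod.exhaust)
    have sgn: "sgn r = s" if "0 < s * r" "\<bar>s\<bar> = 1" for r s :: real
      using that by (auto simp: abs_if zero_less_mult_iff split: if_splits)
    have "(\<sigma>, h) \<in> degree_index n m" "T \<in> Std lam" using a a' by auto
    from sgn[OF sign[OF this] norm_sign_abs]
    show "sgn (Re (form (f a) (f a))) =
        norm_sign n (box_content lam (snd a)) (fst (fst a)) (exponents n (fst (fst a)) (snd (fst a)))"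
      by (simp add: a')
  qed
  also have "\<dots> = (\<Sum>T\<in>Std lam. \<Sum>(\<sigma>, h)\<in>degree_index n m. norm_sign n (box_content lam T) \<sigma> (exponents n \<sigma> h))"
    using sum.cartesian_product[of "\<lambda>x T. norm_sign n (box_content lam T) (fst x) (exponents n (fst x) (snd x))"
        "Std lam" "degree_index n m"]
      sum.swap[of "\<lambda>x T. norm_sign n (box_content lam T) (fst x) (exponents n (fst x) (snd x))"
        "Std lam" "degree_index n m"]
    by (simp add: case_prod_beta)
  finally show ?thesis .
qed

end

theorem theorem6p3:
  fixes n :: nat and lam :: "nat list"
  assumes "n \<ge> 2" and "is_partition lam n"
  shows "\<forall>m. ((\<lambda>c. fps_nth (ch_s n lam c) m) \<longlongrightarrow>
      fps_nth (\<Sum>T\<in>Std lam.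
        (\<Prod>j=0..n-1. 1 / (1 - fps_const ((-1) ^ k_stat n (box_content lam T) j) * fps_X ^ (n - j))) *
        (\<Sum>\<sigma> | \<sigma> permutes {1..n}.
          fps_const ((-1) ^ card (J_set n (box_content lam T) \<sigma>)) *
          (\<Prod>i\<in>I_set n \<sigma>. fps_const ((-1) ^ k_stat n (box_content lam T) i) * fps_X ^ (n - i)))) m)
    (inf at_bot (principal (regular_params n)))"
proof -
  have n: "1 \<le> n" using assms(1) by simp
  \<comment> \<open>The coefficient of degree m is constant for c < -m, so the limit is attained
    there.\<close>
  have "fps_nth (ch_s n lam c) m = (\<Sum>T\<in>Std lam. \<Sum>(\<sigma>, h)\<in>degree_index n m.
      norm_sign n (box_content lam T) \<sigma> (exponents n \<sigma> h))" if "c < - real m" for c m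
  proof -
    interpret standard_module lam n c by unfold_locales (use assms(2) n in auto)
    show ?thesis using degree_signature_eq[of m] that by (simp add: ch_s_def)
  qed
  then have "eventually (\<lambda>c. c \<in> regular_params n \<longrightarrow> fps_nth (ch_s n lam c) m = (\<Sum>T\<in>Std lam. \<Sum>(\<sigma>, h)\<in>degree_index n m.
      norm_sign n (box_content lam T) \<sigma> (exponents n \<sigma> h))) at_bot" for m
    by (intro eventually_mono[OF eventually_gt_at_bot[of "- real m"]]) blast
  then show ?thesis
    unfolding fps_sum_nth generating_function[OF n]
    by (intro allI tendsto_eventually) (simp only: eventually_inf_principal)
qed

end
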